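(* Let $\Bbbk$ be a field of characteristic zero. Fix an integer $n\geq 1$ and let $a\in\Bbbk$. The algebra $R=R(n,a)$ is Artin-Schelter regular of global dimension $n+1$.
   Context: Let $A=\Bbbk[X_0,\dots,X_n]$ be the commutative polynomial ring, $\partial_i=\partial/\partial X_i$, and define the derivations $\Delta=\sum_{i=1}^{n}X_{i-1}\partial_i$ and $\Gamma_a=\sum_{i=0}^n (a+i)X_i\partial_i$ of $A$. For $k\in\mathbb{N}$ put $\binom{\Gamma_a}{k}=\frac{1}{k!}\Gamma_a(\Gamma_a-1)\cdots(\Gamma_a-(k-1))$. Then $R(n,a)$ is the associative $\Bbbk$-algebra with underlying vector space $A$ and multiplication $f\ast g=\sum_{k\ge 0}\Delta^k(f)\binom{\Gamma_a}{k}(g)$. It is $\mathbb{N}$-graded by the usual polynomial degree ($\deg X_i=1$). An $\mathbb{N}$-graded $\Bbbk$-algebra $R$ with $R_0=\Bbbk$ is Artin-Schelter regular if: (1) $\operatorname{gldim}R<\infty$; (2) $R$ has finite Gelfand-Kirillov dimension; (3) $\operatorname{Ext}^i_R(\Bbbk_R,R_R)=0$ for $i\ne\operatorname{gldim}R$, and $\operatorname{Ext}^i_R(\Bbbk_R,R_R)\cong {}_R\Bbbk[\ell]$ for $i=\operatorname{gldim}R$, where $[\ell]$ denotes a shift of degree by some $\ell\in\mathbb{Z}$. *)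

theory Defs
  imports
    "HOL-Algebra.Embedded_Algebras"
    "HOL-Library.Poly_Mapping"
    "HOL-Library.Extended_Nat"
    "HOL-Library.Extended_Real"
begin

section \<open>Modules over noncommutative rings\<close>

text \<open>The library locale \<open>module\<close> requires a commutative base ring. The record
  type \<open>('r, 'u) module\<close> is reused; its fields \<open>mult\<close> and \<open>one\<close> carry no meaning here.
  A right module over \<open>R\<close> is a left module over the opposite ring, so that
  \<open>smult M r m\<close> stands for \<open>m \<cdot> r\<close> when \<open>M\<close> is a right module.\<close>

definition op_ring :: "('r, 'e) ring_scheme \<Rightarrow> 'r ring" where
  "op_ring R = \<lparr>carrier = carrier R, mult = (\<lambda>x y. y \<otimes>\<^bsub>R\<^esub> x), one = \<one>\<^bsub>R\<^esub>,
     zero = \<zero>\<^bsub>R\<^esub>, add = add R\<rparr>"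

locale left_module = R?: ring R + M?: abelian_group M
  for R :: "('r, 'e) ring_scheme" (structure) and M :: "('r, 'u) module" (structure) +
  assumes smult_closed: "\<lbrakk>r \<in> carrier R; x \<in> carrier M\<rbrakk> \<Longrightarrow> r \<odot>\<^bsub>M\<^esub> x \<in> carrier M"
    and smult_l_distr: "\<lbrakk>r \<in> carrier R; s \<in> carrier R; x \<in> carrier M\<rbrakk> \<Longrightarrow>
      (r \<oplus>\<^bsub>R\<^esub> s) \<odot>\<^bsub>M\<^esub> x = r \<odot>\<^bsub>M\<^esub> x \<oplus>\<^bsub>M\<^esub> s \<odot>\<^bsub>M\<^esub> x"
    and smult_r_distr: "\<lbrakk>r \<in> carrier R; x \<in> carrier M; y \<in> carrier M\<rbrakk> \<Longrightarrow>
      r \<odot>\<^bsub>M\<^esub> (x \<oplus>\<^bsub>M\<^esub> y) = r \<odot>\<^bsub>M\<^esub> x \<oplus>\<^bsub>M\<^esub> r \<odot>\<^bsub>M\<^esub> y"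
    and smult_assoc: "\<lbrakk>r \<in> carrier R; s \<in> carrier R; x \<in> carrier M\<rbrakk> \<Longrightarrow>
      (r \<otimes>\<^bsub>R\<^esub> s) \<odot>\<^bsub>M\<^esub> x = r \<odot>\<^bsub>M\<^esub> (s \<odot>\<^bsub>M\<^esub> x)"
    and smult_one: "x \<in> carrier M \<Longrightarrow> \<one>\<^bsub>R\<^esub> \<odot>\<^bsub>M\<^esub> x = x"

definition mod_hom ::
  "('r, 'e) ring_scheme \<Rightarrow> ('r, 'u) module \<Rightarrow> ('r, 'v) module \<Rightarrow> ('u \<Rightarrow> 'v) set" where
  "mod_hom R M N = {f \<in> carrier M \<rightarrow> carrier N.
     (\<forall>x\<in>carrier M. \<forall>y\<in>carrier M. f (x \<oplus>\<^bsub>M\<^esub> y) = f x \<oplus>\<^bsub>N\<^esub> f y) \<and>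
     (\<forall>r\<in>carrier R. \<forall>x\<in>carrier M. f (r \<odot>\<^bsub>M\<^esub> x) = r \<odot>\<^bsub>N\<^esub> f x)}"

definition regular_module :: "('r, 'e) ring_scheme \<Rightarrow> ('r, 'r) module" where
  "regular_module R = \<lparr>carrier = carrier R, mult = mult R, one = \<one>\<^bsub>R\<^esub>,
     zero = \<zero>\<^bsub>R\<^esub>, add = add R, smult = mult R\<rparr>"

definition quot_module :: "('r, 'u) module \<Rightarrow> 'u set \<Rightarrow> ('r, 'u set) module" where
  "quot_module M B = \<lparr>carrier = a_rcosets\<^bsub>M\<^esub> B, mult = undefined, one = undefined,
     zero = B, add = set_add M,
     smult = (\<lambda>r X. \<Union>x\<in>X. B +>\<^bsub>M\<^esub> (r \<odot>\<^bsub>M\<^esub> x))\<rparr>"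

section \<open>Projective resolutions and global dimension\<close>

text \<open>All modules in this section have their carrier inside one type \<open>'u\<close>. If \<open>'u\<close> is
  infinite and \<open>R\<close> embeds into it, then the free module on the carrier of any such module again
  has a copy inside \<open>'u\<close>, so projectivity and projective dimension relative to \<open>'u\<close> are
  the absolute notions.\<close>

definition projective :: "('r, 'e) ring_scheme \<Rightarrow> ('r, 'u) module \<Rightarrow> bool" where
  "projective R P \<longleftrightarrow> left_module R P \<and>
     (\<forall>(A :: ('r, 'u) module) (B :: ('r, 'u) module) g f.
        left_module R A \<and> left_module R B \<and>
        g \<in> mod_hom R A B \<and> g ` carrier A = carrier B \<and> f \<in> mod_hom R P B \<longrightarrow>
        (\<exists>h\<in>mod_hom R P A. \<forall>x\<in>carrier P. g (h x) = f x))"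

definition proj_resolution ::
  "('r, 'e) ring_scheme \<Rightarrow> ('r, 'v) module \<Rightarrow>
   (nat \<Rightarrow> ('r, 'u) module) \<Rightarrow> (nat \<Rightarrow> 'u \<Rightarrow> 'u) \<Rightarrow> ('u \<Rightarrow> 'v) \<Rightarrow> bool" where
  "proj_resolution R M P d aug \<longleftrightarrow>
     left_module R M \<and>
     (\<forall>i. projective R (P i)) \<and>
     (\<forall>i. d i \<in> mod_hom R (P (Suc i)) (P i)) \<and>
     aug \<in> mod_hom R (P 0) M \<and>
     aug ` carrier (P 0) = carrier M \<and>
     d 0 ` carrier (P 1) = {x \<in> carrier (P 0). aug x = \<zero>\<^bsub>M\<^esub>} \<and>
     (\<forall>i. d (Suc i) ` carrier (P (Suc (Suc i))) =
           {x \<in> carrier (P (Suc i)). d i x = \<zero>\<^bsub>P i\<^esub>})"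

definition proj_dim :: "('r, 'e) ring_scheme \<Rightarrow> ('r, 'u) module \<Rightarrow> enat" where
  "proj_dim R M = Inf {enat m | m. \<exists>(P :: nat \<Rightarrow> ('r, 'u) module) d aug.
     proj_resolution R M P d aug \<and> (\<forall>i>m. carrier (P i) = {\<zero>\<^bsub>P i\<^esub>})}"

definition left_gldim :: "'u itself \<Rightarrow> ('r, 'e) ring_scheme \<Rightarrow> enat" where
  "left_gldim U R = Sup {proj_dim R M | M :: ('r, 'u) module. left_module R M}"

definition right_gldim :: "'u itself \<Rightarrow> ('r, 'e) ring_scheme \<Rightarrow> enat" where
  "right_gldim U R = left_gldim U (op_ring R)"

text \<open>For a noncommutative ring the unqualified global dimension is the common value of
  the left and the right one. The type \<open>'r \<times> nat \<times> 'm\<close> is infinite and contains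
  copies of \<open>'r\<close> and of the arbitrary type \<open>'m\<close>.\<close>

definition has_gldim :: "'m itself \<Rightarrow> ('r, 'e) ring_scheme \<Rightarrow> nat \<Rightarrow> bool" where
  "has_gldim T R d \<longleftrightarrow>
     right_gldim TYPE('r \<times> nat \<times> 'm) R = enat d \<and> left_gldim TYPE('r \<times> nat \<times> 'm) R = enat d"

section \<open>Gelfand-Kirillov dimension\<close>

text \<open>\<open>V\<^sup>0 + V\<^sup>1 + \<dots> + V\<^sup>m\<close>, where \<open>V\<^sup>i\<close> is spanned by the products of \<open>i\<close> elements of \<open>V\<close>.\<close>

definition power_span :: "('r, 'e) ring_scheme \<Rightarrow> 'r set \<Rightarrow> 'r set \<Rightarrow> nat \<Rightarrow> 'r set" where
  "power_span R K V m =
     (\<Union>us\<in>{us. set us \<subseteq> {foldr (mult R) vs \<one>\<^bsub>R\<^esub> | vs. set vs \<subseteq> V \<and> length vs \<le> m}}.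
        ring.Span R K us)"

definition GKdim :: "('r, 'e) ring_scheme \<Rightarrow> 'r set \<Rightarrow> ereal" where
  "GKdim R K = (SUP V\<in>{V. subalgebra K V R \<and> ring.finite_dimension R K V}.
     limsup (\<lambda>m. ereal (log (real m) (real (ring.dim R K (power_span R K V m))))))"

section \<open>Gradings\<close>

definition is_direct_sum :: "('a, 'e) ring_scheme \<Rightarrow> ('i \<Rightarrow> 'a set) \<Rightarrow> bool" where
  "is_direct_sum M G \<longleftrightarrow>
     (\<forall>i. additive_subgroup (G i) M) \<and>
     (\<forall>x\<in>carrier M. \<exists>!f. (\<forall>i. f i \<in> G i) \<and> finite {i. f i \<noteq> \<zero>\<^bsub>M\<^esub>} \<and>
        x = (\<Oplus>\<^bsub>M\<^esub>i\<in>{i. f i \<noteq> \<zero>\<^bsub>M\<^esub>}. f i))"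

definition hcomp :: "('a, 'e) ring_scheme \<Rightarrow> ('i \<Rightarrow> 'a set) \<Rightarrow> 'i \<Rightarrow> 'a \<Rightarrow> 'a" where
  "hcomp M G i x = (THE f. (\<forall>i. f i \<in> G i) \<and> finite {i. f i \<noteq> \<zero>\<^bsub>M\<^esub>} \<and>
     x = (\<Oplus>\<^bsub>M\<^esub>i\<in>{i. f i \<noteq> \<zero>\<^bsub>M\<^esub>}. f i)) i"

text \<open>An \<open>\<nat>\<close>-graded algebra \<open>R\<close> over the field \<open>K\<close> with \<open>R\<^sub>0 = K\<close>. As in
  \<^theory>\<open>HOL-Algebra.Embedded_Algebras\<close>, the base field is a subfield of the ring and scalars act
  by multiplication; centrality makes \<open>R\<close> a \<open>K\<close>-algebra.\<close>

definition connected_graded_algebra ::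
  "('r, 'e) ring_scheme \<Rightarrow> 'r set \<Rightarrow> (nat \<Rightarrow> 'r set) \<Rightarrow> bool" where
  "connected_graded_algebra R K G \<longleftrightarrow>
     ring R \<and> subfield K R \<and> (\<forall>c\<in>K. \<forall>x\<in>carrier R. c \<otimes>\<^bsub>R\<^esub> x = x \<otimes>\<^bsub>R\<^esub> c) \<and>
     is_direct_sum R G \<and>
     (\<forall>i j. \<forall>x\<in>G i. \<forall>y\<in>G j. x \<otimes>\<^bsub>R\<^esub> y \<in> G (i + j)) \<and>
     G 0 = K"

definition int_grading :: "('r, 'e) ring_scheme \<Rightarrow> (nat \<Rightarrow> 'r set) \<Rightarrow> int \<Rightarrow> 'r set" where
  "int_grading R G j = (if 0 \<le> j then G (nat j) else {\<zero>\<^bsub>R\<^esub>})"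

definition graded_module ::
  "('r, 'e) ring_scheme \<Rightarrow> (nat \<Rightarrow> 'r set) \<Rightarrow> ('r, 'u) module \<Rightarrow> (int \<Rightarrow> 'u set) \<Rightarrow> bool" where
  "graded_module R G M MG \<longleftrightarrow>
     left_module R M \<and> is_direct_sum M MG \<and>
     (\<forall>i j. \<forall>r\<in>G i. \<forall>x\<in>MG j. r \<odot>\<^bsub>M\<^esub> x \<in> MG (int i + j))"

definition shift :: "(int \<Rightarrow> 'u set) \<Rightarrow> int \<Rightarrow> int \<Rightarrow> 'u set" where
  "shift MG l j = MG (j + l)"

definition graded_iso ::
  "('r, 'e) ring_scheme \<Rightarrow> ('r, 'u) module \<Rightarrow> (int \<Rightarrow> 'u set) \<Rightarrow>
   ('r, 'v) module \<Rightarrow> (int \<Rightarrow> 'v set) \<Rightarrow> bool" where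
  "graded_iso R M MG N NG \<longleftrightarrow>
     (\<exists>f\<in>mod_hom R M N. bij_betw f (carrier M) (carrier N) \<and> (\<forall>j. f ` MG j = NG j))"

text \<open>The trivial module \<open>R / R\<^bsub>\<ge>1\<^esub>\<close>, realised on \<open>R\<^sub>0\<close>: an element of \<open>R\<close> acts through its
  degree \<open>0\<close> component. Since \<open>R\<^sub>0\<close> is a commutative field, the same record is the left
  module \<open>\<^sub>RK\<close> and the right module \<open>K\<^sub>R\<close>.\<close>

definition trivial_module :: "('r, 'e) ring_scheme \<Rightarrow> (nat \<Rightarrow> 'r set) \<Rightarrow> ('r, 'r) module" where
  "trivial_module R G = \<lparr>carrier = G 0, mult = mult R, one = \<one>\<^bsub>R\<^esub>, zero = \<zero>\<^bsub>R\<^esub>, add = add R,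
     smult = (\<lambda>r c. hcomp R G 0 r \<otimes>\<^bsub>R\<^esub> c)\<rparr>"

definition trivial_grading :: "('r, 'e) ring_scheme \<Rightarrow> (nat \<Rightarrow> 'r set) \<Rightarrow> int \<Rightarrow> 'r set" where
  "trivial_grading R G j = (if j = 0 then G 0 else {\<zero>\<^bsub>R\<^esub>})"

section \<open>The graded left modules \<open>Ext\<^sup>i(M\<^sub>R, R\<^sub>R)\<close>\<close>

text \<open>For a graded right module \<open>P\<close>, the graded dual \<open>Hom(P, R\<^sub>R)\<close> is the direct sum over all
  \<open>e\<close> of the groups of right module homomorphisms that are homogeneous of degree \<open>e\<close>. The
  left multiplication of \<open>R\<close> on \<open>R\<^sub>R\<close> makes it a graded left module. Maps are extended by
  \<open>undefined\<close> outside the carrier of \<open>P\<close>, so that equality is equality on \<open>P\<close>.\<close>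

definition dual_deg ::
  "('r, 'e) ring_scheme \<Rightarrow> (nat \<Rightarrow> 'r set) \<Rightarrow> ('r, 'u) module \<Rightarrow> (int \<Rightarrow> 'u set) \<Rightarrow>
   int \<Rightarrow> ('u \<Rightarrow> 'r) set" where
  "dual_deg R G P PG e =
     {f \<in> mod_hom (op_ring R) P (regular_module (op_ring R)) \<inter> extensional (carrier P).
        \<forall>j. f ` PG j \<subseteq> int_grading R G (j + e)}"

definition dual_module ::
  "('r, 'e) ring_scheme \<Rightarrow> (nat \<Rightarrow> 'r set) \<Rightarrow> ('r, 'u) module \<Rightarrow> (int \<Rightarrow> 'u set) \<Rightarrow>
   ('r, 'u \<Rightarrow> 'r) module" where
  "dual_module R G P PG = \<lparr>
     carrier = {\<lambda>x\<in>carrier P. (\<Oplus>\<^bsub>R\<^esub>e\<in>E. F e x) | E F.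
       finite E \<and> (\<forall>e\<in>E. F e \<in> dual_deg R G P PG e)},
     mult = undefined, one = undefined,
     zero = (\<lambda>x\<in>carrier P. \<zero>\<^bsub>R\<^esub>),
     add = (\<lambda>f g. \<lambda>x\<in>carrier P. f x \<oplus>\<^bsub>R\<^esub> g x),
     smult = (\<lambda>r f. \<lambda>x\<in>carrier P. r \<otimes>\<^bsub>R\<^esub> f x)\<rparr>"

record ('r, 'u, 'v) resolution =
  res_mod :: "nat \<Rightarrow> ('r, 'u) module"
  res_grading :: "nat \<Rightarrow> int \<Rightarrow> 'u set"
  res_diff :: "nat \<Rightarrow> 'u \<Rightarrow> 'u"
  res_aug :: "'u \<Rightarrow> 'v"

definition graded_proj_resolution ::
  "('r, 'e) ring_scheme \<Rightarrow> (nat \<Rightarrow> 'r set) \<Rightarrow> ('r, 'v) module \<Rightarrow> (int \<Rightarrow> 'v set) \<Rightarrow>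
   ('r, 'u, 'v) resolution \<Rightarrow> bool" where
  "graded_proj_resolution R G M MG C \<longleftrightarrow>
     proj_resolution R M (res_mod C) (res_diff C) (res_aug C) \<and>
     graded_module R G M MG \<and>
     (\<forall>i. graded_module R G (res_mod C i) (res_grading C i)) \<and>
     (\<forall>i j. res_diff C i ` res_grading C (Suc i) j \<subseteq> res_grading C i j) \<and>
     (\<forall>j. res_aug C ` res_grading C 0 j \<subseteq> MG j)"

definition cochains ::
  "('r, 'e) ring_scheme \<Rightarrow> (nat \<Rightarrow> 'r set) \<Rightarrow> ('r, 'u, 'v) resolution \<Rightarrow> nat \<Rightarrow>
   ('r, 'u \<Rightarrow> 'r) module" where
  "cochains R G C i = dual_module R G (res_mod C i) (res_grading C i)"

definition cocycles ::
  "('r, 'e) ring_scheme \<Rightarrow> (nat \<Rightarrow> 'r set) \<Rightarrow> ('r, 'u, 'v) resolution \<Rightarrow> nat \<Rightarrow>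
   ('u \<Rightarrow> 'r) set" where
  "cocycles R G C i = {f \<in> carrier (cochains R G C i).
     \<forall>x\<in>carrier (res_mod C (Suc i)). f (res_diff C i x) = \<zero>\<^bsub>R\<^esub>}"

fun coboundaries ::
  "('r, 'e) ring_scheme \<Rightarrow> (nat \<Rightarrow> 'r set) \<Rightarrow> ('r, 'u, 'v) resolution \<Rightarrow> nat \<Rightarrow>
   ('u \<Rightarrow> 'r) set" where
  "coboundaries R G C 0 = {\<zero>\<^bsub>cochains R G C 0\<^esub>}"
| "coboundaries R G C (Suc i) =
     (\<lambda>g. \<lambda>x\<in>carrier (res_mod C (Suc i)). g (res_diff C i x)) ` carrier (cochains R G C i)"

definition cohomology ::
  "('r, 'e) ring_scheme \<Rightarrow> (nat \<Rightarrow> 'r set) \<Rightarrow> ('r, 'u, 'v) resolution \<Rightarrow> nat \<Rightarrow>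
   ('r, ('u \<Rightarrow> 'r) set) module" where
  "cohomology R G C i =
     quot_module (cochains R G C i\<lparr>carrier := cocycles R G C i\<rparr>) (coboundaries R G C i)"

definition cohomology_grading ::
  "('r, 'e) ring_scheme \<Rightarrow> (nat \<Rightarrow> 'r set) \<Rightarrow> ('r, 'u, 'v) resolution \<Rightarrow> nat \<Rightarrow>
   int \<Rightarrow> ('u \<Rightarrow> 'r) set set" where
  "cohomology_grading R G C i e =
     (\<lambda>f. coboundaries R G C i +>\<^bsub>cochains R G C i\<^esub> f) `
       (cocycles R G C i \<inter> dual_deg R G (res_mod C i) (res_grading C i) e)"

text \<open>\<open>Ext\<close> is computed from a chosen graded projective resolution of the graded right module
  \<open>M\<close>, with terms in the type \<open>'u\<close>; a different choice gives isomorphic modules.\<close>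

definition chosen_resolution ::
  "'u itself \<Rightarrow> ('r, 'e) ring_scheme \<Rightarrow> (nat \<Rightarrow> 'r set) \<Rightarrow> ('r, 'v) module \<Rightarrow>
   (int \<Rightarrow> 'v set) \<Rightarrow> ('r, 'u, 'v) resolution" where
  "chosen_resolution U R G M MG = (SOME C. graded_proj_resolution (op_ring R) G M MG C)"

definition Ext ::
  "'u itself \<Rightarrow> ('r, 'e) ring_scheme \<Rightarrow> (nat \<Rightarrow> 'r set) \<Rightarrow> nat \<Rightarrow> ('r, 'v) module \<Rightarrow>
   (int \<Rightarrow> 'v set) \<Rightarrow> ('r, ('u \<Rightarrow> 'r) set) module" where
  "Ext U R G i M MG = cohomology R G (chosen_resolution U R G M MG) i"

definition Ext_grading ::
  "'u itself \<Rightarrow> ('r, 'e) ring_scheme \<Rightarrow> (nat \<Rightarrow> 'r set) \<Rightarrow> nat \<Rightarrow> ('r, 'v) module \<Rightarrow>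
   (int \<Rightarrow> 'v set) \<Rightarrow> int \<Rightarrow> ('u \<Rightarrow> 'r) set set" where
  "Ext_grading U R G i M MG = cohomology_grading R G (chosen_resolution U R G M MG) i"

section \<open>Artin-Schelter regular algebras\<close>

definition AS_regular ::
  "'m itself \<Rightarrow> ('r, 'e) ring_scheme \<Rightarrow> 'r set \<Rightarrow> (nat \<Rightarrow> 'r set) \<Rightarrow> bool" where
  "AS_regular T R K G \<longleftrightarrow>
     connected_graded_algebra R K G \<and>
     GKdim R K < \<infinity> \<and>
     (\<exists>d. has_gldim T R d \<and>
        (\<forall>i. i \<noteq> d \<longrightarrow>
           carrier (Ext TYPE('r \<times> nat \<times> 'm) R G i (trivial_module R G) (trivial_grading R G)) =
           {\<zero>\<^bsub>Ext TYPE('r \<times> nat \<times> 'm) R G i (trivial_module R G) (trivial_grading R G)\<^esub>}) \<and>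
        (\<exists>l. graded_iso R
           (Ext TYPE('r \<times> nat \<times> 'm) R G d (trivial_module R G) (trivial_grading R G))
           (Ext_grading TYPE('r \<times> nat \<times> 'm) R G d (trivial_module R G) (trivial_grading R G))
           (trivial_module R G) (shift (trivial_grading R G) l)))"

section \<open>The algebras \<open>R(n, a)\<close>\<close>

text \<open>Polynomials in \<open>X\<^sub>0, X\<^sub>1, \<dots>\<close> over \<open>'k\<close>: finitely supported maps from monomials
  (finitely supported exponent vectors) to coefficients.\<close>

type_synonym 'k mpoly = "(nat \<Rightarrow>\<^sub>0 nat) \<Rightarrow>\<^sub>0 'k"

definition Const :: "'k::zero \<Rightarrow> 'k mpoly" where
  "Const c = Poly_Mapping.single 0 c"

definition Var :: "nat \<Rightarrow> 'k::zero_neq_one mpoly" where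
  "Var i = Poly_Mapping.single (Poly_Mapping.single i 1) 1"

definition mdegree :: "(nat \<Rightarrow>\<^sub>0 nat) \<Rightarrow> nat" where
  "mdegree m = (\<Sum>i\<in>Poly_Mapping.keys m. Poly_Mapping.lookup m i)"

definition polys_upto :: "nat \<Rightarrow> 'k::zero mpoly set" where
  "polys_upto n = {p. \<forall>m\<in>Poly_Mapping.keys p. Poly_Mapping.keys m \<subseteq> {..n}}"

text \<open>In \<open>m - Poly_Mapping.single i 1\<close> the subtraction truncates only when \<open>X\<^sub>i\<close> does not
  occur in \<open>m\<close>, and then the coefficient vanishes.\<close>

definition pdiff :: "nat \<Rightarrow> 'k::comm_ring_1 mpoly \<Rightarrow> 'k mpoly" where
  "pdiff i p = (\<Sum>m\<in>Poly_Mapping.keys p.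
     Poly_Mapping.single (m - Poly_Mapping.single i 1)
       (of_nat (Poly_Mapping.lookup m i) * Poly_Mapping.lookup p m))"

definition Delta :: "nat \<Rightarrow> 'k::comm_ring_1 mpoly \<Rightarrow> 'k mpoly" where
  "Delta n p = (\<Sum>i=1..n. Var (i - 1) * pdiff i p)"

definition Gam :: "nat \<Rightarrow> 'k::comm_ring_1 \<Rightarrow> 'k mpoly \<Rightarrow> 'k mpoly" where
  "Gam n a p = (\<Sum>i=0..n. Const (a + of_nat i) * Var i * pdiff i p)"

text \<open>\<open>\<Gamma> (\<Gamma> - 1) \<dots> (\<Gamma> - (k - 1))\<close> applied to a polynomial.\<close>

fun Gam_falling :: "nat \<Rightarrow> 'k::comm_ring_1 \<Rightarrow> nat \<Rightarrow> 'k mpoly \<Rightarrow> 'k mpoly" where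
  "Gam_falling n a 0 p = p"
| "Gam_falling n a (Suc k) p = Gam_falling n a k (Gam n a p - of_nat k * p)"

definition Gam_binom :: "nat \<Rightarrow> 'k::field_char_0 \<Rightarrow> nat \<Rightarrow> 'k mpoly \<Rightarrow> 'k mpoly" where
  "Gam_binom n a k p = Const (1 / fact k) * Gam_falling n a k p"

text \<open>\<^const>\<open>Sum_any\<close> is the sum over the finitely many \<open>k\<close> with nonzero summand:
  \<open>\<Delta>\<close> is locally nilpotent.\<close>

definition star :: "nat \<Rightarrow> 'k::field_char_0 \<Rightarrow> 'k mpoly \<Rightarrow> 'k mpoly \<Rightarrow> 'k mpoly" where
  "star n a f g = Sum_any (\<lambda>k. (Delta n ^^ k) f * Gam_binom n a k g)"

definition Rna :: "nat \<Rightarrow> 'k::field_char_0 \<Rightarrow> 'k mpoly ring" where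
  "Rna n a = \<lparr>carrier = polys_upto n, mult = star n a, one = 1, zero = 0, add = (+)\<rparr>"

definition Rna_grading :: "nat \<Rightarrow> nat \<Rightarrow> 'k::zero mpoly set" where
  "Rna_grading n d = {p \<in> polys_upto n. \<forall>m\<in>Poly_Mapping.keys p. mdegree m = d}"

end

theory Submission
 imports Defs "HOL-Library.Function_Algebras" "HOL-Computational_Algebra.Formal_Power_Series"
begin

text \<open>Let \<open>\<Omega> = A \<otimes> \<Lambda>(\<theta>\<^sub>0, \<dots>, \<theta>\<^sub>n)\<close>. The derivations \<open>\<Delta>\<close> and \<open>\<Gamma>\<^sub>a\<close> extend to \<open>\<Omega>\<close> by \<open>\<theta>\<^sub>i \<mapsto> \<theta>\<^sub>i\<^sub>-\<^sub>1\<close> and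
 \<open>\<theta>\<^sub>i \<mapsto> (a + i) \<theta>\<^sub>i\<close>, still satisfy \<open>[\<Delta>, \<Gamma>] = \<Delta>\<close>, and commute with the Koszul differential
 \<open>d \<theta>\<^sub>i = X\<^sub>i\<close>. Hence the formula for \<open>f \<star> g\<close> defines an associative product on all of \<open>\<Omega>\<close>, by the Vandermonde
 identity, and \<open>d\<close> is an odd derivation of it. As \<open>\<star>\<close> is the commutative product up to terms of lower weight,
 \<open>\<Omega>\<^sup>i\<close> is a free left and right \<open>R\<close>-module on the products of the \<open>\<theta>\<^sub>j\<close>, so the Koszul complex, which is exact by
 the homotopy given by the de Rham differential, is a minimal free resolution of the trivial module on either side. The pairing of
 \<open>\<Omega>\<^sup>i\<close> and \<open>\<Omega>\<^sup>n\<^sup>+\<^sup>1\<^sup>-\<^sup>i\<close> into \<open>\<Omega>\<^sup>n\<^sup>+\<^sup>1\<close> makes it self-dual, which gives \<open>Ext\<close>; minimality bounds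
 the global dimension from below. For the upper bound, \<open>R\<close> is obtained from the base field by adjoining \<open>X\<^sub>0, \<dots>, X\<^sub>n\<close>
 in turn: each subalgebra is free over the previous one on the powers of \<open>X\<^sub>j\<close>, with \<open>X\<^sub>j c = c' X\<^sub>j + c''\<close>, and such an
 extension raises the projective dimension by at most one.\<close>

text \<open>Nothing is inverted by a formula. The weight gives \<open>X\<^sub>i\<close> and
  \<open>\<theta>\<^sub>i\<close> the value i; Delta lowers it by one and Gamma preserves it.
  Freeness, the pairing and the expansion in powers of a variable each compare a commutative
  expression with a star expression by a map that is the identity up to smaller weight, and such a
  map is bijective by induction on the weight. Extending the product to all forms pays twice: its
  associativity contains the bimodule axioms, and the Leibniz rule makes d linear on both sides
  because d is 0 on polynomials. The notion of regularity shapes the rest. Its modules live inside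
  one type, so constructions made elsewhere are copied along injections. Its \<open>Ext\<close>
  comes from an arbitrary chosen resolution, so cocycles have to be compared with Koszul cocycles.
  Its graded duals contain only finite sums of homogeneous maps, so a cochain obtained from a
  homotopy has to be cut down to finitely many degrees. Characteristic zero enters through the
  binomials of Gamma and through division by the total degree in the homotopy.\<close>

hide_const (open) Multiset.mult

section \<open>Modules and homomorphisms\<close>

context left_module
begin

lemma smult_l_null: "x \<in> carrier M \<Longrightarrow> \<zero>\<^bsub>R\<^esub> \<odot>\<^bsub>M\<^esub> x = \<zero>\<^bsub>M\<^esub>"
 using smult_l_distr[of "\<zero>\<^bsub>R\<^esub>" "\<zero>\<^bsub>R\<^esub>" x] smult_closed[of "\<zero>\<^bsub>R\<^esub>" x]
 by (metis M.add.r_cancel_one' R.l_zero R.zero_closed)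

lemma smult_r_null: "r \<in> carrier R \<Longrightarrow> r \<odot>\<^bsub>M\<^esub> \<zero>\<^bsub>M\<^esub> = \<zero>\<^bsub>M\<^esub>"
 using smult_r_distr[of r "\<zero>\<^bsub>M\<^esub>" "\<zero>\<^bsub>M\<^esub>"] smult_closed[of r "\<zero>\<^bsub>M\<^esub>"]
 by (metis M.add.r_cancel_one' M.l_zero M.zero_closed)

lemma smult_l_minus: "\<lbrakk>r \<in> carrier R; x \<in> carrier M\<rbrakk> \<Longrightarrow> (\<ominus>\<^bsub>R\<^esub> r) \<odot>\<^bsub>M\<^esub> x = \<ominus>\<^bsub>M\<^esub> (r \<odot>\<^bsub>M\<^esub> x)"
 by (metis M.minus_equality R.add.inv_closed R.l_neg smult_closed smult_l_distr smult_l_null)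

lemma smult_r_minus: "\<lbrakk>r \<in> carrier R; x \<in> carrier M\<rbrakk> \<Longrightarrow> r \<odot>\<^bsub>M\<^esub> (\<ominus>\<^bsub>M\<^esub> x) = \<ominus>\<^bsub>M\<^esub> (r \<odot>\<^bsub>M\<^esub> x)"
 by (metis M.add.inv_closed M.l_neg M.minus_equality smult_closed smult_r_distr smult_r_null)

lemma smult_minus_one: "x \<in> carrier M \<Longrightarrow> (\<ominus>\<^bsub>R\<^esub> \<one>\<^bsub>R\<^esub>) \<odot>\<^bsub>M\<^esub> x = \<ominus>\<^bsub>M\<^esub> x"
 by (simp add: smult_l_minus smult_one)

end

text \<open>Closure under negatives comes with the scalars: -x is -1 acting on x.\<close>

lemma left_module_restrict:
 assumes M: "left_module R M" and sub: "H \<subseteq> carrier M" and z: "\<zero>\<^bsub>M\<^esub> \<in> H"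
  and add: "\<And>x y. \<lbrakk>x \<in> H; y \<in> H\<rbrakk> \<Longrightarrow> x \<oplus>\<^bsub>M\<^esub> y \<in> H"
  and sm: "\<And>r x. \<lbrakk>r \<in> carrier R; x \<in> H\<rbrakk> \<Longrightarrow> r \<odot>\<^bsub>M\<^esub> x \<in> H"
 shows "left_module R (M\<lparr>carrier := H\<rparr>)"
proof -
 interpret left_module R M by fact
 have neg: "\<ominus>\<^bsub>M\<^esub> x \<in> H" if "x \<in> H" for x
  using sm[of "\<ominus>\<^bsub>R\<^esub> \<one>\<^bsub>R\<^esub>" x] that sub by (auto simp: smult_minus_one)
 have ab: "abelian_group (M\<lparr>carrier := H\<rparr>)"
 proof (rule abelian_groupI)
  fix x assume "x \<in> carrier (M\<lparr>carrier := H\<rparr>)"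
  then show "\<exists>y\<in>carrier (M\<lparr>carrier := H\<rparr>). y \<oplus>\<^bsub>M\<lparr>carrier := H\<rparr>\<^esub> x = \<zero>\<^bsub>M\<lparr>carrier := H\<rparr>\<^esub>"
   using neg sub by (intro bexI[of _ "\<ominus>\<^bsub>M\<^esub> x"]) (auto simp: M.l_neg subset_iff)
 qed (use sub z add in "auto simp: M.a_ac subset_iff")
 show ?thesis
  by (intro left_module.intro left_module_axioms.intro R.ring_axioms ab)
   (use sub sm in "auto simp: smult_l_distr smult_r_distr smult_assoc smult_one subset_iff")
qed

lemma mod_homI:
 assumes "\<And>x. x \<in> carrier M \<Longrightarrow> f x \<in> carrier N"
  and "\<And>x y. \<lbrakk>x \<in> carrier M; y \<in> carrier M\<rbrakk> \<Longrightarrow> f (x \<oplus>\<^bsub>M\<^esub> y) = f x \<oplus>\<^bsub>N\<^esub> f y"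
  and "\<And>r x. \<lbrakk>r \<in> carrier R; x \<in> carrier M\<rbrakk> \<Longrightarrow> f (r \<odot>\<^bsub>M\<^esub> x) = r \<odot>\<^bsub>N\<^esub> f x"
 shows "f \<in> mod_hom R M N"
 using assms by (auto simp: mod_hom_def)

lemma mod_hom_closed: "\<lbrakk>f \<in> mod_hom R M N; x \<in> carrier M\<rbrakk> \<Longrightarrow> f x \<in> carrier N"
 and mod_hom_add: "\<lbrakk>f \<in> mod_hom R M N; x \<in> carrier M; y \<in> carrier M\<rbrakk> \<Longrightarrow>
  f (x \<oplus>\<^bsub>M\<^esub> y) = f x \<oplus>\<^bsub>N\<^esub> f y"
 and mod_hom_smult: "\<lbrakk>f \<in> mod_hom R M N; r \<in> carrier R; x \<in> carrier M\<rbrakk> \<Longrightarrow>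
  f (r \<odot>\<^bsub>M\<^esub> x) = r \<odot>\<^bsub>N\<^esub> f x"
 by (auto simp: mod_hom_def)

lemma mod_hom_zero:
 assumes "left_module R M" "left_module R N" "f \<in> mod_hom R M N"
 shows "f \<zero>\<^bsub>M\<^esub> = \<zero>\<^bsub>N\<^esub>"
proof -
 interpret M: left_module R M by fact
 interpret N: left_module R N by fact
 have "f (\<zero>\<^bsub>R\<^esub> \<odot>\<^bsub>M\<^esub> \<zero>\<^bsub>M\<^esub>) = \<zero>\<^bsub>R\<^esub> \<odot>\<^bsub>N\<^esub> f \<zero>\<^bsub>M\<^esub>"
  by (rule mod_hom_smult[OF assms(3)]) auto
 then show ?thesis using mod_hom_closed[OF assms(3)] by (simp add: M.smult_r_null N.smult_l_null)
qed

lemma mod_hom_neg: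
 assumes "left_module R M" "left_module R N" "f \<in> mod_hom R M N" "x \<in> carrier M"
 shows "f (\<ominus>\<^bsub>M\<^esub> x) = \<ominus>\<^bsub>N\<^esub> f x"
proof -
 interpret M: left_module R M by fact
 interpret N: left_module R N by fact
 have "f ((\<ominus>\<^bsub>R\<^esub> \<one>\<^bsub>R\<^esub>) \<odot>\<^bsub>M\<^esub> x) = (\<ominus>\<^bsub>R\<^esub> \<one>\<^bsub>R\<^esub>) \<odot>\<^bsub>N\<^esub> f x"
  by (rule mod_hom_smult[OF assms(3)]) (auto simp: assms)
 then show ?thesis using mod_hom_closed[OF assms(3)] assms(4)
  by (simp add: M.smult_minus_one N.smult_minus_one)
qed

lemma mod_hom_diff:
 assumes "left_module R M" "left_module R N" "f \<in> mod_hom R M N" "x \<in> carrier M" "y \<in> carrier M"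
 shows "f (x \<ominus>\<^bsub>M\<^esub> y) = f x \<ominus>\<^bsub>N\<^esub> f y"
proof -
 interpret M: left_module R M by fact
 interpret N: left_module R N by fact
 show ?thesis using assms by (simp add: a_minus_def mod_hom_add[OF assms(3)] mod_hom_neg)
qed

lemma mod_hom_finsum:
 assumes "left_module R M" "left_module R N" "f \<in> mod_hom R M N"
  and "finite I" "\<And>i. i \<in> I \<Longrightarrow> p i \<in> carrier M"
 shows "f (\<Oplus>\<^bsub>M\<^esub>i\<in>I. p i) = (\<Oplus>\<^bsub>N\<^esub>i\<in>I. f (p i))"
proof -
 interpret M: left_module R M by fact
 interpret N: left_module R N by fact
 show ?thesis using assms(4,5)
 proof (induction I rule: finite_induct)
  case empty
  then show ?case by (simp add: mod_hom_zero[OF assms(1-3)])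
 next
  case (insert i I)
  then show ?case using assms(3)
   by (subst M.finsum_insert, auto simp: Pi_def)
    (subst N.finsum_insert, auto simp: Pi_def mod_hom_closed mod_hom_add M.finsum_closed)
 qed
qed

lemma (in left_module) finsum_smult:
 assumes "finite I" "\<And>i. i \<in> I \<Longrightarrow> p i \<in> carrier M" "r \<in> carrier R"
 shows "r \<odot>\<^bsub>M\<^esub> (\<Oplus>\<^bsub>M\<^esub>i\<in>I. p i) = (\<Oplus>\<^bsub>M\<^esub>i\<in>I. r \<odot>\<^bsub>M\<^esub> p i)"
 using assms
proof (induction I rule: finite_induct)
 case empty
 then show ?case by (simp add: smult_r_null)
next
 case (insert i I)
 then show ?case
  by (subst M.finsum_insert, auto simp: Pi_def)
   (subst M.finsum_insert, auto simp: Pi_def smult_closed smult_r_distr M.finsum_closed)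
qed

lemma mod_hom_comp:
 assumes "f \<in> mod_hom R M N" "g \<in> mod_hom R N L"
 shows "(\<lambda>x. g (f x)) \<in> mod_hom R M L"
 using assms by (auto simp: mod_hom_def Pi_iff)

lemma mod_hom_cong:
 assumes "left_module R M" "f \<in> mod_hom R M N" "\<And>x. x \<in> carrier M \<Longrightarrow> f' x = f x"
 shows "f' \<in> mod_hom R M N"
proof -
 interpret left_module R M by fact
 show ?thesis using assms(2,3) by (auto simp: mod_hom_def Pi_iff smult_closed)
qed

lemma mod_hom_plus:
 assumes "left_module R N" "f \<in> mod_hom R M N" "g \<in> mod_hom R M N"
 shows "(\<lambda>x. f x \<oplus>\<^bsub>N\<^esub> g x) \<in> mod_hom R M N"
proof -
 interpret left_module R N by fact
 show ?thesis using assms(2,3)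
  by (auto simp: mod_hom_def Pi_iff smult_r_distr M.a_ac)
qed

lemma mod_hom_uminus:
 assumes "left_module R N" "f \<in> mod_hom R M N"
 shows "(\<lambda>x. \<ominus>\<^bsub>N\<^esub> f x) \<in> mod_hom R M N"
proof -
 interpret left_module R N by fact
 show ?thesis using assms(2)
  by (auto simp: mod_hom_def Pi_iff smult_r_minus M.minus_add)
qed

lemma mod_hom_minus:
 assumes "left_module R N" "f \<in> mod_hom R M N" "g \<in> mod_hom R M N"
 shows "(\<lambda>x. f x \<ominus>\<^bsub>N\<^esub> g x) \<in> mod_hom R M N"
 unfolding a_minus_def by (intro mod_hom_plus mod_hom_uminus assms)

lemma mod_hom_const_zero:
 assumes "left_module R N" shows "(\<lambda>x. \<zero>\<^bsub>N\<^esub>) \<in> mod_hom R M N"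
proof -
 interpret left_module R N by fact
 show ?thesis by (rule mod_homI) (auto simp: smult_r_null)
qed

lemma mod_hom_restrict_cod:
 "\<lbrakk>f \<in> mod_hom R M N; f ` carrier M \<subseteq> H\<rbrakk> \<Longrightarrow> f \<in> mod_hom R M (N\<lparr>carrier := H\<rparr>)"
 by (auto simp: mod_hom_def subset_iff Pi_iff image_iff)

lemma left_module_image:
 assumes M: "left_module R M" and N: "left_module R N" and f: "f \<in> mod_hom R M N"
 shows "left_module R (N\<lparr>carrier := f ` carrier M\<rparr>)"
proof -
 interpret M: left_module R M by fact
 show ?thesis
 proof (rule left_module_restrict[OF N])
  show "\<zero>\<^bsub>N\<^esub> \<in> f ` carrier M" by (metis M.M.zero_closed M N f image_eqI mod_hom_zero)
  fix x y assume "x \<in> f ` carrier M" "y \<in> f ` carrier M"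
  then show "x \<oplus>\<^bsub>N\<^esub> y \<in> f ` carrier M"
   by (auto simp: mod_hom_add[OF f, symmetric])
 next
  fix r x assume "r \<in> carrier R" "x \<in> f ` carrier M"
  then show "r \<odot>\<^bsub>N\<^esub> x \<in> f ` carrier M"
   by (auto simp: mod_hom_smult[OF f, symmetric] M.smult_closed)
 qed (use f in "auto simp: mod_hom_closed")
qed

text \<open>Only the carrier changes, so a kernel stays in the type of M. This lets the recursive
  notion \<open>pd_le\<close> pass from a module to its syzygies.\<close>

definition hom_ker :: "('r, 'u) module \<Rightarrow> ('r, 'v) module \<Rightarrow> ('u \<Rightarrow> 'v) \<Rightarrow> ('r, 'u) module" where
 "hom_ker M N f = M\<lparr>carrier := {x \<in> carrier M. f x = \<zero>\<^bsub>N\<^esub>}\<rparr>"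

lemma left_module_hom_ker:
 assumes M: "left_module R M" and N: "left_module R N" and f: "f \<in> mod_hom R M N"
 shows "left_module R (hom_ker M N f)"
proof -
 interpret M: left_module R M by fact
 interpret N: left_module R N by fact
 show ?thesis unfolding hom_ker_def
  by (rule left_module_restrict[OF M])
   (auto simp: mod_hom_zero[OF M N f] mod_hom_add[OF f] mod_hom_smult[OF f] M.smult_closed
    N.smult_r_null)
qed

lemma hom_ker_simps [simp]:
 "carrier (hom_ker M N f) = {x \<in> carrier M. f x = \<zero>\<^bsub>N\<^esub>}"
 "add (hom_ker M N f) = add M" "zero (hom_ker M N f) = zero M" "smult (hom_ker M N f) = smult M"
 by (simp_all add: hom_ker_def)

lemma left_module_regular: "ring R \<Longrightarrow> left_module R (regular_module R)"
proof -
 assume "ring R"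
 then interpret ring R .
 show ?thesis
 proof (intro left_module.intro left_module_axioms.intro)
  show "abelian_group (regular_module R)"
  proof (rule abelian_groupI)
   fix x assume "x \<in> carrier (regular_module R)"
   then show "\<exists>y\<in>carrier (regular_module R). y \<oplus>\<^bsub>regular_module R\<^esub> x = \<zero>\<^bsub>regular_module R\<^esub>"
    by (intro bexI[of _ "a_inv R x"]) (auto simp: regular_module_def l_neg)
  qed (auto simp: regular_module_def a_ac)
 qed (auto simp: regular_module_def l_distr r_distr m_assoc ring_axioms)
qed

lemma regular_module_simps [simp]:
 "carrier (regular_module R) = carrier R" "add (regular_module R) = add R"
 "zero (regular_module R) = zero R" "smult (regular_module R) = mult R"
 by (simp_all add: regular_module_def)

section \<open>Projective and free modules\<close>

lemma projective_left_module: "projective R P \<Longrightarrow> left_module R P"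
 by (simp add: projective_def)

lemma projective_zero:
 assumes "left_module R M" "carrier M = {\<zero>\<^bsub>M\<^esub>}" shows "projective R M"
 unfolding projective_def
proof (intro conjI allI impI, fact, elim conjE)
 fix A B :: "('a, 'c) module" and g f
 assume *: "left_module R A" "left_module R B" "g \<in> mod_hom R A B" "f \<in> mod_hom R M B"
 show "\<exists>h\<in>mod_hom R M A. \<forall>x\<in>carrier M. g (h x) = f x"
  using * by (intro bexI[of _ "\<lambda>x. \<zero>\<^bsub>A\<^esub>"])
   (auto simp: assms mod_hom_zero[OF assms(1) *(2,4)] mod_hom_zero[OF *(1-3)] mod_hom_const_zero)
qed

text \<open>Freeness by a dual basis: the functionals \<open>c b\<close> are the coordinates with
  respect to \<open>e b\<close>, finitely many nonzero at each element and jointly injective. In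
  this form freeness passes through restriction of scalars and transport by composing
  functionals.\<close>

definition free_on ::
 "('r, 'e) ring_scheme \<Rightarrow> ('r, 'u) module \<Rightarrow> 'b set \<Rightarrow> ('b \<Rightarrow> 'u) \<Rightarrow> ('b \<Rightarrow> 'u \<Rightarrow> 'r) \<Rightarrow> bool" where
 "free_on R P B e c \<longleftrightarrow> left_module R P \<and>
   (\<forall>b\<in>B. e b \<in> carrier P \<and> c b \<in> mod_hom R P (regular_module R)) \<and>
   (\<forall>p\<in>carrier P. finite {b \<in> B. c b p \<noteq> \<zero>\<^bsub>R\<^esub>}) \<and>
   (\<forall>b\<in>B. \<forall>b'\<in>B. c b (e b') = (if b = b' then \<one>\<^bsub>R\<^esub> else \<zero>\<^bsub>R\<^esub>)) \<and>
   (\<forall>p\<in>carrier P. (\<forall>b\<in>B. c b p = \<zero>\<^bsub>R\<^esub>) \<longrightarrow> p = \<zero>\<^bsub>P\<^esub>)"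

text \<open>The difference of the two sides has all coordinates zero, and the coordinates separate
  elements.\<close>

lemma free_on_expand:
 assumes F: "free_on R P B e c" and p: "p \<in> carrier P"
 shows "p = (\<Oplus>\<^bsub>P\<^esub>b\<in>{b \<in> B. c b p \<noteq> \<zero>\<^bsub>R\<^esub>}. c b p \<odot>\<^bsub>P\<^esub> e b)"
proof -
 interpret P: left_module R P using F by (simp add: free_on_def)
 have reg: "left_module R (regular_module R)" by (rule left_module_regular) (rule P.R.ring_axioms)
 interpret Reg: left_module R "regular_module R" by (rule reg)
 have e: "e b \<in> carrier P" and c: "c b \<in> mod_hom R P (regular_module R)" if "b \<in> B" for b
  using F that by (auto simp: free_on_def)
 have cc: "c b q \<in> carrier R" if "b \<in> B" "q \<in> carrier P" for b q
  using mod_hom_closed[OF c] that by simp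
 define Z where "Z = {b \<in> B. c b p \<noteq> \<zero>\<^bsub>R\<^esub>}"
 define q where "q = (\<Oplus>\<^bsub>P\<^esub>b\<in>Z. c b p \<odot>\<^bsub>P\<^esub> e b)"
 have fin: "finite Z" using F p by (auto simp: free_on_def Z_def)
 have q: "q \<in> carrier P" unfolding q_def
  by (rule P.M.finsum_closed) (use p e cc in "auto simp: Z_def P.smult_closed")
 have "c b' q = c b' p" if b': "b' \<in> B" for b'
 proof -
  have "c b' q = (\<Oplus>\<^bsub>regular_module R\<^esub>b\<in>Z. c b' (c b p \<odot>\<^bsub>P\<^esub> e b))" unfolding q_def
   by (rule mod_hom_finsum[OF P.left_module_axioms reg c[OF b'] fin])
    (use p e cc in "auto simp: Z_def P.smult_closed")
  also have "\<dots> = (\<Oplus>\<^bsub>regular_module R\<^esub>b\<in>Z. if b' = b then c b p else \<zero>\<^bsub>R\<^esub>)"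
  proof (rule Reg.M.finsum_cong', simp)
   fix b assume "b \<in> Z"
   then have b: "b \<in> B" by (simp add: Z_def)
   have "c b' (c b p \<odot>\<^bsub>P\<^esub> e b) = c b p \<otimes>\<^bsub>R\<^esub> c b' (e b)"
    using mod_hom_smult[OF c[OF b'] cc[OF b p] e[OF b]] by simp
   also have "c b' (e b) = (if b' = b then \<one>\<^bsub>R\<^esub> else \<zero>\<^bsub>R\<^esub>)" using F b b' by (auto simp: free_on_def)
   finally show "c b' (c b p \<odot>\<^bsub>P\<^esub> e b) = (if b' = b then c b p else \<zero>\<^bsub>R\<^esub>)"
    using cc[OF b p] by auto
  qed (use p cc in "auto simp: Z_def")
  also have "\<dots> = c b' p"
  proof (cases "b' \<in> Z")
   case True
   then show ?thesis
    using Reg.M.finsum_singleton[OF True fin, of "\<lambda>b. c b p", unfolded regular_module_simps] p cc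
    by (simp add: Z_def Pi_iff)
  next
   case False
   then have "(\<Oplus>\<^bsub>regular_module R\<^esub>b\<in>Z. if b' = b then c b p else \<zero>\<^bsub>R\<^esub>)
     = (\<Oplus>\<^bsub>regular_module R\<^esub>b\<in>Z. \<zero>\<^bsub>regular_module R\<^esub>)"
    by (intro Reg.M.finsum_cong') auto
   then show ?thesis using False b' by (simp add: Z_def Reg.M.add.finprod_one_eqI)
  qed
  finally show ?thesis .
 qed
 then have "c b (p \<ominus>\<^bsub>P\<^esub> q) = \<zero>\<^bsub>R\<^esub>" if "b \<in> B" for b
  using mod_hom_diff[OF P.left_module_axioms reg c[OF that] p q] that cc[OF that p]
   Reg.M.r_neg[of "c b p"] by (simp add: a_minus_def)
 then have "p \<ominus>\<^bsub>P\<^esub> q = \<zero>\<^bsub>P\<^esub>" using F p q by (auto simp: free_on_def)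
 then have "p = q" using p q P.M.minus_equality[of p "\<ominus>\<^bsub>P\<^esub> q"] by (simp add: a_minus_def)
 then show ?thesis by (simp add: q_def Z_def)
qed

lemma free_on_induct [consumes 2, case_names zero basis add]:
 assumes F: "free_on R P B e c" and p: "p \<in> carrier P"
  and zero: "Q \<zero>\<^bsub>P\<^esub>" and basis: "\<And>r b. \<lbrakk>r \<in> carrier R; b \<in> B\<rbrakk> \<Longrightarrow> Q (r \<odot>\<^bsub>P\<^esub> e b)"
  and add: "\<And>x y. \<lbrakk>x \<in> carrier P; y \<in> carrier P; Q x; Q y\<rbrakk> \<Longrightarrow> Q (x \<oplus>\<^bsub>P\<^esub> y)"
 shows "Q p"
proof -
 interpret P: left_module R P using F by (simp add: free_on_def)
 have e: "e b \<in> carrier P" and c: "c b p \<in> carrier R" if "b \<in> B" for b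
  using F that p mod_hom_closed[of "c b" R P "regular_module R" p] by (auto simp: free_on_def)
 have "Q (\<Oplus>\<^bsub>P\<^esub>b\<in>J. c b p \<odot>\<^bsub>P\<^esub> e b)" if "finite J" "J \<subseteq> B" for J
  using that
 proof (induction J rule: finite_induct)
  case (insert b J)
  then have "(\<Oplus>\<^bsub>P\<^esub>b\<in>insert b J. c b p \<odot>\<^bsub>P\<^esub> e b) = c b p \<odot>\<^bsub>P\<^esub> e b \<oplus>\<^bsub>P\<^esub> (\<Oplus>\<^bsub>P\<^esub>b\<in>J. c b p \<odot>\<^bsub>P\<^esub> e b)"
   by (intro P.M.finsum_insert) (auto simp: e c P.smult_closed subset_iff)
  then show ?case using insert
   by (auto intro!: add basis P.M.finsum_closed simp: e c P.smult_closed subset_iff)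
 qed (simp add: zero)
 then show ?thesis using free_on_expand[OF F p] F p by (fastforce simp: free_on_def)
qed

text \<open>The extension is the coordinate sum over the support of p. Supports vary with p, so each
  identity is checked over a common finite index set, where the additional terms vanish.\<close>

lemma free_on_extend:
 assumes F: "free_on R P B e c" and X: "left_module R X" and v: "\<And>b. b \<in> B \<Longrightarrow> v b \<in> carrier X"
 shows "\<exists>h\<in>mod_hom R P X. \<forall>b\<in>B. h (e b) = v b"
proof -
 interpret P: left_module R P using F by (simp add: free_on_def)
 interpret X: left_module R X by fact
 have e: "e b \<in> carrier P" and c: "c b \<in> mod_hom R P (regular_module R)" if "b \<in> B" for b
  using F that by (auto simp: free_on_def)
 have cc: "c b q \<in> carrier R" if "b \<in> B" "q \<in> carrier P" for b q
  using mod_hom_closed[OF c] that by simp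
 define Z where "Z p = {b \<in> B. c b p \<noteq> \<zero>\<^bsub>R\<^esub>}" for p
 define h where "h p = (\<Oplus>\<^bsub>X\<^esub>b\<in>Z p. c b p \<odot>\<^bsub>X\<^esub> v b)" for p
 have fin: "finite (Z p)" if "p \<in> carrier P" for p using F that by (auto simp: free_on_def Z_def)
 have big: "h p = (\<Oplus>\<^bsub>X\<^esub>b\<in>J. c b p \<odot>\<^bsub>X\<^esub> v b)"
  if "p \<in> carrier P" "finite J" "Z p \<subseteq> J" "J \<subseteq> B" for p J
  unfolding h_def
  by (rule X.M.add.finprod_mono_neutral_cong_left)
   (use that v cc in "auto simp: Z_def X.smult_l_null X.smult_closed subset_iff")
 have "h \<in> mod_hom R P X"
 proof (rule mod_homI)
  fix p assume p: "p \<in> carrier P"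
  show "h p \<in> carrier X" unfolding h_def
   by (rule X.M.finsum_closed) (use p v cc in "auto simp: Z_def X.smult_closed")
 next
  fix p q assume p: "p \<in> carrier P" and q: "q \<in> carrier P"
  let ?J = "Z p \<union> Z q \<union> Z (p \<oplus>\<^bsub>P\<^esub> q)"
  have J: "finite ?J" "?J \<subseteq> B" using fin p q by (auto simp: Z_def)
  have "h (p \<oplus>\<^bsub>P\<^esub> q) = (\<Oplus>\<^bsub>X\<^esub>b\<in>?J. c b (p \<oplus>\<^bsub>P\<^esub> q) \<odot>\<^bsub>X\<^esub> v b)"
   by (rule big) (use J p q in auto)
  also have "\<dots> = (\<Oplus>\<^bsub>X\<^esub>b\<in>?J. c b p \<odot>\<^bsub>X\<^esub> v b \<oplus>\<^bsub>X\<^esub> c b q \<odot>\<^bsub>X\<^esub> v b)"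
  proof (rule X.M.finsum_cong')
   fix b assume "b \<in> ?J"
   then have b: "b \<in> B" using J by auto
   show "c b (p \<oplus>\<^bsub>P\<^esub> q) \<odot>\<^bsub>X\<^esub> v b = c b p \<odot>\<^bsub>X\<^esub> v b \<oplus>\<^bsub>X\<^esub> c b q \<odot>\<^bsub>X\<^esub> v b"
    using mod_hom_add[OF c[OF b] p q] v[OF b] cc b p q by (simp add: X.smult_l_distr)
  qed (use J v cc p q in "auto simp: X.smult_closed subset_iff")
  also have "\<dots> = (\<Oplus>\<^bsub>X\<^esub>b\<in>?J. c b p \<odot>\<^bsub>X\<^esub> v b) \<oplus>\<^bsub>X\<^esub> (\<Oplus>\<^bsub>X\<^esub>b\<in>?J. c b q \<odot>\<^bsub>X\<^esub> v b)"
   by (rule X.M.finsum_addf) (use J v cc p q in "auto simp: X.smult_closed subset_iff")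
  also have "\<dots> = h p \<oplus>\<^bsub>X\<^esub> h q"
   using big[OF p J(1) _ J(2)] big[OF q J(1) _ J(2)] by (simp add: le_supI1)
  finally show "h (p \<oplus>\<^bsub>P\<^esub> q) = h p \<oplus>\<^bsub>X\<^esub> h q" .
 next
  fix r p assume r: "r \<in> carrier R" and p: "p \<in> carrier P"
  let ?J = "Z p \<union> Z (r \<odot>\<^bsub>P\<^esub> p)"
  have rp: "r \<odot>\<^bsub>P\<^esub> p \<in> carrier P" using r p by (simp add: P.smult_closed)
  have J: "finite ?J" "?J \<subseteq> B" using fin p rp by (auto simp: Z_def)
  have "h (r \<odot>\<^bsub>P\<^esub> p) = (\<Oplus>\<^bsub>X\<^esub>b\<in>?J. c b (r \<odot>\<^bsub>P\<^esub> p) \<odot>\<^bsub>X\<^esub> v b)"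
   by (rule big) (use J rp in auto)
  also have "\<dots> = (\<Oplus>\<^bsub>X\<^esub>b\<in>?J. r \<odot>\<^bsub>X\<^esub> (c b p \<odot>\<^bsub>X\<^esub> v b))"
  proof (rule X.M.finsum_cong')
   fix b assume "b \<in> ?J"
   then have b: "b \<in> B" using J by auto
   show "c b (r \<odot>\<^bsub>P\<^esub> p) \<odot>\<^bsub>X\<^esub> v b = r \<odot>\<^bsub>X\<^esub> (c b p \<odot>\<^bsub>X\<^esub> v b)"
    using mod_hom_smult[OF c[OF b] r p] v[OF b] cc[OF b p] r by (simp add: X.smult_assoc)
  qed (use J v cc p r in "auto simp: X.smult_closed subset_iff")
  also have "\<dots> = r \<odot>\<^bsub>X\<^esub> (\<Oplus>\<^bsub>X\<^esub>b\<in>?J. c b p \<odot>\<^bsub>X\<^esub> v b)"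
   by (rule X.finsum_smult[symmetric]) (use J v cc p r in "auto simp: X.smult_closed subset_iff")
  also have "\<dots> = r \<odot>\<^bsub>X\<^esub> h p" using big[OF p J(1) _ J(2)] by simp
  finally show "h (r \<odot>\<^bsub>P\<^esub> p) = r \<odot>\<^bsub>X\<^esub> h p" .
 qed
 moreover have "h (e b) = v b" if b: "b \<in> B" for b
 proof -
  have "h (e b) = (\<Oplus>\<^bsub>X\<^esub>b'\<in>{b}. c b' (e b) \<odot>\<^bsub>X\<^esub> v b')"
   by (rule big) (use F b e in "auto simp: Z_def free_on_def split: if_splits")
  also have "\<dots> = c b (e b) \<odot>\<^bsub>X\<^esub> v b"
   using b v[OF b] cc[OF b e[OF b]] by (simp add: X.smult_closed)
  finally show ?thesis using F b v[OF b] by (simp add: free_on_def X.smult_one)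
 qed
 ultimately show ?thesis by blast
qed

lemma free_on_projective:
 fixes P :: "('r, 'u) module"
 assumes F: "free_on R P B e c"
 shows "projective R P"
proof -
 have P: "left_module R P" using F by (simp add: free_on_def)
 interpret P: left_module R P by fact
 have e: "e b \<in> carrier P" if "b \<in> B" for b using F that by (auto simp: free_on_def)
 show ?thesis unfolding projective_def
 proof (intro conjI allI impI P, elim conjE)
  fix X Y :: "('r, 'u) module" and g f
  assume X: "left_module R X" and Y: "left_module R Y" and g: "g \<in> mod_hom R X Y"
   and sur: "g ` carrier X = carrier Y" and f: "f \<in> mod_hom R P Y"
  have "\<forall>b\<in>B. \<exists>x\<in>carrier X. g x = f (e b)"
   using sur e mod_hom_closed[OF f] by (metis imageE)
  then obtain v where v: "\<And>b. b \<in> B \<Longrightarrow> v b \<in> carrier X" "\<And>b. b \<in> B \<Longrightarrow> g (v b) = f (e b)" by metis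
  obtain h where h: "h \<in> mod_hom R P X" "\<And>b. b \<in> B \<Longrightarrow> h (e b) = v b"
   using free_on_extend[OF F X, of v] v(1) by blast
  have "g (h p) = f p" if "p \<in> carrier P" for p
   using F that
  proof (induction p rule: free_on_induct)
   case zero
   then show ?case by (simp add: mod_hom_zero[OF P X h(1)] mod_hom_zero[OF X Y g] mod_hom_zero[OF P Y f])
  next
   case (basis r b)
   then show ?case using e h v
    by (simp add: mod_hom_smult[OF h(1)] mod_hom_smult[OF g] mod_hom_smult[OF f])
  next
   case (add x y)
   then show ?case using mod_hom_closed[OF h(1)]
    by (simp add: mod_hom_add[OF h(1)] mod_hom_add[OF g] mod_hom_add[OF f])
  qed
  then show "\<exists>h\<in>mod_hom R P X. \<forall>p\<in>carrier P. g (h p) = f p" using h(1) by blast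
 qed
qed

lemma projective_retract:
 fixes F P :: "('r, 'u) module"
 assumes F: "projective R F" and P: "left_module R P" and i: "i \<in> mod_hom R P F" and r: "r \<in> mod_hom R F P"
  and ri: "\<And>p. p \<in> carrier P \<Longrightarrow> r (i p) = p"
 shows "projective R P"
 unfolding projective_def
proof (intro conjI allI impI P, elim conjE)
 fix X Y :: "('r, 'u) module" and g f
 assume "left_module R X" "left_module R Y" "g \<in> mod_hom R X Y" "g ` carrier X = carrier Y"
  and f: "f \<in> mod_hom R P Y"
 with F mod_hom_comp[OF r f] obtain h where h: "h \<in> mod_hom R F X" "\<forall>x\<in>carrier F. g (h x) = f (r x)"
  unfolding projective_def by blast
 then show "\<exists>h\<in>mod_hom R P X. \<forall>p\<in>carrier P. g (h p) = f p"
  using mod_hom_comp[OF i h(1)] mod_hom_closed[OF i] ri by (intro bexI) auto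
qed

section \<open>Transport of structure\<close>

text \<open>Projectivity, resolutions and \<open>Ext\<close> speak of modules inside a single type.
  This copies a module built elsewhere into that type, along a map that is injective on its
  carrier.\<close>

definition transport :: "('w \<Rightarrow> 'u) \<Rightarrow> ('r, 'w) module \<Rightarrow> ('r, 'u) module" where
 "transport t N = \<lparr>carrier = t ` carrier N, mult = undefined, one = undefined, zero = t \<zero>\<^bsub>N\<^esub>,
   add = (\<lambda>x y. t (inv_into (carrier N) t x \<oplus>\<^bsub>N\<^esub> inv_into (carrier N) t y)),
   smult = (\<lambda>r x. t (r \<odot>\<^bsub>N\<^esub> inv_into (carrier N) t x))\<rparr>"

lemma transport_simps [simp]:
 "carrier (transport t N) = t ` carrier N" "zero (transport t N) = t \<zero>\<^bsub>N\<^esub>"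
 by (simp_all add: transport_def)

lemma
 assumes N: "left_module R N" and t: "inj_on t (carrier N)"
 shows left_module_transport: "left_module R (transport t N)"
  and transport_hom: "t \<in> mod_hom R N (transport t N)"
  and transport_inv_hom: "inv_into (carrier N) t \<in> mod_hom R (transport t N) N"
proof -
 interpret N: left_module R N by fact
 have inv [simp]: "inv_into (carrier N) t (t x) = x" if "x \<in> carrier N" for x
  using t that by simp
 have add [simp]: "t x \<oplus>\<^bsub>transport t N\<^esub> t y = t (x \<oplus>\<^bsub>N\<^esub> y)" if "x \<in> carrier N" "y \<in> carrier N" for x y
  using that by (simp add: transport_def)
 have sm [simp]: "r \<odot>\<^bsub>transport t N\<^esub> t x = t (r \<odot>\<^bsub>N\<^esub> x)" if "x \<in> carrier N" for r x
  using that by (simp add: transport_def)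
 have "abelian_group (transport t N)"
 proof (rule abelian_groupI)
  fix x assume "x \<in> carrier (transport t N)"
  then obtain y where y: "y \<in> carrier N" "x = t y" by auto
  then show "\<exists>y\<in>carrier (transport t N). y \<oplus>\<^bsub>transport t N\<^esub> x = \<zero>\<^bsub>transport t N\<^esub>"
   by (intro bexI[of _ "t (\<ominus>\<^bsub>N\<^esub> y)"]) (auto simp: N.M.l_neg)
 qed (auto simp: N.M.a_ac)
 then show "left_module R (transport t N)"
  by (intro left_module.intro left_module_axioms.intro N.R.ring_axioms)
   (auto simp: N.smult_closed N.smult_l_distr N.smult_r_distr N.smult_assoc N.smult_one)
 show "t \<in> mod_hom R N (transport t N)" by (rule mod_homI) auto
 show "inv_into (carrier N) t \<in> mod_hom R (transport t N) N"
  by (rule mod_homI) (auto simp: N.smult_closed)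
qed

text \<open>The definition of projectivity only provides lifts along surjections between modules in
  the type of P. Replacing B by the image of g makes g onto, and a set-theoretic section of g
  carries that image into the type of A. So targets of any type become admissible, and g only has to
  cover the image of f.\<close>

lemma projective_lift:
 fixes A :: "('r, 'u) module" and B :: "('r, 'v) module" and P :: "('r, 'u) module"
 assumes P: "projective R P" and A: "left_module R A" and B: "left_module R B"
  and g: "g \<in> mod_hom R A B" and f: "f \<in> mod_hom R P B"
  and sub: "f ` carrier P \<subseteq> g ` carrier A"
 shows "\<exists>h\<in>mod_hom R P A. \<forall>x\<in>carrier P. g (h x) = f x"
proof -
 define B' where "B' = B\<lparr>carrier := g ` carrier A\<rparr>"
 define t where "t = inv_into (carrier A) g"
 have B': "left_module R B'" unfolding B'_def by (rule left_module_image[OF A B g])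
 have t: "inj_on t (carrier B')" by (simp add: t_def B'_def inj_on_inv_into)
 have g': "g \<in> mod_hom R A B'" and f': "f \<in> mod_hom R P B'"
  using g f sub by (auto simp: B'_def intro: mod_hom_restrict_cod)
 have c: "carrier B' = g ` carrier A" by (simp add: B'_def)
 have "(\<lambda>x. t (g x)) ` carrier A = carrier (transport t B')" by (auto simp: c)
 with P[unfolded projective_def, THEN conjunct2, rule_format, of A "transport t B'" "\<lambda>x. t (g x)" "\<lambda>x. t (f x)"]
 obtain h where h: "h \<in> mod_hom R P A" "\<And>x. x \<in> carrier P \<Longrightarrow> t (g (h x)) = t (f x)"
  using A left_module_transport[OF B' t] mod_hom_comp[OF g' transport_hom[OF B' t]]
   mod_hom_comp[OF f' transport_hom[OF B' t]] by blast
 have "g (h x) = f x" if "x \<in> carrier P" for x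
  using inj_onD[OF t h(2)[OF that]] mod_hom_closed[OF h(1) that] that sub by (simp add: c image_subset_iff)
 then show ?thesis using h(1) by blast
qed

lemma transport_free_on:
 assumes F: "free_on R N B e c" and t: "inj_on t (carrier N)"
 shows "free_on R (transport t N) B (\<lambda>b. t (e b)) (\<lambda>b x. c b (inv_into (carrier N) t x))"
proof -
 have N: "left_module R N" using F by (simp add: free_on_def)
 have c: "c b \<in> mod_hom R N (regular_module R)" and e: "e b \<in> carrier N" if "b \<in> B" for b
  using F that by (auto simp: free_on_def)
 show ?thesis unfolding free_on_def
 proof (intro conjI ballI impI)
  show "left_module R (transport t N)" by (rule left_module_transport[OF N t])
  fix b assume b: "b \<in> B"
  show "t (e b) \<in> carrier (transport t N)" using e[OF b] by simp
  show "(\<lambda>x. c b (inv_into (carrier N) t x)) \<in> mod_hom R (transport t N) (regular_module R)"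
   by (rule mod_hom_comp[OF transport_inv_hom[OF N t] c[OF b]])
 next
  fix x assume "x \<in> carrier (transport t N)"
  then show "finite {b \<in> B. c b (inv_into (carrier N) t x) \<noteq> \<zero>\<^bsub>R\<^esub>}"
   using F t by (auto simp: free_on_def)
 next
  fix b b' assume "b \<in> B" "b' \<in> B"
  then show "c b (inv_into (carrier N) t (t (e b'))) = (if b = b' then \<one>\<^bsub>R\<^esub> else \<zero>\<^bsub>R\<^esub>)"
   using F t e by (simp add: free_on_def)
 next
  fix x assume "x \<in> carrier (transport t N)" "\<forall>b\<in>B. c b (inv_into (carrier N) t x) = \<zero>\<^bsub>R\<^esub>"
  then show "x = \<zero>\<^bsub>transport t N\<^esub>"
   using F t by (auto simp: free_on_def)
 qed
qed

text \<open>The hypothesis makes \<open>'u\<close> large enough to contain the free module on any of its subsets.\<close>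

lemma free_cover:
 fixes M :: "('r, 'u) module" and enc :: "('u \<times> 'r) list \<Rightarrow> 'u"
 assumes enc: "inj enc" and M: "left_module R M"
 shows "\<exists>(F :: ('r, 'u) module) e c \<pi>. free_on R F (carrier M) e c \<and> \<pi> \<in> mod_hom R F M \<and>
  \<pi> ` carrier F = carrier M"
proof -
 interpret M: left_module R M by fact
 define supp :: "('u \<Rightarrow> 'r) \<Rightarrow> 'u set" where "supp f = {b. f b \<noteq> \<zero>\<^bsub>R\<^esub>}" for f
 define C where "C = {f. finite (supp f) \<and> supp f \<subseteq> carrier M \<and> (\<forall>b. f b \<in> carrier R)}"
 define N :: "('r, 'u \<Rightarrow> 'r) module" where
  "N = \<lparr>carrier = C, mult = undefined, one = undefined, zero = (\<lambda>b. \<zero>\<^bsub>R\<^esub>),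
   add = (\<lambda>f g b. f b \<oplus>\<^bsub>R\<^esub> g b), smult = (\<lambda>r f b. r \<otimes>\<^bsub>R\<^esub> f b)\<rparr>"
 have Ns [simp]: "carrier N = C" "zero N = (\<lambda>b. \<zero>\<^bsub>R\<^esub>)"
  "add N = (\<lambda>f g b. f b \<oplus>\<^bsub>R\<^esub> g b)" "smult N = (\<lambda>r f b. r \<otimes>\<^bsub>R\<^esub> f b)" by (simp_all add: N_def)
 have Cc: "f b \<in> carrier R" if "f \<in> C" for f b using that by (auto simp: C_def)
 have Cz: "f b = \<zero>\<^bsub>R\<^esub>" if "f \<in> C" "b \<notin> carrier M" for f b using that by (auto simp: C_def supp_def)
 have CI: "h \<in> C" if "f \<in> C" "g \<in> C" "\<And>b. h b \<in> carrier R"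
  "\<And>b. f b = \<zero>\<^bsub>R\<^esub> \<Longrightarrow> g b = \<zero>\<^bsub>R\<^esub> \<Longrightarrow> h b = \<zero>\<^bsub>R\<^esub>" for f g h
 proof -
  have "supp h \<subseteq> supp f \<union> supp g" using that(4) by (auto simp: supp_def)
  then show ?thesis using that(1-3) finite_subset[of "supp h" "supp f \<union> supp g"] by (auto simp: C_def)
 qed
 have C0: "(\<lambda>b. \<zero>\<^bsub>R\<^esub>) \<in> C" by (simp add: C_def supp_def)
 have "abelian_group N"
 proof (rule abelian_groupI)
  fix f assume f: "f \<in> carrier N"
  have "(\<lambda>b. \<ominus>\<^bsub>R\<^esub> f b) \<in> C" by (rule CI[of f f]) (use f Cc in auto)
  then show "\<exists>g\<in>carrier N. g \<oplus>\<^bsub>N\<^esub> f = \<zero>\<^bsub>N\<^esub>"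
   using f Cc by (intro bexI[of _ "\<lambda>b. \<ominus>\<^bsub>R\<^esub> f b"]) (auto simp: M.R.l_neg)
 next
  fix f g assume "f \<in> carrier N" "g \<in> carrier N"
  then show "f \<oplus>\<^bsub>N\<^esub> g \<in> carrier N" using Cc by (auto intro: CI[of f g])
 qed (use C0 Cc in "auto simp: M.R.a_ac")
 then have N: "left_module R N"
 proof (intro left_module.intro left_module_axioms.intro M.R.ring_axioms)
  fix r f assume "r \<in> carrier R" "f \<in> carrier N"
  then show "r \<odot>\<^bsub>N\<^esub> f \<in> carrier N" using Cc by (auto intro!: CI[of f f])
 qed (use Cc in "auto simp: M.R.l_distr M.R.r_distr M.R.m_assoc")
 define e where "e m = (\<lambda>b. if b = m then \<one>\<^bsub>R\<^esub> else \<zero>\<^bsub>R\<^esub>)" for m :: 'u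
 have F: "free_on R N (carrier M) e (\<lambda>b f. f b)"
  unfolding free_on_def
 proof (intro conjI ballI impI)
  fix b assume b: "b \<in> carrier M"
  have "supp (e b) \<subseteq> {b}" by (auto simp: supp_def e_def)
  then show "e b \<in> carrier N" using b finite_subset[of "supp (e b)" "{b}"]
   by (auto simp: C_def e_def)
  show "(\<lambda>f. f b) \<in> mod_hom R N (regular_module R)" by (rule mod_homI) (auto simp: Cc)
 next
  fix f assume "f \<in> carrier N"
  then show "finite {b \<in> carrier M. f b \<noteq> \<zero>\<^bsub>R\<^esub>}"
   by (auto simp: C_def supp_def intro: rev_finite_subset)
 next
  fix f assume "f \<in> carrier N" "\<forall>b\<in>carrier M. f b = \<zero>\<^bsub>R\<^esub>"
  then show "f = \<zero>\<^bsub>N\<^esub>" using Cz by (intro ext) auto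
 qed (auto simp: N e_def)
 \<comment> \<open>A finitely supported function is coded by a list of its graph. The enumeration is
   chosen from the support alone, and the set of entries recovers the support and the
   values.\<close>
 define t where "t f = enc (map (\<lambda>b. (b, f b)) (SOME xs. set xs = supp f))" for f
 have "inj_on t C"
 proof (rule inj_onI)
  fix f g assume fg: "f \<in> C" "g \<in> C" "t f = t g"
  have s: "set (SOME xs. set xs = supp f) = supp f" if "f \<in> C" for f
   by (rule someI_ex, rule finite_list) (use that in "simp add: C_def")
  have "map (\<lambda>b. (b, f b)) (SOME xs. set xs = supp f) = map (\<lambda>b. (b, g b)) (SOME xs. set xs = supp g)"
   by (rule injD[OF enc]) (use fg(3) in "simp only: t_def")
  from arg_cong[where f = set, OF this] have im: "(\<lambda>b. (b, f b)) ` supp f = (\<lambda>b. (b, g b)) ` supp g"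
   by (simp only: set_map s[OF fg(1)] s[OF fg(2)])
  have eq: "(b, c) \<in> (\<lambda>b. (b, f b)) ` supp f \<longleftrightarrow> (b, c) \<in> (\<lambda>b. (b, g b)) ` supp g" for b c
   unfolding im ..
  have *: "b \<in> supp f \<and> c = f b \<longleftrightarrow> b \<in> supp g \<and> c = g b" for b c
   using eq[of b c] by auto
  show "f = g"
  proof
   fix b show "f b = g b" using *[of b "f b"] *[of b "g b"] by (auto simp: supp_def)
  qed
 qed
 then have t: "inj_on t (carrier N)" by simp
 define \<pi>' where "\<pi>' f = (\<Oplus>\<^bsub>M\<^esub>b\<in>supp f. f b \<odot>\<^bsub>M\<^esub> b)" for f
 have big: "\<pi>' f = (\<Oplus>\<^bsub>M\<^esub>b\<in>J. f b \<odot>\<^bsub>M\<^esub> b)" if "f \<in> C" "finite J" "supp f \<subseteq> J" "J \<subseteq> carrier M" for f J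
  unfolding \<pi>'_def
  by (rule M.M.add.finprod_mono_neutral_cong_left)
   (use that Cc in "auto simp: supp_def M.smult_l_null M.smult_closed subset_iff")
 have \<pi>': "\<pi>' \<in> mod_hom R N M"
 proof (rule mod_homI)
  fix f assume f: "f \<in> carrier N"
  show "\<pi>' f \<in> carrier M" unfolding \<pi>'_def
   by (rule M.M.finsum_closed) (use f in "auto simp: C_def M.smult_closed")
 next
  fix f g assume fg: "f \<in> carrier N" "g \<in> carrier N"
  let ?J = "supp f \<union> supp g"
  have J: "finite ?J" "?J \<subseteq> carrier M" using fg by (auto simp: C_def)
  have "\<pi>' (f \<oplus>\<^bsub>N\<^esub> g) = (\<Oplus>\<^bsub>M\<^esub>b\<in>?J. (f \<oplus>\<^bsub>N\<^esub> g) b \<odot>\<^bsub>M\<^esub> b)"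
  proof (rule big[OF _ J(1) _ J(2)])
   show "f \<oplus>\<^bsub>N\<^esub> g \<in> C" using fg Cc by (auto intro: CI[of f g])
   show "supp (f \<oplus>\<^bsub>N\<^esub> g) \<subseteq> ?J" by (auto simp: supp_def)
  qed
  also have "\<dots> = (\<Oplus>\<^bsub>M\<^esub>b\<in>?J. f b \<odot>\<^bsub>M\<^esub> b \<oplus>\<^bsub>M\<^esub> g b \<odot>\<^bsub>M\<^esub> b)"
   by (rule M.M.finsum_cong') (use fg Cc J in "auto simp: M.smult_l_distr M.smult_closed subset_iff")
  also have "\<dots> = (\<Oplus>\<^bsub>M\<^esub>b\<in>?J. f b \<odot>\<^bsub>M\<^esub> b) \<oplus>\<^bsub>M\<^esub> (\<Oplus>\<^bsub>M\<^esub>b\<in>?J. g b \<odot>\<^bsub>M\<^esub> b)"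
   by (rule M.M.finsum_addf) (use fg Cc J in "auto simp: M.smult_closed subset_iff")
  also have "\<dots> = \<pi>' f \<oplus>\<^bsub>M\<^esub> \<pi>' g" using fg big[OF _ J(1) _ J(2)] by simp
  finally show "\<pi>' (f \<oplus>\<^bsub>N\<^esub> g) = \<pi>' f \<oplus>\<^bsub>M\<^esub> \<pi>' g" .
 next
  fix r f assume r: "r \<in> carrier R" and f: "f \<in> carrier N"
  have J: "finite (supp f)" "supp f \<subseteq> carrier M" using f by (auto simp: C_def)
  have "\<pi>' (r \<odot>\<^bsub>N\<^esub> f) = (\<Oplus>\<^bsub>M\<^esub>b\<in>supp f. (r \<odot>\<^bsub>N\<^esub> f) b \<odot>\<^bsub>M\<^esub> b)"
  proof (rule big[OF _ J(1) _ J(2)])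
   show "r \<odot>\<^bsub>N\<^esub> f \<in> C" using f r Cc by (auto intro!: CI[of f f])
   show "supp (r \<odot>\<^bsub>N\<^esub> f) \<subseteq> supp f" using r by (auto simp: supp_def)
  qed
  also have "\<dots> = (\<Oplus>\<^bsub>M\<^esub>b\<in>supp f. r \<odot>\<^bsub>M\<^esub> (f b \<odot>\<^bsub>M\<^esub> b))"
   by (rule M.M.finsum_cong') (use f r Cc J in "auto simp: M.smult_assoc M.smult_closed subset_iff")
  also have "\<dots> = r \<odot>\<^bsub>M\<^esub> \<pi>' f" unfolding \<pi>'_def
   by (rule M.finsum_smult[symmetric]) (use f r Cc J in "auto simp: M.smult_closed subset_iff")
  finally show "\<pi>' (r \<odot>\<^bsub>N\<^esub> f) = r \<odot>\<^bsub>M\<^esub> \<pi>' f" .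
 qed
 have \<pi>'e: "\<pi>' (e m) = m" if m: "m \<in> carrier M" for m
 proof -
  have "e m \<in> C" using F m by (auto simp: free_on_def)
  then have "\<pi>' (e m) = (\<Oplus>\<^bsub>M\<^esub>b\<in>{m}. e m b \<odot>\<^bsub>M\<^esub> b)"
   by (rule big) (use m in "auto simp: supp_def e_def split: if_splits")
  then show ?thesis using m by (simp add: e_def M.smult_one M.smult_closed)
 qed
 have "(\<lambda>x. \<pi>' (inv_into (carrier N) t x)) ` carrier (transport t N) = carrier M"
 proof -
  have "e m \<in> C" if "m \<in> carrier M" for m using F that by (auto simp: free_on_def)
  then have "carrier M \<subseteq> \<pi>' ` C" using \<pi>'e by (metis image_eqI subsetI)
  moreover have "\<pi>' ` C \<subseteq> carrier M" using mod_hom_closed[OF \<pi>'] by auto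
  ultimately show ?thesis using t by (simp add: image_image)
 qed
 then show ?thesis
  using transport_free_on[OF F t] mod_hom_comp[OF transport_inv_hom[OF N t] \<pi>'] by blast
qed

section \<open>Comparison of projective resolutions\<close>

lemma proj_resolutionD:
 assumes "proj_resolution R M P d aug"
 shows "left_module R M" "\<And>i. projective R (P i)" "\<And>i. left_module R (P i)"
  "\<And>i. d i \<in> mod_hom R (P (Suc i)) (P i)" "aug \<in> mod_hom R (P 0) M"
  "aug ` carrier (P 0) = carrier M"
  "d 0 ` carrier (P (Suc 0)) = {x \<in> carrier (P 0). aug x = \<zero>\<^bsub>M\<^esub>}"
  "\<And>i. d (Suc i) ` carrier (P (Suc (Suc i))) = {x \<in> carrier (P (Suc i)). d i x = \<zero>\<^bsub>P i\<^esub>}"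
  "\<And>x. x \<in> carrier (P (Suc 0)) \<Longrightarrow> aug (d 0 x) = \<zero>\<^bsub>M\<^esub>"
  "\<And>i x. x \<in> carrier (P (Suc (Suc i))) \<Longrightarrow> d i (d (Suc i) x) = \<zero>\<^bsub>P i\<^esub>"
proof -
 show *: "left_module R M" "\<And>i. projective R (P i)" "\<And>i. left_module R (P i)"
  "\<And>i. d i \<in> mod_hom R (P (Suc i)) (P i)" "aug \<in> mod_hom R (P 0) M"
  "aug ` carrier (P 0) = carrier M"
  "d 0 ` carrier (P (Suc 0)) = {x \<in> carrier (P 0). aug x = \<zero>\<^bsub>M\<^esub>}"
  "\<And>i. d (Suc i) ` carrier (P (Suc (Suc i))) = {x \<in> carrier (P (Suc i)). d i x = \<zero>\<^bsub>P i\<^esub>}"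
  using assms unfolding proj_resolution_def by (auto simp: projective_left_module)
 show "\<And>x. x \<in> carrier (P (Suc 0)) \<Longrightarrow> aug (d 0 x) = \<zero>\<^bsub>M\<^esub>" using *(7) by auto
 show "\<And>i x. x \<in> carrier (P (Suc (Suc i))) \<Longrightarrow> d i (d (Suc i) x) = \<zero>\<^bsub>P i\<^esub>" using *(8) by blast
qed

lemma proj_resolution_lift:
 fixes P Q :: "nat \<Rightarrow> ('r, 'u) module"
 assumes P: "proj_resolution R M P d aug" and Q: "proj_resolution R M Q d' aug'"
 shows "\<exists>f. (\<forall>i. f i \<in> mod_hom R (P i) (Q i)) \<and> (\<forall>x\<in>carrier (P 0). aug' (f 0 x) = aug x) \<and>
  (\<forall>i. \<forall>x\<in>carrier (P (Suc i)). d' i (f (Suc i) x) = f i (d i x))"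
proof -
 note p = proj_resolutionD[OF P] and q = proj_resolutionD[OF Q]
 \<comment> \<open>The invariant of the recursion is that f sends boundaries to boundaries, which is
   the condition for lifting f d through d'.\<close>
 define good where "good i f \<longleftrightarrow> f \<in> mod_hom R (P i) (Q i) \<and>
  (\<lambda>x. f (d i x)) ` carrier (P (Suc i)) \<subseteq> d' i ` carrier (Q (Suc i)) \<and>
  (i = 0 \<longrightarrow> (\<forall>x\<in>carrier (P 0). aug' (f x) = aug x))" for i f
 have "\<exists>f. \<forall>i. good i (f i) \<and> (\<forall>x\<in>carrier (P (Suc i)). d' i (f (Suc i) x) = f i (d i x))"
 proof (rule dependent_nat_choice)
  obtain f where f: "f \<in> mod_hom R (P 0) (Q 0)" "\<forall>x\<in>carrier (P 0). aug' (f x) = aug x"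
   using projective_lift[OF p(2) q(3) p(1) q(5) p(5)] p(6) q(6) by auto
  have "f (d 0 x) \<in> d' 0 ` carrier (Q (Suc 0))" if "x \<in> carrier (P (Suc 0))" for x
   using f that mod_hom_closed[OF p(4) that] mod_hom_closed[OF f(1)] by (auto simp: q(7) p(9))
  then show "\<exists>f. good 0 f" using f by (auto simp: good_def)
 next
  fix f i assume f: "good i f"
  then have fh: "f \<in> mod_hom R (P i) (Q i)" by (simp add: good_def)
  have "\<exists>g\<in>mod_hom R (P (Suc i)) (Q (Suc i)). \<forall>x\<in>carrier (P (Suc i)). d' i (g x) = f (d i x)"
   by (rule projective_lift[OF p(2) q(3) q(3) q(4) mod_hom_comp[OF p(4) fh]])
    (use f in "simp add: good_def")
  then obtain g where g: "g \<in> mod_hom R (P (Suc i)) (Q (Suc i))"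
   "\<And>x. x \<in> carrier (P (Suc i)) \<Longrightarrow> d' i (g x) = f (d i x)" by blast
  have "g (d (Suc i) x) \<in> d' (Suc i) ` carrier (Q (Suc (Suc i)))"
   if x: "x \<in> carrier (P (Suc (Suc i)))" for x
   using g(2)[of "d (Suc i) x"] mod_hom_closed[OF p(4) x] mod_hom_closed[OF g(1)]
    mod_hom_zero[OF p(3) q(3) fh] p(10)[OF x] by (simp add: q(8))
  then show "\<exists>g. good (Suc i) g \<and> (\<forall>x\<in>carrier (P (Suc i)). d' i (g x) = f (d i x))"
   using g by (auto simp: good_def)
 qed
 then show ?thesis by (auto simp: good_def)
qed

text \<open>Only the vanishing of \<open>aug \<circ> u\<^sub>0\<close> is used, so this is applied to \<open>g f - id\<close>.\<close>

lemma proj_resolution_homotopy: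
 fixes P Q :: "nat \<Rightarrow> ('r, 'u) module"
 assumes P: "proj_resolution R M P d aug" and Q: "proj_resolution R M Q d' aug'"
  and u: "\<And>i. u i \<in> mod_hom R (P i) (Q i)"
  and ud: "\<And>i x. x \<in> carrier (P (Suc i)) \<Longrightarrow> d' i (u (Suc i) x) = u i (d i x)"
  and u0: "\<And>x. x \<in> carrier (P 0) \<Longrightarrow> aug' (u 0 x) = \<zero>\<^bsub>M\<^esub>"
 shows "\<exists>h. (\<forall>i. h i \<in> mod_hom R (P i) (Q (Suc i))) \<and> (\<forall>x\<in>carrier (P 0). u 0 x = d' 0 (h 0 x)) \<and>
  (\<forall>i. \<forall>x\<in>carrier (P (Suc i)). u (Suc i) x = d' (Suc i) (h (Suc i) x) \<oplus>\<^bsub>Q (Suc i)\<^esub> h i (d i x))"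
proof -
 note p = proj_resolutionD[OF P] and q = proj_resolutionD[OF Q]
 \<comment> \<open>The invariant d' h d = u d says that u - h d takes values in the cycles one
   degree higher; by exactness these are boundaries, so u - h d lifts through d'.\<close>
 define good where "good i h \<longleftrightarrow> h \<in> mod_hom R (P i) (Q (Suc i)) \<and>
  (\<forall>x\<in>carrier (P (Suc i)). d' i (h (d i x)) = u i (d i x)) \<and>
  (i = 0 \<longrightarrow> (\<forall>x\<in>carrier (P 0). u 0 x = d' 0 (h x)))" for i h
 have "\<exists>h. \<forall>i. good i (h i) \<and> (\<forall>x\<in>carrier (P (Suc i)).
  u (Suc i) x = d' (Suc i) (h (Suc i) x) \<oplus>\<^bsub>Q (Suc i)\<^esub> h i (d i x))"
 proof (rule dependent_nat_choice)
  have "\<exists>h\<in>mod_hom R (P 0) (Q (Suc 0)). \<forall>x\<in>carrier (P 0). d' 0 (h x) = u 0 x"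
   by (rule projective_lift[OF p(2) q(3) q(3) q(4) u]) (use u0 mod_hom_closed[OF u] in "auto simp: q(7)")
  then obtain h where h: "h \<in> mod_hom R (P 0) (Q (Suc 0))" "\<And>x. x \<in> carrier (P 0) \<Longrightarrow> d' 0 (h x) = u 0 x"
   by blast
  then show "\<exists>h. good 0 h" using mod_hom_closed[OF p(4)] by (auto simp: good_def)
 next
  fix h i assume h: "good i h"
  then have hh: "h \<in> mod_hom R (P i) (Q (Suc i))" by (simp add: good_def)
  interpret Q0: left_module R "Q i" by (rule q(3))
  interpret Q1: left_module R "Q (Suc i)" by (rule q(3))
  interpret Q2: left_module R "Q (Suc (Suc i))" by (rule q(3))
  define v where "v x = u (Suc i) x \<ominus>\<^bsub>Q (Suc i)\<^esub> h (d i x)" for x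
  have v: "v \<in> mod_hom R (P (Suc i)) (Q (Suc i))" unfolding v_def
   by (intro mod_hom_minus q(3) u mod_hom_comp[OF p(4) hh])
  have "d' i (v x) = \<zero>\<^bsub>Q i\<^esub>" if x: "x \<in> carrier (P (Suc i))" for x
  proof -
   have "d i x \<in> carrier (P i)" by (rule mod_hom_closed[OF p(4) x])
   then have "d' i (v x) = d' i (u (Suc i) x) \<ominus>\<^bsub>Q i\<^esub> d' i (h (d i x))" unfolding v_def
    by (rule mod_hom_diff[OF q(3) q(3) q(4) mod_hom_closed[OF u x] mod_hom_closed[OF hh]])
   also have "\<dots> = u i (d i x) \<ominus>\<^bsub>Q i\<^esub> u i (d i x)" using h x by (simp add: ud good_def)
   finally show ?thesis using mod_hom_closed[OF u mod_hom_closed[OF p(4) x]]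
    by (simp add: a_minus_def Q0.M.r_neg)
  qed
  then have "v ` carrier (P (Suc i)) \<subseteq> d' (Suc i) ` carrier (Q (Suc (Suc i)))"
   using mod_hom_closed[OF v] by (auto simp: q(8))
  from projective_lift[OF p(2) q(3) q(3) q(4) v this] obtain g
   where g: "g \<in> mod_hom R (P (Suc i)) (Q (Suc (Suc i)))"
    "\<And>x. x \<in> carrier (P (Suc i)) \<Longrightarrow> d' (Suc i) (g x) = v x" by blast
  have main: "u (Suc i) x = d' (Suc i) (g x) \<oplus>\<^bsub>Q (Suc i)\<^esub> h (d i x)" if x: "x \<in> carrier (P (Suc i))" for x
   using g(2)[OF x] mod_hom_closed[OF u x] mod_hom_closed[OF hh mod_hom_closed[OF p(4) x]]
   by (simp add: v_def a_minus_def Q1.M.a_assoc Q1.M.l_neg)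
  have "d' (Suc i) (g (d (Suc i) x)) = u (Suc i) (d (Suc i) x)" if x: "x \<in> carrier (P (Suc (Suc i)))" for x
   using main[OF mod_hom_closed[OF p(4) x]] p(10)[OF x] mod_hom_zero[OF p(3) q(3) hh]
    mod_hom_closed[OF q(4) mod_hom_closed[OF g(1) mod_hom_closed[OF p(4) x]]] by simp
  then show "\<exists>g. good (Suc i) g \<and> (\<forall>x\<in>carrier (P (Suc i)).
   u (Suc i) x = d' (Suc i) (g x) \<oplus>\<^bsub>Q (Suc i)\<^esub> h (d i x))"
   using g(1) main by (auto simp: good_def)
 qed
 then show ?thesis by (auto simp: good_def)
qed

section \<open>Projective dimension\<close>

text \<open>This says that every syzygy of \<open>M\<close> of order \<open>m\<close> is projective.\<close>

primrec pd_le :: "('r, 'e) ring_scheme \<Rightarrow> nat \<Rightarrow> ('r, 'u) module \<Rightarrow> bool" where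
 "pd_le R 0 M \<longleftrightarrow> projective R M"
| "pd_le R (Suc m) M \<longleftrightarrow> (\<forall>(P :: ('r, 'u) module) g. projective R P \<and> g \<in> mod_hom R P M \<and>
   g ` carrier P = carrier M \<longrightarrow> pd_le R m (hom_ker P M g))"

lemma proj_resolution_extend:
 assumes M: "left_module R M" and P: "projective R P" and g: "g \<in> mod_hom R P M"
  and sur: "g ` carrier P = carrier M" and Q: "proj_resolution R (hom_ker P M g) Q d aug"
 shows "proj_resolution R M (case_nat P Q) (case_nat aug d) g"
proof -
 note q = proj_resolutionD[OF Q]
 have P': "left_module R P" by (rule projective_left_module[OF P])
 have aug: "aug \<in> mod_hom R (Q 0) P"
  using q(5) by (auto simp: mod_hom_def)
 have d: "(case i of 0 \<Rightarrow> aug | Suc x \<Rightarrow> d x) \<in> mod_hom R (Q i) (case i of 0 \<Rightarrow> P | Suc x \<Rightarrow> Q x)" for i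
  using aug q(4) by (cases i) auto
 have k: "(case i of 0 \<Rightarrow> d 0 | Suc x \<Rightarrow> d (Suc x)) = d i" for i by (cases i) auto
 show ?thesis unfolding proj_resolution_def
  using M P g sur q(2) q(6,7) d
  by (auto simp: q(8) split: nat.split)
qed

text \<open>P sits in degree 0 and is followed by copies of its zero submodule, so the augmentation
  and all differentials can be the identity function.\<close>

lemma proj_resolution_of_projective:
 assumes P: "projective R P"
 shows "proj_resolution R P (case_nat P (\<lambda>_. P\<lparr>carrier := {\<zero>\<^bsub>P\<^esub>}\<rparr>)) (\<lambda>i x. x) (\<lambda>x. x)"
proof -
 interpret P: left_module R P by (rule projective_left_module[OF P])
 have Z: "left_module R (P\<lparr>carrier := {\<zero>\<^bsub>P\<^esub>}\<rparr>)"
  by (rule left_module_restrict) (auto simp: P.left_module_axioms P.smult_r_null)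
 then have "projective R (P\<lparr>carrier := {\<zero>\<^bsub>P\<^esub>}\<rparr>)" by (rule projective_zero) simp
 then show ?thesis unfolding proj_resolution_def
  using P by (auto simp: P.left_module_axioms mod_hom_def split: nat.split)
qed

text \<open>\<open>pd_le\<close> speaks of all projective covers; free covers inside the type supply
  one at each step, and the m-th syzygy is the last nonzero term.\<close>

lemma pd_le_imp_proj_resolution:
 fixes M :: "('r, 'u) module" and enc :: "('u \<times> 'r) list \<Rightarrow> 'u"
 assumes enc: "inj enc" and "left_module R M" "pd_le R m M"
 shows "\<exists>(P :: nat \<Rightarrow> ('r, 'u) module) d aug. proj_resolution R M P d aug \<and>
  (\<forall>i>m. carrier (P i) = {\<zero>\<^bsub>P i\<^esub>})"
 using assms(2,3)
proof (induction m arbitrary: M)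
 case 0
 then have "proj_resolution R M (case_nat M (\<lambda>_. M\<lparr>carrier := {\<zero>\<^bsub>M\<^esub>}\<rparr>)) (\<lambda>i x. x) (\<lambda>x. x)"
  by (simp add: proj_resolution_of_projective)
 then show ?case by (intro exI conjI, assumption) (auto split: nat.split)
next
 case (Suc m)
 obtain F :: "('r, 'u) module" and e c \<pi>
  where F: "free_on R F (carrier M) e c" "\<pi> \<in> mod_hom R F M" "\<pi> ` carrier F = carrier M"
  using free_cover[OF enc Suc.prems(1)] by blast
 have pF: "projective R F" by (rule free_on_projective[OF F(1)])
 then have "pd_le R m (hom_ker F M \<pi>)" using Suc.prems F(2,3) by auto
 with Suc.IH[OF left_module_hom_ker[OF projective_left_module[OF pF] Suc.prems(1) F(2)]]
 obtain P :: "nat \<Rightarrow> ('r, 'u) module" and d aug where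
  P: "proj_resolution R (hom_ker F M \<pi>) P d aug" "\<forall>i>m. carrier (P i) = {\<zero>\<^bsub>P i\<^esub>}" by blast
 show ?case
  by (rule exI[of _ "case_nat F P"], intro exI conjI,
    rule proj_resolution_extend[OF Suc.prems(1) pF F(2,3) P(1)])
   (use P(2) in "auto split: nat.split")
qed

lemma pd_le_imp_proj_dim_le:
 fixes M :: "('r, 'u) module" and enc :: "('u \<times> 'r) list \<Rightarrow> 'u"
 assumes "inj enc" "left_module R M" "pd_le R m M"
 shows "proj_dim R M \<le> enat m"
 unfolding proj_dim_def using pd_le_imp_proj_resolution[OF assms] by (intro Inf_lower) blast

section \<open>Global dimension of Ore extensions\<close>

lemma left_module_subring:
 assumes M: "left_module R M" and S: "ring (R\<lparr>carrier := S\<rparr>)" "S \<subseteq> carrier R"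
 shows "left_module (R\<lparr>carrier := S\<rparr>) M"
proof -
 interpret left_module R M by fact
 show ?thesis
  by (intro left_module.intro left_module_axioms.intro S M.abelian_group_axioms)
   (use S in "auto simp: smult_closed smult_l_distr smult_r_distr smult_assoc smult_one subset_iff")
qed

lemma mod_hom_subring: "\<lbrakk>f \<in> mod_hom R M N; S \<subseteq> carrier R\<rbrakk> \<Longrightarrow> f \<in> mod_hom (R\<lparr>carrier := S\<rparr>) M N"
 by (auto simp: mod_hom_def)

text \<open>The automorphism and the derivation of an Ore extension stay implicit: R is left free
  over S on the powers of x, and x S is contained in S x + S.\<close>

locale ore_extension = R?: ring R for R :: "('r, 'e) ring_scheme" (structure) +
 fixes S x and \<kappa> :: "nat \<Rightarrow> 'r \<Rightarrow> 'r"
 assumes S_ring: "ring (R\<lparr>carrier := S\<rparr>)" and S_sub: "S \<subseteq> carrier R" and x: "x \<in> carrier R"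
  and free: "free_on (R\<lparr>carrier := S\<rparr>) (regular_module R) UNIV (\<lambda>i. x [^] i) \<kappa>"
  and commute: "c \<in> S \<Longrightarrow> \<exists>t\<in>S. \<exists>u\<in>S. x \<otimes> c = t \<otimes> x \<oplus> u"
begin

abbreviation "RS \<equiv> R\<lparr>carrier := S\<rparr>"

text \<open>Coordinates over S are the coefficients, with respect to the powers of x, of the
  coordinates over R.\<close>

lemma free_on_restrict:
 assumes F: "free_on R P B e c"
 shows "free_on RS P (B \<times> UNIV) (\<lambda>(b, i). (x [^] i) \<odot>\<^bsub>P\<^esub> e b) (\<lambda>(b, i) p. \<kappa> i (c b p))"
proof -
 have P: "left_module R P" using F by (simp add: free_on_def)
 interpret P: left_module R P by fact
 have e: "e b \<in> carrier P" and c: "c b \<in> mod_hom R P (regular_module R)" if "b \<in> B" for b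
  using F that by (auto simp: free_on_def)
 have cc: "c b q \<in> carrier R" if "b \<in> B" "q \<in> carrier P" for b q
  using mod_hom_closed[OF c] that by simp
 have \<kappa>: "\<kappa> i \<in> mod_hom RS (regular_module R) (regular_module RS)" for i using free by (simp add: free_on_def)
 have \<kappa>0: "\<kappa> i \<zero> = \<zero>" for i
  using mod_hom_zero[OF left_module_subring[OF left_module_regular[OF R.ring_axioms] S_ring S_sub]
    left_module_regular[OF S_ring] \<kappa>] by simp
 have P': "left_module RS P" by (rule left_module_subring[OF P S_ring S_sub])
 show ?thesis unfolding free_on_def
 proof (intro conjI ballI impI P')
  fix bi assume bi: "bi \<in> B \<times> (UNIV :: nat set)"
  then obtain b i where [simp]: "bi = (b, i)" and b: "b \<in> B" by auto
  show "(case bi of (b, i) \<Rightarrow> (x [^] i) \<odot>\<^bsub>P\<^esub> e b) \<in> carrier P"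
   using e[OF b] x by (simp add: P.smult_closed)
  show "(case bi of (b, i) \<Rightarrow> \<lambda>p. \<kappa> i (c b p)) \<in> mod_hom RS P (regular_module RS)"
   using mod_hom_comp[OF mod_hom_subring[OF c[OF b] S_sub] \<kappa>] by simp
 next
  fix p assume p: "p \<in> carrier P"
  have "{bi \<in> B \<times> UNIV. (case bi of (b, i) \<Rightarrow> \<lambda>p. \<kappa> i (c b p)) p \<noteq> \<zero>\<^bsub>RS\<^esub>} \<subseteq>
   (SIGMA b:{b \<in> B. c b p \<noteq> \<zero>}. {i. \<kappa> i (c b p) \<noteq> \<zero>})" using \<kappa>0 by auto
  moreover have "finite (SIGMA b:{b \<in> B. c b p \<noteq> \<zero>}. {i. \<kappa> i (c b p) \<noteq> \<zero>})"
   using F free p cc by (intro finite_SigmaI) (auto simp: free_on_def)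
  ultimately show "finite {bi \<in> B \<times> UNIV. (case bi of (b, i) \<Rightarrow> \<lambda>p. \<kappa> i (c b p)) p \<noteq> \<zero>\<^bsub>RS\<^esub>}"
   by (rule finite_subset)
 next
  fix bi bi' assume "bi \<in> B \<times> (UNIV :: nat set)" "bi' \<in> B \<times> (UNIV :: nat set)"
  then obtain b i b' i' where [simp]: "bi = (b, i)" "bi' = (b', i')" and b: "b \<in> B" "b' \<in> B" by auto
  have "c b ((x [^] i') \<odot>\<^bsub>P\<^esub> e b') = (x [^] i') \<otimes> (if b = b' then \<one> else \<zero>)"
   using mod_hom_smult[OF c[OF b(1)] _ e[OF b(2)], of "x [^] i'"] x F b by (simp add: free_on_def)
  then show "(case bi of (b, i) \<Rightarrow> \<lambda>p. \<kappa> i (c b p)) (case bi' of (b, i) \<Rightarrow> (x [^] i) \<odot>\<^bsub>P\<^esub> e b) =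
   (if bi = bi' then \<one>\<^bsub>RS\<^esub> else \<zero>\<^bsub>RS\<^esub>)"
   using free x by (auto simp: free_on_def \<kappa>0)
 next
  fix p assume p: "p \<in> carrier P"
   and z: "\<forall>bi\<in>B \<times> UNIV. (case bi of (b, i) \<Rightarrow> \<lambda>p. \<kappa> i (c b p)) p = \<zero>\<^bsub>RS\<^esub>"
  have "c b p = \<zero>" if b: "b \<in> B" for b
   using free cc[OF b p] z b by (auto simp: free_on_def)
  then show "p = \<zero>\<^bsub>P\<^esub>" using F p by (auto simp: free_on_def)
 qed
qed

text \<open>P is a retract of a free R-module, and that module remains free over S.\<close>

lemma projective_restrict:
 fixes P :: "('r, 'u) module" and enc :: "('u \<times> 'r) list \<Rightarrow> 'u"
 assumes enc: "inj enc" and P: "projective R P"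
 shows "projective RS P"
proof -
 have P': "left_module R P" by (rule projective_left_module[OF P])
 obtain F :: "('r, 'u) module" and e c \<pi> where
  F: "free_on R F (carrier P) e c" "\<pi> \<in> mod_hom R F P" "\<pi> ` carrier F = carrier P"
  using free_cover[OF enc P'] by blast
 have F': "left_module R F" using F(1) by (simp add: free_on_def)
 have "(\<lambda>x. x) \<in> mod_hom R P P" by (rule mod_homI) auto
 from projective_lift[OF P F' P' F(2) this] obtain i where
  i: "i \<in> mod_hom R P F" "\<And>p. p \<in> carrier P \<Longrightarrow> \<pi> (i p) = p" using F(3) by auto
 show ?thesis
  by (rule projective_retract[OF free_on_projective[OF free_on_restrict[OF F(1)]]
     left_module_subring[OF P' S_ring S_sub] mod_hom_subring[OF i(1) S_sub]
     mod_hom_subring[OF F(2) S_sub] i(2)])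
qed

text \<open>The coboundary equation says that \<open>Ext\<close> of a free module vanishes: a pair \<open>(X \<oplus> F, D)\<close> with \<open>x\<close>
 acting by \<open>(u, p) \<mapsto> (x u + D p, x p)\<close> is an extension of \<open>F\<close> by \<open>X\<close>.\<close>

lemma free_on_semilinear:
 assumes F: "free_on R P B e c" and X: "left_module R X"
  and D: "\<And>p. p \<in> carrier P \<Longrightarrow> D p \<in> carrier X"
  and D_add: "\<And>p q. \<lbrakk>p \<in> carrier P; q \<in> carrier P\<rbrakk> \<Longrightarrow> D (p \<oplus>\<^bsub>P\<^esub> q) = D p \<oplus>\<^bsub>X\<^esub> D q"
  and D_semi: "\<And>c t u p. \<lbrakk>c \<in> S; t \<in> S; u \<in> S; x \<otimes> c = t \<otimes> x \<oplus> u; p \<in> carrier P\<rbrakk> \<Longrightarrow>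
   D (c \<odot>\<^bsub>P\<^esub> p) = t \<odot>\<^bsub>X\<^esub> D p"
 shows "\<exists>\<psi>\<in>mod_hom RS P X. \<forall>p\<in>carrier P. \<psi> (x \<odot>\<^bsub>P\<^esub> p) = x \<odot>\<^bsub>X\<^esub> \<psi> p \<oplus>\<^bsub>X\<^esub> D p"
proof -
 have P: "left_module R P" using F by (simp add: free_on_def)
 interpret P: left_module R P by fact
 interpret X: left_module R X by fact
 have e: "e b \<in> carrier P" if "b \<in> B" for b using F that by (auto simp: free_on_def)
 \<comment> \<open>The values on x^i e_b come from the required equation itself: start with 0 and
   apply the equation once for every further power of x.\<close>
 define v where "v b i = rec_nat \<zero>\<^bsub>X\<^esub> (\<lambda>i w. x \<odot>\<^bsub>X\<^esub> w \<oplus>\<^bsub>X\<^esub> D ((x [^] i) \<odot>\<^bsub>P\<^esub> e b)) i" for b i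
 have v: "v b i \<in> carrier X" if "b \<in> B" for b and i :: nat
  by (induction i) (use that x e in "auto simp: v_def X.smult_closed D P.smult_closed")
 note F' = free_on_restrict[OF F]
 have X': "left_module RS X" by (rule left_module_subring[OF X S_ring S_sub])
 obtain \<psi> where \<psi>: "\<psi> \<in> mod_hom RS P X" "\<And>b i. b \<in> B \<Longrightarrow> \<psi> ((x [^] i) \<odot>\<^bsub>P\<^esub> e b) = v b i"
  using free_on_extend[OF F' X', of "\<lambda>(b, i). v b i"] v by fastforce
 have \<psi>c: "\<psi> p \<in> carrier X" if "p \<in> carrier P" for p using mod_hom_closed[OF \<psi>(1) that] .
 have "\<psi> (x \<odot>\<^bsub>P\<^esub> p) = x \<odot>\<^bsub>X\<^esub> \<psi> p \<oplus>\<^bsub>X\<^esub> D p" if "p \<in> carrier P" for p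
  using F' that
 proof (induction p rule: free_on_induct)
  case zero
  have "D \<zero>\<^bsub>P\<^esub> \<oplus>\<^bsub>X\<^esub> D \<zero>\<^bsub>P\<^esub> = D \<zero>\<^bsub>P\<^esub>" using D_add[of "\<zero>\<^bsub>P\<^esub>" "\<zero>\<^bsub>P\<^esub>"] by simp
  then have "D \<zero>\<^bsub>P\<^esub> = \<zero>\<^bsub>X\<^esub>" using D[of "\<zero>\<^bsub>P\<^esub>"] by (simp add: X.M.add.l_cancel_one)
  then show ?case
   using mod_hom_zero[OF left_module_subring[OF P S_ring S_sub] X' \<psi>(1)] x
   by (simp add: P.smult_r_null X.smult_r_null)
 next
  case (basis s bi)
  then obtain b i where [simp]: "bi = (b, i)" and b: "b \<in> B" and s: "s \<in> S" by auto
  define m where "m = (x [^] i) \<odot>\<^bsub>P\<^esub> e b"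
  have m: "m \<in> carrier P" using x e b by (simp add: m_def P.smult_closed)
  have xm: "x \<odot>\<^bsub>P\<^esub> m = (x [^] Suc i) \<odot>\<^bsub>P\<^esub> e b"
   using P.smult_assoc[OF x _ e[OF b], of "x [^] i"] x by (simp only: m_def R.nat_pow_Suc2[OF x] R.nat_pow_closed)
  have \<psi>m: "\<psi> (x \<odot>\<^bsub>P\<^esub> m) = x \<odot>\<^bsub>X\<^esub> \<psi> m \<oplus>\<^bsub>X\<^esub> D m"
   unfolding xm \<psi>(2)[OF b] using \<psi>(2)[OF b, of i] by (simp add: m_def v_def)
  \<comment> \<open>The relation x s = t x + u carries s past x in both modules, and semilinearity
    turns \<open>t\<close> acting on \<open>D m\<close> into D of \<open>s\<close> acting on
    m.\<close>
  obtain t u where tu: "t \<in> S" "u \<in> S" "x \<otimes> s = t \<otimes> x \<oplus> u" using commute[OF s] by blast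
  have in_R: "s \<in> carrier R" "t \<in> carrier R" "u \<in> carrier R" using s tu S_sub by auto
  have xmP: "x \<odot>\<^bsub>P\<^esub> m \<in> carrier P" using x m by (simp add: P.smult_closed)
  have "x \<odot>\<^bsub>P\<^esub> (s \<odot>\<^bsub>P\<^esub> m) = t \<odot>\<^bsub>P\<^esub> (x \<odot>\<^bsub>P\<^esub> m) \<oplus>\<^bsub>P\<^esub> u \<odot>\<^bsub>P\<^esub> m"
   using in_R x m tu by (simp add: P.smult_assoc[symmetric] P.smult_l_distr)
  then have "\<psi> (x \<odot>\<^bsub>P\<^esub> (s \<odot>\<^bsub>P\<^esub> m)) = t \<odot>\<^bsub>X\<^esub> (x \<odot>\<^bsub>X\<^esub> \<psi> m \<oplus>\<^bsub>X\<^esub> D m) \<oplus>\<^bsub>X\<^esub> u \<odot>\<^bsub>X\<^esub> \<psi> m"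
   using in_R x m xmP tu \<psi>m mod_hom_add[OF \<psi>(1), of "t \<odot>\<^bsub>P\<^esub> (x \<odot>\<^bsub>P\<^esub> m)" "u \<odot>\<^bsub>P\<^esub> m"]
    mod_hom_smult[OF \<psi>(1), of t "x \<odot>\<^bsub>P\<^esub> m"] mod_hom_smult[OF \<psi>(1), of u m]
   by (simp add: P.smult_closed)
  also have "\<dots> = (t \<odot>\<^bsub>X\<^esub> (x \<odot>\<^bsub>X\<^esub> \<psi> m) \<oplus>\<^bsub>X\<^esub> u \<odot>\<^bsub>X\<^esub> \<psi> m) \<oplus>\<^bsub>X\<^esub> t \<odot>\<^bsub>X\<^esub> D m"
   using in_R x \<psi>c[OF m] D[OF m] by (simp add: X.smult_r_distr X.smult_closed X.M.a_ac)
  also have "t \<odot>\<^bsub>X\<^esub> (x \<odot>\<^bsub>X\<^esub> \<psi> m) \<oplus>\<^bsub>X\<^esub> u \<odot>\<^bsub>X\<^esub> \<psi> m = x \<odot>\<^bsub>X\<^esub> (s \<odot>\<^bsub>X\<^esub> \<psi> m)"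
   using in_R x \<psi>c[OF m] tu by (simp add: X.smult_assoc[symmetric] X.smult_l_distr)
  also have "t \<odot>\<^bsub>X\<^esub> D m = D (s \<odot>\<^bsub>P\<^esub> m)" using D_semi[OF s tu m] by simp
  also have "s \<odot>\<^bsub>X\<^esub> \<psi> m = \<psi> (s \<odot>\<^bsub>P\<^esub> m)" using mod_hom_smult[OF \<psi>(1), of s m] s m by simp
  finally show ?case by (simp add: m_def)
 next
  case (add p q)
  then show ?case using x
   by (simp add: P.smult_r_distr mod_hom_add[OF \<psi>(1)] P.smult_closed D_add \<psi>c D X.smult_r_distr
     X.smult_closed X.M.a_ac)
 qed
 then show ?thesis using \<psi>(1) by blast
qed

text \<open>Every element of R is an S-combination of powers of x, and h respects S and x
  separately.\<close>

lemma hom_of_semilinear: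
 assumes K: "left_module R K" and A: "left_module R A" and h: "h \<in> mod_hom RS K A"
  and hx: "\<And>k. k \<in> carrier K \<Longrightarrow> h (x \<odot>\<^bsub>K\<^esub> k) = x \<odot>\<^bsub>A\<^esub> h k"
 shows "h \<in> mod_hom R K A"
proof -
 interpret K: left_module R K by fact
 interpret A: left_module R A by fact
 have hc: "h k \<in> carrier A" if "k \<in> carrier K" for k by (rule mod_hom_closed[OF h that])
 have pow: "h ((x [^] i) \<odot>\<^bsub>K\<^esub> k) = (x [^] i) \<odot>\<^bsub>A\<^esub> h k" if "k \<in> carrier K" for k and i :: nat
  using that
 proof (induction i arbitrary: k)
  case (Suc i)
  then show ?case using x Suc.IH[of "x \<odot>\<^bsub>K\<^esub> k"] hx hc
   by (simp add: K.smult_assoc A.smult_assoc K.smult_closed)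
 qed (use hc in "simp add: K.smult_one A.smult_one")
 have "h (r \<odot>\<^bsub>K\<^esub> k) = r \<odot>\<^bsub>A\<^esub> h k" if r: "r \<in> carrier (regular_module R)" and k: "k \<in> carrier K" for r k
  using free r
 proof (induction r rule: free_on_induct)
  case zero
  show ?case using k hc mod_hom_zero[OF left_module_subring[OF K S_ring S_sub] left_module_subring[OF A S_ring S_sub] h]
   by (simp add: K.smult_l_null A.smult_l_null)
 next
  case (basis s i)
  then have s: "s \<in> S" "s \<in> carrier R" using S_sub by auto
  then show ?case using k x hc mod_hom_smult[OF h, of s "(x [^] i) \<odot>\<^bsub>K\<^esub> k"]
   by (simp add: K.smult_assoc A.smult_assoc K.smult_closed pow)
 next
  case (add r r')
  then show ?case using k hc
   by (simp add: K.smult_l_distr A.smult_l_distr mod_hom_add[OF h] K.smult_closed)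
 qed
 then show ?thesis using h by (auto simp: mod_hom_def)
qed

text \<open>A map f on the kernel K is first lifted S-linearly, using an S-splitting of P over M.
  The lift fails to commute with x by a map D with values in the kernel of q. On a free cover of P
  this D is the defect of an S-linear map \<psi>, and subtracting \<psi> restores linearity over R
  without changing the composite with q.\<close>

lemma projective_syzygy:
 fixes P M :: "('r, 'u) module" and enc :: "('u \<times> 'r) list \<Rightarrow> 'u"
 assumes enc: "inj enc" and M: "left_module R M" and MS: "projective RS M"
  and P: "projective R P" and g: "g \<in> mod_hom R P M" and sur: "g ` carrier P = carrier M"
 shows "projective R (hom_ker P M g)"
proof -
 define K where "K = hom_ker P M g"
 have P': "left_module R P" by (rule projective_left_module[OF P])
 have K: "left_module R K" unfolding K_def by (rule left_module_hom_ker[OF P' M g])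
 have Kc: "k \<in> carrier K \<longleftrightarrow> k \<in> carrier P \<and> g k = \<zero>\<^bsub>M\<^esub>" for k by (simp add: K_def)
 have Ks [simp]: "add K = add P" "smult K = smult P" "zero K = zero P" by (simp_all add: K_def)
 interpret M: left_module R M by fact
 interpret P: left_module R P by fact
 interpret K: left_module R K by fact
 note sub = left_module_subring[OF _ S_ring S_sub]
 have id: "(\<lambda>x. x) \<in> mod_hom R' N N" for R' :: "('r, 'e) ring_scheme" and N :: "('r, 'u) module"
  by (rule mod_homI) auto
 obtain s where s: "s \<in> mod_hom RS M P" "\<And>m. m \<in> carrier M \<Longrightarrow> g (s m) = m"
  using projective_lift[OF MS sub[OF P'] sub[OF M] mod_hom_subring[OF g S_sub] id] sur by auto
 obtain F :: "('r, 'u) module" and e c \<rho> where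
  F: "free_on R F (carrier P) e c" "\<rho> \<in> mod_hom R F P" "\<rho> ` carrier F = carrier P"
  using free_cover[OF enc P'] by blast
 have F': "left_module R F" using F(1) by (simp add: free_on_def)
 interpret F: left_module R F by fact
 obtain i where i: "i \<in> mod_hom R P F" "\<And>p. p \<in> carrier P \<Longrightarrow> \<rho> (i p) = p"
  using projective_lift[OF P F' P' F(2) id] F(3) by auto
 \<comment> \<open>The projection of P onto K along the section s. It is linear over S only, which
   is the source of the defect D below.\<close>
 define \<pi> where "\<pi> p = p \<ominus>\<^bsub>P\<^esub> s (g p)" for p
 have "\<pi> \<in> mod_hom RS P P" unfolding \<pi>_def
  by (intro mod_hom_minus sub[OF P'] id mod_hom_comp[OF mod_hom_subring[OF g S_sub] s(1)])
 moreover have "\<pi> p \<in> carrier K" if p: "p \<in> carrier P" for p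
  using p mod_hom_diff[OF P' M g p mod_hom_closed[OF s(1) mod_hom_closed[OF g p]]]
   mod_hom_closed[OF g p] mod_hom_closed[OF s(1) mod_hom_closed[OF g p]] s(2)
  by (simp add: Kc \<pi>_def a_minus_def M.M.r_neg)
 ultimately have \<pi>: "\<pi> \<in> mod_hom RS P K" by (auto simp: mod_hom_def)
 have \<pi>K: "\<pi> k = k" if "k \<in> carrier K" for k
  using that mod_hom_zero[OF sub[OF M] sub[OF P'] s(1)] by (simp add: Kc \<pi>_def a_minus_def)
 have PS: "projective RS P" by (rule projective_restrict[OF enc P])
 show ?thesis unfolding K_def[symmetric] projective_def
 proof (intro conjI allI impI K, elim conjE)
  fix A B :: "('r, 'u) module" and q f
  assume A: "left_module R A" and B: "left_module R B" and q: "q \<in> mod_hom R A B"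
   and qs: "q ` carrier A = carrier B" and f: "f \<in> mod_hom R K B"
  interpret A: left_module R A by fact
  interpret B: left_module R B by fact
  define X where "X = hom_ker A B q"
  have X: "left_module R X" unfolding X_def by (rule left_module_hom_ker[OF A B q])
  have Xc: "y \<in> carrier X \<longleftrightarrow> y \<in> carrier A \<and> q y = \<zero>\<^bsub>B\<^esub>" for y by (simp add: X_def)
  have Xs [simp]: "add X = add A" "smult X = smult A" by (simp_all add: X_def)
  have f\<pi>: "(\<lambda>p. f (\<pi> p)) \<in> mod_hom RS P B" by (rule mod_hom_comp[OF \<pi> mod_hom_subring[OF f S_sub]])
  obtain \<phi> where \<phi>: "\<phi> \<in> mod_hom RS P A" "\<And>p. p \<in> carrier P \<Longrightarrow> q (\<phi> p) = f (\<pi> p)"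
   using projective_lift[OF PS sub[OF A] sub[OF B] mod_hom_subring[OF q S_sub] f\<pi>]
    qs mod_hom_closed[OF f\<pi>] by (metis image_subsetI)
  have \<phi>c: "\<phi> p \<in> carrier A" if "p \<in> carrier P" for p by (rule mod_hom_closed[OF \<phi>(1) that])
  have KP: "k \<in> carrier P" if "k \<in> carrier K" for k using that by (simp add: Kc)
  have xK: "r \<odot>\<^bsub>P\<^esub> k \<in> carrier K" if "k \<in> carrier K" "r \<in> carrier R" for k r
   using K.smult_closed that by simp
  \<comment> \<open>The failure of \<phi> to commute with x. It dies under q because f is R-linear,
    and it is twisted by c |-> t because the terms with u cancel.\<close>
  define D where "D k = \<phi> (x \<odot>\<^bsub>P\<^esub> k) \<ominus>\<^bsub>A\<^esub> x \<odot>\<^bsub>A\<^esub> \<phi> k" for k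
  have D: "D k \<in> carrier X" if k: "k \<in> carrier K" for k
  proof -
   have "q (D k) = q (\<phi> (x \<odot>\<^bsub>P\<^esub> k)) \<ominus>\<^bsub>B\<^esub> q (x \<odot>\<^bsub>A\<^esub> \<phi> k)" unfolding D_def
    by (rule mod_hom_diff[OF A B q]) (use x k KP \<phi>c in "auto simp: P.smult_closed A.smult_closed")
   also have "\<dots> = f (x \<odot>\<^bsub>P\<^esub> k) \<ominus>\<^bsub>B\<^esub> x \<odot>\<^bsub>B\<^esub> f k"
    using x k KP \<phi>c xK by (simp add: \<phi>(2) P.smult_closed mod_hom_smult[OF q] \<pi>K)
   also have "\<dots> = \<zero>\<^bsub>B\<^esub>"
    using mod_hom_smult[OF f x k] mod_hom_closed[OF f k] x by (simp add: a_minus_def B.M.r_neg B.smult_closed)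
   finally show ?thesis using x k KP \<phi>c by (simp add: Xc D_def P.smult_closed A.smult_closed)
  qed
  have D_add: "D (k \<oplus>\<^bsub>P\<^esub> k') = D k \<oplus>\<^bsub>A\<^esub> D k'" if "k \<in> carrier K" "k' \<in> carrier K" for k k'
   using that[THEN KP] x \<phi>c
   by (simp add: D_def P.smult_r_distr mod_hom_add[OF \<phi>(1)] P.smult_closed A.smult_r_distr
     A.smult_closed a_minus_def A.M.minus_add A.M.a_ac)
  have D_semi: "D (c \<odot>\<^bsub>P\<^esub> k) = t \<odot>\<^bsub>A\<^esub> D k"
   if tu: "c \<in> S" "t \<in> S" "u \<in> S" "x \<otimes> c = t \<otimes> x \<oplus> u" and k: "k \<in> carrier K" for c t u k
  proof -
   have in_R: "c \<in> carrier R" "t \<in> carrier R" "u \<in> carrier R" using tu S_sub by auto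
   note k = KP[OF k]
   have xk: "x \<odot>\<^bsub>P\<^esub> k \<in> carrier P" using x k by (simp add: P.smult_closed)
   have "x \<odot>\<^bsub>P\<^esub> (c \<odot>\<^bsub>P\<^esub> k) = t \<odot>\<^bsub>P\<^esub> (x \<odot>\<^bsub>P\<^esub> k) \<oplus>\<^bsub>P\<^esub> u \<odot>\<^bsub>P\<^esub> k"
    using in_R x k tu by (simp add: P.smult_assoc[symmetric] P.smult_l_distr)
   then have "\<phi> (x \<odot>\<^bsub>P\<^esub> (c \<odot>\<^bsub>P\<^esub> k)) = t \<odot>\<^bsub>A\<^esub> \<phi> (x \<odot>\<^bsub>P\<^esub> k) \<oplus>\<^bsub>A\<^esub> u \<odot>\<^bsub>A\<^esub> \<phi> k"
    using in_R k xk tu mod_hom_add[OF \<phi>(1), of "t \<odot>\<^bsub>P\<^esub> (x \<odot>\<^bsub>P\<^esub> k)" "u \<odot>\<^bsub>P\<^esub> k"]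
     mod_hom_smult[OF \<phi>(1), of t "x \<odot>\<^bsub>P\<^esub> k"] mod_hom_smult[OF \<phi>(1), of u k]
    by (simp add: P.smult_closed)
   moreover have "x \<odot>\<^bsub>A\<^esub> \<phi> (c \<odot>\<^bsub>P\<^esub> k) = t \<odot>\<^bsub>A\<^esub> (x \<odot>\<^bsub>A\<^esub> \<phi> k) \<oplus>\<^bsub>A\<^esub> u \<odot>\<^bsub>A\<^esub> \<phi> k"
    using in_R x k tu \<phi>c[OF k] mod_hom_smult[OF \<phi>(1), of c k]
    by (simp add: A.smult_assoc[symmetric] A.smult_l_distr)
   ultimately show ?thesis using in_R x k xk \<phi>c[OF k] \<phi>c[OF xk]
    by (simp add: D_def a_minus_def A.smult_r_distr A.smult_r_minus A.smult_closed A.M.minus_add A.M.a_ac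
      A.M.r_neg1 A.M.r_neg2 A.M.r_neg A.M.l_neg)
  qed
  \<comment> \<open>D is controlled on K only. Composing with F -> P -> K gives a semilinear map on
    a free module, where \<open>free_on_semilinear\<close> applies.\<close>
  have \<pi>\<rho>: "(\<lambda>p. \<pi> (\<rho> p)) \<in> mod_hom RS F K" by (rule mod_hom_comp[OF mod_hom_subring[OF F(2) S_sub] \<pi>])
  obtain \<psi> where \<psi>: "\<psi> \<in> mod_hom RS F X"
   "\<And>p. p \<in> carrier F \<Longrightarrow> \<psi> (x \<odot>\<^bsub>F\<^esub> p) = x \<odot>\<^bsub>X\<^esub> \<psi> p \<oplus>\<^bsub>X\<^esub> D (\<pi> (\<rho> p))"
  proof -
   have "\<exists>\<psi>\<in>mod_hom RS F X. \<forall>p\<in>carrier F. \<psi> (x \<odot>\<^bsub>F\<^esub> p) = x \<odot>\<^bsub>X\<^esub> \<psi> p \<oplus>\<^bsub>X\<^esub> D (\<pi> (\<rho> p))"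
   proof (rule free_on_semilinear[OF F(1) X])
    fix p assume "p \<in> carrier F"
    then show "D (\<pi> (\<rho> p)) \<in> carrier X" by (rule D[OF mod_hom_closed[OF \<pi>\<rho>]])
   next
    fix p p' assume "p \<in> carrier F" "p' \<in> carrier F"
    then show "D (\<pi> (\<rho> (p \<oplus>\<^bsub>F\<^esub> p'))) = D (\<pi> (\<rho> p)) \<oplus>\<^bsub>X\<^esub> D (\<pi> (\<rho> p'))"
     using mod_hom_add[OF \<pi>\<rho>] D_add mod_hom_closed[OF \<pi>\<rho>] by simp
   next
    fix c t u p assume "c \<in> S" "t \<in> S" "u \<in> S" "x \<otimes> c = t \<otimes> x \<oplus> u" "p \<in> carrier F"
    then show "D (\<pi> (\<rho> (c \<odot>\<^bsub>F\<^esub> p))) = t \<odot>\<^bsub>X\<^esub> D (\<pi> (\<rho> p))"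
     using mod_hom_smult[OF \<pi>\<rho>, of c p] D_semi mod_hom_closed[OF \<pi>\<rho>] by simp
   qed
   then show ?thesis using that by blast
  qed
  have \<psi>i: "(\<lambda>k. \<psi> (i k)) \<in> mod_hom RS K A"
  proof -
   have "i \<in> mod_hom RS K F" using mod_hom_subring[OF i(1) S_sub] KP by (auto simp: mod_hom_def)
   moreover have "\<psi> \<in> mod_hom RS F A" using \<psi>(1) by (auto simp: mod_hom_def Xc Pi_iff)
   ultimately show ?thesis by (rule mod_hom_comp)
  qed
  have \<phi>K: "\<phi> \<in> mod_hom RS K A" using \<phi>(1) KP by (auto simp: mod_hom_def)
  \<comment> \<open>Both \<phi> and \<psi> i have the defect D on K, so their difference commutes
    with x; as \<psi> takes values in the kernel of q, it still lifts f.\<close>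
  define h where "h k = \<phi> k \<ominus>\<^bsub>A\<^esub> \<psi> (i k)" for k
  have hS: "h \<in> mod_hom RS K A" unfolding h_def by (rule mod_hom_minus[OF sub[OF A] \<phi>K \<psi>i])
  have "h \<in> mod_hom R K A"
  proof (rule hom_of_semilinear[OF K A hS])
   fix k assume k: "k \<in> carrier K"
   note kP = KP[OF k]
   have \<psi>k: "\<psi> (i k) \<in> carrier A" by (rule mod_hom_closed[OF \<psi>i k])
   have xk: "x \<odot>\<^bsub>P\<^esub> k \<in> carrier P" using x kP by (simp add: P.smult_closed)
   have "\<psi> (i (x \<odot>\<^bsub>P\<^esub> k)) = x \<odot>\<^bsub>A\<^esub> \<psi> (i k) \<oplus>\<^bsub>A\<^esub> D k"
    using mod_hom_smult[OF i(1) x kP] \<psi>(2)[OF mod_hom_closed[OF i(1) kP]] i(2)[OF kP] \<pi>K[OF k] by simp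
   then show "h (x \<odot>\<^bsub>K\<^esub> k) = x \<odot>\<^bsub>A\<^esub> h k"
    using x \<phi>c[OF kP] \<phi>c[OF xk] \<psi>k
    by (simp add: h_def D_def a_minus_def A.smult_r_distr A.smult_r_minus A.smult_closed A.M.minus_add A.M.a_ac
      A.M.r_neg1 A.M.r_neg2 A.M.r_neg A.M.l_neg)
  qed
  moreover have "q (h k) = f k" if k: "k \<in> carrier K" for k
  proof -
   have \<psi>k: "\<psi> (i k) \<in> carrier A" by (rule mod_hom_closed[OF \<psi>i k])
   have "\<psi> (i k) \<in> carrier X" by (rule mod_hom_closed[OF \<psi>(1) mod_hom_closed[OF i(1) KP[OF k]]])
   then show ?thesis
    using mod_hom_diff[OF A B q \<phi>c[OF KP[OF k]] \<psi>k] \<phi>(2)[OF KP[OF k]] \<pi>K[OF k] mod_hom_closed[OF f k]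
    by (simp add: h_def Xc a_minus_def)
  qed
  ultimately show "\<exists>h\<in>mod_hom R K A. \<forall>k\<in>carrier K. q (h k) = f k" by blast
 qed
qed

text \<open>An R-projective cover of M is also an S-projective cover, and \<open>pd_le\<close>
  speaks of all covers; so the bound over S applies to the very syzygy taken over R. The additional
  step is spent at the bottom, in \<open>projective_syzygy\<close>.\<close>

lemma pd_le_Suc:
 fixes M :: "('r, 'u) module" and enc :: "('u \<times> 'r) list \<Rightarrow> 'u"
 assumes enc: "inj enc" and "left_module R M" "pd_le RS m M"
 shows "pd_le R (Suc m) M"
 using assms(2,3)
proof (induction m arbitrary: M)
 case 0
 then show ?case using projective_syzygy[OF enc] by auto
next
 case (Suc m)
 show ?case unfolding pd_le.simps(2)[of R "Suc m" M]
 proof (intro allI impI, elim conjE)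
  fix P :: "('r, 'u) module" and g
  assume P: "projective R P" and g: "g \<in> mod_hom R P M" "g ` carrier P = carrier M"
  have "pd_le RS m (hom_ker P M g)"
   using Suc.prems(2) projective_restrict[OF enc P] mod_hom_subring[OF g(1) S_sub] g(2) by simp
  then show "pd_le R (Suc m) (hom_ker P M g)"
   by (rule Suc.IH[OF left_module_hom_ker[OF projective_left_module[OF P] Suc.prems(1) g(1)]])
 qed
qed

end

section \<open>Modules over division rings\<close>

text \<open>Base of the tower of extensions. Zorn's lemma is applied to graphs of partial lifts. If
  p lies outside the domain of a maximal one, then only the zero multiple of p lies inside, by
  division, so any preimage of \<open>f p\<close> may be prescribed at p.\<close>

lemma projective_division_ring:
 fixes P :: "('r, 'u) module"
 assumes P: "left_module R P" and inv: "\<And>c. \<lbrakk>c \<in> carrier R; c \<noteq> \<zero>\<^bsub>R\<^esub>\<rbrakk> \<Longrightarrow> \<exists>c'\<in>carrier R. c' \<otimes>\<^bsub>R\<^esub> c = \<one>\<^bsub>R\<^esub>"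
 shows "projective R P"
 unfolding projective_def
proof (intro conjI allI impI P, elim conjE)
 fix A B :: "('r, 'u) module" and g f
 assume A: "left_module R A" and B: "left_module R B" and g: "g \<in> mod_hom R A B"
  and gs: "g ` carrier A = carrier B" and f: "f \<in> mod_hom R P B"
 interpret P: left_module R P by fact
 interpret A: left_module R A by fact
 interpret B: left_module R B by fact
 \<comment> \<open>Graphs of partial lifts: submodules of P x A compatible with f and g. Having only
   0 above 0 makes such a graph single-valued, as one sees by taking differences.\<close>
 define GG where "GG = {G. G \<subseteq> carrier P \<times> carrier A \<and> (\<zero>\<^bsub>P\<^esub>, \<zero>\<^bsub>A\<^esub>) \<in> G \<and>
  (\<forall>p a. (p, a) \<in> G \<longrightarrow> g a = f p) \<and> (\<forall>a. (\<zero>\<^bsub>P\<^esub>, a) \<in> G \<longrightarrow> a = \<zero>\<^bsub>A\<^esub>) \<and>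
  (\<forall>p a p' a'. (p, a) \<in> G \<longrightarrow> (p', a') \<in> G \<longrightarrow> (p \<oplus>\<^bsub>P\<^esub> p', a \<oplus>\<^bsub>A\<^esub> a') \<in> G) \<and>
  (\<forall>r p a. r \<in> carrier R \<longrightarrow> (p, a) \<in> G \<longrightarrow> (r \<odot>\<^bsub>P\<^esub> p, r \<odot>\<^bsub>A\<^esub> a) \<in> G)}"
 have "\<exists>G\<in>GG. \<forall>G'\<in>GG. G \<subseteq> G' \<longrightarrow> G' = G"
 proof (rule subset_Zorn_nonempty)
  have "{(\<zero>\<^bsub>P\<^esub>, \<zero>\<^bsub>A\<^esub>)} \<in> GG"
   by (auto simp: GG_def mod_hom_zero[OF A B g] mod_hom_zero[OF P B f] P.smult_r_null A.smult_r_null)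
  then show "GG \<noteq> {}" by blast
 next
  fix C assume C: "C \<noteq> {}" "subset.chain GG C"
  then have ch: "\<And>X Y. X \<in> C \<Longrightarrow> Y \<in> C \<Longrightarrow> X \<subseteq> Y \<or> Y \<subseteq> X" and CG: "\<And>X. X \<in> C \<Longrightarrow> X \<in> GG"
   by (auto simp: subset.chain_def)
  have add: "(p \<oplus>\<^bsub>P\<^esub> p', a \<oplus>\<^bsub>A\<^esub> a') \<in> \<Union>C" if "(p, a) \<in> X" "X \<in> C" "(p', a') \<in> Y" "Y \<in> C" for p a p' a' X Y
  proof -
   have "\<exists>Z\<in>C. (p, a) \<in> Z \<and> (p', a') \<in> Z" using ch[OF that(2,4)] that by blast
   then obtain Z where Z: "Z \<in> C" "(p, a) \<in> Z" "(p', a') \<in> Z" by blast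
   then have "(p \<oplus>\<^bsub>P\<^esub> p', a \<oplus>\<^bsub>A\<^esub> a') \<in> Z" using CG[OF Z(1)] unfolding GG_def by simp
   then show ?thesis using Z(1) by blast
  qed
  have 1: "X \<subseteq> carrier P \<times> carrier A" and 2: "(\<zero>\<^bsub>P\<^esub>, \<zero>\<^bsub>A\<^esub>) \<in> X" and 3: "(p, a) \<in> X \<Longrightarrow> g a = f p"
   and 4: "(\<zero>\<^bsub>P\<^esub>, a) \<in> X \<Longrightarrow> a = \<zero>\<^bsub>A\<^esub>"
   and 5: "r \<in> carrier R \<Longrightarrow> (p, a) \<in> X \<Longrightarrow> (r \<odot>\<^bsub>P\<^esub> p, r \<odot>\<^bsub>A\<^esub> a) \<in> X" if "X \<in> C" for X p a r
   using CG[OF that] unfolding GG_def mem_Collect_eq by blast+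
  show "\<Union>C \<in> GG" unfolding GG_def mem_Collect_eq
  proof (intro conjI allI impI)
   show "\<Union>C \<subseteq> carrier P \<times> carrier A" using 1 by blast
   show "(\<zero>\<^bsub>P\<^esub>, \<zero>\<^bsub>A\<^esub>) \<in> \<Union>C" using 2 C(1) by blast
   show "g a = f p" if "(p, a) \<in> \<Union>C" for p a using that 3 by blast
   show "a = \<zero>\<^bsub>A\<^esub>" if "(\<zero>\<^bsub>P\<^esub>, a) \<in> \<Union>C" for a using that 4 by blast
   show "(p \<oplus>\<^bsub>P\<^esub> p', a \<oplus>\<^bsub>A\<^esub> a') \<in> \<Union>C" if "(p, a) \<in> \<Union>C" "(p', a') \<in> \<Union>C" for p a p' a'
    using that add by blast
   show "(r \<odot>\<^bsub>P\<^esub> p, r \<odot>\<^bsub>A\<^esub> a) \<in> \<Union>C" if "r \<in> carrier R" "(p, a) \<in> \<Union>C" for r p a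
    using that 5 by blast
  qed
 qed
 then obtain G where G: "G \<in> GG" and max: "\<And>G'. \<lbrakk>G' \<in> GG; G \<subseteq> G'\<rbrakk> \<Longrightarrow> G' = G" by blast
 have Gc: "\<And>p a. (p, a) \<in> G \<Longrightarrow> p \<in> carrier P \<and> a \<in> carrier A" and G0: "(\<zero>\<^bsub>P\<^esub>, \<zero>\<^bsub>A\<^esub>) \<in> G"
  and Gg: "\<And>p a. (p, a) \<in> G \<Longrightarrow> g a = f p" and Gz: "\<And>a. (\<zero>\<^bsub>P\<^esub>, a) \<in> G \<Longrightarrow> a = \<zero>\<^bsub>A\<^esub>"
  and Ga: "\<And>p a p' a'. \<lbrakk>(p, a) \<in> G; (p', a') \<in> G\<rbrakk> \<Longrightarrow> (p \<oplus>\<^bsub>P\<^esub> p', a \<oplus>\<^bsub>A\<^esub> a') \<in> G"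
  and Gs: "\<And>r p a. \<lbrakk>r \<in> carrier R; (p, a) \<in> G\<rbrakk> \<Longrightarrow> (r \<odot>\<^bsub>P\<^esub> p, r \<odot>\<^bsub>A\<^esub> a) \<in> G"
  using G unfolding GG_def mem_Collect_eq by blast+
 have uniq: "a = a'" if "(p, a) \<in> G" "(p, a') \<in> G" for p a a'
 proof -
  have "(p \<oplus>\<^bsub>P\<^esub> (\<ominus>\<^bsub>R\<^esub> \<one>\<^bsub>R\<^esub>) \<odot>\<^bsub>P\<^esub> p, a \<oplus>\<^bsub>A\<^esub> (\<ominus>\<^bsub>R\<^esub> \<one>\<^bsub>R\<^esub>) \<odot>\<^bsub>A\<^esub> a') \<in> G"
   by (intro Ga that Gs) auto
  then have "a \<oplus>\<^bsub>A\<^esub> (\<ominus>\<^bsub>A\<^esub> a') = \<zero>\<^bsub>A\<^esub>"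
   using that[THEN Gc] Gz by (simp add: P.smult_minus_one A.smult_minus_one P.M.r_neg)
  then show ?thesis using that[THEN Gc] A.M.minus_equality[of a "\<ominus>\<^bsub>A\<^esub> a'"] by simp
 qed
 have total: "\<exists>a. (p, a) \<in> G" if p: "p \<in> carrier P" for p
 proof (rule ccontr)
  assume no: "\<nexists>a. (p, a) \<in> G"
  have "f p \<in> g ` carrier A" using mod_hom_closed[OF f p] gs by simp
  then obtain a where a: "a \<in> carrier A" "g a = f p" by auto
  \<comment> \<open>The graph with the line through p adjoined and a as the value at p.\<close>
  define G' where "G' = {(q \<oplus>\<^bsub>P\<^esub> r \<odot>\<^bsub>P\<^esub> p, b \<oplus>\<^bsub>A\<^esub> r \<odot>\<^bsub>A\<^esub> a) | q b r. (q, b) \<in> G \<and> r \<in> carrier R}"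
  have zero: "r = \<zero>\<^bsub>R\<^esub>" if asm: "(q, b) \<in> G" "r \<in> carrier R" "q \<oplus>\<^bsub>P\<^esub> r \<odot>\<^bsub>P\<^esub> p = \<zero>\<^bsub>P\<^esub>" for q b r
  proof (rule ccontr)
   assume "r \<noteq> \<zero>\<^bsub>R\<^esub>"
   then obtain r' where r': "r' \<in> carrier R" "r' \<otimes>\<^bsub>R\<^esub> r = \<one>\<^bsub>R\<^esub>" using inv asm(2) by blast
   have "r \<odot>\<^bsub>P\<^esub> p = \<ominus>\<^bsub>P\<^esub> q"
    using that Gc[OF that(1)] p by (metis P.M.add.m_comm P.M.minus_equality P.smult_closed)
   then have "r' \<odot>\<^bsub>P\<^esub> ((\<ominus>\<^bsub>R\<^esub> \<one>\<^bsub>R\<^esub>) \<odot>\<^bsub>P\<^esub> q) = p"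
    using P.smult_assoc[OF r'(1) that(2) p] r'(2) p Gc[OF that(1)] by (simp add: P.smult_minus_one P.smult_one)
   moreover have "(r' \<odot>\<^bsub>P\<^esub> ((\<ominus>\<^bsub>R\<^esub> \<one>\<^bsub>R\<^esub>) \<odot>\<^bsub>P\<^esub> q), r' \<odot>\<^bsub>A\<^esub> ((\<ominus>\<^bsub>R\<^esub> \<one>\<^bsub>R\<^esub>) \<odot>\<^bsub>A\<^esub> b)) \<in> G"
    by (intro Gs r' that) auto
   ultimately show False using no by auto
  qed
  have "G' \<in> GG" unfolding GG_def mem_Collect_eq
  proof (intro conjI allI impI)
   show "G' \<subseteq> carrier P \<times> carrier A"
    using p a Gc by (auto simp: G'_def P.smult_closed A.smult_closed)
   show "(\<zero>\<^bsub>P\<^esub>, \<zero>\<^bsub>A\<^esub>) \<in> G'" unfolding G'_def mem_Collect_eq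
    by (intro exI[of _ "\<zero>\<^bsub>P\<^esub>"] exI[of _ "\<zero>\<^bsub>A\<^esub>"] exI[of _ "\<zero>\<^bsub>R\<^esub>"])
     (use p a G0 in "auto simp: P.smult_l_null A.smult_l_null")
   show "g b = f q" if "(q, b) \<in> G'" for q b
    using that p a Gc Gg
    by (auto simp: G'_def mod_hom_add[OF g] mod_hom_add[OF f] mod_hom_smult[OF g] mod_hom_smult[OF f]
      P.smult_closed A.smult_closed)
   show "b = \<zero>\<^bsub>A\<^esub>" if "(\<zero>\<^bsub>P\<^esub>, b) \<in> G'" for b
   proof -
    from that obtain q c r where *: "(q, c) \<in> G" "r \<in> carrier R" "\<zero>\<^bsub>P\<^esub> = q \<oplus>\<^bsub>P\<^esub> r \<odot>\<^bsub>P\<^esub> p"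
     "b = c \<oplus>\<^bsub>A\<^esub> r \<odot>\<^bsub>A\<^esub> a" by (auto simp: G'_def)
    have "r = \<zero>\<^bsub>R\<^esub>" using zero[OF *(1,2)] *(3) by simp
    then show ?thesis using * Gc[OF *(1)] p a Gz by (simp add: P.smult_l_null A.smult_l_null)
   qed
   show "(q \<oplus>\<^bsub>P\<^esub> q', b \<oplus>\<^bsub>A\<^esub> b') \<in> G'" if "(q, b) \<in> G'" "(q', b') \<in> G'" for q b q' b'
   proof -
    from that obtain q1 b1 r1 q2 b2 r2 where *: "(q1, b1) \<in> G" "r1 \<in> carrier R" "q = q1 \<oplus>\<^bsub>P\<^esub> r1 \<odot>\<^bsub>P\<^esub> p"
     "b = b1 \<oplus>\<^bsub>A\<^esub> r1 \<odot>\<^bsub>A\<^esub> a" "(q2, b2) \<in> G" "r2 \<in> carrier R" "q' = q2 \<oplus>\<^bsub>P\<^esub> r2 \<odot>\<^bsub>P\<^esub> p"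
     "b' = b2 \<oplus>\<^bsub>A\<^esub> r2 \<odot>\<^bsub>A\<^esub> a" by (auto simp: G'_def)
    show ?thesis unfolding G'_def mem_Collect_eq
     by (intro exI[of _ "q1 \<oplus>\<^bsub>P\<^esub> q2"] exI[of _ "b1 \<oplus>\<^bsub>A\<^esub> b2"] exI[of _ "r1 \<oplus>\<^bsub>R\<^esub> r2"])
      (use * p a *(1,5)[THEN Gc] in "auto simp: Ga P.smult_l_distr A.smult_l_distr P.smult_closed
       A.smult_closed P.M.a_ac A.M.a_ac")
   qed
   show "(r \<odot>\<^bsub>P\<^esub> q, r \<odot>\<^bsub>A\<^esub> b) \<in> G'" if r: "r \<in> carrier R" and "(q, b) \<in> G'" for r q b
   proof -
    from that obtain q1 b1 r1 where *: "(q1, b1) \<in> G" "r1 \<in> carrier R" "q = q1 \<oplus>\<^bsub>P\<^esub> r1 \<odot>\<^bsub>P\<^esub> p"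
     "b = b1 \<oplus>\<^bsub>A\<^esub> r1 \<odot>\<^bsub>A\<^esub> a" by (auto simp: G'_def)
    show ?thesis unfolding G'_def mem_Collect_eq
     by (intro exI[of _ "r \<odot>\<^bsub>P\<^esub> q1"] exI[of _ "r \<odot>\<^bsub>A\<^esub> b1"] exI[of _ "r \<otimes>\<^bsub>R\<^esub> r1"])
      (use * r p a *(1)[THEN Gc] in "auto simp: Gs P.smult_r_distr A.smult_r_distr P.smult_closed
       A.smult_closed P.smult_assoc A.smult_assoc")
   qed
  qed
  moreover have "G \<subseteq> G'"
  proof
   fix z assume "z \<in> G"
   moreover obtain q b where "z = (q, b)" by (cases z)
   ultimately show "z \<in> G'" unfolding G'_def mem_Collect_eq using Gc p a
    by (intro exI[of _ q] exI[of _ b] exI[of _ "\<zero>\<^bsub>R\<^esub>"]) (auto simp: P.smult_l_null A.smult_l_null)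
  qed
  ultimately have "G' = G" by (rule max)
  moreover have "(p, a) \<in> G'" unfolding G'_def mem_Collect_eq
   by (intro exI[of _ "\<zero>\<^bsub>P\<^esub>"] exI[of _ "\<zero>\<^bsub>A\<^esub>"] exI[of _ "\<one>\<^bsub>R\<^esub>"])
    (use p a G0 in "auto simp: P.smult_one A.smult_one")
  ultimately show False using no by auto
 qed
 define h where "h p = (THE a. (p, a) \<in> G)" for p
 have h: "(p, h p) \<in> G" if "p \<in> carrier P" for p
  unfolding h_def by (rule theI') (use total[OF that] uniq in blast)
 have "h \<in> mod_hom R P A"
 proof (rule mod_homI)
  fix p assume "p \<in> carrier P" then show "h p \<in> carrier A" using Gc h by blast
 next
  fix p q assume "p \<in> carrier P" "q \<in> carrier P"
  then show "h (p \<oplus>\<^bsub>P\<^esub> q) = h p \<oplus>\<^bsub>A\<^esub> h q" by (intro uniq[OF h Ga[OF h h]]) auto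
 next
  fix r p assume "r \<in> carrier R" "p \<in> carrier P"
  then show "h (r \<odot>\<^bsub>P\<^esub> p) = r \<odot>\<^bsub>A\<^esub> h p" by (intro uniq[OF h Gs[OF _ h]]) (auto simp: P.smult_closed)
 qed
 then show "\<exists>h\<in>mod_hom R P A. \<forall>x\<in>carrier P. g (h x) = f x" using h Gg by blast
qed

section \<open>Polynomials\<close>

declare One_nat_def [simp del]

abbreviation "cf \<equiv> Poly_Mapping.lookup"
abbreviation "sgl \<equiv> Poly_Mapping.single"
abbreviation "mkeys \<equiv> Poly_Mapping.keys"

lemma cf_Const_mult [simp]: "cf (Const c * p) m = c * cf p m"
proof -
 have "Const c * p = Poly_Mapping.map ((*) c) p"
  by (simp add: Const_def mult_map_scale_conv_mult)
 then show ?thesis by (simp add: Poly_Mapping.map.rep_eq when_def)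
qed

lemma cf_Const_mult' [simp]: "cf (p * Const c) m = c * cf p m"
 for p :: "'k::comm_ring_1 mpoly"
 using cf_Const_mult[of c p m] by (simp add: mult.commute)

lemma cf_of_nat_mult [simp]: "cf (of_nat k * p) m = of_nat k * cf p m" "cf (p * of_nat k) m = of_nat k * cf p m"
 for p :: "'k::comm_ring_1 mpoly"
 using cf_Const_mult[of "of_nat k" p m] by (simp_all add: Const_def mult.commute)

lemma Const_simps [simp]:
 "Const 0 = 0" "Const 1 = 1" "Const c + Const d = Const (c + d)" "Const c * Const d = Const (c * d)"
 "- Const c = Const (- c)" "Const c - Const d = Const (c - d)"
 by (simp_all add: Const_def mult_single single_add single_uminus single_diff)

lemma mpoly_induct [case_names zero single add]:
 fixes p :: "'a \<Rightarrow>\<^sub>0 'b::ab_group_add"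
 assumes "P 0" "\<And>m. cf p m \<noteq> 0 \<Longrightarrow> P (sgl m (cf p m))" "\<And>p q. P p \<Longrightarrow> P q \<Longrightarrow> P (p + q)"
 shows "P p"
proof -
 have "P (\<Sum>m\<in>A. sgl m (cf p m))" if "finite A" "A \<subseteq> mkeys p" for A
  using that by (induction A rule: finite_induct) (auto intro!: assms simp: in_keys_iff)
 moreover have "(\<Sum>m\<in>mkeys p. sgl m (cf p m)) = p"
  by (rule poly_mapping_eqI)
   (auto simp: lookup_sum lookup_single when_def in_keys_iff)
 ultimately show ?thesis by (metis finite_keys order_refl)
qed

lemma mpoly_eq_on_singles:
 fixes p :: "'a \<Rightarrow>\<^sub>0 'b::ab_group_add"
 assumes "\<And>m c. F (sgl m c) = G (sgl m c)" "F 0 = G 0"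
  "\<And>p q. F (p + q) = F p + F q" "\<And>p q. G (p + q) = G p + G q"
 shows "F p = G p"
 by (induction p rule: mpoly_induct) (simp_all add: assms)

text \<open>Operators that are diagonal in the monomial basis. Gamma, its binomials, the projections
  to a degree and division by the degree are all of this kind, so they can be compared coefficient
  by coefficient.\<close>

definition diag :: "((nat \<Rightarrow>\<^sub>0 nat) \<Rightarrow> 'k) \<Rightarrow> 'k::comm_ring_1 mpoly \<Rightarrow> 'k mpoly" where
 "diag c p = Poly_Mapping.mapp (\<lambda>m v. c m * v) p"

lemma cf_diag [simp]: "cf (diag c p) m = c m * cf p m"
 by (simp add: diag_def lookup_mapp when_def in_keys_iff)

lemma diag_single [simp]: "diag c (sgl m v) = sgl m (c m * v)"
 by (rule poly_mapping_eqI) (simp add: lookup_single when_def)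

lemma diag_simps [simp]: "diag c 0 = 0" "diag c (p + q) = diag c p + diag c q"
 "diag c (Const d * p) = Const d * diag c p" "diag c (- p) = - diag c p"
 by (rule poly_mapping_eqI, simp add: lookup_add distrib_left mult_ac)+

lemma diag_diag [simp]: "diag c (diag d p) = diag (\<lambda>m. c m * d m) p"
 by (rule poly_mapping_eqI) simp

text \<open>On monomials this is additivity of the eigenvalues, and both sides are
  biadditive.\<close>

lemma diag_mult:
 assumes "\<And>m m'. c (m + m') = c1 m + c2 m'"
 shows "diag c (p * q) = diag c1 p * q + p * diag c2 q"
proof (rule mpoly_eq_on_singles[of "\<lambda>p. diag c (p * q)" "\<lambda>p. diag c1 p * q + p * diag c2 q"])
 fix m d
 have c: "c (m' + m) = c1 m + c2 m'" for m' using assms[of m m'] by (simp add: add.commute)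
 show "diag c (sgl m d * q) = diag c1 (sgl m d) * q + sgl m d * diag c2 q"
  by (rule mpoly_eq_on_singles[of "\<lambda>q. diag c (sgl m d * q)" "\<lambda>q. diag c1 (sgl m d) * q + sgl m d * diag c2 q"])
   (simp_all add: mult_single c algebra_simps single_add[symmetric])
qed (simp_all add: algebra_simps)

lemma pdiff_single: "pdiff i (sgl m c) = sgl (m - sgl i 1) (of_nat (cf m i) * c)"
 by (simp add: pdiff_def)

lemma cf_pdiff: "cf (pdiff i p) m = of_nat (Suc (cf m i)) * cf p (m + sgl i 1)"
proof -
 \<comment> \<open>Truncated subtraction could send several monomials to m, but wherever it
   truncates the factor \<open>cf k i\<close> is 0.\<close>
 have *: "(of_nat (cf k i) * cf p k when k - sgl i 1 = m) = (if k = m + sgl i 1 then of_nat (cf k i) * cf p k else 0)" for k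
 proof (cases "cf k i = 0")
  case True
  then have "k \<noteq> m + sgl i 1" by (auto simp: lookup_add)
  then show ?thesis using True by simp
 next
  case False
  have "k - sgl i 1 = m \<longleftrightarrow> k = m + sgl i 1"
   unfolding poly_mapping_eq_iff fun_eq_iff lookup_add lookup_minus using False
   by (force simp: lookup_single when_def)
  then show ?thesis by (simp add: when_def)
 qed
 have "cf (pdiff i p) m = (\<Sum>k\<in>mkeys p. of_nat (cf k i) * cf p k when k - sgl i 1 = m)"
  by (simp add: pdiff_def lookup_sum lookup_single)
 also have "\<dots> = of_nat (Suc (cf m i)) * cf p (m + sgl i 1)"
  unfolding * by (auto simp: in_keys_iff lookup_add add.commute)
 finally show ?thesis .
qed

lemma pdiff_simps [simp]: "pdiff i 0 = 0" "pdiff i (p + q) = pdiff i p + pdiff i q"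
 "pdiff i (Const c * p) = Const c * pdiff i p" "pdiff i (- p) = - pdiff i p"
 by (rule poly_mapping_eqI, simp add: cf_pdiff lookup_add distrib_left mult_ac)+

lemma minus_single_add:
 fixes m :: "nat \<Rightarrow>\<^sub>0 nat" assumes "cf m i \<noteq> 0"
 shows "m - sgl i 1 + m' = m + m' - sgl i 1" "sgl i 1 + (m - sgl i 1) = m"
 using assms by (auto simp: poly_mapping_eq_iff fun_eq_iff lookup_add lookup_minus lookup_single when_def)

lemma pdiff_mult: "pdiff i (p * q) = pdiff i p * q + p * pdiff i q"
proof (rule mpoly_eq_on_singles[of "\<lambda>p. pdiff i (p * q)" "\<lambda>p. pdiff i p * q + p * pdiff i q"])
 fix m c
 show "pdiff i (sgl m c * q) = pdiff i (sgl m c) * q + sgl m c * pdiff i q"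
 proof (rule mpoly_eq_on_singles[of "\<lambda>q. pdiff i (sgl m c * q)" "\<lambda>q. pdiff i (sgl m c) * q + sgl m c * pdiff i q"])
  fix m' d
  have 1: "sgl (m - sgl i 1 + m') (of_nat (cf m i) * x) = sgl (m + m' - sgl i 1) (of_nat (cf m i) * x)" for x :: 'a
   by (cases "cf m i = 0") (simp_all add: minus_single_add)
  have 2: "sgl (m + (m' - sgl i 1)) (of_nat (cf m' i) * x) = sgl (m + m' - sgl i 1) (of_nat (cf m' i) * x)" for x :: 'a
   using minus_single_add(1)[of m' i m] by (cases "cf m' i = 0") (simp_all add: add.commute)
  show "pdiff i (sgl m c * sgl m' d) = pdiff i (sgl m c) * sgl m' d + sgl m c * pdiff i (sgl m' d)"
   using 1[of "c * d"] 2[of "c * d"]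
   by (simp add: mult_single pdiff_single lookup_add single_add[symmetric] algebra_simps)
 qed (simp_all add: algebra_simps)
qed (simp_all add: algebra_simps)

lemma pdiff_Var: "pdiff i (Var j) = (if i = j then 1 else 0)"
 by (simp add: Var_def pdiff_single lookup_single when_def)

lemma Var_pdiff_single: "Var i * pdiff i (sgl m c) = sgl m (of_nat (cf m i) * c)"
 by (cases "cf m i = 0") (simp_all add: Var_def pdiff_single mult_single minus_single_add)

lemma Euler_diag:
 "(\<Sum>i\<in>A. Const (c i) * Var i * pdiff i p) = diag (\<lambda>m. \<Sum>i\<in>A. c i * of_nat (cf m i)) p"
proof (rule mpoly_eq_on_singles[where F = "\<lambda>p. \<Sum>i\<in>A. Const (c i) * Var i * pdiff i p"])
 fix m d
 show "(\<Sum>i\<in>A. Const (c i) * Var i * pdiff i (sgl m d)) = diag (\<lambda>m. \<Sum>i\<in>A. c i * of_nat (cf m i)) (sgl m d)"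
  by (rule poly_mapping_eqI)
   (auto simp: mult.assoc Var_pdiff_single lookup_sum lookup_single when_def sum_distrib_right)
qed (simp_all add: algebra_simps sum.distrib)

lemma cf_Var_mult:
 fixes p :: "'k::comm_ring_1 mpoly"
 shows "cf (Var i * p) m = (if cf m i = 0 then 0 else cf p (m - sgl i 1))"
proof (induction p rule: mpoly_induct)
 case (single m')
 have "m = sgl i 1 + m' \<longleftrightarrow> cf m i \<noteq> 0 \<and> m' = m - sgl i 1"
  using minus_single_add(2)[of m i] by (auto simp: lookup_add)
 then show ?case by (auto simp: Var_def mult_single lookup_single when_def)
qed (simp_all add: algebra_simps lookup_add)

lemma Delta_add: "Delta n (p + q) = Delta n p + Delta n q"
 and Delta_Const: "Delta n (Const c * p) = Const c * Delta n p"
 and Delta_zero [simp]: "Delta n 0 = 0"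
 and Delta_minus: "Delta n (- p) = - Delta n p"
proof -
 show "Delta n (p + q) = Delta n p + Delta n q" by (simp add: Delta_def distrib_left sum.distrib)
 show "Delta n (Const c * p) = Const c * Delta n p"
  by (simp add: Delta_def sum_distrib_left mult.left_commute)
qed (simp_all add: Delta_def sum_negf)

lemma Delta_mult: "Delta n (p * q) = Delta n p * q + p * Delta n q"
 unfolding Delta_def sum_distrib_left sum_distrib_right sum.distrib[symmetric] pdiff_mult
 by (intro sum.cong) (simp_all add: algebra_simps)

text \<open>The eigenvalue of \<Gamma> on the monomial m.\<close>

definition gam_wt :: "nat \<Rightarrow> 'k::comm_ring_1 \<Rightarrow> (nat \<Rightarrow>\<^sub>0 nat) \<Rightarrow> 'k" where
 "gam_wt n a m = (\<Sum>i=0..n. (a + of_nat i) * of_nat (cf m i))"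

lemma gam_wt_add [simp]: "gam_wt n a (m + m') = gam_wt n a m + gam_wt n a m'"
 by (simp add: gam_wt_def lookup_add algebra_simps sum.distrib)

lemma gam_wt_zero [simp]: "gam_wt n a 0 = 0"
 by (simp add: gam_wt_def)

lemma gam_wt_single: "gam_wt n a (sgl i 1) = (if i \<le> n then a + of_nat i else 0)"
 by (simp add: gam_wt_def lookup_single when_def if_distrib cong: if_cong)

lemma Gam_diag: "Gam n a p = diag (gam_wt n a) p"
 unfolding Gam_def gam_wt_def by (rule Euler_diag)

lemma Gam_falling_diag: "Gam_falling n a k p = diag (\<lambda>m. \<Prod>i=0..<k. gam_wt n a m - of_nat i) p"
proof (induction k arbitrary: p)
 case 0
 show ?case by (rule poly_mapping_eqI) simp
next
 case (Suc k)
 show ?case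
  by (rule poly_mapping_eqI) (simp add: Suc Gam_diag lookup_minus left_diff_distrib right_diff_distrib mult_ac)
qed

lemma Gam_binom_diag: "Gam_binom n a k p = diag (\<lambda>m. gam_wt n a m gchoose k) p"
 by (rule poly_mapping_eqI) (simp add: Gam_binom_def Gam_falling_diag gbinomial_prod_rev)

lemma diag_Var_mult:
 "diag c (Var i * p) = Var i * diag (\<lambda>m. c (sgl i 1 + m)) p"
 by (rule mpoly_eq_on_singles[of "\<lambda>p. diag c (Var i * p)"])
  (simp_all add: Var_def mult_single algebra_simps)

lemma cf_Var_pdiff:
 assumes "cf (Var i * pdiff j p) m \<noteq> 0"
 shows "\<exists>m'. cf p m' \<noteq> 0 \<and> m' + sgl i 1 = m + sgl j 1 \<and> cf m' j \<noteq> 0"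
proof -
 have m: "cf m i \<noteq> 0" and "cf p (m - sgl i 1 + sgl j 1) \<noteq> 0"
  using assms by (auto simp: cf_Var_mult cf_pdiff split: if_splits)
 moreover have "m - sgl i 1 + sgl j 1 + sgl i 1 = m + sgl j 1"
  using minus_single_add(2)[OF m] by (metis add.assoc add.commute)
 ultimately show ?thesis by (intro exI[of _ "m - sgl i 1 + sgl j 1"]) (auto simp: lookup_add)
qed

lemma cf_Delta_nonzero:
 assumes "cf (Delta n p) m \<noteq> 0"
 shows "\<exists>m' j. cf p m' \<noteq> 0 \<and> 1 \<le> j \<and> j \<le> n \<and> cf m' j \<noteq> 0 \<and> m' + sgl (j - 1) 1 = m + sgl j 1"
proof -
 obtain j where "j \<in> {1..n}" "cf (Var (j - 1) * pdiff j p) m \<noteq> 0"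
  using assms unfolding Delta_def lookup_sum by (rule sum.not_neutral_contains_not_neutral)
 from cf_Var_pdiff[OF this(2)] this(1) show ?thesis by auto
qed

text \<open>\<open>[\<Gamma>, \<Delta>] = - \<Delta>\<close>, with \<open>\<Gamma>\<close> shifted by a constant.\<close>

lemma diag_Delta:
 "diag (\<lambda>m. gam_wt n a m + c) (Delta n p) = Delta n (diag (\<lambda>m. gam_wt n a m + c) p) - Delta n p"
proof (rule mpoly_eq_on_singles[of "\<lambda>p. diag (\<lambda>m. gam_wt n a m + c) (Delta n p)"])
 fix m d
 have "diag (\<lambda>m. gam_wt n a m + c) (Var (j - 1) * pdiff j (sgl m d)) =
  Var (j - 1) * pdiff j (sgl m ((gam_wt n a m + c) * d)) - Var (j - 1) * pdiff j (sgl m d)" if j: "j \<in> {1..n}" for j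
 proof (cases "cf m j = 0")
  case False
  have "gam_wt n a (sgl j 1 + (m - sgl j 1)) = gam_wt n a m"
   using minus_single_add(2)[OF False] by simp
  then have "gam_wt n a m = a + of_nat j + gam_wt n a (m - sgl j 1)"
   using j by (simp add: gam_wt_single del: One_nat_def)
  moreover have "gam_wt n a (sgl (j - 1) 1) = a + of_nat j - 1"
   using j by (auto simp: gam_wt_single of_nat_diff simp del: One_nat_def)
  \<comment> \<open>Trading a factor \<open>X\<^sub>j\<close> for
    \<open>X\<^sub>j\<^sub>-\<^sub>1\<close> lowers the eigenvalue by exactly 1, whatever a
    is.\<close>
  ultimately have "gam_wt n a m = gam_wt n a (m - sgl j 1 + sgl (j - 1) 1) + 1" by simp
  then show ?thesis
   by (simp add: Var_def pdiff_single mult_single single_diff[symmetric] algebra_simps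
     del: gam_wt_add)
 qed (simp add: Var_def pdiff_single mult_single)
 then have "(\<Sum>j=1..n. diag (\<lambda>m. gam_wt n a m + c) (Var (j - 1) * pdiff j (sgl m d))) =
  (\<Sum>j=1..n. Var (j - 1) * pdiff j (sgl m ((gam_wt n a m + c) * d)) - Var (j - 1) * pdiff j (sgl m d))"
  by (intro sum.cong) auto
 moreover have "diag f (sum g A) = (\<Sum>j\<in>A. diag f (g j))" for f :: "(nat \<Rightarrow>\<^sub>0 nat) \<Rightarrow> 'a" and g and A :: "nat set"
  by (induction A rule: infinite_finite_induct) auto
 ultimately show "diag (\<lambda>m. gam_wt n a m + c) (Delta n (sgl m d)) =
  Delta n (diag (\<lambda>m. gam_wt n a m + c) (sgl m d)) - Delta n (sgl m d)"
  by (simp add: Delta_def sum_subtractf)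
qed (simp_all add: Delta_add algebra_simps)

section \<open>The exterior algebra over the polynomial ring\<close>

text \<open>A form \<open>w\<close> stands for \<open>\<Sum>\<^sub>I w I \<cdot> \<theta>\<^sub>I\<close>, where \<open>\<theta>\<^sub>I\<close> is the product of the \<open>\<theta>\<^sub>i\<close>, \<open>i \<in> I\<close>, in increasing order.\<close>

type_synonym 'k form = "nat set \<Rightarrow> 'k mpoly"

text \<open>The sign of sorting \<open>\<theta>\<^sub>I \<theta>\<^sub>J\<close>, counted by the
  inversions between I and J. On finite sets it is multiplicative under disjoint unions in either
  argument, and the sign computations below rest on this. Its values are polynomials so that no
  coercion intervenes.\<close>

definition sg :: "nat set \<Rightarrow> nat set \<Rightarrow> 'k::comm_ring_1 mpoly" where
 "sg I J = (-1) ^ card {(i, j). i \<in> I \<and> j \<in> J \<and> j < i}"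

lemma sg_sq: "sg I J * sg I J = 1"
 by (simp add: sg_def power_mult_distrib[symmetric])

lemma finite_inv: "finite I \<Longrightarrow> finite J \<Longrightarrow> finite {(i, j). i \<in> I \<and> j \<in> J \<and> j < i}"
 by (rule finite_subset[of _ "I \<times> J"]) auto

lemma sg_Un1:
 assumes "finite I" "finite J" "finite K" "I \<inter> J = {}"
 shows "sg (I \<union> J) K = sg I K * sg J K"
proof -
 have "{(i, j). i \<in> I \<union> J \<and> j \<in> K \<and> j < i} = {(i, j). i \<in> I \<and> j \<in> K \<and> j < i} \<union> {(i, j). i \<in> J \<and> j \<in> K \<and> j < i}"
  by auto
 moreover have "card ({(i, j). i \<in> I \<and> j \<in> K \<and> j < i} \<union> {(i, j). i \<in> J \<and> j \<in> K \<and> j < i}) =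
  card {(i, j). i \<in> I \<and> j \<in> K \<and> j < i} + card {(i, j). i \<in> J \<and> j \<in> K \<and> j < i}"
  by (rule card_Un_disjoint) (use assms in "auto simp: finite_inv")
 ultimately show ?thesis unfolding sg_def by (simp add: power_add)
qed

lemma sg_Un2:
 assumes "finite I" "finite J" "finite K" "I \<inter> J = {}"
 shows "sg K (I \<union> J) = sg K I * sg K J"
proof -
 have "{(i, j). i \<in> K \<and> j \<in> I \<union> J \<and> j < i} = {(i, j). i \<in> K \<and> j \<in> I \<and> j < i} \<union> {(i, j). i \<in> K \<and> j \<in> J \<and> j < i}"
  by auto
 moreover have "card ({(i, j). i \<in> K \<and> j \<in> I \<and> j < i} \<union> {(i, j). i \<in> K \<and> j \<in> J \<and> j < i}) =
  card {(i, j). i \<in> K \<and> j \<in> I \<and> j < i} + card {(i, j). i \<in> K \<and> j \<in> J \<and> j < i}"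
  by (rule card_Un_disjoint) (use assms in "auto simp: finite_inv")
 ultimately show ?thesis unfolding sg_def by (simp add: power_add)
qed

lemma sg_swap:
 assumes "finite I" "finite J" "I \<inter> J = {}"
 shows "sg I J * sg J I = (-1) ^ (card I * card J)"
proof -
 have "card {(j, i). j \<in> J \<and> i \<in> I \<and> i < j} = card {(i, j). i \<in> I \<and> j \<in> J \<and> i < j}"
  by (rule bij_betw_same_card[of prod.swap]) (auto simp: bij_betw_def inj_on_def image_iff)
 moreover have "card {(i, j). i \<in> I \<and> j \<in> J \<and> j < i} + card {(i, j). i \<in> I \<and> j \<in> J \<and> i < j} = card (I \<times> J)"
 proof -
  have "I \<times> J = {(i, j). i \<in> I \<and> j \<in> J \<and> j < i} \<union> {(i, j). i \<in> I \<and> j \<in> J \<and> i < j}"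
   using assms(3) by auto
  moreover have "finite {(i, j). i \<in> I \<and> j \<in> J \<and> i < j}"
   by (rule finite_subset[of _ "I \<times> J"]) (use assms in auto)
  moreover have "card ({(i, j). i \<in> I \<and> j \<in> J \<and> j < i} \<union> {(i, j). i \<in> I \<and> j \<in> J \<and> i < j}) =
   card {(i, j). i \<in> I \<and> j \<in> J \<and> j < i} + card {(i, j). i \<in> I \<and> j \<in> J \<and> i < j}"
   by (rule card_Un_disjoint) (use assms calculation(2) in "auto simp: finite_inv")
  ultimately show ?thesis by simp
 qed
 ultimately show ?thesis by (simp add: sg_def power_add[symmetric] card_cartesian_product)
qed

lemma sg_empty [simp]: "sg {} J = 1" "sg I {} = 1"
 by (simp_all add: sg_def)

lemma sg_single_single: "i \<noteq> j \<Longrightarrow> sg {i} {j} = - (sg {j} {i} :: 'k::comm_ring_1 mpoly)"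
proof -
 assume "i \<noteq> j"
 then have "sg {i} {j} * sg {j} {i} = (-1 :: 'k mpoly)" using sg_swap[of "{i}" "{j}"] by simp
 then have "(sg {i} {j} * sg {j} {i}) * sg {j} {i} = (- sg {j} {i} :: 'k mpoly)" by simp
 then show ?thesis by (simp only: mult.assoc sg_sq mult_1_right)
qed

text \<open>K is split into the index sets of the two factors. For infinite K the sum has infinitely
  many indices and is 0 by convention, so a product is always supported on finite sets.\<close>

definition wedge :: "'k::comm_ring_1 form \<Rightarrow> 'k form \<Rightarrow> 'k form" (infixl \<open>\<bullet>\<close> 70) where
 "v \<bullet> w = (\<lambda>K. \<Sum>I\<in>Pow K. sg I (K - I) * v I * w (K - I))"

lemma wedge_infinite: "infinite K \<Longrightarrow> (v \<bullet> w) K = 0"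
 by (simp add: wedge_def)

text \<open>Both sides sum over the ordered splittings of K into three blocks, and by
  multiplicativity both signs count the inversions between the three pairs of blocks.\<close>

lemma wedge_assoc: "(u \<bullet> v) \<bullet> w = u \<bullet> (v \<bullet> w)"
proof
 fix K show "((u \<bullet> v) \<bullet> w) K = (u \<bullet> (v \<bullet> w)) K"
 proof (cases "finite K")
  case True
  have fin: "finite L" if "L \<subseteq> K" for L using that True finite_subset by blast
  have "((u \<bullet> v) \<bullet> w) K = (\<Sum>L\<in>Pow K. \<Sum>I\<in>Pow L. sg L (K - L) * sg I (L - I) * u I * v (L - I) * w (K - L))"
   by (simp add: wedge_def sum_distrib_left sum_distrib_right mult.assoc)
  also have "\<dots> = (\<Sum>(L, I)\<in>(SIGMA L:Pow K. Pow L). sg L (K - L) * sg I (L - I) * u I * v (L - I) * w (K - L))"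
   using fin True by (subst sum.Sigma) auto
  also have "\<dots> = (\<Sum>(I, J)\<in>(SIGMA I:Pow K. Pow (K - I)). sg I (K - I) * sg J (K - I - J) * u I * v J * w (K - I - J))"
  proof (rule sum.reindex_bij_witness[where i = "\<lambda>(I, J). (I \<union> J, I)" and j = "\<lambda>(L, I). (I, L - I)"])
   fix LI assume "LI \<in> (SIGMA L:Pow K. Pow L)"
   then obtain L I where [simp]: "LI = (L, I)" and LI: "L \<subseteq> K" "I \<subseteq> L" by auto
   have f: "finite I" "finite (L - I)" "finite (K - L)" using LI fin by auto
   have K: "K - I - (L - I) = K - L" using LI by auto
   have s1: "sg L (K - L) = (sg I (K - L) * sg (L - I) (K - L) :: 'a mpoly)"
    using sg_Un1[OF f(1,2,3)] LI by (simp add: Un_absorb1 Un_Diff_cancel)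
   have s2: "sg I (K - I) = (sg I (L - I) * sg I (K - L) :: 'a mpoly)"
   proof -
    have "K - I = (L - I) \<union> (K - L)" using LI by auto
    then show ?thesis using sg_Un2[OF f(2,3,1)] LI by auto
   qed
   show "(case case LI of (L, I) \<Rightarrow> (I, L - I) of (I, J) \<Rightarrow>
     sg I (K - I) * sg J (K - I - J) * u I * v J * w (K - I - J)) =
    (case LI of (L, I) \<Rightarrow> sg L (K - L) * sg I (L - I) * u I * v (L - I) * w (K - L))"
    unfolding \<open>LI = (L, I)\<close> prod.case by (simp only: K s1 s2 mult_ac)
  qed auto
  also have "\<dots> = (u \<bullet> (v \<bullet> w)) K"
   using True by (subst sum.Sigma[symmetric]) (auto simp: wedge_def sum_distrib_left mult_ac)
  finally show ?thesis .
 qed (simp add: wedge_infinite)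
qed

lemma sum_fun_apply: "(\<Sum>a\<in>A. f a) x = (\<Sum>a\<in>A. f a x)" for f :: "'a \<Rightarrow> 'b \<Rightarrow> 'c::comm_monoid_add"
 by (induction A rule: infinite_finite_induct) auto

definition pm :: "'k::comm_ring_1 mpoly \<Rightarrow> 'k form \<Rightarrow> 'k form" where "pm p w = (\<lambda>I. p * w I)"

lemma pm_apply [simp]: "pm p w I = p * w I" by (simp add: pm_def)

lemma wedge_add: "(u + v) \<bullet> w = u \<bullet> w + v \<bullet> w" "u \<bullet> (v + w) = u \<bullet> v + u \<bullet> w"
 and wedge_pm: "pm p v \<bullet> w = pm p (v \<bullet> w)" "v \<bullet> pm p w = pm p (v \<bullet> w)"
 and wedge_zero [simp]: "0 \<bullet> w = 0" "v \<bullet> 0 = 0"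
 and wedge_minus: "(- v) \<bullet> w = - (v \<bullet> w)" "v \<bullet> (- w) = - (v \<bullet> w)"
 by (rule ext, simp add: wedge_def sum.distrib[symmetric] algebra_simps sum_distrib_left sum_negf)+

lemma wedge_sum: "sum f A \<bullet> w = (\<Sum>i\<in>A. f i \<bullet> w)" "v \<bullet> sum f A = (\<Sum>i\<in>A. v \<bullet> f i)"
 by (induction A rule: infinite_finite_induct) (simp_all add: wedge_add)

lemma pm_simps: "pm p (v + w) = pm p v + pm p w" "pm (p + q) w = pm p w + pm q w" "pm p (pm q w) = pm (p * q) w"
 "pm p 0 = 0" "pm 0 w = 0" "pm 1 w = w" "pm p (- w) = - pm p w" "pm (- p) w = - pm p w"
 by (rule ext, simp add: algebra_simps)+

lemma pm_sum: "pm p (sum f A) = (\<Sum>i\<in>A. pm p (f i))"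
 by (rule ext) (simp add: sum_fun_apply sum_distrib_left)

definition th :: "nat \<Rightarrow> 'k::comm_ring_1 form" where "th j = (\<lambda>I. if I = {j} then 1 else 0)"

text \<open>The grading involution, which carries the signs in the Leibniz rules of odd
  derivations.\<close>

definition parity :: "'k::comm_ring_1 form \<Rightarrow> 'k form" where "parity w = (\<lambda>I. (-1) ^ card I * w I)"

text \<open>Contraction with the dual of \<open>\<theta>\<^sub>j\<close>.\<close>

definition iot :: "nat \<Rightarrow> 'k::comm_ring_1 form \<Rightarrow> 'k form" where
 "iot j w = (\<lambda>I. if j \<in> I then 0 else sg {j} I * w (insert j I))"

lemma iot_simps [simp]: "iot j 0 = 0" "iot j (v + w) = iot j v + iot j w" "iot j (pm p w) = pm p (iot j w)"
 "iot j (- w) = - iot j w"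
 by (rule ext, simp add: iot_def algebra_simps)+

lemma iot_sum: "iot j (sum f A) = (\<Sum>i\<in>A. iot j (f i))"
 by (rule ext) (simp add: iot_def sum_fun_apply sum_distrib_left)

lemma th_wedge: "(th j \<bullet> w) K = (if finite K \<and> j \<in> K then sg {j} (K - {j}) * w (K - {j}) else 0)"
proof (cases "finite K")
 case True
 have "(th j \<bullet> w) K = (\<Sum>I\<in>Pow K. if I = {j} then sg {j} (K - {j}) * w (K - {j}) else 0)"
  unfolding wedge_def th_def by (intro sum.cong) auto
 then show ?thesis using True by simp
qed (simp add: wedge_infinite)

lemma wedge_th: "v \<bullet> th j = th j \<bullet> parity v"
proof
 fix K show "(v \<bullet> th j) K = (th j \<bullet> parity v) K"
 proof (cases "finite K")
  case True
  have *: "I \<subseteq> K \<Longrightarrow> K - I = {j} \<longleftrightarrow> j \<in> K \<and> I = K - {j}" for I by auto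
  have "(v \<bullet> th j) K = (\<Sum>I\<in>Pow K. if j \<in> K \<and> I = K - {j} then sg (K - {j}) {j} * v (K - {j}) else 0)"
   unfolding wedge_def th_def by (intro sum.cong) (auto simp: * double_diff)
  also have "\<dots> = (if j \<in> K then sg (K - {j}) {j} * v (K - {j}) else 0)" using True by auto
  also have "sg (K - {j}) {j} = (sg {j} (K - {j}) * (-1) ^ card (K - {j}) :: 'a mpoly)" if "j \<in> K"
  proof -
   have "sg {j} (K - {j}) * sg (K - {j}) {j} = ((-1) ^ card (K - {j}) :: 'a mpoly)"
    using sg_swap[of "{j}" "K - {j}"] True by simp
   then have "sg {j} (K - {j}) * (sg {j} (K - {j}) * sg (K - {j}) {j}) = (sg {j} (K - {j}) * (-1) ^ card (K - {j}) :: 'a mpoly)"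
    by simp
   then show ?thesis by (simp only: mult.assoc[symmetric] sg_sq mult_1_left)
  qed
  ultimately show ?thesis using True by (simp add: th_wedge parity_def mult.assoc)
 qed (simp add: wedge_infinite)
qed

text \<open>For j outside K, the splittings of \<open>insert j K\<close> fall into those with j on
  the left and those with j on the right, one kind for each term. For j in K the left side is 0, and
  the two terms on the right cancel for each splitting of \<open>K - {j}\<close>.\<close>

lemma iot_wedge: "iot j (v \<bullet> w) = iot j v \<bullet> w + parity v \<bullet> iot j w"
proof
 fix K show "iot j (v \<bullet> w) K = (iot j v \<bullet> w + parity v \<bullet> iot j w) K"
 proof (cases "finite K")
  case fin: True
  have f: "finite L" if "L \<subseteq> K" for L using that fin finite_subset by blast
  have neg1: "sg I {j} * sg {j} I = ((-1) ^ card I :: 'a mpoly)" if "j \<notin> I" "finite I" for I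
   using sg_swap[of I "{j}"] that by simp
  have sgm: "sg I {j} = (sg {j} I * (-1) ^ card I :: 'a mpoly)" if "j \<notin> I" "finite I" for I
  proof -
   have "(sg I {j} * sg {j} I) * sg {j} I = (sg {j} I * (-1) ^ card I :: 'a mpoly)" by (simp add: neg1 that)
   then show ?thesis by (simp only: mult.assoc sg_sq mult_1_right)
  qed
  show ?thesis
  proof (cases "j \<in> K")
   case False
   have split: "Pow (insert j K) = Pow K \<union> insert j ` Pow K" "Pow K \<inter> insert j ` Pow K = {}"
    using False by (auto simp: Pow_insert)
   have "iot j (v \<bullet> w) K = (\<Sum>I\<in>Pow (insert j K). sg {j} K * (sg I (insert j K - I) * v I * w (insert j K - I)))"
    using False by (simp add: iot_def wedge_def sum_distrib_left)
   also have "\<dots> = (\<Sum>I\<in>Pow K. sg {j} K * (sg I (insert j K - I) * v I * w (insert j K - I))) +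
     (\<Sum>I\<in>Pow K. sg {j} K * (sg (insert j I) (K - I) * v (insert j I) * w (K - I)))"
   proof -
    have "inj_on (insert j) (Pow K)" using False by (auto simp: inj_on_def)
    moreover have "insert j K - insert j I = K - I" if "I \<subseteq> K" for I using False that by auto
    ultimately show ?thesis using fin split by (subst split(1), subst sum.union_disjoint)
     (auto simp: sum.reindex)
   qed
   also have "(\<Sum>I\<in>Pow K. sg {j} K * (sg I (insert j K - I) * v I * w (insert j K - I))) = (parity v \<bullet> iot j w) K"
    unfolding wedge_def
   proof (rule sum.cong)
    fix I assume "I \<in> Pow K"
    then have I: "I \<subseteq> K" "finite I" "finite (K - I)" "j \<notin> I" "insert j K - I = insert j (K - I)" using f False by auto
    have "sg I (insert j (K - I)) = (sg I {j} * sg I (K - I) :: 'a mpoly)"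
     using sg_Un2[of "{j}" "K - I" I] I False by simp
    moreover have "sg {j} K = (sg {j} I * sg {j} (K - I) :: 'a mpoly)"
    proof -
     have "K = I \<union> (K - I)" using I by auto
     then show ?thesis using sg_Un2[of I "K - I" "{j}"] I by auto
    qed
    ultimately have "sg {j} K * sg I (insert j (K - I)) = (sg {j} I * sg {j} I) * ((-1) ^ card I * sg {j} (K - I) * sg I (K - I) :: 'a mpoly)"
     by (simp add: sgm[OF I(4,2)] mult_ac)
    then have "sg {j} K * sg I (insert j (K - I)) = ((-1) ^ card I * sg {j} (K - I) * sg I (K - I) :: 'a mpoly)"
     by (simp add: sg_sq)
    then show "sg {j} K * (sg I (insert j K - I) * v I * w (insert j K - I)) = sg I (K - I) * parity v I * iot j w (K - I)"
     using False by (simp add: I(5) parity_def iot_def mult.assoc[symmetric])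
   qed simp
   also have "(\<Sum>I\<in>Pow K. sg {j} K * (sg (insert j I) (K - I) * v (insert j I) * w (K - I))) = (iot j v \<bullet> w) K"
    unfolding wedge_def
   proof (rule sum.cong)
    fix I assume "I \<in> Pow K"
    then have I: "I \<subseteq> K" "finite I" "finite (K - I)" "j \<notin> I" using f False by auto
    have "sg (insert j I) (K - I) = (sg {j} (K - I) * sg I (K - I) :: 'a mpoly)"
     using sg_Un1[of "{j}" I "K - I"] I False by simp
    moreover have "sg {j} K = (sg {j} I * sg {j} (K - I) :: 'a mpoly)"
    proof -
     have "K = I \<union> (K - I)" using I by auto
     then show ?thesis using sg_Un2[of I "K - I" "{j}"] I by auto
    qed
    ultimately have "sg {j} K * sg (insert j I) (K - I) = (sg {j} (K - I) * sg {j} (K - I)) * (sg {j} I * sg I (K - I) :: 'a mpoly)"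
     by (simp add: mult_ac)
    then have "sg {j} K * sg (insert j I) (K - I) = (sg {j} I * sg I (K - I) :: 'a mpoly)" by (simp add: sg_sq)
    then show "sg {j} K * (sg (insert j I) (K - I) * v (insert j I) * w (K - I)) = sg I (K - I) * iot j v I * w (K - I)"
     using I by (simp add: iot_def mult.assoc[symmetric])
   qed simp
   finally show ?thesis by (simp add: add.commute)
  next
   case True
   define M where "M = K - {j}"
   have M: "finite M" "j \<notin> M" "K = insert j M" using True fin by (auto simp: M_def)
   have split: "Pow K = Pow M \<union> insert j ` Pow M" "Pow M \<inter> insert j ` Pow M = {}" and inj: "inj_on (insert j) (Pow M)"
    using M(2) by (auto simp: M(3) Pow_insert inj_on_def)
   have d: "K - insert j I = M - I" "K - I = insert j (M - I)" if "I \<subseteq> M" for I using M that by auto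
   have "(iot j v \<bullet> w + parity v \<bullet> iot j w) K =
    (\<Sum>I\<in>Pow K. sg I (K - I) * iot j v I * w (K - I) + sg I (K - I) * parity v I * iot j w (K - I))"
    by (simp add: wedge_def sum.distrib)
   also have "\<dots> = (\<Sum>I\<in>Pow M. sg I (K - I) * (sg {j} I * v (insert j I)) * w (K - I)) +
    (\<Sum>I\<in>Pow M. sg (insert j I) (M - I) * parity v (insert j I) * (sg {j} (M - I) * w (insert j (M - I))))"
    unfolding split(1) using M split(2) inj d
    by (subst sum.union_disjoint) (auto simp: sum.reindex iot_def intro!: arg_cong2[where f = "(+)"] sum.cong)
   also have "\<dots> = (\<Sum>I\<in>Pow M. sg I (K - I) * (sg {j} I * v (insert j I)) * w (K - I) +
    sg (insert j I) (M - I) * parity v (insert j I) * (sg {j} (M - I) * w (insert j (M - I))))"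
    by (simp add: sum.distrib)
   also have "\<dots> = 0"
   proof (rule sum.neutral, rule ballI)
    fix I assume "I \<in> Pow M"
    then have I: "I \<subseteq> M" "finite I" "finite (M - I)" "j \<notin> I" "j \<notin> M - I" using M finite_subset by auto
    have 1: "sg I (K - I) = (sg I {j} * sg I (M - I) :: 'a mpoly)"
     using sg_Un2[of "{j}" "M - I" I] I by (simp add: d(2))
    have 2: "sg (insert j I) (M - I) = (sg {j} (M - I) * sg I (M - I) :: 'a mpoly)"
     using sg_Un1[of "{j}" I "M - I"] I by simp
    have 3: "parity v (insert j I) = - ((-1) ^ card I * v (insert j I))" using I by (simp add: parity_def)
    have 4: "sg I (K - I) * sg {j} I = ((-1) ^ card I * sg I (M - I) :: 'a mpoly)"
     unfolding 1 using neg1[OF I(4,2)] by (simp add: mult_ac)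
    have 5: "sg (insert j I) (M - I) * sg {j} (M - I) = (sg I (M - I) :: 'a mpoly)"
     unfolding 2 using arg_cong[OF sg_sq[of "{j}" "M - I"], of "\<lambda>z. z * sg I (M - I)"] by (simp add: mult_ac)
    have "sg I (K - I) * (sg {j} I * v (insert j I)) * w (K - I) =
     ((-1) ^ card I * sg I (M - I)) * v (insert j I) * w (insert j (M - I))"
     unfolding 4[symmetric] d(2)[OF I(1)] by (simp only: mult_ac)
    moreover have "sg (insert j I) (M - I) * parity v (insert j I) * (sg {j} (M - I) * w (insert j (M - I))) =
     sg I (M - I) * parity v (insert j I) * w (insert j (M - I))"
     unfolding 5[symmetric] by (simp only: mult_ac)
    ultimately show "sg I (K - I) * (sg {j} I * v (insert j I)) * w (K - I) +
      sg (insert j I) (M - I) * parity v (insert j I) * (sg {j} (M - I) * w (insert j (M - I))) = 0"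
     unfolding 3 by (simp add: algebra_simps)
   qed
   finally show ?thesis using True by (simp add: iot_def)
  qed
 qed (auto simp: wedge_infinite iot_def)
qed

definition bas :: "nat set \<Rightarrow> (nat \<Rightarrow>\<^sub>0 nat) \<Rightarrow> 'k::comm_ring_1 \<Rightarrow> 'k form" where
 "bas I m c = (\<lambda>J. if J = I then sgl m c else 0)"

lemma additive_sum:
 assumes "h 0 = 0" "\<And>u v. h (u + v) = h u + h v" shows "h (sum f A) = (\<Sum>i\<in>A. h (f i))"
 using sum_comp_morphism[of h f A] assms by (simp add: o_def)

lemma form_induct [consumes 1, case_names zero basis add]:
 assumes fin: "finite {I. w I \<noteq> 0}" and "P 0"
  and "\<And>I m. cf (w I) m \<noteq> 0 \<Longrightarrow> P (bas I m (cf (w I) m))" and "\<And>u v. P u \<Longrightarrow> P v \<Longrightarrow> P (u + v)"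
 shows "P w"
proof -
 have 1: "P (\<lambda>J. if J = I then w I else 0)" for I
 proof (rule mpoly_induct[where P = "\<lambda>p. P (\<lambda>J. if J = I then p else 0)" and p = "w I"], goal_cases)
  case 1
  then show ?case using assms(2) by (simp add: zero_fun_def)
 next
  case (2 m)
  then show ?case using assms(3)[of I m] by (simp add: bas_def)
 next
  case (3 p q)
  moreover have "(\<lambda>J. if J = I then p + q else 0) = (\<lambda>J. if J = I then p else 0) + (\<lambda>J. if J = I then q else 0)"
   by auto
  ultimately show ?case using assms(4) by metis
 qed
 have 2: "P (\<Sum>I\<in>A. (\<lambda>J. if J = I then w I else 0))" if "finite A" for A
  using that by (induction A rule: finite_induct) (simp_all only: sum.empty sum.insert not_False_eq_True assms(2,4) 1)
 have 3: "(\<Sum>I\<in>{I. w I \<noteq> 0}. (\<lambda>J. if J = I then w I else 0)) = w"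
  using fin by (intro ext) (simp add: sum_fun_apply)
 show ?thesis using 2[OF fin] unfolding 3 .
qed

text \<open>Forms are functions on all sets of indices, whereas signs and cardinalities only behave
  well on finite sets. Every wedge product satisfies this condition.\<close>

definition fsup :: "'k::zero form \<Rightarrow> bool" where "fsup w \<longleftrightarrow> (\<forall>I. infinite I \<longrightarrow> w I = 0)"

lemma iot_anticommute: "fsup w \<Longrightarrow> iot j (iot l w) = - iot l (iot j w)"
proof
 fix I assume w: "fsup w"
 show "iot j (iot l w) I = (- iot l (iot j w)) I"
 proof (cases "finite I \<and> j \<noteq> l \<and> j \<notin> I \<and> l \<notin> I")
  case True
  have "sg {l} (insert j I) = (sg {l} {j} * sg {l} I :: 'a mpoly)" "sg {j} (insert l I) = (sg {j} {l} * sg {j} I :: 'a mpoly)"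
   using sg_Un2[of "{j}" I "{l}"] sg_Un2[of "{l}" I "{j}"] True by auto
  then show ?thesis using True sg_single_single[of j l, where ?'k = 'a]
   by (simp add: iot_def insert_commute mult_ac)
 qed (use w in "auto simp: iot_def fsup_def")
qed

definition emb :: "'k::zero mpoly \<Rightarrow> 'k form" where "emb p = (\<lambda>I. if I = {} then p else 0)"

lemma emb_wedge: "fsup w \<Longrightarrow> emb p \<bullet> w = pm p w"
proof
 fix K assume w: "fsup w"
 show "(emb p \<bullet> w) K = pm p w K"
 proof (cases "finite K")
  case True
  have "(emb p \<bullet> w) K = (\<Sum>I\<in>Pow K. if I = {} then p * w K else 0)"
   unfolding wedge_def by (intro sum.cong) (auto simp: emb_def)
  then show ?thesis using True by simp
 qed (use w in "simp add: wedge_infinite fsup_def")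
qed

lemma wedge_emb: "fsup w \<Longrightarrow> w \<bullet> emb p = pm p w"
proof
 fix K assume w: "fsup w"
 show "(w \<bullet> emb p) K = pm p w K"
 proof (cases "finite K")
  case True
  have "(w \<bullet> emb p) K = (\<Sum>I\<in>Pow K. if I = K then p * w K else 0)"
   unfolding wedge_def by (intro sum.cong) (auto simp: emb_def)
  then show ?thesis using True by simp
 qed (use w in "simp add: wedge_infinite fsup_def")
qed

lemma iot_th_wedge:
 assumes "fsup w" shows "iot j (th l \<bullet> w) = (if j = l then w else 0) - th l \<bullet> iot j w"
proof -
 have 1: "iot j (th l) = (if j = l then emb 1 else (0 :: 'a form))"
  by (rule ext) (auto simp: iot_def th_def emb_def insert_eq_iff)
 have 2: "parity (th l) = - (th l :: 'a form)" by (rule ext) (simp add: parity_def th_def)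
 show ?thesis unfolding iot_wedge 1 2 using emb_wedge[OF assms, of 1] by (simp add: wedge_minus pm_simps)
qed

section \<open>The derivations and the Koszul differential on forms\<close>

locale forms =
 fixes n :: nat and a :: "'k::field_char_0"
begin

abbreviation "PU \<equiv> polys_upto n :: 'k mpoly set"

text \<open>The eigenvalue of \<Gamma> on the product of the monomial m with
  \<open>\<theta>\<^sub>I\<close>.\<close>

definition gam :: "nat set \<Rightarrow> (nat \<Rightarrow>\<^sub>0 nat) \<Rightarrow> 'k" where
 "gam I m = gam_wt n a m + (\<Sum>j\<in>I. a + of_nat j)"

text \<open>The operator F(\<Gamma>). The identity gives \<Gamma> itself, and the binomial functions
  give the right factors in the star product.\<close>

definition DG :: "('k \<Rightarrow> 'k) \<Rightarrow> 'k form \<Rightarrow> 'k form" where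
 "DG F w = (\<lambda>I. diag (\<lambda>m. F (gam I m)) (w I))"

text \<open>The first summand acts on the coefficients; the second is the derivation that sends
  \<open>\<theta>\<^sub>j\<close> to \<open>\<theta>\<^sub>j\<^sub>-\<^sub>1\<close> and
  \<open>\<theta>\<^sub>0\<close> to 0.\<close>

definition Dl :: "'k form \<Rightarrow> 'k form" where
 "Dl w = (\<lambda>I. Delta n (w I)) + (\<Sum>j=1..n. th (j - 1) \<bullet> iot j w)"

text \<open>The Koszul differential, written as contraction with the Euler vector field.\<close>

definition dd :: "'k form \<Rightarrow> 'k form" where
 "dd w = (\<Sum>j\<le>n. pm (Var j) (iot j w))"

abbreviation Gm :: "'k form \<Rightarrow> 'k form" where "Gm \<equiv> DG (\<lambda>x. x)"
abbreviation gb :: "nat \<Rightarrow> 'k form \<Rightarrow> 'k form" where "gb k \<equiv> DG (\<lambda>x. x gchoose k)"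

definition st :: "'k form \<Rightarrow> 'k form \<Rightarrow> 'k form" (infixl \<open>\<star>\<close> 70) where
 "v \<star> w = Sum_any (\<lambda>k. (Dl ^^ k) v \<bullet> gb k w)"

lemma DG_simps [simp]: "DG F 0 = 0" "DG F (v + w) = DG F v + DG F w" "DG F (pm (Const c) w) = pm (Const c) (DG F w)"
 "DG F (- w) = - DG F w"
 by (rule ext, simp add: DG_def)+

lemma DG_sum: "DG F (sum f A) = (\<Sum>i\<in>A. DG F (f i))"
 by (rule additive_sum[of "DG F"]) simp_all

lemma Dl_simps [simp]: "Dl 0 = 0" "Dl (v + w) = Dl v + Dl w" "Dl (pm (Const c) w) = pm (Const c) (Dl w)"
 "Dl (- w) = - Dl w"
proof -
 show "Dl 0 = 0" by (rule ext) (simp add: Dl_def sum_fun_apply)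
 show "Dl (v + w) = Dl v + Dl w"
  by (rule ext) (simp add: Dl_def Delta_add sum_fun_apply wedge_add sum.distrib)
 show "Dl (pm (Const c) w) = pm (Const c) (Dl w)"
  by (rule ext) (simp add: Dl_def Delta_Const sum_fun_apply wedge_pm distrib_left sum_distrib_left)
 show "Dl (- w) = - Dl w"
  by (rule ext) (simp add: Dl_def Delta_minus sum_fun_apply wedge_minus sum_negf)
qed

lemma Dl_sum: "Dl (sum f A) = (\<Sum>i\<in>A. Dl (f i))"
 by (rule additive_sum[of "Dl"]) simp_all

lemma Dl_pow_simps [simp]: "(Dl ^^ k) 0 = 0" "(Dl ^^ k) (v + w) = (Dl ^^ k) v + (Dl ^^ k) w"
 "(Dl ^^ k) (pm (Const c) w) = pm (Const c) ((Dl ^^ k) w)" "(Dl ^^ k) (- w) = - (Dl ^^ k) w"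
 by (induction k) simp_all

lemma Dl_pow_sum: "(Dl ^^ k) (sum f A) = (\<Sum>i\<in>A. (Dl ^^ k) (f i))"
 by (rule additive_sum[of "Dl ^^ k"]) simp_all

lemma dd_simps [simp]: "dd 0 = 0" "dd (v + w) = dd v + dd w" "dd (pm (Const c) w) = pm (Const c) (dd w)"
 "dd (- w) = - dd w"
 by (rule ext, simp add: dd_def sum_fun_apply algebra_simps sum.distrib sum_distrib_left sum_negf)+

lemma dd_sum: "dd (sum f A) = (\<Sum>i\<in>A. dd (f i))"
 by (rule additive_sum[of "dd"]) simp_all

lemma Dl_wedge: "Dl (v \<bullet> w) = Dl v \<bullet> w + v \<bullet> Dl w"
proof -
 have 1: "(\<lambda>I. Delta n ((v \<bullet> w) I)) = (\<lambda>I. Delta n (v I)) \<bullet> w + v \<bullet> (\<lambda>I. Delta n (w I))"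
 proof
  fix K
  have sgD: "Delta n (sg I J * p) = sg I J * Delta n p" for I J and p :: "'k mpoly"
   by (cases "even (card {(i, j). i \<in> I \<and> j \<in> J \<and> j < i})") (simp_all add: sg_def Delta_minus)
  have sgD2: "Delta n (sg I J * p * q) = sg I J * Delta n p * q + sg I J * p * Delta n q" for I J and p q :: "'k mpoly"
   unfolding mult.assoc sgD by (simp add: Delta_mult distrib_left)
  have "Delta n (sum f A) = (\<Sum>i\<in>A. Delta n (f i))" for f :: "nat set \<Rightarrow> 'k mpoly" and A
   by (induction A rule: infinite_finite_induct) (simp_all add: Delta_add)
  then show "Delta n ((v \<bullet> w) K) = ((\<lambda>I. Delta n (v I)) \<bullet> w + v \<bullet> (\<lambda>I. Delta n (w I))) K"
   by (simp only: wedge_def sgD2 sum.distrib plus_fun_apply)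
 qed
 \<comment> \<open>Contraction and multiplication by a theta are both odd; the sign produced by the
   contraction is undone when \<open>th (j - 1)\<close> moves past v.\<close>
 have 2: "th (j - 1) \<bullet> iot j (v \<bullet> w) = (th (j - 1) \<bullet> iot j v) \<bullet> w + v \<bullet> (th (j - 1) \<bullet> iot j w)" for j
 proof -
  have "th (j - 1) \<bullet> (parity v \<bullet> iot j w) = v \<bullet> (th (j - 1) \<bullet> iot j w)"
   by (simp only: wedge_assoc[symmetric] wedge_th)
  then show ?thesis by (simp only: iot_wedge wedge_add wedge_assoc)
 qed
 show ?thesis
  by (simp only: Dl_def 1 2 sum.distrib wedge_add wedge_sum add_ac)
qed

lemma dd_wedge: "dd (v \<bullet> w) = dd v \<bullet> w + parity v \<bullet> dd w"
 by (simp add: dd_def iot_wedge pm_simps sum.distrib wedge_sum wedge_pm)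

lemma gam_Un: "\<lbrakk>finite I; finite J; I \<inter> J = {}\<rbrakk> \<Longrightarrow> gam (I \<union> J) (m + m') = gam I m + gam J m'"
 by (simp add: gam_def sum.union_disjoint)

lemma Gm_wedge: "Gm (v \<bullet> w) = Gm v \<bullet> w + v \<bullet> Gm w"
proof
 fix K show "Gm (v \<bullet> w) K = (Gm v \<bullet> w + v \<bullet> Gm w) K"
 proof (cases "finite K")
  case True
  have sgD: "diag c (sg I J * p) = sg I J * diag c p" for c I J and p :: "'k mpoly"
   by (cases "even (card {(i, j). i \<in> I \<and> j \<in> J \<and> j < i})") (simp_all add: sg_def)
  have "diag c (sum f A) = (\<Sum>i\<in>A. diag c (f i))" for f :: "nat set \<Rightarrow> 'k mpoly" and A c
   by (induction A rule: infinite_finite_induct) simp_all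
  moreover have "diag (gam K) (v I * w (K - I)) = diag (gam I) (v I) * w (K - I) + v I * diag (gam (K - I)) (w (K - I))"
   if "I \<in> Pow K" for I
  proof (rule diag_mult)
   fix m m'
   show "gam K (m + m') = gam I m + gam (K - I) m'"
    using gam_Un[of I "K - I" m m'] that True finite_subset[of I K] by (auto simp: Un_absorb1)
  qed
  ultimately show ?thesis
   by (simp add: DG_def wedge_def mult.assoc sgD distrib_left sum.distrib)
 qed (simp add: wedge_infinite DG_def)
qed

lemma gam_insert: "\<lbrakk>finite I; j \<notin> I\<rbrakk> \<Longrightarrow> gam (insert j I) m = gam I m + (a + of_nat j)"
 by (simp add: gam_def)

text \<open>Lowering an index by one lowers the eigenvalue by one, whether it is the index of a
  variable or of a theta. In the first case the thetas contribute a constant, which is the shift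
  provided for in \<open>diag_Delta\<close>.\<close>

lemma Gm_Dl:
 assumes w: "fsup w" shows "Gm (Dl w) = Dl (Gm w) - Dl w"
proof -
 have 1: "Gm (\<lambda>I. Delta n (w I)) = (\<lambda>I. Delta n (Gm w I)) - (\<lambda>I. Delta n (w I))"
  by (rule ext) (simp add: DG_def gam_def diag_Delta)
 have 2: "Gm (th (j - 1) \<bullet> iot j w) = th (j - 1) \<bullet> iot j (Gm w) - th (j - 1) \<bullet> iot j w" if j: "1 \<le> j" for j
 proof
  fix K
  show "Gm (th (j - 1) \<bullet> iot j w) K = (th (j - 1) \<bullet> iot j (Gm w) - th (j - 1) \<bullet> iot j w) K"
  proof (cases "finite K \<and> j - 1 \<in> K \<and> j \<notin> K - {j - 1}")
   case True
   define L where "L = K - {j - 1}"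
   have L: "finite L" "j - 1 \<notin> L" "K = insert (j - 1) L" "j \<notin> L" using True by (auto simp: L_def)
   have sgD: "diag c (sg I J * p) = sg I J * diag c p" for c I J and p :: "'k mpoly"
    by (cases "even (card {(i, j). i \<in> I \<and> j \<in> J \<and> j < i})") (simp_all add: sg_def)
   have "gam K m = gam (insert j L) m - 1" for m
    using L j by (simp add: gam_insert of_nat_diff)
   then have "diag (gam K) p = diag (gam (insert j L)) p - p" for p
    by (intro poly_mapping_eqI) (simp add: lookup_minus left_diff_distrib)
   then show ?thesis using True L
    by (simp add: th_wedge iot_def DG_def sgD L_def[symmetric] right_diff_distrib)
  qed (auto simp: th_wedge iot_def DG_def)
 qed
 have "Gm (Dl w) = Gm (\<lambda>I. Delta n (w I)) + (\<Sum>j=1..n. Gm (th (j - 1) \<bullet> iot j w))"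
  by (simp add: Dl_def DG_sum)
 also have "(\<Sum>j=1..n. Gm (th (j - 1) \<bullet> iot j w)) = (\<Sum>j=1..n. th (j - 1) \<bullet> iot j (Gm w)) - (\<Sum>j=1..n. th (j - 1) \<bullet> iot j w)"
  unfolding sum_subtractf[symmetric] by (intro sum.cong 2) auto
 finally have "Gm (Dl w) = Gm (\<lambda>I. Delta n (w I)) + ((\<Sum>j=1..n. th (j - 1) \<bullet> iot j (Gm w)) - (\<Sum>j=1..n. th (j - 1) \<bullet> iot j w))" .
 then show ?thesis unfolding 1 Dl_def by (simp only: add_diff_add)
qed

text \<open>\<open>dd\<close> trades \<open>\<theta>\<^sub>j\<close> for \<open>X\<^sub>j\<close>,
  so it commutes with every diagonal operator that does not see the trade. This covers both \<Gamma>
  and the total degree.\<close>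

lemma diag_dd:
 assumes w: "fsup w" and c: "\<And>I j m. \<lbrakk>finite I; j \<notin> I; j \<le> n\<rbrakk> \<Longrightarrow> c I (sgl j 1 + m) = c (insert j I) m"
 shows "(\<lambda>I. diag (c I) (dd w I)) = dd (\<lambda>I. diag (c I) (w I))"
proof
 fix I
 have *: "diag (c I) (Var j * iot j w I) = Var j * iot j (\<lambda>I. diag (c I) (w I)) I" if j: "j \<le> n" for j
 proof (cases "finite I \<and> j \<notin> I")
  case True
  have sgD: "diag c (sg I J * p) = sg I J * diag c p" for c I J and p :: "'k mpoly"
   by (cases "even (card {(i, j). i \<in> I \<and> j \<in> J \<and> j < i})") (simp_all add: sg_def)
  show ?thesis using True c[of I j] j by (simp add: iot_def sgD diag_Var_mult)
 qed (use w in "auto simp: iot_def fsup_def")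
 have "diag (c I) (sum f A) = (\<Sum>i\<in>A. diag (c I) (f i))" for f :: "nat \<Rightarrow> 'k mpoly" and A
  by (rule additive_sum[of "diag (c I)"]) simp_all
 then show "diag (c I) (dd w I) = dd (\<lambda>I. diag (c I) (w I)) I"
  using * by (simp add: dd_def sum_fun_apply)
qed

lemma DG_dd:
 assumes w: "fsup w" shows "DG F (dd w) = dd (DG F w)"
 unfolding DG_def
proof (rule diag_dd[OF w])
 fix I j m assume "finite I" "j \<notin> I" "j \<le> n"
 then have "gam I (sgl j 1 + m) = gam (insert j I) m"
  using gam_wt_single[of n a j] by (simp add: gam_insert) (simp add: gam_def)
 then show "F (gam I (sgl j 1 + m)) = F (gam (insert j I) m)" by (rule arg_cong)
qed

lemma fsup_iot: "fsup w \<Longrightarrow> fsup (iot j w)"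
 by (auto simp: fsup_def iot_def)

lemma fsup_pm: "fsup w \<Longrightarrow> fsup (pm p w)"
 by (auto simp: fsup_def)

lemma fsup_add: "fsup v \<Longrightarrow> fsup w \<Longrightarrow> fsup (v + w)" and fsup_zero: "fsup 0"
 by (auto simp: fsup_def)

lemma iot_pm_Var: "iot l (dd w) = (\<Sum>j\<le>n. pm (Var j) (iot l (iot j w)))"
 by (simp add: dd_def iot_sum)

text \<open>The double sum is symmetric in the variables and antisymmetric in the contractions, so
  it equals its own negative; in characteristic zero it vanishes.\<close>

lemma dd_dd:
 assumes w: "fsup w" shows "dd (dd w) = 0"
proof -
 define S where "S = dd (dd w)"
 have "S = (\<Sum>l\<le>n. \<Sum>j\<le>n. pm (Var l * Var j) (iot l (iot j w)))"
  by (simp add: S_def dd_def[of "dd w"] iot_pm_Var pm_sum pm_simps)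
 also have "\<dots> = (\<Sum>l\<le>n. \<Sum>j\<le>n. - pm (Var j * Var l) (iot j (iot l w)))"
 proof (intro sum.cong refl)
  fix l j
  show "pm (Var l * Var j) (iot l (iot j w)) = - pm (Var j * Var l) (iot j (iot l w))"
   using iot_anticommute[OF w, of l j] by (simp add: pm_simps mult.commute)
 qed
 also have "\<dots> = - (\<Sum>j\<le>n. \<Sum>l\<le>n. pm (Var j * Var l) (iot j (iot l w)))"
  unfolding sum_negf by (subst sum.swap) simp
 also have "\<dots> = - S"
  by (simp add: S_def dd_def[of "dd w"] iot_pm_Var pm_sum pm_simps)
 finally have "S = - S" .
 have "S I = 0" for I
 proof (rule poly_mapping_eqI)
  fix m
  have "cf (S I) m = - cf (S I) m" using arg_cong[OF \<open>S = - S\<close>, of "\<lambda>w. cf (w I) m"] by simp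
  then show "cf (S I) m = cf 0 m" by (simp add: eq_neg_iff_add_eq_0)
 qed
 then show ?thesis by (intro ext) (simp add: S_def)
qed

lemma dd_th_wedge:
 assumes "l \<le> n" "fsup u" shows "dd (th l \<bullet> u) = pm (Var l) u - th l \<bullet> dd u"
proof -
 have "dd (th l \<bullet> u) = (\<Sum>j\<le>n. pm (Var j) (if j = l then u else 0)) - (\<Sum>j\<le>n. pm (Var j) (th l \<bullet> iot j u))"
  unfolding sum_subtractf[symmetric] dd_def iot_th_wedge[OF assms(2)]
  by (intro sum.cong) (auto simp: fun_eq_iff right_diff_distrib)
 also have "(\<Sum>j\<le>n. pm (Var j) (if j = l then u else 0)) = pm (Var l) u"
  using assms(1) by (simp add: if_distrib[of "pm _"] pm_simps cong: if_cong)
 finally show ?thesis by (simp only: dd_def[of u] wedge_sum wedge_pm)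
qed

text \<open>The terms \<open>X\<^sub>j\<^sub>-\<^sub>1\<close> produced when Delta meets the factor
  \<open>X\<^sub>j\<close> of \<open>dd\<close> are those produced when \<open>dd\<close> meets the
  factor \<open>\<theta>\<^sub>j\<^sub>-\<^sub>1\<close> of Delta. This is where variables and
  thetas have to be shifted alike.\<close>

lemma Dl_dd:
 assumes w: "fsup w" shows "Dl (dd w) = dd (Dl w)"
proof -
 define Dp :: "'k form \<Rightarrow> 'k form" where "Dp w = (\<lambda>I. Delta n (w I))" for w
 have Dp_sum: "Dp (sum f A) = (\<Sum>i\<in>A. Dp (f i))" for f and A :: "nat set"
  by (induction A rule: infinite_finite_induct) (auto simp: Dp_def Delta_add fun_eq_iff)
 have DV: "Delta n (Var j :: 'k mpoly) = (if 1 \<le> j \<and> j \<le> n then Var (j - 1) else 0)" for j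
  by (simp add: Delta_def pdiff_Var if_distrib[of "(*) _"] sum.delta' cong: if_cong)
 have Dp_pm: "Dp (pm (Var j) u) = pm (if 1 \<le> j \<and> j \<le> n then Var (j - 1) else 0) u + pm (Var j) (Dp u)" for j u
  by (rule ext) (simp add: Dp_def Delta_mult DV)
 have Dp_iot: "Dp (iot j u) = iot j (Dp u)" for j u
 proof
  fix I
  show "Dp (iot j u) I = iot j (Dp u) I"
   by (cases "even (card {(i, k). i \<in> {j} \<and> k \<in> I \<and> k < i})")
    (simp_all add: Dp_def iot_def sg_def Delta_minus)
 qed
 have Dp_dd: "Dp (dd w) = (\<Sum>j=1..n. pm (Var (j - 1)) (iot j w)) + dd (Dp w)"
 proof -
  have "Dp (dd w) = (\<Sum>j\<le>n. pm (if 1 \<le> j \<and> j \<le> n then Var (j - 1) else 0) (iot j w)) + dd (Dp w)"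
   by (simp add: dd_def Dp_sum Dp_pm Dp_iot sum.distrib)
  also have "(\<Sum>j\<le>n. pm (if 1 \<le> j \<and> j \<le> n then Var (j - 1) else 0) (iot j w)) = (\<Sum>j=1..n. pm (Var (j - 1)) (iot j w))"
   by (rule sum.mono_neutral_cong_right) (auto simp: pm_simps)
  finally show ?thesis .
 qed
 have iot_dd: "iot j (dd w) = - dd (iot j w)" for j
  unfolding iot_pm_Var unfolding dd_def sum_negf[symmetric]
  by (intro sum.cong) (auto simp: iot_anticommute[OF w, of j] pm_simps)
 have "Dl (dd w) = Dp (dd w) + (\<Sum>j=1..n. th (j - 1) \<bullet> iot j (dd w))" by (simp add: Dl_def Dp_def)
 also have "\<dots> = dd (Dp w) + (\<Sum>j=1..n. pm (Var (j - 1)) (iot j w) - th (j - 1) \<bullet> dd (iot j w))"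
  by (simp add: Dp_dd iot_dd wedge_minus sum_subtractf sum_negf)
 also have "(\<Sum>j=1..n. pm (Var (j - 1)) (iot j w) - th (j - 1) \<bullet> dd (iot j w)) = (\<Sum>j=1..n. dd (th (j - 1) \<bullet> iot j w))"
  by (intro sum.cong) (auto simp: dd_th_wedge fsup_iot[OF w])
 finally show ?thesis by (simp only: Dl_def Dp_def dd_sum dd_simps(2))
qed

definition eig :: "'k \<Rightarrow> 'k form \<Rightarrow> bool" where "eig g w \<longleftrightarrow> Gm w = pm (Const g) w"

lemma eig_DG:
 assumes "eig g w" shows "DG F w = pm (Const (F g)) w"
proof (rule ext, rule poly_mapping_eqI)
 fix I m
 have "cf (Gm w I) m = cf (pm (Const g) w I) m" using assms by (simp add: eig_def)
 then show "cf (DG F w I) m = cf (pm (Const (F g)) w I) m" by (auto simp: DG_def)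
qed

lemma eig_wedge: "eig g v \<Longrightarrow> eig h w \<Longrightarrow> eig (g + h) (v \<bullet> w)"
 unfolding eig_def Gm_wedge by (simp only: wedge_pm Const_simps(3)[symmetric] pm_simps(2))

lemma eig_Dl: "fsup w \<Longrightarrow> eig g w \<Longrightarrow> eig (g - 1) (Dl w)"
 unfolding eig_def by (rule ext) (simp only: Gm_Dl Dl_simps pm_apply minus_apply Const_simps(6)[symmetric] left_diff_distrib
  Const_simps(2) mult_1_left)

lemma eig_bas: "eig (gam I m) (bas I m c)"
 unfolding eig_def by (rule ext, rule poly_mapping_eqI) (auto simp: DG_def bas_def lookup_single when_def)

end

section \<open>Degrees, supports and the unipotence principle\<close>

lemma mdegree_alt: "\<lbrakk>mkeys m \<subseteq> A; finite A\<rbrakk> \<Longrightarrow> mdegree m = (\<Sum>i\<in>A. cf m i)"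
 unfolding mdegree_def by (rule sum.mono_neutral_left) (auto simp: in_keys_iff)

lemma keys_add_nat: "mkeys (m + m') = mkeys m \<union> mkeys m'"
 for m m' :: "nat \<Rightarrow>\<^sub>0 nat"
 by (auto simp: in_keys_iff lookup_add)

lemma mdegree_add [simp]: "mdegree (m + m') = mdegree m + mdegree m'"
proof -
 let ?A = "mkeys m \<union> mkeys m'"
 have "mdegree (m + m') = (\<Sum>i\<in>?A. cf (m + m') i)" by (rule mdegree_alt) (auto simp: keys_add_nat)
 moreover have "mdegree m = (\<Sum>i\<in>?A. cf m i)" by (rule mdegree_alt) auto
 moreover have "mdegree m' = (\<Sum>i\<in>?A. cf m' i)" by (rule mdegree_alt) auto
 ultimately show ?thesis by (simp add: lookup_add sum.distrib)
qed

lemma mdegree_simps [simp]: "mdegree 0 = 0" "mdegree (sgl i 1) = 1"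
 by (simp_all add: mdegree_def)

lemma mdegree_eq_0 [simp]: "mdegree m = 0 \<longleftrightarrow> m = 0"
 by (auto simp: mdegree_def in_keys_iff intro!: poly_mapping_eqI)

lemma cf_sg_mult: "cf (sg I J * p) m \<noteq> 0 \<longleftrightarrow> cf p m \<noteq> 0"
 by (cases "even (card {(i, j). i \<in> I \<and> j \<in> J \<and> j < i})") (simp_all add: sg_def)

lemma cf_mult_nonzero: "cf (p * q) m \<noteq> 0 \<Longrightarrow> \<exists>m1 m2. cf p m1 \<noteq> 0 \<and> cf q m2 \<noteq> 0 \<and> m = m1 + m2"
 using keys_mult[of p q] unfolding subset_iff mem_Collect_eq in_keys_iff by blast

lemma cf_wedge_nonzero:
 assumes "cf ((v \<bullet> w) K) m \<noteq> 0"
 shows "finite K \<and> (\<exists>I m1 m2. I \<subseteq> K \<and> cf (v I) m1 \<noteq> 0 \<and> cf (w (K - I)) m2 \<noteq> 0 \<and> m = m1 + m2)"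
proof
 show K: "finite K" using assms by (metis wedge_infinite lookup_zero)
 obtain I where I: "I \<in> Pow K" "cf (sg I (K - I) * v I * w (K - I)) m \<noteq> 0"
  using assms unfolding wedge_def lookup_sum by (rule sum.not_neutral_contains_not_neutral)
 then have "cf (v I * w (K - I)) m \<noteq> 0" by (simp add: mult.assoc cf_sg_mult)
 from cf_mult_nonzero[OF this] I(1)
 show "\<exists>I m1 m2. I \<subseteq> K \<and> cf (v I) m1 \<noteq> 0 \<and> cf (w (K - I)) m2 \<noteq> 0 \<and> m = m1 + m2" by blast
qed

text \<open>The source of all bijections below. The filtration F exhausts V and starts at 0, and f
  is the identity up to a lower level. If f x = 0, then f x - x = -x lies one level below x, and so
  on down to 0. To reach y, correct y by a preimage of the error y - f y, found one level
  below.\<close>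

lemma unipotent_bij:
 fixes F :: "nat \<Rightarrow> 'a::ab_group_add set"
 assumes V: "\<And>x. x \<in> V \<Longrightarrow> \<exists>s. x \<in> F s" and FV: "\<And>s. F s \<subseteq> V" and F0: "F 0 \<subseteq> {0}"
  and neg: "\<And>s x. x \<in> F s \<Longrightarrow> - x \<in> F s"
  and V_add: "\<And>x y. \<lbrakk>x \<in> V; y \<in> V\<rbrakk> \<Longrightarrow> x + y \<in> V"
  and f_add: "\<And>x y. \<lbrakk>x \<in> V; y \<in> V\<rbrakk> \<Longrightarrow> f (x + y) = f x + f y"
  and f_low: "\<And>s x. x \<in> F (Suc s) \<Longrightarrow> f x - x \<in> F s"
 shows "bij_betw f V V"
proof -
 have f_mem: "f x \<in> V" if xV: "x \<in> V" for x
 proof -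
  obtain s where s: "x \<in> F s" using V[OF xV] by blast
  show ?thesis
  proof (cases s)
   case 0
   then have "x = 0" using s F0 by auto
   then show ?thesis using f_add[OF xV xV] xV by simp
  next
   case (Suc t)
   then have "f x - x \<in> V" using f_low s FV by blast
   then show ?thesis using V_add[OF _ xV] by fastforce
  qed
 qed
 have V_neg: "- x \<in> V" if "x \<in> V" for x using V[OF that] neg FV by blast
 have inj0: "x = 0" if "x \<in> F s" "f x = 0" for s x
  using that
 proof (induction s arbitrary: x)
  case (Suc s)
  have "- x \<in> F s" using f_low[OF Suc.prems(1)] Suc.prems(2) by simp
  then have "x \<in> F s" using neg by fastforce
  then show ?case using Suc by blast
 qed (use F0 in auto)
 have "inj_on f V"
 proof (rule inj_onI)
  fix x y assume xy: "x \<in> V" "y \<in> V" "f x = f y"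
  have d: "x + - y \<in> V" using V_add[OF xy(1) V_neg[OF xy(2)]] .
  have "f x = f ((x + - y) + y)" by simp
  also have "\<dots> = f (x + - y) + f y" by (rule f_add[OF d xy(2)])
  finally have "f (x + - y) = 0" using xy(3) by simp
  then have "x + - y = 0" using V[OF d] inj0 by blast
  then show "x = y" by simp
 qed
 moreover have "\<exists>x\<in>V. f x = y" if "y \<in> F s" for s y
  using that
 proof (induction s arbitrary: y)
  case 0
  then have y: "y = 0" "0 \<in> V" using F0 FV by auto
  have "f 0 = f 0 + f 0" using f_add[OF y(2) y(2)] by simp
  then show ?case using y by (intro bexI[of _ 0]) auto
 next
  case (Suc s)
  have yV: "y \<in> V" using Suc.prems FV by blast
  have "- (f y - y) \<in> F s" by (rule neg[OF f_low[OF Suc.prems]])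
  then obtain x where x: "x \<in> V" "f x = - (f y - y)" using Suc.IH by blast
  have "f (x + y) = y" using f_add[OF x(1) yV] x(2) by simp
  then show ?case using V_add[OF x(1) yV] by blast
 qed
 then have "V \<subseteq> f ` V" using V by blast
 ultimately show ?thesis using f_mem by (auto simp: bij_betw_def)
qed

context forms
begin

abbreviation "upn I m Q \<equiv> I \<subseteq> {..n} \<and> mkeys m \<subseteq> {..n} \<and> Q"

text \<open>Forms in the variables up to n whose terms satisfy P in their exterior and polynomial
  degrees. The exterior powers, the graded pieces and conditions such as positive polynomial degree
  are all instances, so that closure under each operation is proved once.\<close>

definition fmP :: "(nat \<Rightarrow> nat \<Rightarrow> bool) \<Rightarrow> 'k form set" where
 "fmP P = {w. \<forall>I m. cf (w I) m \<noteq> 0 \<longrightarrow> upn I m (P (card I) (mdegree m))}"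

abbreviation "Om \<equiv> fmP (\<lambda>_ _. True)"

lemma fmPI: "(\<And>I m. cf (w I) m \<noteq> 0 \<Longrightarrow> upn I m (P (card I) (mdegree m))) \<Longrightarrow> w \<in> fmP P"
 by (simp add: fmP_def)

lemma fmPD: "w \<in> fmP P \<Longrightarrow> cf (w I) m \<noteq> 0 \<Longrightarrow> upn I m (P (card I) (mdegree m))"
 unfolding fmP_def by blast

lemma fmP_mono: "w \<in> fmP P \<Longrightarrow> (\<And>c d. P c d \<Longrightarrow> Q c d) \<Longrightarrow> w \<in> fmP Q"
 unfolding fmP_def by blast

lemma fmP_Om: "w \<in> fmP P \<Longrightarrow> w \<in> Om"
 by (erule fmP_mono) simp

lemma fmP_zero [simp]: "0 \<in> fmP P"
 by (simp add: fmP_def)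

lemma fmP_add: "\<lbrakk>v \<in> fmP P; w \<in> fmP P\<rbrakk> \<Longrightarrow> v + w \<in> fmP P"
proof (rule fmPI)
 fix I m assume vw: "v \<in> fmP P" "w \<in> fmP P" "cf ((v + w) I) m \<noteq> 0"
 then have "cf (v I) m \<noteq> 0 \<or> cf (w I) m \<noteq> 0" by (auto simp: lookup_add)
 then show "upn I m (P (card I) (mdegree m))"
  using fmPD[OF vw(1), of I m] fmPD[OF vw(2), of I m] by blast
qed

lemma fmP_uminus: "w \<in> fmP P \<Longrightarrow> - w \<in> fmP P"
 by (simp add: fmP_def)

lemma fmP_diff: "\<lbrakk>v \<in> fmP P; w \<in> fmP P\<rbrakk> \<Longrightarrow> v - w \<in> fmP P"
 using fmP_add[OF _ fmP_uminus] by simp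

lemma fmP_sc: "w \<in> fmP P \<Longrightarrow> pm (Const c) w \<in> fmP P"
 by (auto simp: fmP_def)

lemma fmP_sum: "(\<And>i. i \<in> A \<Longrightarrow> f i \<in> fmP P) \<Longrightarrow> sum f A \<in> fmP P"
 by (induction A rule: infinite_finite_induct) (auto intro: fmP_add)

lemma fmP_DG: "w \<in> fmP P \<Longrightarrow> DG F w \<in> fmP P"
 by (auto simp: fmP_def DG_def)

lemma fmP_outside:
 assumes "w \<in> fmP P" "\<not> I \<subseteq> {..n}" shows "w I = 0"
proof (rule poly_mapping_eqI)
 fix m show "cf (w I) m = cf 0 m" using assms fmPD[OF assms(1), of I m] by auto
qed

lemma fmP_fsup: "w \<in> fmP P \<Longrightarrow> fsup w"
 unfolding fsup_def using fmP_outside[of w P] finite_subset[of _ "{..n}"] by auto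

lemma fmP_finite: "w \<in> fmP P \<Longrightarrow> finite {I. w I \<noteq> 0}"
proof (rule finite_subset)
 assume w: "w \<in> fmP P"
 show "{I. w I \<noteq> 0} \<subseteq> Pow {..n}" using fmP_outside[OF w] by blast
qed simp

lemma fmP_bas: "\<lbrakk>w \<in> fmP P; cf (w I) m \<noteq> 0\<rbrakk> \<Longrightarrow> bas I m c \<in> fmP P"
 by (auto simp: fmP_def bas_def lookup_single when_def split: if_splits)

lemma fmP_induct [consumes 1, case_names zero basis add]:
 assumes w: "w \<in> fmP P" and "Q 0" and bas: "\<And>I m c. bas I m c \<in> fmP P \<Longrightarrow> Q (bas I m c)"
  and add: "\<And>u v. \<lbrakk>u \<in> fmP P; v \<in> fmP P; Q u; Q v\<rbrakk> \<Longrightarrow> Q (u + v)"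
 shows "Q w"
proof -
 have "w \<in> fmP P \<and> Q w"
  using fmP_finite[OF w]
 proof (induction w rule: form_induct[where P = "\<lambda>w. w \<in> fmP P \<and> Q w"])
  case (basis I m)
  then show ?case using fmP_bas[OF w] bas by blast
 qed (use assms(2) add fmP_add in auto)
 then show ?thesis ..
qed

text \<open>A term of \<open>Dl w\<close> arises by lowering the index of one variable, or of one
  theta whose new index is free. The estimates of degree and of weight both start from these two
  moves.\<close>

lemma cf_Dl_nonzero:
 assumes "cf (Dl w I) m \<noteq> 0"
 shows "(\<exists>m' j. cf (w I) m' \<noteq> 0 \<and> 1 \<le> j \<and> j \<le> n \<and> m' + sgl (j - 1) 1 = m + sgl j 1) \<or>
  (\<exists>j L. 1 \<le> j \<and> j \<le> n \<and> finite L \<and> j \<notin> L \<and> j - 1 \<notin> L \<and> I = insert (j - 1) L \<and> cf (w (insert j L)) m \<noteq> 0)"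
proof (cases "cf (Delta n (w I)) m = 0")
 case False
 then show ?thesis using cf_Delta_nonzero[OF False] by blast
next
 case True
 then have "(\<Sum>j=1..n. cf ((th (j - 1) \<bullet> iot j w) I) m) \<noteq> 0"
  using assms by (simp add: Dl_def lookup_add sum_fun_apply lookup_sum)
 then obtain j where j: "j \<in> {1..n}" "cf ((th (j - 1) \<bullet> iot j w) I) m \<noteq> 0"
  by (rule sum.not_neutral_contains_not_neutral)
 then have "finite I" "j - 1 \<in> I" "j \<notin> I - {j - 1}" "cf (w (insert j (I - {j - 1}))) m \<noteq> 0"
  by (auto simp: th_wedge iot_def cf_sg_mult split: if_splits)
 then show ?thesis using j(1) by (intro disjI2 exI[of _ j] exI[of _ "I - {j - 1}"]) auto
qed

lemma fmP_Dl:
 assumes w: "w \<in> fmP P" shows "Dl w \<in> fmP P"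
proof (rule fmPI)
 fix I m assume "cf (Dl w I) m \<noteq> 0"
 from cf_Dl_nonzero[OF this]
 show "upn I m (P (card I) (mdegree m))"
 proof (elim disjE exE conjE)
  fix m' j assume *: "cf (w I) m' \<noteq> 0" "1 \<le> j" "j \<le> n" "m' + sgl (j - 1) 1 = m + sgl j 1"
  note f = fmPD[OF w *(1)]
  have "mkeys m \<subseteq> mkeys (m + sgl j 1)" by (auto simp: keys_add_nat)
  also have "\<dots> \<subseteq> {..n}" unfolding *(4)[symmetric] keys_add_nat using f *(3) by auto
  moreover have "mdegree m = mdegree m'" using arg_cong[OF *(4), of mdegree] by simp
  ultimately show ?thesis using f by auto
 next
  fix j L assume *: "1 \<le> j" "j \<le> n" "finite L" "j \<notin> L" "j - 1 \<notin> L" "I = insert (j - 1) L"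
   "cf (w (insert j L)) m \<noteq> 0"
  show ?thesis using fmPD[OF w *(7)] * by auto
 qed
qed

lemma fmP_Dl_pow: "w \<in> fmP P \<Longrightarrow> (Dl ^^ k) w \<in> fmP P"
 by (induction k) (auto intro: fmP_Dl)

lemma fmP_wedge:
 assumes v: "v \<in> fmP P" and w: "w \<in> fmP Q"
  and S: "\<And>c d c' d'. P c d \<Longrightarrow> Q c' d' \<Longrightarrow> S (c + c') (d + d')"
 shows "v \<bullet> w \<in> fmP S"
proof (rule fmPI)
 fix K m assume "cf ((v \<bullet> w) K) m \<noteq> 0"
 from cf_wedge_nonzero[OF this] obtain I m1 m2 where
  *: "finite K" "I \<subseteq> K" "cf (v I) m1 \<noteq> 0" "cf (w (K - I)) m2 \<noteq> 0" "m = m1 + m2" by blast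
 note f = fmPD[OF v *(3)] fmPD[OF w *(4)]
 have "card K = card I + card (K - I)" using *(1,2) by (metis card_Diff_subset card_mono finite_subset le_add_diff_inverse)
 then show "K \<subseteq> {..n} \<and> mkeys m \<subseteq> {..n} \<and> S (card K) (mdegree m)"
  using f *(2) S by (auto simp: *(5) keys_add_nat)
qed

lemma fmP_dd:
 assumes w: "w \<in> fmP P" and S: "\<And>c d. P (Suc c) d \<Longrightarrow> S c (Suc d)"
 shows "dd w \<in> fmP S"
proof (rule fmPI)
 fix I m assume "cf (dd w I) m \<noteq> 0"
 then have "(\<Sum>j\<le>n. cf (Var j * iot j w I) m) \<noteq> 0" by (simp add: dd_def sum_fun_apply lookup_sum)
 then obtain j where j: "j \<in> {..n}" "cf (Var j * iot j w I) m \<noteq> 0" by (rule sum.not_neutral_contains_not_neutral)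
 then have m: "cf m j \<noteq> 0" and c: "cf (w (insert j I)) (m - sgl j 1) \<noteq> 0" and jI: "j \<notin> I"
  by (auto simp: cf_Var_mult iot_def cf_sg_mult split: if_splits)
 note f = fmPD[OF w c]
 have "finite I" using f finite_subset[of "insert j I" "{..n}"] by simp
 moreover have "m = (m - sgl j 1) + sgl j 1" using minus_single_add(2)[OF m] by (simp add: add.commute)
 then have "mkeys m = insert j (mkeys (m - sgl j 1))" "mdegree m = Suc (mdegree (m - sgl j 1))"
  by (metis keys_add_nat keys_single Un_insert_right sup_bot_right one_neq_zero, metis mdegree_add mdegree_simps(2) Suc_eq_plus1)
 ultimately show "upn I m (S (card I) (mdegree m))"
  using f j(1) jI S by auto
qed

section \<open>The weight filtration\<close>

definition wgt :: "nat set \<Rightarrow> (nat \<Rightarrow>\<^sub>0 nat) \<Rightarrow> nat" where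
 "wgt I m = (\<Sum>i\<in>I. i) + (\<Sum>i\<le>n. i * cf m i)"

text \<open>The inequality is strict so that level 0 is zero, as \<open>unipotent_bij\<close> asks
  of its filtration. A wedge product of levels s and t is then at level s + t - 1.\<close>

definition lv :: "nat \<Rightarrow> 'k form set" where
 "lv s = {w \<in> Om. \<forall>I m. cf (w I) m \<noteq> 0 \<longrightarrow> wgt I m < s}"

lemma lv_Om: "w \<in> lv s \<Longrightarrow> w \<in> Om" by (simp add: lv_def)

lemma lvD: "w \<in> lv s \<Longrightarrow> cf (w I) m \<noteq> 0 \<Longrightarrow> wgt I m < s" unfolding lv_def by blast

lemma lv_0: "w \<in> lv 0 \<Longrightarrow> w = 0"
 by (rule ext, rule poly_mapping_eqI) (auto simp: lv_def)

lemma lv_mono: "w \<in> lv s \<Longrightarrow> s \<le> t \<Longrightarrow> w \<in> lv t"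
 unfolding lv_def by (blast intro: less_le_trans)

lemma lv_zero [simp]: "0 \<in> lv s" by (simp add: lv_def)

lemma lv_add: "\<lbrakk>v \<in> lv s; w \<in> lv s\<rbrakk> \<Longrightarrow> v + w \<in> lv s"
 unfolding lv_def mem_Collect_eq
proof (intro conjI fmP_add allI impI, blast, blast)
 fix I m assume vw: "v \<in> Om \<and> (\<forall>I m. cf (v I) m \<noteq> 0 \<longrightarrow> wgt I m < s)"
  "w \<in> Om \<and> (\<forall>I m. cf (w I) m \<noteq> 0 \<longrightarrow> wgt I m < s)" "cf ((v + w) I) m \<noteq> 0"
 then have "cf (v I) m \<noteq> 0 \<or> cf (w I) m \<noteq> 0" by (auto simp: lookup_add)
 then show "wgt I m < s" using vw(1,2) by blast
qed

lemma lv_sum: "(\<And>i. i \<in> A \<Longrightarrow> f i \<in> lv s) \<Longrightarrow> sum f A \<in> lv s"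
 by (induction A rule: infinite_finite_induct) (auto intro: lv_add)

lemma lv_uminus: "w \<in> lv s \<Longrightarrow> - w \<in> lv s"
 by (auto simp: lv_def fmP_uminus)

lemma lv_DG: "w \<in> lv s \<Longrightarrow> DG F w \<in> lv s"
 by (auto simp: lv_def fmP_DG) (auto simp: DG_def)

lemma lv_ex: "w \<in> Om \<Longrightarrow> \<exists>s. w \<in> lv s"
proof (induction w rule: fmP_induct)
 case (basis I m c)
 then have "bas I m c \<in> lv (Suc (wgt I m))"
  by (auto simp: lv_def) (auto simp: bas_def lookup_single when_def split: if_splits)
 then show ?case ..
next
 case (add u v)
 then obtain s t where "u \<in> lv s" "v \<in> lv t" by blast
 then have "u + v \<in> lv (max s t)" by (intro lv_add) (auto intro: lv_mono)
 then show ?case ..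
qed (rule exI, rule lv_zero)

text \<open>Either kind of move lowers the weight by exactly 1. The truncated s - 1 does no harm,
  since level 0 contains only 0.\<close>

lemma lv_Dl:
 assumes w: "w \<in> lv s" shows "Dl w \<in> lv (s - 1)"
 unfolding lv_def mem_Collect_eq
proof (intro conjI allI impI fmP_Dl lv_Om[OF w])
 fix I m assume "cf (Dl w I) m \<noteq> 0"
 from cf_Dl_nonzero[OF this] show "wgt I m < s - 1"
 proof (elim disjE exE conjE)
  fix m' j assume *: "cf (w I) m' \<noteq> 0" "1 \<le> j" "j \<le> n" "m' + sgl (j - 1) 1 = m + sgl j 1"
  have "(\<Sum>i\<le>n. i * cf (m' + sgl (j - 1) 1) i) = (\<Sum>i\<le>n. i * cf (m + sgl j 1) i)" by (simp add: *(4))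
  moreover have "(\<Sum>i\<le>n. i * cf (k + sgl j' 1) i) = (\<Sum>i\<le>n. i * cf k i) + j'" if "j' \<le> n" for j' k
  proof -
   have "i * cf (sgl j' 1) i = (if i = j' then j' else 0)" for i by (auto simp: lookup_single when_def)
   then show ?thesis using that by (simp add: lookup_add distrib_left sum.distrib)
  qed
  ultimately have "wgt I m' + (j - 1) = wgt I m + j" using *(3) by (simp add: wgt_def)
  then show ?thesis using lvD[OF w *(1)] *(2) by simp
 next
  fix j L assume *: "1 \<le> j" "j \<le> n" "finite L" "j \<notin> L" "j - 1 \<notin> L" "I = insert (j - 1) L"
   "cf (w (insert j L)) m \<noteq> 0"
  have "wgt (insert j L) m = Suc (wgt I m)" using * by (simp add: wgt_def)
  then show ?thesis using lvD[OF w *(7)] by simp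
 qed
qed

lemma lv_Dl_pow: "w \<in> lv s \<Longrightarrow> (Dl ^^ k) w \<in> lv (s - k)"
proof (induction k)
 case (Suc k)
 then show ?case using lv_Dl[of "(Dl ^^ k) w" "s - k"] by (simp add: One_nat_def)
qed simp

lemma lv_wedge:
 assumes v: "v \<in> lv s" and w: "w \<in> lv t" shows "v \<bullet> w \<in> lv (s + t - 1)"
 unfolding lv_def mem_Collect_eq
proof (intro conjI allI impI)
 show "v \<bullet> w \<in> Om" by (rule fmP_wedge[OF lv_Om[OF v] lv_Om[OF w]])
 fix K m assume "cf ((v \<bullet> w) K) m \<noteq> 0"
 from cf_wedge_nonzero[OF this] obtain I m1 m2 where
  *: "finite K" "I \<subseteq> K" "cf (v I) m1 \<noteq> 0" "cf (w (K - I)) m2 \<noteq> 0" "m = m1 + m2" by blast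
 have "wgt K m = wgt I m1 + wgt (K - I) m2"
  using sum.subset_diff[OF *(2,1), of "\<lambda>i. i"] by (simp add: wgt_def *(5) lookup_add distrib_left sum.distrib)
 then show "wgt K m < s + t - 1" using lvD[OF v *(3)] lvD[OF w *(4)] by simp
qed

section \<open>The star product on forms\<close>

definition nilp :: "nat \<Rightarrow> 'k form \<Rightarrow> bool" where "nilp N v \<longleftrightarrow> (\<forall>k\<ge>N. (Dl ^^ k) v = 0)"

lemma nilp_ex: "v \<in> Om \<Longrightarrow> \<exists>N. nilp N v"
proof -
 assume "v \<in> Om"
 then obtain s where s: "v \<in> lv s" using lv_ex by blast
 have "(Dl ^^ k) v = 0" if "s \<le> k" for k using lv_0 lv_Dl_pow[OF s, of k] that by simp
 then show ?thesis unfolding nilp_def by blast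
qed

lemma nilp_mono: "nilp N v \<Longrightarrow> N \<le> M \<Longrightarrow> nilp M v"
 by (auto simp: nilp_def)

lemma nilp_add: "nilp N u \<Longrightarrow> nilp N v \<Longrightarrow> nilp N (u + v)"
 by (auto simp: nilp_def)

lemma nilp_ex2: "\<lbrakk>u \<in> Om; v \<in> Om\<rbrakk> \<Longrightarrow> \<exists>N. nilp N u \<and> nilp N v"
 using nilp_ex[of u] nilp_ex[of v] nilp_mono[of _ u] nilp_mono[of _ v] max.cobounded1 max.cobounded2 by blast

lemma st_eq:
 assumes "nilp N v" shows "v \<star> w = (\<Sum>k<N. (Dl ^^ k) v \<bullet> gb k w)"
 unfolding st_def
proof (rule Sum_any.expand_superset)
 show "{k. (Dl ^^ k) v \<bullet> gb k w \<noteq> 0} \<subseteq> {..<N}"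
 proof
  fix k assume k: "k \<in> {k. (Dl ^^ k) v \<bullet> gb k w \<noteq> 0}"
  show "k \<in> {..<N}"
  proof (rule ccontr)
   assume "k \<notin> {..<N}"
   then have "(Dl ^^ k) v = 0" using assms by (simp add: nilp_def)
   then show False using k by (simp only: mem_Collect_eq wedge_zero) simp
  qed
 qed
qed simp

lemma st_add_right: "v \<in> Om \<Longrightarrow> v \<star> (w + w') = v \<star> w + v \<star> w'"
proof -
 assume "v \<in> Om"
 then obtain N where "nilp N v" using nilp_ex by blast
 then show ?thesis by (simp only: st_eq DG_simps wedge_add sum.distrib)
qed

lemma st_add_left: "\<lbrakk>u \<in> Om; v \<in> Om\<rbrakk> \<Longrightarrow> (u + v) \<star> w = u \<star> w + v \<star> w"
proof -
 assume "u \<in> Om" "v \<in> Om"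
 then obtain N where N: "nilp N u" "nilp N v" using nilp_ex2 by blast
 then show ?thesis using nilp_add[OF N] by (simp only: st_eq Dl_pow_simps wedge_add sum.distrib)
qed

lemma st_zero [simp]: "0 \<star> w = 0" "v \<star> 0 = 0"
 by (simp_all add: st_def)

lemma st_sc_right: "v \<in> Om \<Longrightarrow> v \<star> pm (Const c) w = pm (Const c) (v \<star> w)"
proof -
 assume "v \<in> Om"
 then obtain N where "nilp N v" using nilp_ex by blast
 then show ?thesis by (simp only: st_eq DG_simps wedge_pm pm_sum)
qed

lemma st_sc_left: "v \<in> Om \<Longrightarrow> pm (Const c) v \<star> w = pm (Const c) (v \<star> w)"
proof -
 assume "v \<in> Om"
 then obtain N where N: "nilp N v" using nilp_ex by blast
 then have "nilp N (pm (Const c) v)" by (simp add: nilp_def pm_simps)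
 with N show ?thesis by (simp only: st_eq Dl_pow_simps wedge_pm pm_sum)
qed

lemma st_sum_left: "(\<And>i. i \<in> A \<Longrightarrow> f i \<in> Om) \<Longrightarrow> sum f A \<star> w = (\<Sum>i\<in>A. f i \<star> w)"
 by (induction A rule: infinite_finite_induct) (auto simp: st_add_left fmP_sum)

lemma st_sum_right: "v \<in> Om \<Longrightarrow> v \<star> sum f A = (\<Sum>i\<in>A. v \<star> f i)"
 by (rule additive_sum[of "(\<star>) v"]) (auto simp: st_add_right)

lemma fmP_st:
 assumes v: "v \<in> fmP P" and w: "w \<in> fmP Q"
  and S: "\<And>c d c' d'. P c d \<Longrightarrow> Q c' d' \<Longrightarrow> S (c + c') (d + d')"
 shows "v \<star> w \<in> fmP S"
proof -
 obtain N where N: "nilp N v" using nilp_ex[OF fmP_Om[OF v]] by blast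
 show ?thesis unfolding st_eq[OF N]
  by (intro fmP_sum fmP_wedge[OF fmP_Dl_pow[OF v] fmP_DG[OF w]] S)
qed

lemma Om_st: "\<lbrakk>v \<in> Om; w \<in> Om\<rbrakk> \<Longrightarrow> v \<star> w \<in> Om"
 by (rule fmP_st) auto

text \<open>The bounds being strict, the wedge product itself is at level p + q - 1. Each term with
  k >= 1 contains Delta and therefore lies at least one level lower.\<close>

lemma st_lower:
 assumes v: "v \<in> lv p" and w: "w \<in> lv q" shows "v \<star> w - v \<bullet> w \<in> lv (p + q - 2)"
proof (cases "p = 0")
 case True
 then show ?thesis using lv_0[of v] v by simp
next
 case False
 have "(Dl ^^ k) v = 0" if "p \<le> k" for k using lv_0 lv_Dl_pow[OF v, of k] that by simp
 then have N: "nilp p v" by (simp add: nilp_def)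
 have "v \<star> w = (Dl ^^ 0) v \<bullet> gb 0 w + (\<Sum>k=1..<p. (Dl ^^ k) v \<bullet> gb k w)"
  unfolding st_eq[OF N] using False by (simp add: lessThan_atLeast0 sum.atLeast_Suc_lessThan One_nat_def)
 moreover have "gb 0 w = w" by (rule ext, rule poly_mapping_eqI) (simp add: DG_def)
 ultimately have "v \<star> w - v \<bullet> w = (\<Sum>k=1..<p. (Dl ^^ k) v \<bullet> gb k w)" by (simp only: funpow_0 add_diff_cancel_left')
 moreover have "(\<Sum>k=1..<p. (Dl ^^ k) v \<bullet> gb k w) \<in> lv (p + q - 2)"
 proof (rule lv_sum)
  fix k assume k: "k \<in> {1..<p}"
  show "(Dl ^^ k) v \<bullet> gb k w \<in> lv (p + q - 2)"
   by (rule lv_mono[OF lv_wedge[OF lv_Dl_pow[OF v] lv_DG[OF w]]]) (use k in auto)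
 qed
 ultimately show ?thesis by (simp only:)
qed

lemma Dl_pow_wedge:
 "(Dl ^^ j) (v \<bullet> w) = (\<Sum>p\<le>j. pm (of_nat (j choose p)) ((Dl ^^ p) v \<bullet> (Dl ^^ (j - p)) w))"
proof (induction j)
 case (Suc j)
 define T where "T p q = (Dl ^^ p) v \<bullet> (Dl ^^ q) w" for p q
 have DT: "Dl (T p q) = T (Suc p) q + T p (Suc q)" for p q by (simp add: T_def Dl_wedge)
 have c: "(of_nat c :: 'k mpoly) = Const (of_nat c)" for c by (simp add: Const_def)
 have "(Dl ^^ Suc j) (v \<bullet> w) = (\<Sum>p\<le>j. pm (of_nat (j choose p)) (T (Suc p) (j - p) + T p (Suc (j - p))))"
  by (simp only: funpow.simps o_apply Suc.IH Dl_sum c T_def[symmetric] Dl_simps(3) DT)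
 also have "\<dots> = (\<Sum>p\<le>j. pm (of_nat (j choose p)) (T (Suc p) (j - p))) + (\<Sum>p\<le>j. pm (of_nat (j choose p)) (T p (Suc j - p)))"
  by (simp only: pm_simps(1) sum.distrib) (auto intro!: arg_cong2[where f = "(+)"] sum.cong simp: Suc_diff_le)
 also have "(\<Sum>p\<le>j. pm (of_nat (j choose p)) (T p (Suc j - p))) =
   T 0 (Suc j) + (\<Sum>p\<le>j. pm (of_nat (j choose Suc p)) (T (Suc p) (j - p)))"
 proof -
  have "(\<Sum>p\<le>j. pm (of_nat (j choose p)) (T p (Suc j - p))) = (\<Sum>p\<le>Suc j. pm (of_nat (j choose p)) (T p (Suc j - p)))"
   by (simp add: pm_simps binomial_eq_0)
  also have "\<dots> = T 0 (Suc j) + (\<Sum>p\<le>j. pm (of_nat (j choose Suc p)) (T (Suc p) (j - p)))"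
   by (subst sum.atMost_Suc_shift) (simp add: pm_simps)
  finally show ?thesis .
 qed
 also have "(\<Sum>p\<le>j. pm (of_nat (j choose p)) (T (Suc p) (j - p))) +
   (T 0 (Suc j) + (\<Sum>p\<le>j. pm (of_nat (j choose Suc p)) (T (Suc p) (j - p)))) =
   T 0 (Suc j) + (\<Sum>p\<le>j. pm (of_nat (Suc j choose Suc p)) (T (Suc p) (j - p)))"
  by (simp only: binomial_Suc_Suc of_nat_add pm_simps(2) sum.distrib add_ac)
 also have "\<dots> = (\<Sum>p\<le>Suc j. pm (of_nat (Suc j choose p)) (T p (Suc j - p)))"
  by (subst sum.atMost_Suc_shift) (simp add: pm_simps)
 finally show ?case by (simp only: T_def)
qed (simp add: pm_simps)

text \<open>Passes between summation along the diagonals i + j = k and summation over a rectangle,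
  for f vanishing off their common part. Associativity uses it in both directions.\<close>

lemma sum_triangle:
 fixes f :: "nat \<Rightarrow> nat \<Rightarrow> 'b::comm_monoid_add"
 assumes "\<And>i j. i \<ge> A \<or> j \<ge> B \<or> i + j \<ge> N \<Longrightarrow> f i j = 0"
 shows "(\<Sum>k<N. \<Sum>i\<le>k. f i (k - i)) = (\<Sum>i<A. \<Sum>j<B. f i j)"
proof -
 have nz: "i < A \<and> j < B \<and> i + j < N" if "f i j \<noteq> 0" for i j
  using assms[of i j] that by (meson not_le)
 have "(\<Sum>k<N. \<Sum>i\<le>k. f i (k - i)) = (\<Sum>(i, j)\<in>{(i, j). i + j < N}. f i j)"
  by (rule sum.triangle_reindex[symmetric])
 also have "\<dots> = (\<Sum>(i, j)\<in>{..<A} \<times> {..<B}. f i j)"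
 proof (rule sum.mono_neutral_cong)
  show "finite {(i, j). i + j < N}" by (rule finite_subset[of _ "{..<N} \<times> {..<N}"]) auto
 qed (use nz in auto)
 finally show ?thesis by (simp add: sum.cartesian_product)
qed

lemma Dl_pow_eig: "fsup w \<Longrightarrow> w \<in> Om \<Longrightarrow> eig g w \<Longrightarrow> eig (g - of_nat k) ((Dl ^^ k) w)"
proof (induction k)
 case (Suc k)
 have "eig (g - of_nat k - 1) (Dl ((Dl ^^ k) w))"
  using Suc by (intro eig_Dl fmP_fsup[of _ "\<lambda>_ _. True"] fmP_Dl_pow)
 then show ?case by (simp add: algebra_simps)
qed simp

text \<open>\<Gamma> acts on y and z only, so these are taken to be eigenvectors. Both sides are
  combinations of the products of \<open>T s l\<close> with z. On the left the coefficient is a sum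
  of products of binomials, which trinomial revision and the Vandermonde identity turn into
  \<open>c s l\<close>. On the right \<open>c s l\<close> appears at once, because the product of
  the l-th derivative of y with z has eigenvalue \<beta> - l + \<gamma>.\<close>

lemma st_assoc_eig:
 assumes x: "x \<in> Om" and y: "y \<in> Om" and ey: "eig \<beta> y" and ez: "eig \<gamma> z"
 shows "(x \<star> y) \<star> z = x \<star> (y \<star> z)"
proof -
 obtain N where Nx: "nilp N x" and Ny: "nilp N y" using nilp_ex2[OF x y] by blast
 define T where "T s l = (Dl ^^ s) x \<bullet> (Dl ^^ l) y" for s l
 have T0: "T s l = 0" if "s \<ge> N \<or> l \<ge> N" for s l
 proof -
  have "(Dl ^^ s) x = 0 \<or> (Dl ^^ l) y = 0" using that Nx Ny by (auto simp: nilp_def)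
  then show ?thesis unfolding T_def by (elim disjE) (simp_all only: wedge_zero)
 qed
 have xy: "x \<star> y = (\<Sum>i<N. pm (Const (\<beta> gchoose i)) (T i 0))"
  unfolding st_eq[OF Nx] by (simp only: eig_DG[OF ey] wedge_pm T_def funpow_0)
 have DT: "(Dl ^^ j) (T i 0) = (\<Sum>p\<le>j. pm (Const (of_nat (j choose p))) (T (p + i) (j - p)))" for i j
  unfolding T_def Dl_pow_wedge by (simp add: funpow_add Const_def)
 have Dxy: "(Dl ^^ j) (x \<star> y) = (\<Sum>i<N. \<Sum>p\<le>j. pm (Const ((\<beta> gchoose i) * of_nat (j choose p))) (T (p + i) (j - p)))" for j
  unfolding xy Dl_pow_sum Dl_pow_simps DT pm_sum pm_simps(3) Const_simps ..
 have pm0: "pm c (0 :: 'k form) = 0" for c by (rule pm_simps(4))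
 \<comment> \<open>When at least 2N derivatives are distributed over x and y, one of the two
   receives at least N of them.\<close>
 have nxy: "nilp (2 * N) (x \<star> y)"
  unfolding nilp_def Dxy
 proof (intro allI impI sum.neutral ballI)
  fix j i p assume "2 * N \<le> j" "p \<in> {..j}"
  then have "T (p + i) (j - p) = 0" by (intro T0) auto
  then show "pm (Const ((\<beta> gchoose i) * of_nat (j choose p))) (T (p + i) (j - p)) = 0" by (simp only: pm0)
 qed
 define c where "c s l = (\<gamma> gchoose l) * (\<beta> - of_nat l + \<gamma> gchoose s)" for s l
 have coeff: "(\<Sum>p\<le>s. (\<gamma> gchoose (p + l)) * ((\<beta> gchoose (s - p)) * of_nat ((p + l) choose p))) = c s l" for s l
 proof -
  have "(\<Sum>p\<le>s. (\<gamma> gchoose (p + l)) * ((\<beta> gchoose (s - p)) * of_nat ((p + l) choose p))) =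
   (\<Sum>p\<le>s. (\<gamma> gchoose l) * ((\<gamma> - of_nat l gchoose p) * (\<beta> gchoose (s - p))))"
  proof (intro sum.cong refl)
   fix p
   have "(\<gamma> gchoose (p + l)) * of_nat ((p + l) choose p) = (\<gamma> gchoose l) * (\<gamma> - of_nat l gchoose p)"
    using gbinomial_trinomial_revision[of l "p + l" \<gamma>] binomial_symmetric[of p "p + l"]
    by (simp add: binomial_gbinomial)
   then show "(\<gamma> gchoose (p + l)) * ((\<beta> gchoose (s - p)) * of_nat ((p + l) choose p)) =
    (\<gamma> gchoose l) * ((\<gamma> - of_nat l gchoose p) * (\<beta> gchoose (s - p)))"
    by (simp add: mult_ac)
  qed
  also have "\<dots> = (\<gamma> gchoose l) * (\<gamma> - of_nat l + \<beta> gchoose s)"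
   by (simp add: sum_distrib_left[symmetric] gbinomial_Vandermonde atMost_atLeast0)
  finally show ?thesis by (simp add: c_def algebra_simps)
 qed
 have "(x \<star> y) \<star> z = (\<Sum>j<2 * N. (Dl ^^ j) (x \<star> y) \<bullet> pm (Const (\<gamma> gchoose j)) z)"
  unfolding st_eq[OF nxy] eig_DG[OF ez] ..
 also have "\<dots> = (\<Sum>j<2 * N. \<Sum>p\<le>j. \<Sum>i<N. pm (Const ((\<gamma> gchoose (p + (j - p))) * ((\<beta> gchoose i) * of_nat ((p + (j - p)) choose p)))) (T (p + i) (j - p)) \<bullet> z)"
  unfolding Dxy
  by (intro sum.cong refl, subst sum.swap) (simp add: wedge_sum wedge_pm pm_sum pm_simps mult_ac)
 also have "\<dots> = (\<Sum>p<N. \<Sum>l<N. \<Sum>i<N. pm (Const ((\<gamma> gchoose (p + l)) * ((\<beta> gchoose i) * of_nat ((p + l) choose p)))) (T (p + i) l) \<bullet> z)"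
 proof (rule sum_triangle)
  fix p l assume "p \<ge> N \<or> l \<ge> N \<or> p + l \<ge> 2 * N"
  then have "T (p + i) l = 0" for i by (intro T0) auto
  then show "(\<Sum>i<N. pm (Const ((\<gamma> gchoose (p + l)) * ((\<beta> gchoose i) * of_nat ((p + l) choose p)))) (T (p + i) l) \<bullet> z) = 0"
   by (simp only: pm0 wedge_zero sum.neutral_const)
 qed
 also have "\<dots> = (\<Sum>l<N. \<Sum>p<N. \<Sum>i<N. pm (Const ((\<gamma> gchoose (p + l)) * ((\<beta> gchoose i) * of_nat ((p + l) choose p)))) (T (p + i) l) \<bullet> z)"
  by (rule sum.swap)
 \<comment> \<open>Collect the terms with p + i = s, on which T depends through s and l
   only.\<close>
 also have "\<dots> = (\<Sum>l<N. \<Sum>s<N. \<Sum>p\<le>s. pm (Const ((\<gamma> gchoose (p + l)) * ((\<beta> gchoose (s - p)) * of_nat ((p + l) choose p)))) (T (p + (s - p)) l) \<bullet> z)"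
 proof (rule sum.cong[OF refl], rule sum_triangle[symmetric])
  fix l p i assume "p \<ge> N \<or> i \<ge> N \<or> p + i \<ge> N"
  then have "T (p + i) l = 0" by (intro T0) auto
  then show "pm (Const ((\<gamma> gchoose (p + l)) * ((\<beta> gchoose i) * of_nat ((p + l) choose p)))) (T (p + i) l) \<bullet> z = 0"
   by (simp only: pm0 wedge_zero)
 qed
 also have "\<dots> = (\<Sum>l<N. \<Sum>s<N. pm (Const (c s l)) (T s l \<bullet> z))"
 proof (intro sum.cong refl)
  fix l s
  have C: "Const (sum f A) = (\<Sum>i\<in>A. Const (f i))" for f :: "nat \<Rightarrow> 'k" and A
   by (induction A rule: infinite_finite_induct) (simp_all flip: Const_simps(3))
  have P: "pm (sum f A) w = (\<Sum>i\<in>A. pm (f i) w)" for f :: "nat \<Rightarrow> 'k mpoly" and A w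
   by (rule additive_sum[of "\<lambda>p. pm p w"]) (simp_all only: pm_simps)
  show "(\<Sum>p\<le>s. pm (Const ((\<gamma> gchoose (p + l)) * ((\<beta> gchoose (s - p)) * of_nat ((p + l) choose p)))) (T (p + (s - p)) l) \<bullet> z) =
   pm (Const (c s l)) (T s l \<bullet> z)"
   unfolding coeff[symmetric] C P by (intro sum.cong refl) (simp add: wedge_pm)
 qed
 also have "\<dots> = (\<Sum>s<N. \<Sum>l<N. pm (Const (c s l)) (T s l \<bullet> z))" by (rule sum.swap)
 also have "\<dots> = x \<star> (y \<star> z)"
 proof -
  have e: "eig (\<beta> - of_nat l + \<gamma>) ((Dl ^^ l) y \<bullet> z)" for l
   by (rule eig_wedge[OF Dl_pow_eig[OF fmP_fsup[OF y] y ey] ez])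
  have yz: "y \<star> z = (\<Sum>l<N. pm (Const (\<gamma> gchoose l)) ((Dl ^^ l) y \<bullet> z))"
   unfolding st_eq[OF Ny] by (simp only: eig_DG[OF ez] wedge_pm)
  show ?thesis
   unfolding st_eq[OF Nx] yz DG_sum DG_simps(3) eig_DG[OF e] wedge_sum wedge_pm
   by (intro sum.cong refl) (simp add: T_def c_def pm_simps wedge_assoc)
 qed
 finally show ?thesis .
qed

text \<open>Both sides are biadditive in y and z, and forms with a single term are eigenvectors of
  \<Gamma>.\<close>

lemma st_assoc:
 assumes x: "x \<in> Om" and y: "y \<in> Om" and z: "z \<in> Om"
 shows "(x \<star> y) \<star> z = x \<star> (y \<star> z)"
 using z
proof (induction z rule: fmP_induct)
 case (basis J m' d)
 show ?case using y
 proof (induction y rule: fmP_induct)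
  case (basis I m c)
  show ?case by (rule st_assoc_eig[OF x basis eig_bas eig_bas])
 next
  case (add u v)
  then show ?case
   by (simp only: st_add_right[OF x] st_add_left[OF Om_st[OF x add(1)] Om_st[OF x add(2)]] st_add_left)
 qed (simp only: st_zero)
next
 case (add u v)
 then show ?case by (simp only: st_add_right[OF x] st_add_right[OF y] st_add_right[OF Om_st[OF x y]])
qed (simp only: st_zero)

lemma parity_fmP: "w \<in> fmP (\<lambda>c d. c = i) \<Longrightarrow> parity w = pm (Const ((-1) ^ i)) w"
proof (rule ext, rule poly_mapping_eqI)
 fix I m assume w: "w \<in> fmP (\<lambda>c d. c = i)"
 show "cf (parity w I) m = cf (pm (Const ((-1) ^ i)) w I) m"
  using fmPD[OF w, of I m] by (cases "cf (w I) m = 0"; cases "even (card I)") (auto simp: parity_def)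
qed

text \<open>\<open>dd\<close> commutes with Delta and with functions of \<Gamma>, so the Leibniz
  rule for the wedge product applies term by term; on forms of one exterior degree the parity is a
  scalar.\<close>

lemma dd_st:
 assumes v: "v \<in> fmP (\<lambda>c d. c = i)" and w: "w \<in> Om"
 shows "dd (v \<star> w) = dd v \<star> w + pm (Const ((-1) ^ i)) (v \<star> dd w)"
proof -
 have v': "v \<in> Om" by (rule fmP_Om[OF v])
 have ddv: "dd v \<in> Om" by (rule fmP_dd[OF v']) simp
 obtain N where N: "nilp N v" "nilp N (dd v)" using nilp_ex2[OF v' ddv] by blast
 have comm: "(Dl ^^ k) (dd v) = dd ((Dl ^^ k) v)" for k
  by (induction k) (simp_all add: Dl_dd[OF fmP_fsup[OF fmP_Dl_pow[OF v]]])
 show ?thesis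
  unfolding st_eq[OF N(1)] st_eq[OF N(2)] comm dd_sum dd_wedge parity_fmP[OF fmP_Dl_pow[OF v]]
   DG_dd[OF fmP_fsup[OF w]] wedge_pm pm_sum sum.distrib ..
qed

lemma emb_simps [simp]: "emb 0 = (0 :: 'k form)" "emb (p + q) = emb p + (emb q :: 'k form)"
 "emb (- p) = - (emb p :: 'k form)" "emb (Const c * p) = pm (Const c) (emb p :: 'k form)"
 by (auto simp: emb_def fun_eq_iff)

lemma emb_inj: "emb p = emb q \<longleftrightarrow> p = (q :: 'k mpoly)"
 by (metis emb_def)

lemma emb_fmP: "p \<in> PU \<Longrightarrow> (\<And>m. cf p m \<noteq> 0 \<Longrightarrow> P 0 (mdegree m)) \<Longrightarrow> emb p \<in> fmP P"
 by (auto simp: fmP_def emb_def polys_upto_def in_keys_iff split: if_splits)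

lemma emb_Om: "emb p \<in> Om \<longleftrightarrow> p \<in> PU"
 by (auto simp: fmP_def emb_def polys_upto_def in_keys_iff split: if_splits)

lemma fmP_0_emb: "w \<in> fmP (\<lambda>c d. c = 0) \<Longrightarrow> w = emb (w {})"
proof (rule ext, rule poly_mapping_eqI)
 fix I m assume w: "w \<in> fmP (\<lambda>c d. c = 0)"
 show "cf (w I) m = cf (emb (w {}) I) m"
  using fmPD[OF w, of I m] finite_subset[of I "{..n}"] by (cases "cf (w I) m = 0") (auto simp: emb_def)
qed

lemma fsup_emb: "fsup (emb p)" by (auto simp: fsup_def emb_def)

lemma Dl_emb: "Dl (emb p) = emb (Delta n p)"
proof -
 have 1: "iot j (emb p) = 0" for j by (rule ext) (simp add: iot_def emb_def)
 show ?thesis unfolding Dl_def 1 by (rule ext) (simp add: emb_def)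
qed

lemma Dl_pow_emb: "(Dl ^^ k) (emb p) = emb ((Delta n ^^ k) p)"
 by (induction k) (simp_all add: Dl_emb)

lemma gb_emb: "gb k (emb p) = emb (Gam_binom n a k p)"
 by (rule ext) (simp add: DG_def emb_def Gam_binom_diag gam_def)

lemma emb_mult: "emb p \<bullet> emb q = emb (p * q)"
 unfolding emb_wedge[OF fsup_emb] by (rule ext) (simp add: emb_def)

text \<open>Identifies R(n,a) with the forms of exterior degree 0, so that its ring axioms become
  cases of the laws on forms.\<close>

lemma star_emb:
 assumes "f \<in> PU" shows "emb f \<star> emb g = emb (star n a f g)"
proof -
 obtain N where N: "nilp N (emb f)" using nilp_ex assms emb_Om by blast
 have "star n a f g = (\<Sum>k<N. (Delta n ^^ k) f * Gam_binom n a k g)"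
  unfolding star_def
 proof (rule Sum_any.expand_superset)
  show "{k. (Delta n ^^ k) f * Gam_binom n a k g \<noteq> 0} \<subseteq> {..<N}"
  proof
   fix k assume k: "k \<in> {k. (Delta n ^^ k) f * Gam_binom n a k g \<noteq> 0}"
   show "k \<in> {..<N}"
   proof (rule ccontr)
    assume "k \<notin> {..<N}"
    then have "emb ((Delta n ^^ k) f) = emb 0" using N by (simp add: nilp_def Dl_pow_emb)
    then show False using k by (simp only: emb_inj) simp
   qed
  qed
 qed simp
 moreover have "emb (sum h A) = (\<Sum>i\<in>A. emb (h i))" for h :: "nat \<Rightarrow> 'k mpoly" and A
  by (rule additive_sum[of emb]) (simp_all only: emb_simps)
 ultimately show ?thesis unfolding st_eq[OF N] Dl_pow_emb gb_emb emb_mult by simp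
qed

lemma Delta_one: "Delta n (1 :: 'k mpoly) = 0"
 using Delta_mult[of n 1 "1 :: 'k mpoly"] by simp

lemma one_st: "fsup w \<Longrightarrow> emb 1 \<star> w = w"
proof -
 assume w: "fsup w"
 have "(Delta n ^^ Suc k) (1 :: 'k mpoly) = 0" for k
  by (induction k) (simp_all add: Delta_one)
 then have "(Dl ^^ Suc k) (emb 1) = 0" for k
  by (simp only: Dl_pow_emb emb_simps)
 then have "nilp 1 (emb 1)" unfolding nilp_def by (metis One_nat_def Suc_le_D)
 moreover have "gb 0 w = w" by (rule ext, rule poly_mapping_eqI) (simp add: DG_def)
 ultimately show ?thesis using emb_wedge[OF w, of 1] by (simp add: st_eq pm_simps)
qed

text \<open>Constants have \<Gamma>-eigenvalue 0, and 0 choose k is 0 for k > 0.\<close>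

lemma st_one: "w \<in> Om \<Longrightarrow> w \<star> emb 1 = w"
proof -
 assume w: "w \<in> Om"
 then obtain N where "nilp N w" using nilp_ex by blast
 then have N: "nilp (Suc N) w" by (rule nilp_mono) simp
 have eig: "eig 0 (emb 1)"
  unfolding eig_def by (rule ext, rule poly_mapping_eqI) (auto simp: DG_def emb_def gam_def lookup_one when_def)
 have "w \<star> emb 1 = (\<Sum>k<Suc N. if k = 0 then w else 0)"
  unfolding st_eq[OF N] eig_DG[OF eig]
 proof (intro sum.cong refl)
  fix k show "(Dl ^^ k) w \<bullet> pm (Const (0 gchoose k)) (emb 1) = (if k = 0 then w else 0)"
   using wedge_emb[OF fmP_fsup[OF w], of 1] by (cases k) (simp_all add: pm_simps)
 qed
 then show ?thesis by simp
qed

end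

lemma cf_mult_0: "cf (p * q) 0 = cf p 0 * cf q 0" for p q :: "'k::comm_ring_1 mpoly"
proof (induction p rule: mpoly_induct)
 case (single m)
 show ?case
 proof (induction q rule: mpoly_induct)
  case (single m')
  have "m + m' = 0 \<longleftrightarrow> m = 0 \<and> m' = 0" using mdegree_eq_0[of "m + m'"] by simp
  then show ?case by (auto simp: mult_single lookup_single when_def)
 qed (simp_all add: algebra_simps lookup_add)
qed (simp_all add: algebra_simps lookup_add)

lemma diff_add_add: "(x - y) + (z + y) = x + z" for x y z :: "'a::ab_group_add"
 by simp

section \<open>Exactness of the Koszul complex\<close>

context forms
begin

text \<open>The de Rham differential. In characteristic zero it contracts the Koszul complex, because
 \<open>d D + D d\<close> multiplies \<open>X\<^sup>m \<theta>\<^sub>I\<close> by \<open>card I + mdegree m\<close>.\<close>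

definition DR :: "'k form \<Rightarrow> 'k form" where
 "DR w = (\<Sum>j\<le>n. th j \<bullet> (\<lambda>I. pdiff j (w I)))"

lemma DR_zero: "DR 0 = 0"
proof -
 have "(\<lambda>I. pdiff j ((0 :: 'k form) I)) = 0" for j by auto
 then show ?thesis unfolding DR_def by (simp only: wedge_zero sum.neutral_const)
qed

text \<open>Cartan's formula for the Euler field. The mixed terms
  \<open>th j \<bullet> dd (pd j w)\<close> cancel. There remain the Euler operator, which counts
  the polynomial degree, and the sum of \<open>\<theta>\<^sub>j\<close> times contraction with j,
  which counts the exterior degree.\<close>

lemma dd_DR:
 assumes w: "w \<in> Om"
 shows "dd (DR w) + DR (dd w) = (\<lambda>I. diag (\<lambda>m. of_nat (card I + mdegree m)) (w I))"
proof -
 define pd where "pd j w = (\<lambda>I. pdiff j (w I))" for j and w :: "'k form"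
 have fs: "fsup w" by (rule fmP_fsup[OF w])
 have fspd: "fsup (pd j w)" for j using fs by (auto simp: fsup_def pd_def)
 have pd_sum: "pd j (sum f A) = (\<Sum>i\<in>A. pd j (f i))" for j f and A :: "nat set"
  by (rule additive_sum[of "pd j"]) (auto simp: pd_def fun_eq_iff)
 have pd_iot: "pd j (iot l w) = iot l (pd j w)" for j l
 proof
  fix I show "pd j (iot l w) I = iot l (pd j w) I"
   by (cases "even (card {(i, k). i \<in> {l} \<and> k \<in> I \<and> k < i})") (simp_all add: pd_def iot_def sg_def)
 qed
 have pd_pm: "pd j (pm (Var l) u) = (if j = l then u else 0) + pm (Var l) (pd j u)" for j l u
  by (rule ext) (simp add: pd_def pdiff_mult pdiff_Var)
 have pd_dd: "pd j (dd w) = iot j w + dd (pd j w)" if j: "j \<le> n" for j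
 proof -
  have "pd j (dd w) = (\<Sum>l\<le>n. if j = l then iot l w else 0) + (\<Sum>l\<le>n. pm (Var l) (iot l (pd j w)))"
   unfolding dd_def pd_sum pd_pm pd_iot sum.distrib ..
  also have "(\<Sum>l\<le>n. if j = l then iot l w else 0) = iot j w" using j by simp
  finally show ?thesis by (simp only: dd_def)
 qed
 have 1: "dd (DR w) = (\<Sum>j\<le>n. pm (Var j) (pd j w)) - (\<Sum>j\<le>n. th j \<bullet> dd (pd j w))"
  unfolding DR_def dd_sum sum_subtractf[symmetric] pd_def[symmetric]
  by (intro sum.cong refl dd_th_wedge fspd) simp
 have 2: "DR (dd w) = (\<Sum>j\<le>n. th j \<bullet> iot j w) + (\<Sum>j\<le>n. th j \<bullet> dd (pd j w))"
  unfolding DR_def sum.distrib[symmetric] wedge_add[symmetric] pd_def[symmetric]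
  by (intro sum.cong refl) (simp add: pd_dd)
 have "dd (DR w) + DR (dd w) = (\<Sum>j\<le>n. pm (Var j) (pd j w)) + (\<Sum>j\<le>n. th j \<bullet> iot j w)"
  unfolding 1 2 by (rule diff_add_add)
 also have "\<dots> = (\<lambda>I. diag (\<lambda>m. of_nat (card I + mdegree m)) (w I))"
 proof (rule ext, rule poly_mapping_eqI)
  fix I m
  have "(\<Sum>j\<le>n. pm (Var j) (pd j w)) I = (\<Sum>j\<le>n. Const 1 * Var j * pdiff j (w I))"
   by (simp add: sum_fun_apply pd_def)
  also have "\<dots> = diag (\<lambda>m. \<Sum>j\<le>n. 1 * of_nat (cf m j)) (w I)" by (rule Euler_diag)
  finally have A: "cf ((\<Sum>j\<le>n. pm (Var j) (pd j w)) I) m = of_nat (\<Sum>j\<le>n. cf m j) * cf (w I) m" by simp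
  have B: "(\<Sum>j\<le>n. th j \<bullet> iot j w) I = of_nat (card I) * w I" if I: "I \<subseteq> {..n}"
  proof -
   have fin: "finite I" using I finite_subset by blast
   have "(th j \<bullet> iot j w) I = (if j \<in> I then w I else 0)" for j
    using fin by (simp add: th_wedge iot_def mult.assoc[symmetric] sg_sq insert_absorb)
   then have "(\<Sum>j\<le>n. th j \<bullet> iot j w) I = (\<Sum>j\<in>{..n} \<inter> I. w I)"
    by (simp add: sum_fun_apply sum.If_cases Collect_mem_eq)
   also have "{..n} \<inter> I = I" using I by auto
   finally show ?thesis by simp
  qed
  show "cf (((\<Sum>j\<le>n. pm (Var j) (pd j w)) + (\<Sum>j\<le>n. th j \<bullet> iot j w)) I) m =
   cf (diag (\<lambda>m. of_nat (card I + mdegree m)) (w I)) m"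
  proof (cases "w I = 0")
   case True
   have "(th j \<bullet> iot j w) I = 0" for j using True by (simp add: th_wedge iot_def insert_absorb)
   then show ?thesis using A True by (simp add: lookup_add sum_fun_apply)
  next
   case False
   then have I: "I \<subseteq> {..n}" using fmP_outside[OF w] by blast
   show ?thesis
   proof (cases "cf (w I) m = 0")
    case False
    have "mdegree m = (\<Sum>j\<le>n. cf m j)" by (rule mdegree_alt) (use fmPD[OF w False] in auto)
    then show ?thesis using A B[OF I] by (simp add: lookup_add algebra_simps)
   qed (use A B[OF I] in \<open>simp add: lookup_add\<close>)
  qed
 qed
 finally show ?thesis .
qed

lemma fmP_DR:
 assumes w: "w \<in> fmP P" and S: "\<And>c d. P c (Suc d) \<Longrightarrow> S (Suc c) d"
 shows "DR w \<in> fmP S"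
proof (rule fmPI)
 fix I m assume "cf (DR w I) m \<noteq> 0"
 then have "(\<Sum>j\<le>n. cf ((th j \<bullet> (\<lambda>I. pdiff j (w I))) I) m) \<noteq> 0" by (simp add: DR_def sum_fun_apply lookup_sum)
 then obtain j where j: "j \<in> {..n}" "cf ((th j \<bullet> (\<lambda>I. pdiff j (w I))) I) m \<noteq> 0"
  by (rule sum.not_neutral_contains_not_neutral)
 then have I: "finite I" "j \<in> I" and c: "cf (w (I - {j})) (m + sgl j 1) \<noteq> 0"
  by (auto simp: th_wedge cf_sg_mult cf_pdiff split: if_splits)
 note f = fmPD[OF w c]
 have "card I = Suc (card (I - {j}))" using I by (metis card.remove)
 moreover have "P (card (I - {j})) (Suc (mdegree m))" using f unfolding mdegree_add mdegree_simps(2) Suc_eq_plus1 by blast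
 moreover have "I \<subseteq> insert j {..n}" "mkeys m \<subseteq> {..n}" using f by (auto simp: keys_add_nat)
 ultimately show "upn I m (S (card I) (mdegree m))"
  using S j(1) by (simp add: insert_absorb)
qed

text \<open>Divide by the total degree before applying \<open>DR\<close>. The division commutes with
  \<open>dd\<close>, since trading a theta for a variable preserves the total degree. The only term
  of total degree 0 is the constant term, which \<open>c0\<close> excludes.\<close>

lemma Koszul_exact:
 assumes w: "w \<in> fmP P" and dw: "dd w = 0" and c0: "cf (w {}) 0 = 0"
  and S: "\<And>c d. P c (Suc d) \<Longrightarrow> S (Suc c) d"
 shows "\<exists>w'\<in>fmP S. dd w' = w"
proof -
 define v where "v = (\<lambda>I. diag (\<lambda>m. inverse (of_nat (card I + mdegree m))) (w I))"
 have fs: "fsup w" by (rule fmP_fsup[OF w])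
 have v: "v \<in> fmP P" using w by (auto simp: fmP_def v_def)
 have "(\<lambda>I. diag (\<lambda>m. inverse (of_nat (card I + mdegree m))) (dd w I)) = dd v"
  unfolding v_def by (rule diag_dd[OF fs]) simp
 then have dv: "dd v = 0" using dw by (auto simp: fun_eq_iff)
 have "dd (DR v) + DR (dd v) = w"
  unfolding dd_DR[OF fmP_Om[OF v]]
 proof (rule ext, rule poly_mapping_eqI)
  fix I m
  show "cf (diag (\<lambda>m. of_nat (card I + mdegree m)) (v I)) m = cf (w I) m"
  proof (cases "cf (w I) m = 0")
   case False
   then have "finite I" using fmPD[OF w False] finite_subset by blast
   then have "card I + mdegree m \<noteq> 0" using False c0 by auto
   then have "(of_nat (card I + mdegree m) :: 'k) \<noteq> 0" by (simp only: of_nat_eq_0_iff not_False_eq_True)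
   then show ?thesis by (simp only: v_def cf_diag mult.assoc[symmetric] right_inverse mult_1_left not_False_eq_True)
  qed (simp add: v_def)
 qed
 then have "dd (DR v) = w" unfolding dv DR_zero by simp
 then show ?thesis using fmP_DR[OF v, of S] S by blast
qed

section \<open>Freeness and duality\<close>

abbreviation "V i \<equiv> fmP (\<lambda>c d. c = i)"

definition bs :: "nat set \<Rightarrow> 'k form" where "bs I = bas I 0 1"

lemma bs_fmP: "I \<subseteq> {..n} \<Longrightarrow> bs I \<in> fmP (\<lambda>c d. c = card I \<and> d = 0)"
 by (auto simp: fmP_def bs_def bas_def lookup_one when_def split: if_splits)

lemma bs_V: "I \<subseteq> {..n} \<Longrightarrow> bs I \<in> V (card I)"
 by (rule fmP_mono[OF bs_fmP]) auto

lemma bs_Om: "I \<subseteq> {..n} \<Longrightarrow> bs I \<in> Om"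
 by (rule fmP_Om[OF bs_fmP])

lemma bs_lv: "I \<subseteq> {..n} \<Longrightarrow> bs I \<in> lv (Suc (\<Sum>I))"
 using bs_Om[of I] by (auto simp: lv_def bs_def bas_def lookup_one when_def wgt_def split: if_splits)

lemma emb_lv:
 assumes "w \<in> lv s" shows "emb (w I) \<in> lv (s - \<Sum>I)"
 unfolding lv_def mem_Collect_eq
proof (intro conjI allI impI)
 have "w I \<in> PU" using fmPD[OF lv_Om[OF assms], of I] by (auto simp: polys_upto_def in_keys_iff)
 then show "emb (w I) \<in> Om" by (simp add: emb_Om)
 fix J m assume "cf (emb (w I) J) m \<noteq> 0"
 then have "J = {}" "cf (w I) m \<noteq> 0" by (auto simp: emb_def split: if_splits)
 then show "wgt J m < s - \<Sum>I" using lvD[OF assms, of I m] by (simp add: wgt_def)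
qed

lemma emb_bs: "finite I \<Longrightarrow> emb p \<bullet> bs I = (\<lambda>J. if J = I then p else 0)" "finite I \<Longrightarrow> bs I \<bullet> emb p = (\<lambda>J. if J = I then p else 0)"
proof -
 assume "finite I"
 then have "fsup (bs I)" by (auto simp: fsup_def bs_def bas_def)
 then show "emb p \<bullet> bs I = (\<lambda>J. if J = I then p else 0)" "bs I \<bullet> emb p = (\<lambda>J. if J = I then p else 0)"
  by (auto simp: emb_wedge wedge_emb bs_def bas_def)
qed

lemma V_component: "w \<in> fmP P \<Longrightarrow> w I \<in> PU"
 using fmPD[of w P I] by (auto simp: polys_upto_def in_keys_iff)

definition LB :: "nat \<Rightarrow> nat set set" where "LB i = {I. I \<subseteq> {..n} \<and> card I = i}"

lemma finite_LB [simp]: "finite (LB i)"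
 by (rule finite_subset[of _ "Pow {..n}"]) (auto simp: LB_def)

lemma LB_finite: "I \<in> LB i \<Longrightarrow> finite I"
 using finite_subset[of I "{..n}"] by (auto simp: LB_def)

lemma V_expand: "w \<in> V i \<Longrightarrow> w = (\<Sum>I\<in>LB i. (\<lambda>J. if J = I then w I else 0))"
proof (rule ext)
 fix J assume w: "w \<in> V i"
 have "w J = 0" if "J \<notin> LB i"
 proof (rule poly_mapping_eqI)
  fix m show "cf (w J) m = cf 0 m" using fmPD[OF w, of J m] that by (auto simp: LB_def)
 qed
 then show "w J = (\<Sum>I\<in>LB i. (\<lambda>J. if J = I then w I else 0)) J"
  by (simp add: sum_fun_apply)
qed

lemma VI:
 assumes "\<And>I. I \<in> LB i \<Longrightarrow> w I \<in> PU" "\<And>I. I \<notin> LB i \<Longrightarrow> w I = 0"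
 shows "w \<in> V i"
proof (rule fmPI)
 fix I m assume "cf (w I) m \<noteq> 0"
 moreover have "I \<in> LB i"
 proof (rule ccontr)
  assume "I \<notin> LB i"
  then show False using assms(2) calculation by simp
 qed
 ultimately show "upn I m (card I = i)"
  using assms(1) by (auto simp: LB_def polys_upto_def in_keys_iff)
qed

lemma V_unipotent:
 assumes f_add: "\<And>x y. \<lbrakk>x \<in> V i; y \<in> V i\<rbrakk> \<Longrightarrow> f (x + y) = f x + f y"
  and f_V: "\<And>x. x \<in> V i \<Longrightarrow> f x \<in> V i"
  and f_low: "\<And>s x. \<lbrakk>x \<in> V i; x \<in> lv (Suc s)\<rbrakk> \<Longrightarrow> f x - x \<in> lv s"
 shows "bij_betw f (V i) (V i)"
proof (rule unipotent_bij[where F = "\<lambda>s. lv s \<inter> V i"])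
 fix x assume "x \<in> V i"
 then show "\<exists>s. x \<in> lv s \<inter> V i" using lv_ex fmP_Om by blast
next
 fix s x assume "x \<in> lv (Suc s) \<inter> V i"
 then show "f x - x \<in> lv s \<inter> V i" using f_low f_V fmP_diff by blast
qed (use lv_0 lv_uminus fmP_uminus fmP_add f_add in auto)

text \<open>The Boolean chooses the side, \<open>True\<close> for left multiplication, so that both
  module structures are handled by the same lemmas.\<close>

definition act :: "bool \<Rightarrow> 'k mpoly \<Rightarrow> 'k form \<Rightarrow> 'k form" where
 "act s r w = (if s then emb r \<star> w else w \<star> emb r)"
text \<open>The form w serves as its own family of coordinates: \<open>psi\<close> replaces the
  commutative products of \<open>w I\<close> and \<open>\<theta>\<^sub>I\<close> by star products.
  Its bijectivity is freeness of the exterior power on the products of thetas.\<close>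

definition psi :: "bool \<Rightarrow> nat \<Rightarrow> 'k form \<Rightarrow> 'k form" where "psi s i w = (\<Sum>I\<in>LB i. act s (w I) (bs I))"

lemma emb_V0: "p \<in> PU \<Longrightarrow> emb p \<in> V 0"
 by (rule emb_fmP) auto

text \<open>Identity up to lower weight, by \<open>st_lower\<close> in each summand. Every form is
  the sum of its wedge products \<open>emb (x I) \<bullet> bs I\<close>, so only the differences
  from the star products remain.\<close>

lemma psi_bij: "bij_betw (psi s i) (V i) (V i)"
proof (rule V_unipotent)
 have L: "I \<subseteq> {..n}" "finite I" "card I = i" if "I \<in> LB i" for I using LB_finite[OF that] that by (auto simp: LB_def)
 have c: "emb (w I) \<in> V 0" "emb (w I) \<in> Om" if "w \<in> V i" for w I
  using V_component[OF that] emb_V0 emb_Om by auto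
 fix x assume x: "x \<in> V i"
 show "psi s i (x + y) = psi s i x + psi s i y" if y: "y \<in> V i" for y
  unfolding psi_def sum.distrib[symmetric]
 proof (intro sum.cong refl)
  fix I assume I: "I \<in> LB i"
  show "act s ((x + y) I) (bs I) = act s (x I) (bs I) + act s (y I) (bs I)"
   by (cases s) (simp_all only: act_def if_True if_False plus_fun_apply emb_simps
    st_add_left[OF c(2)[OF x] c(2)[OF y]] st_add_right[OF bs_Om[OF L(1)[OF I]]])
 qed
 show "psi s i x \<in> V i" unfolding psi_def act_def
 proof (rule fmP_sum)
  fix I assume I: "I \<in> LB i"
  have "emb (x I) \<star> bs I \<in> V i" by (rule fmP_st[OF c(1)[OF x] bs_V[OF L(1)[OF I]]]) (simp add: L(3)[OF I])
  moreover have "bs I \<star> emb (x I) \<in> V i" by (rule fmP_st[OF bs_V[OF L(1)[OF I]] c(1)[OF x]]) (simp add: L(3)[OF I])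
  ultimately show "(if s then emb (x I) \<star> bs I else bs I \<star> emb (x I)) \<in> V i" by (cases s) (simp_all only: if_True if_False)
 qed
 fix l assume lv: "x \<in> lv (Suc l)"
 have "x = (\<Sum>I\<in>LB i. emb (x I) \<bullet> bs I)"
  by (subst V_expand[OF x], rule sum.cong) (auto simp: emb_bs L)
 then have "psi s i x - x = (\<Sum>I\<in>LB i. act s (x I) (bs I)) - (\<Sum>I\<in>LB i. emb (x I) \<bullet> bs I)" by (simp only: psi_def)
 also have "\<dots> = (\<Sum>I\<in>LB i. act s (x I) (bs I) - emb (x I) \<bullet> bs I)" by (rule sum_subtractf[symmetric])
 also have "\<dots> \<in> lv l"
 proof (rule lv_sum)
  fix I assume I: "I \<in> LB i"
  note b = bs_lv[OF L(1)[OF I]] and e = emb_lv[OF lv, of I]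
  \<comment> \<open>If the weight of \<open>\<theta>\<^sub>I\<close> exceeds l, then the coefficient
    at I is 0. The case is treated apart because the level \<open>Suc l - \<Sum>I\<close> of the
    coefficient is then truncated.\<close>
  show "act s (x I) (bs I) - emb (x I) \<bullet> bs I \<in> lv l"
  proof (cases "\<Sum>I \<le> l")
   case True
   then have le: "(Suc l - \<Sum>I) + Suc (\<Sum>I) - 2 \<le> l" "Suc (\<Sum>I) + (Suc l - \<Sum>I) - 2 \<le> l" by auto
   have comm: "emb (x I) \<bullet> bs I = bs I \<bullet> emb (x I)" by (simp only: emb_bs[OF L(2)[OF I]])
   have "bs I \<star> emb (x I) - emb (x I) \<bullet> bs I \<in> lv l" unfolding comm by (rule lv_mono[OF st_lower[OF b e] le(2)])
   then show ?thesis using lv_mono[OF st_lower[OF e b] le(1)]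
    by (cases s) (simp_all only: act_def if_True if_False)
  next
   case False
   then have "emb (x I) = 0" using lv_0 e by simp
   then show ?thesis by (simp only: act_def st_zero wedge_zero if_cancel diff_zero lv_zero)
  qed
 qed
 finally show "psi s i x - x \<in> lv l" .
qed

section \<open>The top form and the pairing into the top exterior power\<close>

abbreviation "top_set \<equiv> {..n}"

lemma V_top: "w \<in> V (Suc n) \<Longrightarrow> w = pm (w top_set) (bs top_set)"
proof -
 assume w: "w \<in> V (Suc n)"
 have "LB (Suc n) = {top_set}"
  using card_subset_eq[of top_set] by (auto simp: LB_def)
 then have "(\<Sum>I\<in>LB (Suc n). (\<lambda>J. if J = I then w I else 0)) = (\<lambda>J. if J = top_set then w top_set else 0)"
  by (intro ext) (simp add: sum_fun_apply)
 with V_expand[OF w] have "w = (\<lambda>J. if J = top_set then w top_set else 0)" by (rule trans)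
 also have "\<dots> = pm (w top_set) (bs top_set)" by (auto simp: bs_def bas_def)
 finally show ?thesis .
qed

lemma V_big: "w \<in> V i \<Longrightarrow> i > Suc n \<Longrightarrow> w = 0"
proof (rule ext, rule poly_mapping_eqI)
 fix I m assume w: "w \<in> V i" and i: "i > Suc n"
 have "card I \<le> Suc n" if "I \<subseteq> {..n}" using card_mono[OF _ that] by simp
 then show "cf (w I) m = cf (0 I) m" using fmPD[OF w, of I m] i by (cases "cf (w I) m = 0") auto
qed

text \<open>The image would keep exterior degree n + 1 and polynomial degree 0 but have smaller
  weight, and there is no such term.\<close>

lemma Dl_top: "Dl (bs top_set) = 0"
proof (rule ext, rule poly_mapping_eqI)
 fix I m
 have 1: "Dl (bs top_set) \<in> fmP (\<lambda>c d. c = Suc n \<and> d = 0)"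
  by (rule fmP_mono[OF fmP_Dl[OF bs_fmP]]) auto
 have 2: "Dl (bs top_set) \<in> lv (\<Sum>top_set)" using lv_Dl[OF bs_lv[of top_set]] by simp
 show "cf (Dl (bs top_set) I) m = cf (0 I) m"
 proof (rule ccontr)
  assume "cf (Dl (bs top_set) I) m \<noteq> cf (0 I) m"
  then have nz: "cf (Dl (bs top_set) I) m \<noteq> 0" by simp
  have "I = top_set" using fmPD[OF 1 nz] card_subset_eq[of top_set I] by auto
  then show False using lvD[OF 2 nz] by (simp add: wgt_def)
 qed
qed

text \<open>Delta kills the top form and so acts on the coefficient p alone. The top exterior power
  is thus a copy of R as a right module, with \<open>top\<close> as coordinate.\<close>

lemma top_st_emb:
 assumes p: "p \<in> PU" shows "pm p (bs top_set) \<star> emb f = pm (star n a p f) (bs top_set)"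
proof -
 have fs: "fsup (bs top_set)" by (rule fmP_fsup[OF bs_Om]) simp
 have pe: "pm p (bs top_set) = emb p \<bullet> bs top_set" for p by (rule emb_wedge[OF fs, symmetric])
 have D: "(Dl ^^ k) (pm p (bs top_set)) = pm ((Delta n ^^ k) p) (bs top_set)" for k
 proof (induction k)
  case (Suc k)
  show ?case
   by (simp only: funpow.simps o_apply Suc.IH) (simp only: pe Dl_wedge Dl_emb Dl_top wedge_zero add_0_right)
 qed (simp only: funpow_0)
 obtain N where N: "nilp N (emb p)" using nilp_ex p emb_Om by blast
 have N': "nilp N (pm p (bs top_set))"
  unfolding nilp_def D
 proof (intro allI impI)
  fix k assume "N \<le> k"
  then have "emb ((Delta n ^^ k) p) = emb 0" using N by (simp add: nilp_def Dl_pow_emb)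
  then show "pm ((Delta n ^^ k) p) (bs top_set) = 0" by (simp only: emb_inj pm_simps)
 qed
 have "pm p (bs top_set) \<star> emb f = (\<Sum>k<N. pm ((Delta n ^^ k) p * Gam_binom n a k f) (bs top_set))"
  unfolding st_eq[OF N'] D gb_emb
  by (intro sum.cong refl) (simp add: wedge_emb fsup_pm[OF fs] pm_simps mult.commute)
 also have "\<dots> = (emb p \<star> emb f) \<bullet> bs top_set"
  unfolding st_eq[OF N] Dl_pow_emb gb_emb emb_mult wedge_sum pe ..
 also have "\<dots> = pm (star n a p f) (bs top_set)" by (simp only: star_emb[OF p] pe)
 finally show ?thesis .
qed

definition top :: "'k form \<Rightarrow> 'k mpoly" where "top w = w top_set"

lemma top_add [simp]: "top (v + w) = top v + top w" "top 0 = 0" "top (- w) = - top w"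
 "top (pm p w) = p * top w"
 by (simp_all add: top_def)

lemma top_bs: "top (bs top_set) = 1"
 by (simp add: top_def bs_def bas_def)

lemma top_star:
 assumes "w \<in> V (Suc n)" shows "top (w \<star> emb f) = star n a (top w) f"
proof -
 have "w \<star> emb f = pm (star n a (top w) f) (bs top_set)"
  unfolding top_def using top_st_emb[OF V_component[OF assms]] V_top[OF assms] by metis
 then show ?thesis by (simp add: top_bs)
qed

text \<open>The normalisation by signs and complements makes the pairing \<open>v \<mapsto> (top (v \<star> \<theta>\<^sub>I))\<^sub>I\<close> unipotent.\<close>

lemma top_pairing:
 assumes i: "i \<le> Suc n" and \<beta>: "\<And>I. I \<in> LB i \<Longrightarrow> \<beta> I \<in> PU"
 shows "\<exists>!v. v \<in> V (Suc n - i) \<and> (\<forall>I\<in>LB i. top (v \<star> bs I) = \<beta> I)"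
proof -
 let ?c = "\<lambda>I. top_set - I"
 have cL: "?c J \<in> LB i" if "J \<in> LB (Suc n - i)" for J
  using that i LB_finite[OF that] by (auto simp: LB_def card_Diff_subset)
 have cL': "?c I \<in> LB (Suc n - i)" if "I \<in> LB i" for I
  using that i LB_finite[OF that] by (auto simp: LB_def card_Diff_subset)
 have cc: "?c (?c J) = J" if "J \<in> LB k" for J k using that by (auto simp: LB_def)
 have L: "I \<subseteq> {..n}" "finite I" "card I = k" if "I \<in> LB k" for I k using LB_finite[OF that] that by (auto simp: LB_def)
 define f where "f v = (\<lambda>J. if J \<in> LB (Suc n - i) then sg J (?c J) * top (v \<star> bs (?c J)) else 0)" for v
 have V': "v \<star> bs (?c J) \<in> V (Suc n)" if "v \<in> V (Suc n - i)" "J \<in> LB (Suc n - i)" for v J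
  by (rule fmP_st[OF that(1) bs_V[OF L(1)[OF cL[OF that(2)]]]]) (use L(3)[OF cL[OF that(2)]] i in simp)
 have sgp: "sg I J * p \<in> PU" if "p \<in> PU" for I J and p :: "'k mpoly"
  using that by (auto simp: polys_upto_def in_keys_iff cf_sg_mult)
 have bij: "bij_betw f (V (Suc n - i)) (V (Suc n - i))"
 proof (rule V_unipotent)
  fix x y assume "x \<in> V (Suc n - i)" "y \<in> V (Suc n - i)"
  then show "f (x + y) = f x + f y"
   by (intro ext) (simp add: f_def st_add_left fmP_Om distrib_left)
 next
  fix x assume x: "x \<in> V (Suc n - i)"
  show "f x \<in> V (Suc n - i)"
   by (rule VI) (use V_component[OF V'[OF x]] in "auto simp: f_def top_def sgp")
 next
  fix s x assume x: "x \<in> V (Suc n - i)" and lv: "x \<in> lv (Suc s)"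
  have "f x J - x J = sg J (?c J) * top (x \<star> bs (?c J) - x \<bullet> bs (?c J))" if J: "J \<in> LB (Suc n - i)" for J
  proof -
   have "(x \<bullet> bs (?c J)) top_set = (\<Sum>I\<in>Pow top_set. if I = J then sg J (?c J) * x J else 0)"
    unfolding wedge_def
   proof (intro sum.cong refl)
    fix I assume "I \<in> Pow top_set"
    then have "top_set - I = ?c J \<longleftrightarrow> I = J" using L(1)[OF J] by auto
    then show "sg I (top_set - I) * x I * bs (?c J) (top_set - I) = (if I = J then sg J (?c J) * x J else 0)"
     by (auto simp: bs_def bas_def)
   qed
   also have "\<dots> = sg J (?c J) * x J" using L(1)[OF J] by simp
   finally have "x J = sg J (?c J) * top (x \<bullet> bs (?c J))"
    by (simp add: top_def mult.assoc[symmetric] sg_sq)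
   then show ?thesis using J by (simp add: f_def top_def right_diff_distrib)
  qed
  moreover have "f x J - x J = 0" if "J \<notin> LB (Suc n - i)" for J
  proof -
   have "x J = 0"
   proof (rule poly_mapping_eqI)
    fix m show "cf (x J) m = cf 0 m" using fmPD[OF x, of J m] that by (auto simp: LB_def)
   qed
   then show ?thesis using that by (simp add: f_def)
  qed
  ultimately have fx: "f x J - x J = (if J \<in> LB (Suc n - i) then sg J (?c J) * top (x \<star> bs (?c J) - x \<bullet> bs (?c J)) else 0)" for J
   by simp
  have "f x \<in> V (Suc n - i)"
   by (rule VI) (use V_component[OF V'[OF x]] in "auto simp: f_def top_def sgp")
  then have "f x - x \<in> Om" using x fmP_diff fmP_Om by blast
  then show "f x - x \<in> lv s" unfolding lv_def mem_Collect_eq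
  proof (intro conjI allI impI)
   fix J m assume "cf ((f x - x) J) m \<noteq> 0"
   then have J: "J \<in> LB (Suc n - i)" and c: "cf ((x \<star> bs (?c J) - x \<bullet> bs (?c J)) top_set) m \<noteq> 0"
    using fx[of J] by (auto simp: cf_sg_mult top_def split: if_splits)
   have "x \<star> bs (?c J) - x \<bullet> bs (?c J) \<in> lv (Suc s + Suc (\<Sum>(?c J)) - 2)"
    by (rule st_lower[OF lv bs_lv]) auto
   from lvD[OF this c] have "wgt top_set m < s + \<Sum>(?c J)" by simp
   \<comment> \<open>The weights of \<open>\<theta>\<^sub>J\<close> and of its complement add up to
     that of the top form, so a loss of weight in the top coefficient is a loss at J.\<close>
   moreover have "wgt top_set m = wgt J m + \<Sum>(?c J)"
    using sum.subset_diff[of J top_set "\<lambda>i. i"] L(1)[OF J] by (simp add: wgt_def)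
   ultimately show "wgt J m < s" by simp
  qed
 qed
 define \<beta>' where "\<beta>' = (\<lambda>J. if J \<in> LB (Suc n - i) then sg J (?c J) * \<beta> (?c J) else 0)"
 have \<beta>'V: "\<beta>' \<in> V (Suc n - i)" by (rule VI) (use \<beta>[OF cL] in "auto simp: \<beta>'_def sgp")
 have iff: "f v = \<beta>' \<longleftrightarrow> (\<forall>I\<in>LB i. top (v \<star> bs I) = \<beta> I)" for v
 proof
  assume fv: "f v = \<beta>'"
  show "\<forall>I\<in>LB i. top (v \<star> bs I) = \<beta> I"
  proof
   fix I assume I: "I \<in> LB i"
   have "sg (?c I) I * top (v \<star> bs I) = sg (?c I) I * \<beta> I"
    using fun_cong[OF fv, of "?c I"] cL'[OF I] cc[OF I] by (simp add: f_def \<beta>'_def)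
   then have "(sg (?c I) I * sg (?c I) I) * top (v \<star> bs I) = (sg (?c I) I * sg (?c I) I) * \<beta> I"
    by (simp only: mult.assoc)
   then show "top (v \<star> bs I) = \<beta> I" by (simp add: sg_sq)
  qed
 next
  assume "\<forall>I\<in>LB i. top (v \<star> bs I) = \<beta> I"
  then show "f v = \<beta>'" using cL by (auto simp: f_def \<beta>'_def)
 qed
 have "\<exists>!v. v \<in> V (Suc n - i) \<and> f v = \<beta>'"
 proof (rule ex_ex1I)
  have "\<beta>' \<in> f ` V (Suc n - i)" using bij_betw_imp_surj_on[OF bij] \<beta>'V by simp
  then show "\<exists>v. v \<in> V (Suc n - i) \<and> f v = \<beta>'" by blast
 next
  fix v w assume "v \<in> V (Suc n - i) \<and> f v = \<beta>'" "w \<in> V (Suc n - i) \<and> f w = \<beta>'"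
  then show "v = w" using inj_onD[OF bij_betw_imp_inj_on[OF bij], of v w] by simp
 qed
 then show ?thesis unfolding iff .
qed

lemma cf_Delta_0: "cf (Delta n p) 0 = 0"
proof (rule ccontr)
 assume "cf (Delta n p) 0 \<noteq> 0"
 from cf_Delta_nonzero[OF this] obtain m' :: "nat \<Rightarrow>\<^sub>0 nat" and j where *: "1 \<le> j" "m' + sgl (j - 1) 1 = 0 + sgl j 1" by blast
 from arg_cong[OF *(2), of "\<lambda>m. cf m (j - 1)"] show False using *(1) by (auto simp: lookup_add lookup_single when_def split: if_splits)
qed

text \<open>Delta of a polynomial has no constant term, so only k = 0 contributes. Constant terms
  are therefore multiplicative, which drives the minimality arguments.\<close>

lemma cf_star_const:
 assumes p: "p \<in> PU" and w: "w \<in> Om" shows "cf ((emb p \<star> w) I) 0 = cf p 0 * cf (w I) 0"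
proof -
 obtain N where "nilp N (emb p)" using nilp_ex p emb_Om by blast
 then have N: "nilp (Suc N) (emb p)" by (rule nilp_mono) simp
 have "(emb p \<star> w) I = (\<Sum>k<Suc N. (Delta n ^^ k) p * gb k w I)"
  unfolding st_eq[OF N] Dl_pow_emb sum_fun_apply
  by (intro sum.cong refl) (simp add: emb_wedge fmP_fsup[OF fmP_DG[OF w]])
 then have "cf ((emb p \<star> w) I) 0 = (\<Sum>k<Suc N. cf ((Delta n ^^ k) p) 0 * cf (gb k w I) 0)"
  by (simp only: lookup_sum cf_mult_0)
 also have "\<dots> = (\<Sum>k<Suc N. if k = 0 then cf p 0 * cf (w I) 0 else 0)"
 proof (intro sum.cong refl)
  fix k show "cf ((Delta n ^^ k) p) 0 * cf (gb k w I) 0 = (if k = 0 then cf p 0 * cf (w I) 0 else 0)"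
   by (cases k) (simp_all add: cf_Delta_0 DG_def)
 qed
 finally show ?thesis by simp
qed

text \<open>This is exactness of the dual of the Koszul complex. The pairing represents \<phi> on
  the basis by a form v, and right linearity extends this to all of \<open>V i\<close>. By the
  Leibniz rule the cocycle condition says that \<open>dd v\<close> pairs to 0 with the basis one
  degree higher, whence \<open>dd v = 0\<close> by uniqueness, and Koszul exactness gives v'. For i
  = n + 1 the form v has exterior degree 0 and its constant term is an obstruction;
  \<open>const\<close> removes it.\<close>

lemma dual_exact:
 fixes \<phi> :: "'k form \<Rightarrow> 'k mpoly"
 assumes i: "i \<le> Suc n"
  and \<phi>: "\<And>w. w \<in> V i \<Longrightarrow> \<phi> w \<in> PU"
   "\<And>v w. \<lbrakk>v \<in> V i; w \<in> V i\<rbrakk> \<Longrightarrow> \<phi> (v + w) = \<phi> v + \<phi> w"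
   "\<And>w f. \<lbrakk>w \<in> V i; f \<in> PU\<rbrakk> \<Longrightarrow> \<phi> (w \<star> emb f) = star n a (\<phi> w) f"
  and coc: "\<And>u. u \<in> V (Suc i) \<Longrightarrow> \<phi> (dd u) = 0"
  and const: "i = Suc n \<Longrightarrow> cf (\<phi> (bs top_set)) 0 = 0"
 shows "\<exists>v'. v' \<in> V (Suc n - i + 1) \<and> (\<forall>w\<in>V i. \<phi> w = top (dd v' \<star> w))"
proof -
 have L: "I \<subseteq> {..n}" "finite I" "card I = k" if "I \<in> LB k" for I k using LB_finite[OF that] that by (auto simp: LB_def)
 have bsV: "bs I \<in> V k" if "I \<in> LB k" for I k using bs_V[OF L(1)[OF that]] L(3)[OF that] by simp
 obtain v where v: "v \<in> V (Suc n - i)" "\<And>I. I \<in> LB i \<Longrightarrow> top (v \<star> bs I) = \<phi> (bs I)"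
  using top_pairing[OF i, of "\<lambda>I. \<phi> (bs I)"] \<phi>(1) bsV by blast
 have vw: "v \<star> w \<in> V (Suc n)" if "w \<in> V i" for w
  by (rule fmP_st[OF v(1) that]) (use i in simp)
 have rep: "\<phi> w = top (v \<star> w)" if w: "w \<in> V i" for w
 proof -
  have "w \<in> psi False i ` V i" using bij_betw_imp_surj_on[OF psi_bij[of False i]] w by simp
  then obtain g where g: "g \<in> V i" "psi False i g = w" by blast
  have e: "bs I \<star> emb (g I) \<in> V i" if "I \<in> LB i" for I
   by (rule fmP_st[OF bsV[OF that] emb_V0[OF V_component[OF g(1)]]]) simp
  have \<phi>0: "\<phi> 0 = 0" using \<phi>(2)[of 0 0] by simp
  have "\<phi> (sum h A) = (\<Sum>I\<in>A. \<phi> (h I))" if "\<And>I. I \<in> A \<Longrightarrow> h I \<in> V i" for h and A :: "nat set set"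
   using that by (induction A rule: infinite_finite_induct) (simp_all only: sum.infinite sum.empty sum.insert \<phi>0 \<phi>(2) fmP_sum insert_iff simp_thms)
  from this[of "LB i", OF e] have "\<phi> w = (\<Sum>I\<in>LB i. \<phi> (bs I \<star> emb (g I)))" unfolding g(2)[symmetric] psi_def act_def if_False .
  also have "\<dots> = (\<Sum>I\<in>LB i. top (v \<star> (bs I \<star> emb (g I))))"
  proof (intro sum.cong refl)
   fix I assume I: "I \<in> LB i"
   have gI: "g I \<in> PU" by (rule V_component[OF g(1)])
   have "\<phi> (bs I \<star> emb (g I)) = star n a (top (v \<star> bs I)) (g I)" using \<phi>(3)[OF bsV[OF I] gI] v(2)[OF I] by simp
   also have "\<dots> = top ((v \<star> bs I) \<star> emb (g I))" by (rule top_star[OF vw[OF bsV[OF I]], symmetric])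
   also have "(v \<star> bs I) \<star> emb (g I) = v \<star> (bs I \<star> emb (g I))"
    by (rule st_assoc) (use v(1) bsV[OF I] gI emb_Om fmP_Om in auto)
   finally show "\<phi> (bs I \<star> emb (g I)) = top (v \<star> (bs I \<star> emb (g I)))" .
  qed
  also have "\<dots> = top (v \<star> w)"
   unfolding g(2)[symmetric] psi_def act_def if_False st_sum_right[OF fmP_Om[OF v(1)]] top_def sum_fun_apply ..
  finally show ?thesis .
 qed
 \<comment> \<open>For i = n + 1 the form \<open>dd v\<close> would have exterior degree -1;
   otherwise uniqueness in the pairing for i + 1 applies.\<close>
 have ddv: "dd v = 0"
 proof (cases "i = Suc n")
  case True
  have "dd v \<in> fmP (\<lambda>c d. Suc c = 0)" by (rule fmP_dd[OF v(1)]) (use True in simp)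
  then have "cf (dd v I) m = 0" for I m using fmPD[of "dd v" "\<lambda>c d. Suc c = 0" I m] by auto
  then show ?thesis by (intro ext poly_mapping_eqI) simp
 next
  case False
  then have i': "Suc i \<le> Suc n" using i by simp
  have dv: "dd v \<in> V (Suc n - Suc i)" by (rule fmP_dd[OF v(1)]) (use i' in auto)
  have z: "top (dd v \<star> bs I) = 0" if I: "I \<in> LB (Suc i)" for I
  proof -
   have vI: "v \<star> bs I \<in> V (Suc (Suc n))" by (rule fmP_st[OF v(1) bsV[OF I]]) (use i in simp)
   \<comment> \<open>The product has exterior degree n + 2, so it is already 0.\<close>
   have "dd (v \<star> bs I) = 0" using V_big[OF vI] by simp
   then have "0 = dd v \<star> bs I + pm (Const ((-1) ^ (Suc n - i))) (v \<star> dd (bs I))"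
    using dd_st[OF v(1) fmP_Om[OF bsV[OF I]]] by simp
   then have "0 = top (dd v \<star> bs I) + Const ((-1) ^ (Suc n - i)) * top (v \<star> dd (bs I))"
    by (metis top_add(1,2,4))
   moreover have "dd (bs I) \<in> V i" by (rule fmP_dd[OF bsV[OF I]]) simp
   then have "top (v \<star> dd (bs I)) = 0" using rep coc[OF bsV[OF I]] by simp
   ultimately show ?thesis by simp
  qed
  have uniq: "\<exists>!v. v \<in> V (Suc n - Suc i) \<and> (\<forall>I\<in>LB (Suc i). top (v \<star> bs I) = 0)"
   by (rule top_pairing[OF i']) (simp add: polys_upto_def)
  have "0 \<in> V (Suc n - Suc i) \<and> (\<forall>I\<in>LB (Suc i). top (0 \<star> bs I) = 0)" by (simp only: fmP_zero st_zero top_add simp_thms Ball_def)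
  with uniq dv z show ?thesis by blast
 qed
 have c0: "cf (v {}) 0 = 0"
 proof (cases "i = Suc n")
  case True
  have T: "top_set \<in> LB i" using True by (simp add: LB_def)
  have v0: "v = emb (v {})" by (rule fmP_0_emb) (use v(1) True in simp)
  have "cf (top (emb (v {}) \<star> bs top_set)) 0 = cf (v {}) 0 * cf (bs top_set top_set) 0"
   unfolding top_def by (rule cf_star_const[OF V_component[OF v(1)] bs_Om]) simp
  then have "cf (top (v \<star> bs top_set)) 0 = cf (v {}) 0"
   unfolding v0[symmetric] by (simp add: bs_def bas_def)
  then show ?thesis using v(2)[OF T] const[OF True] by simp
 next
  case False
  then show ?thesis using fmPD[OF v(1), of "{}" 0] i by auto
 qed
 have "\<exists>v'\<in>V (Suc n - i + 1). dd v' = v"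
  by (rule Koszul_exact[OF v(1) ddv c0]) simp
 then show ?thesis using rep by blast
qed

text \<open>Integration by parts: the star product of v and w has exterior degree n + 2 and
  vanishes, so the Leibniz rule moves \<open>dd\<close> from one factor to the other.\<close>

lemma top_dd_st:
 assumes i: "Suc i \<le> Suc n" and v: "v \<in> V (Suc n - i)" and w: "w \<in> V (Suc i)"
 shows "top (dd v \<star> w) = - (Const ((-1) ^ (Suc n - i)) * top (v \<star> dd w))"
proof -
 have vI: "v \<star> w \<in> V (Suc (Suc n))" by (rule fmP_st[OF v w]) (use i in simp)
 have "dd (v \<star> w) = 0" using V_big[OF vI] by simp
 then have "0 = dd v \<star> w + pm (Const ((-1) ^ (Suc n - i))) (v \<star> dd w)"
  using dd_st[OF v fmP_Om[OF w]] by simp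
 then have "0 = top (dd v \<star> w) + Const ((-1) ^ (Suc n - i)) * top (v \<star> dd w)"
  by (metis top_add(1,2,4))
 then show ?thesis by (simp add: eq_neg_iff_add_eq_0)
qed

end

declare One_nat_def [simp]

section \<open>Graded modules\<close>

locale direct_sum = abelian_group M for M (structure) +
 fixes G :: "'i \<Rightarrow> 'a set"
 assumes ds: "is_direct_sum M G"
begin

lemma G_sub: "x \<in> G i \<Longrightarrow> x \<in> carrier M"
 and G_zero: "\<zero> \<in> G i"
 and G_add: "\<lbrakk>x \<in> G i; y \<in> G i\<rbrakk> \<Longrightarrow> x \<oplus> y \<in> G i"
proof -
 interpret additive_subgroup "G i" M using ds by (simp add: is_direct_sum_def)
 show "x \<in> G i \<Longrightarrow> x \<in> carrier M" "\<zero> \<in> G i" "\<lbrakk>x \<in> G i; y \<in> G i\<rbrakk> \<Longrightarrow> x \<oplus> y \<in> G i"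
  by (auto simp: a_closed a_Hcarr)
qed

lemma hcomp_ex1:
 "x \<in> carrier M \<Longrightarrow> \<exists>!f. (\<forall>i. f i \<in> G i) \<and> finite {i. f i \<noteq> \<zero>} \<and> x = (\<Oplus>i\<in>{i. f i \<noteq> \<zero>}. f i)"
 using ds by (simp add: is_direct_sum_def)

lemma
 assumes "x \<in> carrier M"
 shows hcomp_mem: "hcomp M G i x \<in> G i" and hcomp_finite: "finite {i. hcomp M G i x \<noteq> \<zero>}"
  and hcomp_sum: "x = (\<Oplus>i\<in>{i. hcomp M G i x \<noteq> \<zero>}. hcomp M G i x)"
proof -
 have "(\<lambda>i. hcomp M G i x) = (THE f. (\<forall>i. f i \<in> G i) \<and> finite {i. f i \<noteq> \<zero>} \<and> x = (\<Oplus>i\<in>{i. f i \<noteq> \<zero>}. f i))"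
  by (simp add: hcomp_def)
 with theI'[OF hcomp_ex1[OF assms]]
 have "(\<forall>i. hcomp M G i x \<in> G i) \<and> finite {i. hcomp M G i x \<noteq> \<zero>} \<and>
   x = (\<Oplus>i\<in>{i. hcomp M G i x \<noteq> \<zero>}. hcomp M G i x)" by metis
 then show "hcomp M G i x \<in> G i" "finite {i. hcomp M G i x \<noteq> \<zero>}"
  "x = (\<Oplus>i\<in>{i. hcomp M G i x \<noteq> \<zero>}. hcomp M G i x)" by blast+
qed

lemma hcomp_closed: "x \<in> carrier M \<Longrightarrow> hcomp M G i x \<in> carrier M"
 using hcomp_mem G_sub by blast

lemma hcomp_sum_superset:
 assumes "x \<in> carrier M" "finite J" "{i. hcomp M G i x \<noteq> \<zero>} \<subseteq> J"
 shows "x = (\<Oplus>i\<in>J. hcomp M G i x)"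
proof -
 have "(\<Oplus>i\<in>{i. hcomp M G i x \<noteq> \<zero>}. hcomp M G i x) = (\<Oplus>i\<in>J. hcomp M G i x)"
  by (rule add.finprod_mono_neutral_cong_left) (use assms hcomp_closed in auto)
 then show ?thesis using hcomp_sum[OF assms(1)] by simp
qed

lemma hcomp_unique:
 assumes J: "finite J" and f: "\<And>i. i \<in> J \<Longrightarrow> f i \<in> G i" and x: "x = (\<Oplus>i\<in>J. f i)"
 shows "hcomp M G i x = (if i \<in> J then f i else \<zero>)"
proof -
 define f' where "f' i = (if i \<in> J then f i else \<zero>)" for i
 have f'G: "f' i \<in> G i" for i using f G_zero by (simp add: f'_def)
 have xc: "x \<in> carrier M" unfolding x by (rule finsum_closed, rule Pi_I, rule G_sub, erule f)
 have sub: "{i. f' i \<noteq> \<zero>} \<subseteq> J" by (auto simp: f'_def)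
 have "x = (\<Oplus>i\<in>J. f' i)" unfolding x
  by (rule finsum_cong') (use G_sub[OF f] in "auto simp: f'_def")
 also have "\<dots> = (\<Oplus>i\<in>{i. f' i \<noteq> \<zero>}. f' i)"
  by (rule add.finprod_mono_neutral_cong_left[symmetric]) (use J sub f'G G_sub in auto)
 finally have x': "x = (\<Oplus>i\<in>{i. f' i \<noteq> \<zero>}. f' i)" .
 have "f' = (THE f. (\<forall>i. f i \<in> G i) \<and> finite {i. f i \<noteq> \<zero>} \<and> x = (\<Oplus>i\<in>{i. f i \<noteq> \<zero>}. f i))"
  by (rule the1_equality[OF hcomp_ex1[OF xc], symmetric])
   (use f'G finite_subset[OF sub J] x' in blast)
 then show ?thesis by (simp add: hcomp_def f'_def[symmetric])
qed

lemma hcomp_homog: "x \<in> G j \<Longrightarrow> hcomp M G i x = (if i = j then x else \<zero>)"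
 using hcomp_unique[of "{j}" "\<lambda>_. x" x i] G_sub[of x j] by simp

lemma hcomp_zero [simp]: "hcomp M G i \<zero> = \<zero>"
 using hcomp_homog[OF G_zero[of i], of i] by simp

lemma hcomp_add:
 assumes x: "x \<in> carrier M" and y: "y \<in> carrier M"
 shows "hcomp M G i (x \<oplus> y) = hcomp M G i x \<oplus> hcomp M G i y"
proof -
 let ?J = "{i. hcomp M G i x \<noteq> \<zero>} \<union> {i. hcomp M G i y \<noteq> \<zero>}"
 have J: "finite ?J" using hcomp_finite x y by blast
 have "x \<oplus> y = (\<Oplus>i\<in>?J. hcomp M G i x \<oplus> hcomp M G i y)"
 proof -
  have "(\<Oplus>i\<in>?J. hcomp M G i x \<oplus> hcomp M G i y) = (\<Oplus>i\<in>?J. hcomp M G i x) \<oplus> (\<Oplus>i\<in>?J. hcomp M G i y)"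
   by (rule finsum_addf) (use x y hcomp_closed in auto)
  then show ?thesis using hcomp_sum_superset[OF x J] hcomp_sum_superset[OF y J] by auto
 qed
 from hcomp_unique[OF J _ this, of i] show ?thesis using G_add hcomp_mem x y by auto
qed

lemma direct_sum_induct [consumes 1, case_names zero homog add]:
 assumes x: "x \<in> carrier M" and "Q \<zero>" and "\<And>i x. x \<in> G i \<Longrightarrow> Q x"
  and "\<And>x y. \<lbrakk>x \<in> carrier M; y \<in> carrier M; Q x; Q y\<rbrakk> \<Longrightarrow> Q (x \<oplus> y)"
 shows "Q x"
proof -
 have "Q (\<Oplus>i\<in>J. hcomp M G i x)" if "finite J" for J
  using that
 proof (induction J rule: finite_induct)
  case (insert j J)
  have "(\<Oplus>i\<in>insert j J. hcomp M G i x) = hcomp M G j x \<oplus> (\<Oplus>i\<in>J. hcomp M G i x)"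
   by (rule finsum_insert) (use insert x hcomp_closed in auto)
  then show ?case using insert assms(3)[OF hcomp_mem[OF x]] x hcomp_closed
   by (auto intro!: assms(4) finsum_closed)
 qed (simp add: assms(2))
 then show ?thesis using hcomp_sum[OF x] hcomp_finite[OF x] by metis
qed

end

lemma graded_moduleD:
 assumes "graded_module R G M MG"
 shows "left_module R M" "direct_sum M MG" "\<And>i j r x. \<lbrakk>r \<in> G i; x \<in> MG j\<rbrakk> \<Longrightarrow> r \<odot>\<^bsub>M\<^esub> x \<in> MG (int i + j)"
proof -
 show M: "left_module R M" using assms by (simp add: graded_module_def)
 interpret left_module R M by fact
 show "direct_sum M MG" using assms
  by (simp add: graded_module_def direct_sum_def direct_sum_axioms_def M.abelian_group_axioms)
 show "\<And>i j r x. \<lbrakk>r \<in> G i; x \<in> MG j\<rbrakk> \<Longrightarrow> r \<odot>\<^bsub>M\<^esub> x \<in> MG (int i + j)"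
  using assms by (simp add: graded_module_def)
qed

lemma hcomp_smult:
 assumes M: "graded_module R G M MG" and r: "r \<in> G i" "r \<in> carrier R" and x: "x \<in> carrier M"
 shows "hcomp M MG (int i + j) (r \<odot>\<^bsub>M\<^esub> x) = r \<odot>\<^bsub>M\<^esub> hcomp M MG j x"
proof -
 note m = graded_moduleD[OF M]
 interpret L: left_module R M by (rule m(1))
 interpret D: direct_sum M MG by (rule m(2))
 define J where "J = {j. hcomp M MG j x \<noteq> \<zero>\<^bsub>M\<^esub>}"
 have J: "finite J" unfolding J_def by (rule D.hcomp_finite[OF x])
 have c: "r \<odot>\<^bsub>M\<^esub> hcomp M MG j x \<in> carrier M" for j using r(2) x by (simp add: L.smult_closed D.hcomp_closed)
 have "r \<odot>\<^bsub>M\<^esub> x = r \<odot>\<^bsub>M\<^esub> (\<Oplus>\<^bsub>M\<^esub>j\<in>J. hcomp M MG j x)" using D.hcomp_sum[OF x] by (simp add: J_def)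
 also have "\<dots> = (\<Oplus>\<^bsub>M\<^esub>j\<in>J. r \<odot>\<^bsub>M\<^esub> hcomp M MG j x)"
  by (rule L.finsum_smult[OF J]) (use r(2) x D.hcomp_closed in auto)
 also have "\<dots> = (\<Oplus>\<^bsub>M\<^esub>j\<in>J. r \<odot>\<^bsub>M\<^esub> hcomp M MG ((int i + j) - int i) x)" by simp
 also have "\<dots> = (\<Oplus>\<^bsub>M\<^esub>k\<in>(+) (int i) ` J. r \<odot>\<^bsub>M\<^esub> hcomp M MG (k - int i) x)"
  by (rule L.M.finsum_reindex[symmetric]) (use c in auto)
 finally have e: "r \<odot>\<^bsub>M\<^esub> x = (\<Oplus>\<^bsub>M\<^esub>k\<in>(+) (int i) ` J. r \<odot>\<^bsub>M\<^esub> hcomp M MG (k - int i) x)" .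
 have "r \<odot>\<^bsub>M\<^esub> hcomp M MG (k - int i) x \<in> MG k" for k
  using m(3)[OF r(1) D.hcomp_mem[OF x], of "k - int i"] by simp
 from D.hcomp_unique[OF _ this e, of "int i + j"] J
 show ?thesis using r(2) by (auto simp: J_def L.smult_r_null image_iff)
qed

lemma mod_hom_eq_on_homog:
 assumes M: "direct_sum M MG" "left_module R M" and N: "left_module R N"
  and f: "f \<in> mod_hom R M N" and g: "g \<in> mod_hom R M N"
  and eq: "\<And>j x. x \<in> MG j \<Longrightarrow> f x = g x" and x: "x \<in> carrier M"
 shows "f x = g x"
proof -
 interpret D: direct_sum M MG by fact
 show ?thesis using x
 proof (induction x rule: D.direct_sum_induct)
  case zero
  then show ?case by (simp add: mod_hom_zero[OF M(2) N f] mod_hom_zero[OF M(2) N g])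
 next
  case (add x y)
  then show ?case by (simp add: mod_hom_add[OF f] mod_hom_add[OF g])
 qed (use eq in blast)
qed

text \<open>The degree e part of f: on x of degree j it is the component of \<open>f x\<close> in
  degree j + e, and the sum over the components of x extends this additively.\<close>

definition comp_hom ::
 "('r, 'u) module \<Rightarrow> (int \<Rightarrow> 'u set) \<Rightarrow> ('r, 'v) module \<Rightarrow> (int \<Rightarrow> 'v set) \<Rightarrow> int \<Rightarrow> ('u \<Rightarrow> 'v) \<Rightarrow> 'u \<Rightarrow> 'v" where
 "comp_hom M MG N NG e f x =
   (\<Oplus>\<^bsub>N\<^esub>j\<in>{j. hcomp M MG j x \<noteq> \<zero>\<^bsub>M\<^esub>}. hcomp N NG (j + e) (f (hcomp M MG j x)))"

text \<open>Linearity is tested on homogeneous scalars and homogeneous arguments, where it says that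
  taking components is shifted by the degree of the scalar.\<close>

lemma
 assumes R: "direct_sum R G" and M: "graded_module R G M MG" and N: "graded_module R G N NG"
  and f: "f \<in> mod_hom R M N"
 shows comp_hom_homog: "x \<in> MG j \<Longrightarrow> comp_hom M MG N NG e f x = hcomp N NG (j + e) (f x)"
  and comp_hom_hom: "comp_hom M MG N NG e f \<in> mod_hom R M N"
proof -
 note m = graded_moduleD[OF M] and n = graded_moduleD[OF N]
 interpret LM: left_module R M by (rule m(1))
 interpret DM: direct_sum M MG by (rule m(2))
 interpret LN: left_module R N by (rule n(1))
 interpret DN: direct_sum N NG by (rule n(2))
 interpret DR: direct_sum R G by (rule R)
 let ?c = "comp_hom M MG N NG e f"
 have c: "hcomp N NG k (f (hcomp M MG j x)) \<in> carrier N" if "x \<in> carrier M" for k j x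
  by (intro DN.hcomp_closed mod_hom_closed[OF f] DM.hcomp_closed that)
 have big: "?c x = (\<Oplus>\<^bsub>N\<^esub>j\<in>J. hcomp N NG (j + e) (f (hcomp M MG j x)))"
  if "x \<in> carrier M" "finite J" "{j. hcomp M MG j x \<noteq> \<zero>\<^bsub>M\<^esub>} \<subseteq> J" for x J
  unfolding comp_hom_def
  by (rule LN.M.add.finprod_mono_neutral_cong_left)
   (use that c mod_hom_zero[OF m(1) n(1) f] in auto)
 show hhom: "x \<in> MG j \<Longrightarrow> ?c x = hcomp N NG (j + e) (f x)" for x j
 proof -
  assume x: "x \<in> MG j"
  have xc: "x \<in> carrier M" by (rule DM.G_sub[OF x])
  have "?c x = (\<Oplus>\<^bsub>N\<^esub>j\<in>{j}. hcomp N NG (j + e) (f (hcomp M MG j x)))"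
   by (rule big) (use xc in "auto simp: DM.hcomp_homog[OF x] split: if_splits")
  then show ?thesis using DM.hcomp_homog[OF x, of j] c[OF xc, of "j + e" j] by simp
 qed
 have closed: "?c x \<in> carrier N" if "x \<in> carrier M" for x
  unfolding comp_hom_def by (rule LN.M.finsum_closed) (use c that in auto)
 have hadd: "?c (x \<oplus>\<^bsub>M\<^esub> y) = ?c x \<oplus>\<^bsub>N\<^esub> ?c y" if x: "x \<in> carrier M" and y: "y \<in> carrier M" for x y
 proof -
  let ?J = "{i. hcomp M MG i x \<noteq> \<zero>\<^bsub>M\<^esub>} \<union> {i. hcomp M MG i y \<noteq> \<zero>\<^bsub>M\<^esub>}"
  have J: "finite ?J" using DM.hcomp_finite x y by blast
  have "?c (x \<oplus>\<^bsub>M\<^esub> y) = (\<Oplus>\<^bsub>N\<^esub>j\<in>?J. hcomp N NG (j + e) (f (hcomp M MG j (x \<oplus>\<^bsub>M\<^esub> y))))"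
   by (rule big) (use x y J in "auto simp: DM.hcomp_add")
  also have "\<dots> = (\<Oplus>\<^bsub>N\<^esub>j\<in>?J. hcomp N NG (j + e) (f (hcomp M MG j x)) \<oplus>\<^bsub>N\<^esub> hcomp N NG (j + e) (f (hcomp M MG j y)))"
   by (rule LN.M.finsum_cong')
    (use x y c in "auto simp: DM.hcomp_add mod_hom_add[OF f] DM.hcomp_closed DN.hcomp_add mod_hom_closed[OF f]")
  also have "\<dots> = ?c x \<oplus>\<^bsub>N\<^esub> ?c y"
   using big[OF x J] big[OF y J] x y c by (subst LN.M.finsum_addf) auto
  finally show ?thesis .
 qed
 have sm: "?c (r \<odot>\<^bsub>M\<^esub> x) = r \<odot>\<^bsub>N\<^esub> ?c x" if r: "r \<in> carrier R" and x: "x \<in> carrier M" for r x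
  using x
 proof (induction x rule: DM.direct_sum_induct)
  case zero
  have "?c \<zero>\<^bsub>M\<^esub> = \<zero>\<^bsub>N\<^esub>" using hhom[OF DM.G_zero[of 0]] mod_hom_zero[OF m(1) n(1) f] by simp
  then show ?case using r by (simp add: LM.smult_r_null LN.smult_r_null)
 next
  case (homog j x)
  note xc = DM.G_sub[OF homog]
  show ?case using r
  proof (induction r rule: DR.direct_sum_induct)
   case zero
   have "?c \<zero>\<^bsub>M\<^esub> = \<zero>\<^bsub>N\<^esub>" using hhom[OF DM.G_zero[of 0]] mod_hom_zero[OF m(1) n(1) f] by simp
   then show ?case using xc by (simp add: LM.smult_l_null LN.smult_l_null closed)
  next
   case (homog i r)
   note rc = DR.G_sub[OF homog]
   have "?c (r \<odot>\<^bsub>M\<^esub> x) = hcomp N NG (int i + j + e) (f (r \<odot>\<^bsub>M\<^esub> x))"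
    using hhom[OF m(3)[OF homog \<open>x \<in> MG j\<close>]] .
   also have "\<dots> = hcomp N NG (int i + (j + e)) (r \<odot>\<^bsub>N\<^esub> f x)" by (simp add: mod_hom_smult[OF f rc xc] add.assoc)
   also have "\<dots> = r \<odot>\<^bsub>N\<^esub> hcomp N NG (j + e) (f x)"
    by (rule hcomp_smult[OF N homog rc mod_hom_closed[OF f xc]])
   finally show ?case using hhom[OF \<open>x \<in> MG j\<close>] by simp
  next
   case (add r s)
   then show ?case using xc by (simp add: LM.smult_l_distr hadd LM.smult_closed LN.smult_l_distr closed)
  qed
 next
  case (add x y)
  then show ?case using r by (simp add: LM.smult_r_distr hadd LM.smult_closed LN.smult_r_distr closed)
 qed
 show "?c \<in> mod_hom R M N" by (rule mod_homI) (use closed hadd sm in auto)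
qed

section \<open>Graded comparison maps\<close>

lemma graded_proj_resolutionD:
 assumes "graded_proj_resolution R G M MG C"
 shows "proj_resolution R M (res_mod C) (res_diff C) (res_aug C)" "graded_module R G M MG"
  "\<And>i. graded_module R G (res_mod C i) (res_grading C i)"
  "\<And>i j x. x \<in> res_grading C (Suc i) j \<Longrightarrow> res_diff C i x \<in> res_grading C i j"
  "\<And>j x. x \<in> res_grading C 0 j \<Longrightarrow> res_aug C x \<in> MG j"
 using assms by (auto simp: graded_proj_resolution_def image_subset_iff)

lemma graded_hom_hcomp:
 assumes M: "direct_sum M MG" "left_module R M" and N: "direct_sum N NG" "left_module R N"
  and f: "f \<in> mod_hom R M N" and fd: "\<And>j x. x \<in> MG j \<Longrightarrow> f x \<in> NG j" and x: "x \<in> carrier M"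
 shows "hcomp N NG j (f x) = f (hcomp M MG j x)"
proof -
 interpret DM: direct_sum M MG by fact
 interpret DN: direct_sum N NG by fact
 show ?thesis using x
 proof (induction x rule: DM.direct_sum_induct)
  case zero
  then show ?case by (simp add: mod_hom_zero[OF M(2) N(2) f])
 next
  case (homog i x)
  then show ?case by (simp add: DM.hcomp_homog[OF homog] DN.hcomp_homog[OF fd[OF homog]] mod_hom_zero[OF M(2) N(2) f])
 next
  case (add x y)
  then show ?case by (simp add: mod_hom_add[OF f] DM.hcomp_add DN.hcomp_add mod_hom_closed[OF f] DM.hcomp_closed)
 qed
qed

text \<open>Take the degree 0 part of an ungraded comparison map. Differentials and augmentations
  preserve degrees, so the chain identities survive the passage to this part.\<close>

lemma graded_comparison:
 fixes C D :: "('r, 'u, 'v) resolution"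
 assumes R: "direct_sum R G" and C: "graded_proj_resolution R G M MG C" and D: "graded_proj_resolution R G M MG D"
 shows "\<exists>f. (\<forall>i. f i \<in> mod_hom R (res_mod C i) (res_mod D i)) \<and>
  (\<forall>i j. \<forall>x\<in>res_grading C i j. f i x \<in> res_grading D i j) \<and>
  (\<forall>x\<in>carrier (res_mod C 0). res_aug D (f 0 x) = res_aug C x) \<and>
  (\<forall>i. \<forall>x\<in>carrier (res_mod C (Suc i)). res_diff D i (f (Suc i) x) = f i (res_diff C i x))"
proof -
 note c = graded_proj_resolutionD[OF C] and d = graded_proj_resolutionD[OF D]
 note cp = proj_resolutionD[OF c(1)] and dp = proj_resolutionD[OF d(1)]
 note cg = graded_moduleD[OF c(3)] and dg = graded_moduleD[OF d(3)] and mg = graded_moduleD[OF c(2)]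
 obtain f where f: "\<And>i. f i \<in> mod_hom R (res_mod C i) (res_mod D i)"
  "\<And>x. x \<in> carrier (res_mod C 0) \<Longrightarrow> res_aug D (f 0 x) = res_aug C x"
  "\<And>i x. x \<in> carrier (res_mod C (Suc i)) \<Longrightarrow> res_diff D i (f (Suc i) x) = f i (res_diff C i x)"
  using proj_resolution_lift[OF c(1) d(1)] by blast
 define f0 where "f0 i = comp_hom (res_mod C i) (res_grading C i) (res_mod D i) (res_grading D i) 0 (f i)" for i
 have f0: "f0 i \<in> mod_hom R (res_mod C i) (res_mod D i)" for i
  unfolding f0_def by (rule comp_hom_hom[OF R c(3) d(3) f(1)])
 have f0h: "f0 i x = hcomp (res_mod D i) (res_grading D i) j (f i x)" if "x \<in> res_grading C i j" for i j x
  unfolding f0_def using comp_hom_homog[OF R c(3) d(3) f(1) that, of 0] by simp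
 have sub: "x \<in> carrier (res_mod C i)" if "x \<in> res_grading C i j" for i j x
  by (rule direct_sum.G_sub[OF cg(2) that])
 show ?thesis
 proof (intro exI conjI allI ballI)
  show "f0 i \<in> mod_hom R (res_mod C i) (res_mod D i)" for i by (rule f0)
  show "f0 i x \<in> res_grading D i j" if "x \<in> res_grading C i j" for i j x
   unfolding f0h[OF that] by (rule direct_sum.hcomp_mem[OF dg(2) mod_hom_closed[OF f(1) sub[OF that]]])
  show "res_aug D (f0 0 x) = res_aug C x" if "x \<in> carrier (res_mod C 0)" for x
  proof (rule mod_hom_eq_on_homog[OF cg(2) cg(1) cp(1) mod_hom_comp[OF f0 dp(5)] cp(5) _ that])
   fix j x assume x: "x \<in> res_grading C 0 j"
   have "res_aug D (f0 0 x) = hcomp M MG j (res_aug D (f 0 x))"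
    unfolding f0h[OF x]
    by (rule graded_hom_hcomp[OF dg(2) dg(1) mg(2) mg(1) dp(5) d(5) mod_hom_closed[OF f(1) sub[OF x]], symmetric])
   also have "\<dots> = res_aug C x"
    using f(2)[OF sub[OF x]] direct_sum.hcomp_homog[OF mg(2) c(5)[OF x], of j] by simp
   finally show "res_aug D (f0 0 x) = res_aug C x" .
  qed
  show "res_diff D i (f0 (Suc i) x) = f0 i (res_diff C i x)" if "x \<in> carrier (res_mod C (Suc i))" for i x
  proof (rule mod_hom_eq_on_homog[OF cg(2) cg(1) dp(3) mod_hom_comp[OF f0 dp(4)] mod_hom_comp[OF cp(4) f0] _ that])
   fix j x assume x: "x \<in> res_grading C (Suc i) j"
   have "res_diff D i (f0 (Suc i) x) = hcomp (res_mod D i) (res_grading D i) j (res_diff D i (f (Suc i) x))"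
    unfolding f0h[OF x]
    by (rule graded_hom_hcomp[OF dg(2) dg(1) dg(2) dg(1) dp(4) d(4) mod_hom_closed[OF f(1) sub[OF x]], symmetric])
   also have "\<dots> = f0 i (res_diff C i x)" using f(3)[OF sub[OF x]] f0h[OF c(4)[OF x]] by simp
   finally show "res_diff D i (f0 (Suc i) x) = f0 i (res_diff C i x)" .
  qed
 qed
qed

text \<open>\<open>proj_resolution_homotopy\<close> for the defect g f - 1, which lies over the zero
  map of M.\<close>

lemma resolution_homotopy:
 fixes P Q :: "nat \<Rightarrow> ('r, 'u) module"
 assumes P: "proj_resolution R M P d aug" and Q: "proj_resolution R M Q d' aug'"
  and f: "\<And>i. f i \<in> mod_hom R (P i) (Q i)" "\<And>x. x \<in> carrier (P 0) \<Longrightarrow> aug' (f 0 x) = aug x"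
   "\<And>i x. x \<in> carrier (P (Suc i)) \<Longrightarrow> d' i (f (Suc i) x) = f i (d i x)"
  and g: "\<And>i. g i \<in> mod_hom R (Q i) (P i)" "\<And>x. x \<in> carrier (Q 0) \<Longrightarrow> aug (g 0 x) = aug' x"
   "\<And>i x. x \<in> carrier (Q (Suc i)) \<Longrightarrow> d i (g (Suc i) x) = g i (d' i x)"
 shows "\<exists>h. (\<forall>i. h i \<in> mod_hom R (P i) (P (Suc i))) \<and>
  (\<forall>x\<in>carrier (P 0). g 0 (f 0 x) = x \<oplus>\<^bsub>P 0\<^esub> d 0 (h 0 x)) \<and>
  (\<forall>i. \<forall>x\<in>carrier (P (Suc i)).
   g (Suc i) (f (Suc i) x) = x \<oplus>\<^bsub>P (Suc i)\<^esub> (d (Suc i) (h (Suc i) x) \<oplus>\<^bsub>P (Suc i)\<^esub> h i (d i x)))"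
proof -
 note p = proj_resolutionD[OF P]
 define u where "u i x = g i (f i x) \<ominus>\<^bsub>P i\<^esub> x" for i x
 have id: "(\<lambda>x. x) \<in> mod_hom R (P i) (P i)" for i by (rule mod_homI) auto
 have u: "u i \<in> mod_hom R (P i) (P i)" for i
  unfolding u_def by (intro mod_hom_minus p(3) mod_hom_comp[OF f(1) g(1)] id)
 have gf: "g i (f i x) \<in> carrier (P i)" if "x \<in> carrier (P i)" for i x
  using mod_hom_closed[OF g(1) mod_hom_closed[OF f(1) that]] .
 have ud: "d i (u (Suc i) x) = u i (d i x)" if x: "x \<in> carrier (P (Suc i))" for i x
  unfolding u_def using mod_hom_diff[OF p(3) p(3) p(4) gf[OF x] x] g(3)[OF mod_hom_closed[OF f(1) x]] f(3)[OF x] by simp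
 have u0: "aug (u 0 x) = \<zero>\<^bsub>M\<^esub>" if x: "x \<in> carrier (P 0)" for x
 proof -
  interpret M: left_module R M by (rule p(1))
  show ?thesis unfolding u_def
   using mod_hom_diff[OF p(3) p(1) p(5) gf[OF x] x] g(2)[OF mod_hom_closed[OF f(1) x]] f(2)[OF x]
    mod_hom_closed[OF p(5) x] by (simp add: a_minus_def M.M.r_neg)
 qed
 obtain h where h: "\<And>i. h i \<in> mod_hom R (P i) (P (Suc i))"
  "\<And>x. x \<in> carrier (P 0) \<Longrightarrow> u 0 x = d 0 (h 0 x)"
  "\<And>i x. x \<in> carrier (P (Suc i)) \<Longrightarrow> u (Suc i) x = d (Suc i) (h (Suc i) x) \<oplus>\<^bsub>P (Suc i)\<^esub> h i (d i x)"
  using proj_resolution_homotopy[OF P P u ud u0] by blast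
 have gfu: "g i (f i x) = x \<oplus>\<^bsub>P i\<^esub> u i x" if x: "x \<in> carrier (P i)" for i x
 proof -
  interpret L: left_module R "P i" by (rule p(3))
  show ?thesis using x gf[OF x] by (simp add: u_def a_minus_def L.M.a_lcomm[of x] L.M.r_neg)
 qed
 show ?thesis using h gfu by (intro exI[of _ h]) auto
qed

section \<open>The modules \<open>Ext\<close> computed by comparison\<close>

lemma op_ring_simps [simp]:
 "carrier (op_ring R) = carrier R" "monoid.mult (op_ring R) = (\<lambda>x y. y \<otimes>\<^bsub>R\<^esub> x)" "one (op_ring R) = one R"
 "zero (op_ring R) = zero R" "add (op_ring R) = add R"
 by (simp_all add: op_ring_def)

lemma ring_op_ring: "ring R \<Longrightarrow> ring (op_ring R)"
proof -
 assume "ring R"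
 then interpret ring R .
 show ?thesis
 proof (rule ringI)
  show "abelian_group (op_ring R)"
  proof (rule abelian_groupI)
   fix x assume "x \<in> carrier (op_ring R)"
   then show "\<exists>y\<in>carrier (op_ring R). y \<oplus>\<^bsub>op_ring R\<^esub> x = \<zero>\<^bsub>op_ring R\<^esub>"
    by (intro bexI[of _ "a_inv R x"]) (auto simp: l_neg)
  qed (auto simp: a_ac)
  show "monoid (op_ring R)" by (rule monoidI) (auto simp: m_assoc)
 qed (auto simp: l_distr r_distr)
qed

lemma finsum_cong_struct:
 fixes M :: "('a, 'm) ring_scheme" and N :: "('a, 'n) ring_scheme"
 assumes "carrier M = carrier N" "add M = add N" "zero M = zero N"
 shows "finsum M f A = finsum N f A"
 using assms by (simp add: finsum_def finprod_def)

lemma is_direct_sum_cong_struct: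
 fixes M :: "('a, 'm) ring_scheme" and N :: "('a, 'n) ring_scheme"
 assumes "carrier M = carrier N" "add M = add N" "zero M = zero N"
 shows "is_direct_sum M G = is_direct_sum N G"
proof -
 have "additive_subgroup H M = additive_subgroup H N" for H
  using assms by (simp add: additive_subgroup_def subgroup_def m_inv_def)
 then show ?thesis unfolding is_direct_sum_def finsum_cong_struct[OF assms] using assms by simp
qed

lemma connected_graded_direct_sum:
 assumes "connected_graded_algebra R K G"
 shows "ring R" "direct_sum R G" "direct_sum (op_ring R) G"
proof -
 show R: "ring R" using assms by (simp add: connected_graded_algebra_def)
 interpret ring R by fact
 interpret S: ring "op_ring R" by (rule ring_op_ring) fact
 have d: "is_direct_sum R G" using assms by (simp add: connected_graded_algebra_def)
 then show "direct_sum R G" by (simp add: direct_sum_def direct_sum_axioms_def abelian_group_axioms)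
 have "is_direct_sum (op_ring R) G" using d is_direct_sum_cong_struct[of "op_ring R" R G] by simp
 then show "direct_sum (op_ring R) G" by (simp add: direct_sum_def direct_sum_axioms_def S.abelian_group_axioms)
qed

lemma int_grading_direct_sum:
 assumes "direct_sum R G" shows "is_direct_sum R (int_grading R G)"
proof -
 interpret direct_sum R G by fact
 show ?thesis unfolding is_direct_sum_def
 proof (intro conjI allI ballI)
  fix j
  show "additive_subgroup (int_grading R G j) R"
  proof (cases "0 \<le> j")
   case True
   then show ?thesis using ds by (simp add: is_direct_sum_def int_grading_def)
  next
   case False
   then show ?thesis using add.triv_subgroup by (simp add: int_grading_def additive_subgroup_def)
  qed
 next
  fix x assume x: "x \<in> carrier R"
  have IG: "int_grading R G (int k) = G k" for k by (simp add: int_grading_def)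
  let ?f = "\<lambda>j. if 0 \<le> j then hcomp R G (nat j) x else \<zero>\<^bsub>R\<^esub>"
  show "\<exists>!f. (\<forall>i. f i \<in> int_grading R G i) \<and> finite {i. f i \<noteq> \<zero>\<^bsub>R\<^esub>} \<and> x = (\<Oplus>\<^bsub>R\<^esub>i\<in>{i. f i \<noteq> \<zero>\<^bsub>R\<^esub>}. f i)"
  proof (rule ex1I[of _ ?f])
   have S: "{i. ?f i \<noteq> \<zero>\<^bsub>R\<^esub>} = int ` {k. hcomp R G k x \<noteq> \<zero>\<^bsub>R\<^esub>}"
    by (auto simp: image_iff split: if_splits) (metis int_nat_eq)
   have "(\<Oplus>\<^bsub>R\<^esub>i\<in>{i. ?f i \<noteq> \<zero>\<^bsub>R\<^esub>}. ?f i) = (\<Oplus>\<^bsub>R\<^esub>k\<in>{k. hcomp R G k x \<noteq> \<zero>\<^bsub>R\<^esub>}. ?f (int k))"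
    unfolding S by (rule finsum_reindex) (use x hcomp_closed in auto)
   also have "\<dots> = x" using hcomp_sum[OF x] by simp
   finally show "(\<forall>i. ?f i \<in> int_grading R G i) \<and> finite {i. ?f i \<noteq> \<zero>\<^bsub>R\<^esub>} \<and> x = (\<Oplus>\<^bsub>R\<^esub>i\<in>{i. ?f i \<noteq> \<zero>\<^bsub>R\<^esub>}. ?f i)"
    using hcomp_mem[OF x] hcomp_finite[OF x] S by (auto simp: int_grading_def)
  next
   fix f assume f: "(\<forall>i. f i \<in> int_grading R G i) \<and> finite {i. f i \<noteq> \<zero>\<^bsub>R\<^esub>} \<and> x = (\<Oplus>\<^bsub>R\<^esub>i\<in>{i. f i \<noteq> \<zero>\<^bsub>R\<^esub>}. f i)"
   have neg: "f j = \<zero>\<^bsub>R\<^esub>" if "\<not> 0 \<le> j" for j using f that by (auto simp: int_grading_def dest: spec[of _ j])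
   have fG: "f (int k) \<in> G k" for k using f IG by metis
   have S: "{i. f i \<noteq> \<zero>\<^bsub>R\<^esub>} = int ` {k. f (int k) \<noteq> \<zero>\<^bsub>R\<^esub>}"
   proof (intro equalityI subsetI)
    fix i assume i: "i \<in> {i. f i \<noteq> \<zero>\<^bsub>R\<^esub>}"
    then have "0 \<le> i" using neg by blast
    then show "i \<in> int ` {k. f (int k) \<noteq> \<zero>\<^bsub>R\<^esub>}" using i by (intro image_eqI[of _ _ "nat i"]) auto
   qed auto
   have fin: "finite {k. f (int k) \<noteq> \<zero>\<^bsub>R\<^esub>}" using f unfolding S by (simp add: finite_image_iff)
   have "(\<Oplus>\<^bsub>R\<^esub>i\<in>{i. f i \<noteq> \<zero>\<^bsub>R\<^esub>}. f i) = (\<Oplus>\<^bsub>R\<^esub>k\<in>{k. f (int k) \<noteq> \<zero>\<^bsub>R\<^esub>}. f (int k))"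
    unfolding S by (rule finsum_reindex) (use fG G_sub in auto)
   then have "x = (\<Oplus>\<^bsub>R\<^esub>k\<in>{k. f (int k) \<noteq> \<zero>\<^bsub>R\<^esub>}. f (int k))" using f by simp
   from hcomp_unique[OF fin fG this] have h: "hcomp R G k x = f (int k)" for k by auto
   show "f = ?f"
   proof
    fix j show "f j = ?f j" using neg[of j] h[of "nat j"] by auto
   qed
  qed
 qed
qed

lemma graded_module_regular:
 assumes "connected_graded_algebra R K G"
 shows "graded_module (op_ring R) G (regular_module (op_ring R)) (int_grading R G)"
 unfolding graded_module_def
proof (intro conjI allI ballI)
 note c = connected_graded_direct_sum[OF assms]
 show "left_module (op_ring R) (regular_module (op_ring R))"
  by (rule left_module_regular[OF ring_op_ring[OF c(1)]])
 show "is_direct_sum (regular_module (op_ring R)) (int_grading R G)"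
  by (rule iffD2[OF is_direct_sum_cong_struct int_grading_direct_sum[OF c(2)]]) simp_all
 interpret R: ring R by (rule c(1))
 interpret D: direct_sum R G by (rule c(2))
 fix i j r x assume rx: "r \<in> G i" "x \<in> int_grading R G j"
 show "r \<odot>\<^bsub>regular_module (op_ring R)\<^esub> x \<in> int_grading R G (int i + j)"
 proof (cases "0 \<le> j")
  case True
  then have "x \<otimes>\<^bsub>R\<^esub> r \<in> G (nat j + i)" using rx assms by (auto simp: int_grading_def connected_graded_algebra_def)
  moreover have "nat (int i + j) = nat j + i" using True by simp
  ultimately show ?thesis using True by (simp add: int_grading_def)
 next
  case False
  then show ?thesis using rx D.G_sub[OF rx(1)] D.G_zero by (simp add: int_grading_def)
 qed
qed

text \<open>C stands for the arbitrary resolution behind \<open>Ext\<close>, and E is a model of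
  length N + 1. The dual of the model is exact below the top; at the top, the only obstruction to
  being a coboundary is the constant term at the generator \<open>et\<close>. Minimality says that
  this term vanishes on coboundaries, and \<phi> is a homogeneous functional with value 1 at
  \<open>et\<close>.\<close>

locale ext_comparison =
 fixes R :: "('r, 'e) ring_scheme" (structure) and K :: "'r set" and G :: "nat \<Rightarrow> 'r set"
  and M :: "('r, 'v) module" and MG and C E :: "('r, 'u, 'v) resolution" and N :: nat and et \<phi>
 assumes cga: "connected_graded_algebra R K G"
  and C: "graded_proj_resolution (op_ring R) G M MG C"
  and E: "graded_proj_resolution (op_ring R) G M MG E"
  and vanish: "i > Suc N \<Longrightarrow> carrier (res_mod E i) = {\<zero>\<^bsub>res_mod E i\<^esub>}"
  and exact0: "\<lbrakk>F \<in> mod_hom (op_ring R) (res_mod E 0) (regular_module (op_ring R));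
    \<And>x. x \<in> carrier (res_mod E (Suc 0)) \<Longrightarrow> F (res_diff E 0 x) = \<zero>; x \<in> carrier (res_mod E 0)\<rbrakk> \<Longrightarrow> F x = \<zero>"
  and exact: "\<lbrakk>F \<in> mod_hom (op_ring R) (res_mod E (Suc i)) (regular_module (op_ring R)); i \<le> N;
    \<And>x. x \<in> carrier (res_mod E (Suc (Suc i))) \<Longrightarrow> F (res_diff E (Suc i) x) = \<zero>;
    i = N \<Longrightarrow> hcomp R G 0 (F et) = \<zero>\<rbrakk> \<Longrightarrow>
   \<exists>\<psi>\<in>mod_hom (op_ring R) (res_mod E i) (regular_module (op_ring R)).
    \<forall>x\<in>carrier (res_mod E (Suc i)). F x = \<psi> (res_diff E i x)"
  and et: "et \<in> res_grading E (Suc N) (int (Suc N))"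
  and \<phi>: "\<phi> \<in> mod_hom (op_ring R) (res_mod E (Suc N)) (regular_module (op_ring R))"
   "\<And>j x. x \<in> res_grading E (Suc N) j \<Longrightarrow> \<phi> x \<in> int_grading R G (j - int (Suc N))" "\<phi> et = \<one>"
  and minimal: "\<psi> \<in> mod_hom (op_ring R) (res_mod E N) (regular_module (op_ring R)) \<Longrightarrow>
   hcomp R G 0 (\<psi> (res_diff E N et)) = \<zero>"
begin

abbreviation "S \<equiv> op_ring R"
abbreviation "NN \<equiv> regular_module (op_ring R)"
abbreviation "NG \<equiv> int_grading R G"
abbreviation "CC i \<equiv> carrier (res_mod C i)"
abbreviation "Ch i \<equiv> carrier (cochains R G C i)"
abbreviation "DD i \<equiv> dual_deg R G (res_mod C i) (res_grading C i)"
abbreviation "ZZ \<equiv> cocycles R G C"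
abbreviation "BB \<equiv> coboundaries R G C"
abbreviation "HH \<equiv> cohomology R G C"
abbreviation "zf i \<equiv> (\<lambda>x\<in>CC i. \<zero>)"

lemmas cd = graded_proj_resolutionD[OF C]
lemmas ed = graded_proj_resolutionD[OF E]
lemmas cp = proj_resolutionD[OF cd(1)]
lemmas ep = proj_resolutionD[OF ed(1)]
lemmas cg = graded_moduleD[OF cd(3)]
lemmas eg = graded_moduleD[OF ed(3)]
lemmas ng = graded_moduleD[OF graded_module_regular[OF cga]]

sublocale R: ring R by (rule connected_graded_direct_sum[OF cga])
sublocale D: direct_sum R G by (rule connected_graded_direct_sum[OF cga])
sublocale NL: left_module S NN by (rule ng(1))
sublocale ND: direct_sum NN NG by (rule ng(2))

lemma DS: "direct_sum S G" by (rule connected_graded_direct_sum[OF cga])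

lemma finsum_NN: "finsum NN f A = finsum R f A"
 by (rule finsum_cong_struct) simp_all

lemma C_sub: "x \<in> res_grading C i j \<Longrightarrow> x \<in> CC i"
 by (rule direct_sum.G_sub[OF cg(2)])

lemma hom_R: "F \<in> mod_hom S P NN \<Longrightarrow> x \<in> carrier P \<Longrightarrow> F x \<in> carrier R"
 using mod_hom_closed[of F S P NN x] by simp

lemma hom_cong: "\<lbrakk>F \<in> mod_hom S (res_mod C i) NN; \<And>x. x \<in> CC i \<Longrightarrow> F' x = F x\<rbrakk> \<Longrightarrow> F' \<in> mod_hom S (res_mod C i) NN"
 by (rule mod_hom_cong[OF cp(3)])

text \<open>Finite sums of homogeneous maps are the homomorphisms with one finite set X of degrees
  outside which all their components vanish. This form makes closure under sums and under
  composition with degree-preserving maps immediate; conversely, the parts \<open>comp_hom\<close>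
  over X add up to F.\<close>

lemma cochain_iff:
 "F \<in> Ch i \<longleftrightarrow> F \<in> mod_hom S (res_mod C i) NN \<and> F \<in> extensional (CC i) \<and>
  (\<exists>X. finite X \<and> (\<forall>j. \<forall>x\<in>res_grading C i j. \<forall>e. e \<notin> X \<longrightarrow> hcomp NN NG (j + e) (F x) = \<zero>))"
proof
 assume "F \<in> Ch i"
 then obtain X H where F: "F = (\<lambda>x\<in>CC i. \<Oplus>e\<in>X. H e x)" and X: "finite X"
  and H: "\<And>e. e \<in> X \<Longrightarrow> H e \<in> DD i e"
  by (auto simp: cochains_def dual_module_def)
 have Hh: "H e \<in> mod_hom S (res_mod C i) NN" if "e \<in> X" for e using H[OF that] by (simp add: dual_deg_def)
 have hom: "(\<lambda>x. \<Oplus>e\<in>Y. H e x) \<in> mod_hom S (res_mod C i) NN" if "finite Y" "Y \<subseteq> X" for Y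
  using that
 proof (induction Y rule: finite_induct)
  case empty
  then show ?case using mod_hom_const_zero[OF ng(1), of "res_mod C i"] by simp
 next
  case (insert e Y)
  have "(\<lambda>x. H e x \<oplus>\<^bsub>NN\<^esub> (\<Oplus>e\<in>Y. H e x)) \<in> mod_hom S (res_mod C i) NN"
   using insert Hh by (intro mod_hom_plus ng(1)) auto
  moreover have "(\<Oplus>e\<in>insert e Y. H e x) = H e x \<oplus> (\<Oplus>e\<in>Y. H e x)" if "x \<in> CC i" for x
   by (rule R.finsum_insert) (use insert.hyps insert.prems hom_R[OF Hh that] in "auto simp: subset_iff")
  ultimately show ?case by (rule_tac hom_cong) simp_all
 qed
 have Fh: "F \<in> mod_hom S (res_mod C i) NN" by (rule hom_cong[OF hom[OF X order_refl]]) (simp add: F)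
 have ext: "F \<in> extensional (CC i)" by (simp add: F)
 have "hcomp NN NG (j + e) (F x) = \<zero>" if x: "x \<in> res_grading C i j" and e: "e \<notin> X" for j x e
 proof -
  note xc = C_sub[OF x]
  have "F x = (\<Oplus>\<^bsub>NN\<^esub>k\<in>(+) j ` X. H (k - j) x)"
  proof -
   have "(\<Oplus>k\<in>(+) j ` X. H (k - j) x) = (\<Oplus>e\<in>X. H (j + e - j) x)"
    by (rule R.finsum_reindex) (use hom_R[OF Hh xc] in auto)
   then show ?thesis using xc by (simp add: finsum_NN F)
  qed
  moreover have "H (k - j) x \<in> NG k" if k: "k \<in> (+) j ` X" for k
  proof -
   obtain e where "e \<in> X" "k = j + e" using k by blast
   then show ?thesis using H[of e] x by (auto simp: dual_deg_def image_subset_iff)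
  qed
  ultimately have "hcomp NN NG (j + e) (F x) = (if j + e \<in> (+) j ` X then H (j + e - j) x else \<zero>\<^bsub>NN\<^esub>)"
   using X by (intro ND.hcomp_unique) auto
  then show ?thesis using e by auto
 qed
 then show "F \<in> mod_hom S (res_mod C i) NN \<and> F \<in> extensional (CC i) \<and>
  (\<exists>X. finite X \<and> (\<forall>j. \<forall>x\<in>res_grading C i j. \<forall>e. e \<notin> X \<longrightarrow> hcomp NN NG (j + e) (F x) = \<zero>))"
  using Fh X ext by blast
next
 assume "F \<in> mod_hom S (res_mod C i) NN \<and> F \<in> extensional (CC i) \<and>
  (\<exists>X. finite X \<and> (\<forall>j. \<forall>x\<in>res_grading C i j. \<forall>e. e \<notin> X \<longrightarrow> hcomp NN NG (j + e) (F x) = \<zero>))"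
 then obtain X where F: "F \<in> mod_hom S (res_mod C i) NN" "F \<in> extensional (CC i)"
  and X: "finite X" "\<And>j x e. x \<in> res_grading C i j \<Longrightarrow> e \<notin> X \<Longrightarrow> hcomp NN NG (j + e) (F x) = \<zero>" by blast
 define H where "H e = (\<lambda>x\<in>CC i. comp_hom (res_mod C i) (res_grading C i) NN NG e F x)" for e
 have ch: "comp_hom (res_mod C i) (res_grading C i) NN NG e F \<in> mod_hom S (res_mod C i) NN" for e
  by (rule comp_hom_hom[OF DS cd(3) graded_module_regular[OF cga] F(1)])
 have chh: "comp_hom (res_mod C i) (res_grading C i) NN NG e F x = hcomp NN NG (j + e) (F x)"
  if "x \<in> res_grading C i j" for e j x
  by (rule comp_hom_homog[OF DS cd(3) graded_module_regular[OF cga] F(1) that])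
 have Hh: "H e \<in> mod_hom S (res_mod C i) NN" for e by (rule hom_cong[OF ch]) (simp add: H_def)
 have Hd: "H e \<in> DD i e" for e
  using Hh C_sub ND.hcomp_mem hom_R[OF F(1)]
  by (auto simp: dual_deg_def H_def chh)
 have "F x = (\<Oplus>e\<in>X. H e x)" if x: "x \<in> CC i" for x
  using x
 proof (induction x rule: direct_sum.direct_sum_induct[OF cg(2), consumes 1, case_names zero homog add])
  case zero
  have "H e \<zero>\<^bsub>res_mod C i\<^esub> = \<zero>" for e using mod_hom_zero[OF cp(3) ng(1) Hh] by simp
  then show ?case using mod_hom_zero[OF cp(3) ng(1) F(1)] R.finsum_zero by simp
 next
  case (homog j x)
  note xc = C_sub[OF homog] and Fx = hom_R[OF F(1) C_sub[OF homog]]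
  have "F x = (\<Oplus>\<^bsub>NN\<^esub>k\<in>(+) j ` X. hcomp NN NG k (F x))"
  proof (rule ND.hcomp_sum_superset)
   show "{k. hcomp NN NG k (F x) \<noteq> \<zero>\<^bsub>NN\<^esub>} \<subseteq> (+) j ` X"
   proof
    fix k assume "k \<in> {k. hcomp NN NG k (F x) \<noteq> \<zero>\<^bsub>NN\<^esub>}"
    then have "k - j \<in> X" using X(2)[OF homog, of "k - j"] by auto
    then show "k \<in> (+) j ` X" by (intro image_eqI[of _ _ "k - j"]) auto
   qed
  qed (use Fx X in auto)
  also have "\<dots> = (\<Oplus>\<^bsub>NN\<^esub>e\<in>X. hcomp NN NG (j + e) (F x))"
   by (rule NL.M.finsum_reindex) (use ND.hcomp_closed Fx in auto)
  also have "\<dots> = (\<Oplus>\<^bsub>NN\<^esub>e\<in>X. H e x)"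
   by (rule NL.M.finsum_cong') (use xc hom_R[OF Hh xc] in "auto simp: H_def chh[OF homog]")
  finally show ?case by (simp add: finsum_NN)
 next
  case (add x y)
  have "(\<Oplus>e\<in>X. H e (x \<oplus>\<^bsub>res_mod C i\<^esub> y)) = (\<Oplus>e\<in>X. H e x \<oplus> H e y)"
   by (rule R.finsum_cong') (use mod_hom_add[OF Hh add(1,2)] hom_R[OF Hh] add in auto)
  also have "\<dots> = (\<Oplus>e\<in>X. H e x) \<oplus> (\<Oplus>e\<in>X. H e y)"
   by (rule R.finsum_addf) (use hom_R[OF Hh] add in auto)
  finally show ?case using mod_hom_add[OF F(1) add(1,2)] add by simp
 qed
 then have "F = (\<lambda>x\<in>CC i. \<Oplus>e\<in>X. H e x)"
  using F(2) by (intro ext) (auto simp: extensional_def)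
 then show "F \<in> Ch i"
  using X(1) Hd by (auto simp: cochains_def dual_module_def)
qed

lemma cochain_hom: "F \<in> Ch i \<Longrightarrow> F \<in> mod_hom S (res_mod C i) NN"
 and cochain_ext: "F \<in> Ch i \<Longrightarrow> F \<in> extensional (CC i)"
 by (simp_all only: cochain_iff)

lemma cochains_simps:
 "add (cochains R G C i) = (\<lambda>f g. \<lambda>x\<in>CC i. f x \<oplus> g x)"
 "zero (cochains R G C i) = (zf i)"
 "smult (cochains R G C i) = (\<lambda>r f. \<lambda>x\<in>CC i. r \<otimes> f x)"
 by (simp_all add: cochains_def dual_module_def)

lemma cochain_lin:
 assumes F: "F \<in> Ch i" and H: "H \<in> Ch i"
 shows "(\<lambda>x\<in>CC i. F x \<oplus> H x) \<in> Ch i"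
  and "(\<lambda>x\<in>CC i. \<ominus> F x) \<in> Ch i"
  and "(zf i) \<in> Ch i"
proof -
 note Fh = cochain_hom[OF F] and Hh = cochain_hom[OF H]
 obtain X where X: "finite X" "\<And>j x e. x \<in> res_grading C i j \<Longrightarrow> e \<notin> X \<Longrightarrow> hcomp NN NG (j + e) (F x) = \<zero>"
  using F unfolding cochain_iff by blast
 obtain Y where Y: "finite Y" "\<And>j x e. x \<in> res_grading C i j \<Longrightarrow> e \<notin> Y \<Longrightarrow> hcomp NN NG (j + e) (H x) = \<zero>"
  using H unfolding cochain_iff by blast
 show "(\<lambda>x\<in>CC i. F x \<oplus> H x) \<in> Ch i"
  unfolding cochain_iff
 proof (intro conjI exI[of _ "X \<union> Y"] allI ballI impI)
  show "(\<lambda>x\<in>CC i. F x \<oplus> H x) \<in> mod_hom S (res_mod C i) NN"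
   using hom_cong[OF mod_hom_plus[OF ng(1) Fh Hh]] by simp
  fix j x e assume x: "x \<in> res_grading C i j" and e: "e \<notin> X \<union> Y"
  then show "hcomp NN NG (j + e) ((\<lambda>x\<in>CC i. F x \<oplus> H x) x) = \<zero>"
   using ND.hcomp_add[of "F x" "H x" "j + e"] C_sub[OF x] hom_R[OF Fh] hom_R[OF Hh] X(2) Y(2) by simp
 qed (use X Y in auto)
 show "(\<lambda>x\<in>CC i. \<ominus> F x) \<in> Ch i"
  unfolding cochain_iff
 proof (intro conjI exI[of _ X] allI ballI impI)
  have neg: "\<ominus>\<^bsub>NN\<^esub> y = \<ominus> y" if "y \<in> carrier R" for y
   using NL.M.minus_equality[of "\<ominus> y" y] that by (simp add: R.l_neg)
  show "(\<lambda>x\<in>CC i. \<ominus> F x) \<in> mod_hom S (res_mod C i) NN"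
   using hom_cong[OF mod_hom_uminus[OF ng(1) Fh]] neg hom_R[OF Fh] by simp
  fix j x e assume x: "x \<in> res_grading C i j" and e: "e \<notin> X"
  have Fx: "F x \<in> carrier R" using hom_R[OF Fh C_sub[OF x]] .
  have "hcomp NN NG (j + e) (F x \<oplus>\<^bsub>NN\<^esub> \<ominus> F x) = hcomp NN NG (j + e) (F x) \<oplus>\<^bsub>NN\<^esub> hcomp NN NG (j + e) (\<ominus> F x)"
   by (rule ND.hcomp_add) (use Fx in auto)
  then have "hcomp NN NG (j + e) (\<ominus> F x) = \<zero>"
   using X(2)[OF x e] Fx ND.hcomp_zero ND.hcomp_closed[of "\<ominus> F x" "j + e"] by (simp add: R.r_neg)
  then show "hcomp NN NG (j + e) ((\<lambda>x\<in>CC i. \<ominus> F x) x) = \<zero>"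
   using C_sub[OF x] by simp
 qed (use X in auto)
 show "(zf i) \<in> Ch i"
  unfolding cochain_iff
 proof (intro conjI exI[of _ "{}"] allI ballI impI)
  show "(zf i) \<in> mod_hom S (res_mod C i) NN"
   using hom_cong[OF mod_hom_const_zero[OF ng(1)]] by simp
  fix j x e assume x: "x \<in> res_grading C i j"
  then show "hcomp NN NG (j + e) ((zf i) x) = \<zero>"
   using C_sub[OF x] ND.hcomp_zero by simp
 qed auto
qed

lemma dual_deg_cochain:
 assumes F: "F \<in> DD i e" shows "F \<in> Ch i"
proof -
 have "F = (\<lambda>x\<in>CC i. \<Oplus>e'\<in>{e}. F x)"
 proof
  fix x show "F x = (\<lambda>x\<in>CC i. \<Oplus>e'\<in>{e}. F x) x"
   using F hom_R[of F "res_mod C i" x] by (auto simp: dual_deg_def extensional_def)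
 qed
 then show ?thesis using F unfolding cochains_def dual_module_def
  by simp (intro exI[of _ "{e}"] exI[of _ "\<lambda>_. F"], auto)
qed

lemma cochain_zero: "(zf i) \<in> Ch i"
proof -
 have "(zf i) \<in> DD i 0"
  using hom_cong[OF mod_hom_const_zero[OF ng(1)], of i "\<lambda>x\<in>CC i. \<zero>"] ND.G_zero C_sub
  by (auto simp: dual_deg_def)
 then show ?thesis by (rule dual_deg_cochain)
qed

text \<open>The comparison maps f and g are fixed once and for all, because \<open>ev\<close> below
  refers to g.\<close>

definition f :: "nat \<Rightarrow> 'u \<Rightarrow> 'u" where
 "f = (SOME f. (\<forall>i. f i \<in> mod_hom S (res_mod C i) (res_mod E i)) \<and>
  (\<forall>i j. \<forall>x\<in>res_grading C i j. f i x \<in> res_grading E i j) \<and>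
  (\<forall>x\<in>CC 0. res_aug E (f 0 x) = res_aug C x) \<and>
  (\<forall>i. \<forall>x\<in>CC (Suc i). res_diff E i (f (Suc i) x) = f i (res_diff C i x)))"

definition g :: "nat \<Rightarrow> 'u \<Rightarrow> 'u" where
 "g = (SOME g. (\<forall>i. g i \<in> mod_hom S (res_mod E i) (res_mod C i)) \<and>
  (\<forall>i j. \<forall>x\<in>res_grading E i j. g i x \<in> res_grading C i j) \<and>
  (\<forall>x\<in>carrier (res_mod E 0). res_aug C (g 0 x) = res_aug E x) \<and>
  (\<forall>i. \<forall>x\<in>carrier (res_mod E (Suc i)). res_diff C i (g (Suc i) x) = g i (res_diff E i x)))"

lemma f: "f i \<in> mod_hom S (res_mod C i) (res_mod E i)" "x \<in> res_grading C i j \<Longrightarrow> f i x \<in> res_grading E i j"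
  "x \<in> CC 0 \<Longrightarrow> res_aug E (f 0 x) = res_aug C x"
  "x \<in> CC (Suc i) \<Longrightarrow> res_diff E i (f (Suc i) x) = f i (res_diff C i x)"
 using someI_ex[OF graded_comparison[OF DS C E]] unfolding f_def[symmetric] by blast+

lemma g: "g i \<in> mod_hom S (res_mod E i) (res_mod C i)" "x \<in> res_grading E i j \<Longrightarrow> g i x \<in> res_grading C i j"
  "x \<in> carrier (res_mod E 0) \<Longrightarrow> res_aug C (g 0 x) = res_aug E x"
  "x \<in> carrier (res_mod E (Suc i)) \<Longrightarrow> res_diff C i (g (Suc i) x) = g i (res_diff E i x)"
 using someI_ex[OF graded_comparison[OF DS E C]] unfolding g_def[symmetric] by blast+

text \<open>The constant term of a cochain at the image of the generator \<open>et\<close> in C. On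
  top cocycles it induces the isomorphism of the cohomology with \<open>R\<^sub>0\<close>.\<close>

definition ev :: "('u \<Rightarrow> 'r) \<Rightarrow> 'r" where "ev F = hcomp R G 0 (F (g (Suc N) et))"

lemma et_carrier: "et \<in> carrier (res_mod E (Suc N))"
 by (rule direct_sum.G_sub[OF eg(2) et])

lemma gt_carrier: "g (Suc N) et \<in> CC (Suc N)"
 by (rule mod_hom_closed[OF g(1) et_carrier])

text \<open>Pull F back along g to the model, where exactness writes it as \<psi> d. Since g f = 1 +
  d h + h d and F kills boundaries, F = H d with H = \<psi> f - F h. This H may have infinitely many
  homogeneous parts, but F has parts in the finite set X only, so the parts of H with degrees in X
  suffice; their sum is a cochain.\<close>

lemma cocycle_coboundary:
 assumes F: "F \<in> ZZ i" and e: "i = Suc N \<Longrightarrow> ev F = \<zero>"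
 shows "F \<in> BB i"
proof -
 have Fc: "F \<in> Ch i" and Fd: "\<And>x. x \<in> CC (Suc i) \<Longrightarrow> F (res_diff C i x) = \<zero>"
  using F by (auto simp: cocycles_def)
 note Fh = cochain_hom[OF Fc]
 obtain h where h: "\<And>i. h i \<in> mod_hom S (res_mod C i) (res_mod C (Suc i))"
  "\<And>x. x \<in> CC 0 \<Longrightarrow> g 0 (f 0 x) = x \<oplus>\<^bsub>res_mod C 0\<^esub> res_diff C 0 (h 0 x)"
  "\<And>i x. x \<in> CC (Suc i) \<Longrightarrow> g (Suc i) (f (Suc i) x) = x \<oplus>\<^bsub>res_mod C (Suc i)\<^esub>
   (res_diff C (Suc i) (h (Suc i) x) \<oplus>\<^bsub>res_mod C (Suc i)\<^esub> h i (res_diff C i x))"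
  using resolution_homotopy[OF cd(1) ed(1) f(1,3,4) g(1,3,4)] by blast
 have Fg: "(\<lambda>x. F (g i x)) \<in> mod_hom S (res_mod E i) NN" by (rule mod_hom_comp[OF g(1) Fh])
 have Fgd: "F (g i (res_diff E i x)) = \<zero>" if "x \<in> carrier (res_mod E (Suc i))" for x
  using g(4)[OF that] Fd[OF mod_hom_closed[OF g(1) that]] by simp
 have Fdh: "F (res_diff C i (h i x)) = \<zero>" if "x \<in> CC i" for x
  by (rule Fd[OF mod_hom_closed[OF h(1) that]])
 show ?thesis
 proof (cases i)
  case 0
  have "F x = \<zero>" if x: "x \<in> CC 0" for x
  proof -
   have "F (g 0 (f 0 x)) = \<zero>"
    using exact0[OF Fg[unfolded 0] _ mod_hom_closed[OF f(1) x]] Fgd unfolding 0 by blast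
   moreover have "F (g 0 (f 0 x)) = F x \<oplus> F (res_diff C 0 (h 0 x))"
    unfolding h(2)[OF x] using mod_hom_add[OF Fh[unfolded 0] x mod_hom_closed[OF cp(4) mod_hom_closed[OF h(1) x]]] by simp
   ultimately show ?thesis using Fdh[unfolded 0, OF x] hom_R[OF Fh[unfolded 0] x] by simp
  qed
  then have "F = (\<lambda>x\<in>CC 0. \<zero>)"
   using cochain_ext[OF Fc] 0 by (intro ext) (auto simp: extensional_def)
  then show ?thesis using 0 by (simp add: cochains_simps)
 next
  case (Suc k)
  have "\<exists>\<psi>\<in>mod_hom S (res_mod E k) NN. \<forall>x\<in>carrier (res_mod E (Suc k)). F (g (Suc k) x) = \<psi> (res_diff E k x)"
  proof (cases "k \<le> N")
   case True
   show ?thesis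
    by (rule exact[OF Fg[unfolded Suc] True]) (use Fgd e Suc in "auto simp: ev_def")
  next
   case False
   have "F (g (Suc k) x) = \<zero>" if "x \<in> carrier (res_mod E (Suc k))" for x
    using vanish[of "Suc k"] False that mod_hom_zero[OF ep(3) ng(1) Fg] Suc by simp
   then show ?thesis using mod_hom_const_zero[OF ng(1), of "res_mod E k"] by (intro bexI[of _ "\<lambda>_. \<zero>\<^bsub>NN\<^esub>"]) auto
  qed
  then obtain \<psi> where \<psi>: "\<psi> \<in> mod_hom S (res_mod E k) NN"
   "\<And>x. x \<in> carrier (res_mod E (Suc k)) \<Longrightarrow> F (g (Suc k) x) = \<psi> (res_diff E k x)" by blast
  define H where "H x = \<psi> (f k x) \<ominus>\<^bsub>NN\<^esub> F (h k x)" for x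
  have Hh: "H \<in> mod_hom S (res_mod C k) NN" unfolding H_def
   by (rule mod_hom_minus[OF ng(1) mod_hom_comp[OF f(1) \<psi>(1)] mod_hom_comp[OF h(1) Fh[unfolded Suc]]])
  have HF: "H (res_diff C k x) = F x" if x: "x \<in> CC (Suc k)" for x
  proof -
   let ?d = "res_diff C k x"
   have dc: "?d \<in> CC k" by (rule mod_hom_closed[OF cp(4) x])
   have hd: "h k ?d \<in> CC (Suc k)" by (rule mod_hom_closed[OF h(1) dc])
   have dh: "res_diff C (Suc k) (h (Suc k) x) \<in> CC (Suc k)"
    by (rule mod_hom_closed[OF cp(4) mod_hom_closed[OF h(1) x]])
   interpret CL: left_module S "res_mod C (Suc k)" by (rule cp(3))
   have "\<psi> (f k ?d) = F (g (Suc k) (f (Suc k) x))"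
    using \<psi>(2)[OF mod_hom_closed[OF f(1) x]] f(4)[OF x] by simp
   also have "\<dots> = F x \<oplus> (F (res_diff C (Suc k) (h (Suc k) x)) \<oplus> F (h k ?d))"
    unfolding h(3)[OF x] using x dh hd mod_hom_add[OF Fh[unfolded Suc]] by simp
   also have "\<dots> = F x \<oplus> F (h k ?d)"
    using Fdh[unfolded Suc, OF x] hom_R[OF Fh[unfolded Suc] hd] by simp
   finally have "H ?d = (F x \<oplus>\<^bsub>NN\<^esub> F (h k ?d)) \<ominus>\<^bsub>NN\<^esub> F (h k ?d)" by (simp add: H_def)
   also have "\<dots> = F x"
    using hom_R[OF Fh[unfolded Suc] hd] hom_R[OF Fh[unfolded Suc] x]
     NL.M.a_assoc[of "F x" "F (h k ?d)" "\<ominus>\<^bsub>NN\<^esub> F (h k ?d)"] NL.M.r_neg[of "F (h k ?d)"] NL.M.a_inv_closed[of "F (h k ?d)"]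
    by (simp add: a_minus_def)
   finally show ?thesis .
  qed
  obtain X where X: "finite X" "\<And>j x e. x \<in> res_grading C i j \<Longrightarrow> e \<notin> X \<Longrightarrow> hcomp NN NG (j + e) (F x) = \<zero>"
   using Fc unfolding cochain_iff by blast
  define L where "L e = (\<lambda>x\<in>CC k. comp_hom (res_mod C k) (res_grading C k) NN NG e H x)" for e
  have ch: "comp_hom (res_mod C k) (res_grading C k) NN NG e H \<in> mod_hom S (res_mod C k) NN" for e
   by (rule comp_hom_hom[OF DS cd(3) graded_module_regular[OF cga] Hh])
  have Lh: "L e \<in> mod_hom S (res_mod C k) NN" for e by (rule hom_cong[OF ch]) (simp add: L_def)
  have Lx: "L e x = hcomp NN NG (j + e) (H x)" if "x \<in> res_grading C k j" for e j x
   using comp_hom_homog[OF DS cd(3) graded_module_regular[OF cga] Hh that] C_sub[OF that] by (simp add: L_def)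
  have Ld: "L e \<in> DD k e" for e
  proof -
   have "L e \<in> extensional (CC k)" by (simp add: L_def)
   moreover have "L e x \<in> NG (j + e)" if "x \<in> res_grading C k j" for j x
    unfolding Lx[OF that] by (rule ND.hcomp_mem) (use hom_R[OF Hh C_sub[OF that]] in simp)
   ultimately show ?thesis using Lh by (auto simp: dual_deg_def)
  qed
  define L' where "L' = (\<lambda>x\<in>CC k. \<Oplus>e\<in>X. L e x)"
  have L'c: "L' \<in> Ch k"
   using X(1) Ld by (auto simp: cochains_def dual_module_def L'_def)
  have "L' (res_diff C k x) = F x" if x: "x \<in> CC (Suc k)" for x
  proof (rule mod_hom_eq_on_homog[OF cg(2) cg(1) ng(1) mod_hom_comp[OF cp(4) cochain_hom[OF L'c]] Fh[unfolded Suc] _ x])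
   fix j x assume x: "x \<in> res_grading C (Suc k) j"
   note xc = C_sub[OF x] and dx = cd(4)[OF x]
   have Fx: "F x \<in> carrier R" using hom_R[OF Fh[unfolded Suc] xc] .
   have "L' (res_diff C k x) = (\<Oplus>e\<in>X. L e (res_diff C k x))" using C_sub[OF dx] by (simp add: L'_def)
   also have "\<dots> = (\<Oplus>e\<in>X. hcomp NN NG (j + e) (F x))"
    unfolding Lx[OF dx] HF[OF xc] ..
   also have "\<dots> = (\<Oplus>\<^bsub>NN\<^esub>k\<in>(+) j ` X. hcomp NN NG k (F x))"
    unfolding finsum_NN by (rule R.finsum_reindex[symmetric]) (use ND.hcomp_closed Fx in auto)
   also have "\<dots> = F x"
   proof (rule ND.hcomp_sum_superset[symmetric])
    show "{k. hcomp NN NG k (F x) \<noteq> \<zero>\<^bsub>NN\<^esub>} \<subseteq> (+) j ` X"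
    proof
     fix l assume "l \<in> {k. hcomp NN NG k (F x) \<noteq> \<zero>\<^bsub>NN\<^esub>}"
     then have "l - j \<in> X" using X(2)[unfolded Suc, OF x, of "l - j"] by auto
     then show "l \<in> (+) j ` X" by (intro image_eqI[of _ _ "l - j"]) auto
    qed
   qed (use Fx X in auto)
   finally show "L' (res_diff C k x) = F x" .
  qed
  then have "F = (\<lambda>x\<in>CC (Suc k). L' (res_diff C k x))"
   using cochain_ext[OF Fc] Suc by (intro ext) (auto simp: extensional_def)
  then show ?thesis using L'c Suc by auto
 qed
qed

lemma coboundary_cochain:
 assumes "F \<in> BB i" shows "F \<in> Ch i"
proof (cases i)
 case 0
 then show ?thesis using assms cochain_zero by (simp add: cochains_simps)
next
 case (Suc k)
 then obtain H where H: "H \<in> Ch k" and F: "F = (\<lambda>x\<in>CC (Suc k). H (res_diff C k x))"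
  using assms by auto
 obtain X where X: "finite X" "\<And>j x e. x \<in> res_grading C k j \<Longrightarrow> e \<notin> X \<Longrightarrow> hcomp NN NG (j + e) (H x) = \<zero>"
  using H unfolding cochain_iff by blast
 have "F \<in> mod_hom S (res_mod C (Suc k)) NN"
  by (rule hom_cong[OF mod_hom_comp[OF cp(4) cochain_hom[OF H]]]) (simp add: F)
 then show ?thesis unfolding cochain_iff Suc
  using X C_sub cd(4) by (auto simp: F intro!: exI[of _ X])
qed

lemma coboundary_cocycle:
 assumes "F \<in> BB i" shows "F \<in> ZZ i"
proof -
 have "F (res_diff C i x) = \<zero>" if x: "x \<in> CC (Suc i)" for x
 proof (cases i)
  case 0
  then show ?thesis using assms mod_hom_closed[OF cp(4) x] by (simp add: cochains_simps)
 next
  case (Suc k)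
  then obtain H where H: "H \<in> Ch k" and F: "F = (\<lambda>x\<in>CC (Suc k). H (res_diff C k x))"
   using assms by auto
  show ?thesis using x mod_hom_closed[OF cp(4) x] cp(10)[of x k] mod_hom_zero[OF cp(3) ng(1) cochain_hom[OF H]]
   by (simp add: F Suc)
 qed
 then show ?thesis using coboundary_cochain[OF assms] by (simp add: cocycles_def)
qed

section \<open>Cosets of coboundaries and the cohomology modules\<close>

abbreviation "plus_on i F H \<equiv> (\<lambda>x\<in>CC i. F x \<oplus> H x)"

lemma coboundary_lin:
 assumes F: "F \<in> BB i" and H: "H \<in> BB i"
 shows "plus_on i F H \<in> BB i"
  and "(\<lambda>x\<in>CC i. \<ominus> F x) \<in> BB i"
proof -
 have "plus_on i F H \<in> BB i \<and> (\<lambda>x\<in>CC i. \<ominus> F x) \<in> BB i"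
 proof (cases i)
  case 0
  then show ?thesis using F H by (auto simp: cochains_simps cong: restrict_cong)
 next
  case (Suc k)
  then obtain F' H' where *: "F' \<in> Ch k" "F = (\<lambda>x\<in>CC (Suc k). F' (res_diff C k x))"
   "H' \<in> Ch k" "H = (\<lambda>x\<in>CC (Suc k). H' (res_diff C k x))"
   using F H by auto
  have d: "res_diff C k x \<in> CC k" if "x \<in> CC (Suc k)" for x
   by (rule mod_hom_closed[OF cp(4) that])
  have 1: "plus_on i F H = (\<lambda>x\<in>CC (Suc k). plus_on k F' H' (res_diff C k x))"
   using d by (auto simp: *(2,4) Suc fun_eq_iff)
  have 2: "(\<lambda>x\<in>CC i. \<ominus> F x) =
   (\<lambda>x\<in>CC (Suc k). (\<lambda>x\<in>CC k. \<ominus> F' x) (res_diff C k x))"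
   using d by (auto simp: *(2) Suc fun_eq_iff)
  show ?thesis unfolding 1 2 unfolding Suc coboundaries.simps
   using cochain_lin[OF *(1,3)] by blast
 qed
 then show "plus_on i F H \<in> BB i"
  "(\<lambda>x\<in>CC i. \<ominus> F x) \<in> BB i" by blast+
qed

lemma zero_coboundary: "(zf i) \<in> BB i"
proof (cases i)
 case 0
 then show ?thesis by (simp add: cochains_simps)
next
 case (Suc k)
 have d: "res_diff C k x \<in> CC k" if "x \<in> CC (Suc k)" for x
  by (rule mod_hom_closed[OF cp(4) that])
 have "(zf i) = (\<lambda>x\<in>CC (Suc k). (\<lambda>x\<in>CC k. \<zero>) (res_diff C k x))"
  using d by (auto simp: Suc fun_eq_iff)
 then show ?thesis unfolding Suc coboundaries.simps using cochain_zero by blast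
qed

definition coset :: "nat \<Rightarrow> ('u \<Rightarrow> 'r) \<Rightarrow> ('u \<Rightarrow> 'r) set" where
 "coset i F = {plus_on i h F | h. h \<in> BB i}"

lemma cohomology_carrier: "carrier (HH i) = coset i ` ZZ i"
 and cohomology_zero: "\<zero>\<^bsub>HH i\<^esub> = BB i"
 and cohomology_add: "X \<oplus>\<^bsub>HH i\<^esub> Y = {plus_on i F H | F H. F \<in> X \<and> H \<in> Y}"
 and cohomology_smult: "r \<odot>\<^bsub>HH i\<^esub> X = (\<Union>F\<in>X. coset i (\<lambda>x\<in>CC i. r \<otimes> F x))"
 and cohomology_grading_eq: "cohomology_grading R G C i e =
  coset i ` (ZZ i \<inter> DD i e)"
proof -
 have c: "coset i F = a_r_coset (cochains R G C i\<lparr>carrier := Z\<rparr>) (BB i) F" for F Z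
  by (auto simp: coset_def a_r_coset_def r_coset_def cochains_simps)
 have c': "coset i F = a_r_coset (cochains R G C i) (BB i) F" for F
  by (auto simp: coset_def a_r_coset_def r_coset_def cochains_simps)
 show "carrier (HH i) = coset i ` ZZ i"
  by (auto simp: cohomology_def quot_module_def A_RCOSETS_def RCOSETS_def c[of _ "ZZ i"] a_r_coset_def)
 show "\<zero>\<^bsub>HH i\<^esub> = BB i"
  by (simp add: cohomology_def quot_module_def)
 show "X \<oplus>\<^bsub>HH i\<^esub> Y = {plus_on i F H | F H. F \<in> X \<and> H \<in> Y}"
  by (auto simp: cohomology_def quot_module_def set_add_def set_mult_def cochains_simps)
 show "r \<odot>\<^bsub>HH i\<^esub> X = (\<Union>F\<in>X. coset i (\<lambda>x\<in>CC i. r \<otimes> F x))"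
  by (simp add: cohomology_def quot_module_def c[of _ "ZZ i"] cochains_simps)
 show "cohomology_grading R G C i e =
  coset i ` (ZZ i \<inter> DD i e)"
  by (simp add: cohomology_grading_def c')
qed

lemma coset_eqI:
 assumes F: "F \<in> Ch i" and H: "H \<in> Ch i"
  and b: "(\<lambda>x\<in>CC i. F x \<ominus> H x) \<in> BB i"
 shows "coset i F \<subseteq> coset i H"
proof
 fix L assume "L \<in> coset i F"
 then obtain h where h: "h \<in> BB i" "L = plus_on i h F" by (auto simp: coset_def)
 have "L = plus_on i (plus_on i h (\<lambda>x\<in>CC i. F x \<ominus> H x)) H"
 proof
  fix x
  have "h x \<in> carrier R" "F x \<in> carrier R" "H x \<in> carrier R" if "x \<in> CC i"
   using hom_R[OF cochain_hom[OF F] that] hom_R[OF cochain_hom[OF H] that]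
    hom_R[OF cochain_hom[OF coboundary_cochain[OF h(1)]] that] by auto
  then show "L x = plus_on i (plus_on i h (\<lambda>x\<in>CC i. F x \<ominus> H x)) H x"
   by (auto simp: h(2) a_minus_def R.a_assoc R.l_neg)
 qed
 then show "L \<in> coset i H" unfolding coset_def using coboundary_lin(1)[OF h(1) b] by blast
qed

lemma coset_self: "F \<in> Ch i \<Longrightarrow> F \<in> coset i F"
proof -
 assume F: "F \<in> Ch i"
 have "F = plus_on i (zf i) F"
  using cochain_ext[OF F] hom_R[OF cochain_hom[OF F]] by (intro ext) (auto simp: extensional_def)
 then show ?thesis using zero_coboundary unfolding coset_def by blast
qed

lemma coset_eq_iff:
 assumes F: "F \<in> Ch i" and H: "H \<in> Ch i"
  and b: "(\<lambda>x\<in>CC i. F x \<ominus> H x) \<in> BB i"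
 shows "coset i F = coset i H"
proof
 show "coset i F \<subseteq> coset i H" by (rule coset_eqI[OF F H b])
 have "(\<lambda>x\<in>CC i. \<ominus> ((\<lambda>x\<in>CC i. F x \<ominus> H x) x)) = (\<lambda>x\<in>CC i. H x \<ominus> F x)"
  using hom_R[OF cochain_hom[OF F]] hom_R[OF cochain_hom[OF H]]
  by (intro ext) (auto simp: a_minus_def R.minus_add R.a_comm)
 then show "coset i H \<subseteq> coset i F" using coset_eqI[OF H F] coboundary_lin(2)[OF b b] by simp
qed

lemma zero_coset: "coset i (zf i) = BB i"
proof -
 have "plus_on i h (zf i) = h" if "h \<in> BB i" for h
  using cochain_ext[OF coboundary_cochain[OF that]] hom_R[OF cochain_hom[OF coboundary_cochain[OF that]]]
  by (intro ext) (auto simp: extensional_def)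
 then show ?thesis unfolding coset_def Setcompr_eq_image by (simp only: cong: image_cong) (simp only: image_ident)
qed

lemma cocycle_diff:
 assumes F: "F \<in> ZZ i" and H: "H \<in> ZZ i"
 shows "(\<lambda>x\<in>CC i. F x \<ominus> H x) \<in> ZZ i"
proof -
 have Fc: "F \<in> Ch i" and Hc: "H \<in> Ch i" using F H by (auto simp: cocycles_def)
 have "(\<lambda>x\<in>CC i. F x \<ominus> H x) = plus_on i F (\<lambda>x\<in>CC i. \<ominus> H x)"
  by (auto simp: a_minus_def fun_eq_iff)
 then have "(\<lambda>x\<in>CC i. F x \<ominus> H x) \<in> Ch i"
  using cochain_lin(1)[OF Fc cochain_lin(2)[OF Hc Hc]] by simp
 then show ?thesis using F H mod_hom_closed[OF cp(4)] by (auto simp: cocycles_def a_minus_def)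
qed

lemma zero_cocycle: "(zf i) \<in> ZZ i"
 by (rule coboundary_cocycle[OF zero_coboundary])

theorem cohomology_trivial:
 assumes "i \<noteq> Suc N" shows "carrier (HH i) = {\<zero>\<^bsub>HH i\<^esub>}"
proof -
 have "coset i F = BB i" if F: "F \<in> ZZ i" for F
 proof -
  have Fc: "F \<in> Ch i" using F by (simp add: cocycles_def)
  have "(\<lambda>x\<in>CC i. F x \<ominus> (zf i) x) \<in> BB i"
   by (rule cocycle_coboundary[OF cocycle_diff[OF F zero_cocycle]]) (use assms in simp)
  from coset_eq_iff[OF Fc cochain_zero this] show ?thesis by (simp only: zero_coset)
 qed
 then show ?thesis using zero_cocycle by (force simp: cohomology_carrier cohomology_zero)
qed

lemma hcomp0_mult:
 assumes r: "r \<in> carrier R" and y: "y \<in> carrier R"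
 shows "hcomp R G 0 (r \<otimes> y) = hcomp R G 0 r \<otimes> hcomp R G 0 y"
 using r
proof (induction r rule: D.direct_sum_induct)
 case zero
 then show ?case using y D.hcomp_closed by simp
next
 case (homog i r)
 show ?case using y
 proof (induction y rule: D.direct_sum_induct)
  case zero
  then show ?case using D.G_sub[OF homog] D.hcomp_closed by simp
 next
  case (homog j y)
  have "r \<otimes> y \<in> G (i + j)" using cga homog \<open>r \<in> G i\<close> by (simp add: connected_graded_algebra_def)
  then show ?case
   using D.hcomp_homog[of "r \<otimes> y" "i + j" 0] D.hcomp_homog[OF \<open>r \<in> G i\<close>, of 0] D.hcomp_homog[OF homog, of 0]
    D.G_sub[OF homog] D.G_sub[OF \<open>r \<in> G i\<close>] by auto
 next
  case (add y z)
  then show ?case using D.G_sub[OF homog]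
   by (simp add: R.r_distr D.hcomp_add D.hcomp_closed)
 qed
next
 case (add r s)
 then show ?case using y by (simp add: R.l_distr D.hcomp_add D.hcomp_closed)
qed

lemma ev_coboundary:
 assumes "h \<in> BB (Suc N)" shows "ev h = \<zero>"
proof -
 obtain H where H: "H \<in> Ch N" and h: "h = (\<lambda>x\<in>CC (Suc N). H (res_diff C N x))"
  using assms by auto
 have "h (g (Suc N) et) = H (g N (res_diff E N et))" using gt_carrier g(4)[OF et_carrier] by (simp add: h)
 then show ?thesis using minimal[OF mod_hom_comp[OF g(1) cochain_hom[OF H]]] by (simp add: ev_def)
qed

lemma ev_plus:
 assumes "F \<in> Ch (Suc N)" "H \<in> Ch (Suc N)"
 shows "ev (plus_on (Suc N) F H) = ev F \<oplus> ev H"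
 using gt_carrier hom_R[OF cochain_hom[OF assms(1)]] hom_R[OF cochain_hom[OF assms(2)]]
 by (simp add: ev_def D.hcomp_add)

lemma ev_coset:
 assumes F: "F \<in> Ch (Suc N)" and H: "H \<in> coset (Suc N) F" shows "ev H = ev F"
proof -
 obtain h where h: "h \<in> BB (Suc N)" "H = plus_on (Suc N) h F" using H by (auto simp: coset_def)
 then show ?thesis
  using ev_plus[OF coboundary_cochain[OF h(1)] F] ev_coboundary[OF h(1)] hom_R[OF cochain_hom[OF F] gt_carrier]
  by (simp add: ev_def D.hcomp_closed)
qed

text \<open>\<open>ev\<close> is constant on cosets of coboundaries, so any representative will
  do.\<close>

definition cls :: "('u \<Rightarrow> 'r) set \<Rightarrow> 'r" where "cls X = ev (SOME F. F \<in> X)"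

lemma cls_coset:
 assumes F: "F \<in> Ch (Suc N)" shows "cls (coset (Suc N) F) = ev F"
 unfolding cls_def by (rule ev_coset[OF F someI[of "\<lambda>H. H \<in> coset (Suc N) F", OF coset_self[OF F]]])

text \<open>Every class occurs. The multiple of \<phi> f by c is a cocycle because E vanishes above
  degree N + 1. Since f g = 1 + d k + k d and d k vanishes at \<open>et\<close>, the value of \<phi>
  f g at \<open>et\<close> is 1 plus the value of \<phi> k on the differential of \<open>et\<close>,
  and minimality removes the constant part of the latter.\<close>

lemma \<phi>f_cocycle:
 assumes c: "c \<in> G 0"
 defines "F \<equiv> \<lambda>x\<in>CC (Suc N). c \<otimes> \<phi> (f (Suc N) x)"
 shows "F \<in> ZZ (Suc N) \<inter> DD (Suc N) (- int (Suc N))"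
  and "ev F = c"
proof -
 have cR: "c \<in> carrier R" by (rule D.G_sub[OF c])
 have \<phi>f: "(\<lambda>x. \<phi> (f (Suc N) x)) \<in> mod_hom S (res_mod C (Suc N)) NN" by (rule mod_hom_comp[OF f(1) \<phi>(1)])
 have "(\<lambda>x. c \<otimes> \<phi> (f (Suc N) x)) \<in> mod_hom S (res_mod C (Suc N)) NN"
  by (rule mod_homI)
   (use hom_R[OF \<phi>f] mod_hom_add[OF \<phi>f] mod_hom_smult[OF \<phi>f] cR in "auto simp: R.r_distr R.m_assoc")
 then have Fh: "F \<in> mod_hom S (res_mod C (Suc N)) NN" by (rule hom_cong) (simp add: F_def)
 have "F x \<in> NG (j + - int (Suc N))" if x: "x \<in> res_grading C (Suc N) j" for j x
 proof -
  have p: "\<phi> (f (Suc N) x) \<in> NG (j - int (Suc N))" by (rule \<phi>(2)[OF f(2)[OF x]])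
  have "c \<otimes> y \<in> NG k" if "y \<in> NG k" for y k
  proof (cases "0 \<le> k")
   case True
   then have "c \<otimes> y \<in> G (0 + nat k)" using that c cga by (simp only: connected_graded_algebra_def int_grading_def if_True)
   then show ?thesis using True by (simp add: int_grading_def)
  qed (use that cR in "simp add: int_grading_def")
  from this[OF p] show ?thesis using C_sub[OF x] by (simp add: F_def algebra_simps)
 qed
 moreover have "F \<in> extensional (CC (Suc N))" by (simp add: F_def)
 ultimately have d: "F \<in> DD (Suc N) (- int (Suc N))"
  using Fh unfolding dual_deg_def by blast
 have "F (res_diff C (Suc N) x) = \<zero>" if x: "x \<in> CC (Suc (Suc N))" for x
 proof -
  have "f (Suc (Suc N)) x = \<zero>\<^bsub>res_mod E (Suc (Suc N))\<^esub>" using vanish[of "Suc (Suc N)"] mod_hom_closed[OF f(1) x] by simp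
  then have "f (Suc N) (res_diff C (Suc N) x) = \<zero>\<^bsub>res_mod E (Suc N)\<^esub>"
   using f(4)[OF x] mod_hom_zero[OF ep(3) ep(3) ep(4)] by simp
  then show ?thesis using mod_hom_closed[OF cp(4) x] mod_hom_zero[OF ep(3) ng(1) \<phi>(1)] cR by (simp add: F_def)
 qed
 then show "F \<in> ZZ (Suc N) \<inter> DD (Suc N) (- int (Suc N))"
  using d dual_deg_cochain[OF d] by (simp add: cocycles_def)
 obtain k where k: "\<And>i. k i \<in> mod_hom S (res_mod E i) (res_mod E (Suc i))"
  "\<And>i x. x \<in> carrier (res_mod E (Suc i)) \<Longrightarrow> f (Suc i) (g (Suc i) x) = x \<oplus>\<^bsub>res_mod E (Suc i)\<^esub>
   (res_diff E (Suc i) (k (Suc i) x) \<oplus>\<^bsub>res_mod E (Suc i)\<^esub> k i (res_diff E i x))"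
  using resolution_homotopy[OF ed(1) cd(1) g(1,3,4) f(1,3,4)] by blast
 interpret EL: left_module S "res_mod E (Suc N)" by (rule ep(3))
 have kd: "k N (res_diff E N et) \<in> carrier (res_mod E (Suc N))"
  by (rule mod_hom_closed[OF k(1) mod_hom_closed[OF ep(4) et_carrier]])
 have "k (Suc N) et = \<zero>\<^bsub>res_mod E (Suc (Suc N))\<^esub>" using vanish[of "Suc (Suc N)"] mod_hom_closed[OF k(1) et_carrier] by simp
 then have "res_diff E (Suc N) (k (Suc N) et) = \<zero>\<^bsub>res_mod E (Suc N)\<^esub>" using mod_hom_zero[OF ep(3) ep(3) ep(4)] by simp
 then have "f (Suc N) (g (Suc N) et) = et \<oplus>\<^bsub>res_mod E (Suc N)\<^esub> k N (res_diff E N et)"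
  using k(2)[OF et_carrier] kd by simp
 then have "\<phi> (f (Suc N) (g (Suc N) et)) = \<one> \<oplus> \<phi> (k N (res_diff E N et))"
  using mod_hom_add[OF \<phi>(1) et_carrier kd] \<phi>(3) by simp
 moreover have "hcomp R G 0 (\<phi> (k N (res_diff E N et))) = \<zero>"
  by (rule minimal[OF mod_hom_comp[OF k(1) \<phi>(1)]])
 moreover have one: "\<one> \<in> G 0"
 proof -
  have "\<phi> et \<in> NG 0" using \<phi>(2)[OF et] by simp
  then show ?thesis using \<phi>(3) by (simp add: int_grading_def)
 qed
 ultimately have "hcomp R G 0 (\<phi> (f (Suc N) (g (Suc N) et))) = \<one>"
  using D.hcomp_add[of "\<one>" "\<phi> (k N (res_diff E N et))" 0] D.hcomp_homog[OF one, of 0] hom_R[OF \<phi>(1) kd] by simp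
 then show "ev F = c"
  using gt_carrier hcomp0_mult[OF cR hom_R[OF \<phi>f gt_carrier]] D.hcomp_homog[OF c, of 0] cR by (simp add: ev_def F_def)
qed

text \<open>Injectivity of \<open>cls\<close> is \<open>cocycle_coboundary\<close>, and surjectivity
  comes from the cocycles built out of \<phi>. The shift is N + 1 because \<open>et\<close> has that
  degree, which puts the dual class in degree -(N + 1). A cocycle of any other degree takes at
  \<open>et\<close> a value that is 0 or homogeneous of positive degree, so it has no constant
  term.\<close>

theorem cohomology_top:
 "graded_iso R (HH (Suc N)) (cohomology_grading R G C (Suc N))
  (trivial_module R G) (shift (trivial_grading R G) (int (Suc N)))"
 unfolding graded_iso_def
proof (intro bexI[of _ cls] conjI allI)
 let ?Z = "ZZ (Suc N)"
 have Zc: "F \<in> Ch (Suc N)" if "F \<in> ?Z" for F using that by (simp add: cocycles_def)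
 have Zh: "F x \<in> carrier R" if "F \<in> ?Z" "x \<in> CC (Suc N)" for F x
  by (rule hom_R[OF cochain_hom[OF Zc[OF that(1)]] that(2)])
 have tm: "carrier (trivial_module R G) = G 0" "add (trivial_module R G) = add R"
  "r \<odot>\<^bsub>trivial_module R G\<^esub> c = hcomp R G 0 r \<otimes> c" for r c by (simp_all add: trivial_module_def)
 have evG: "ev F \<in> G 0" if "F \<in> ?Z" for F
  unfolding ev_def by (rule D.hcomp_mem[OF Zh[OF that gt_carrier]])
 have clsZ: "cls (coset (Suc N) F) = ev F" if "F \<in> ?Z" for F by (rule cls_coset[OF Zc[OF that]])
 show "cls \<in> mod_hom R (HH (Suc N)) (trivial_module R G)"
 proof (rule mod_homI)
  fix X assume "X \<in> carrier (HH (Suc N))"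
  then show "cls X \<in> carrier (trivial_module R G)" using clsZ evG by (auto simp: cohomology_carrier tm)
 next
  fix X Y assume "X \<in> carrier (HH (Suc N))" "Y \<in> carrier (HH (Suc N))"
  then obtain F H where F: "F \<in> ?Z" "X = coset (Suc N) F" and H: "H \<in> ?Z" "Y = coset (Suc N) H"
   by (auto simp: cohomology_carrier)
  let ?W = "X \<oplus>\<^bsub>HH (Suc N)\<^esub> Y"
  have cc: "A \<in> Ch (Suc N)" if "A \<in> coset (Suc N) B" "B \<in> ?Z" for A B
   using that cochain_lin(1)[OF coboundary_cochain Zc[OF that(2)]] by (auto simp: coset_def)
  have evW: "ev L = ev F \<oplus> ev H" if "L \<in> ?W" for L
  proof -
   from that obtain A B where AB: "A \<in> X" "B \<in> Y" "L = plus_on (Suc N) A B" by (auto simp: cohomology_add)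
   then have "ev L = ev A \<oplus> ev B" using ev_plus cc F H by simp
   then show ?thesis using AB(1,2) F(2) H(2) ev_coset[OF Zc[OF F(1)]] ev_coset[OF Zc[OF H(1)]] by simp
  qed
  have "plus_on (Suc N) F H \<in> ?W"
   using coset_self[OF Zc[OF F(1)]] coset_self[OF Zc[OF H(1)]] F H by (auto simp: cohomology_add)
  then have "cls ?W = ev F \<oplus> ev H" unfolding cls_def by (rule someI2[of "\<lambda>F. F \<in> ?W", OF _ evW])
  then show "cls ?W = cls X \<oplus>\<^bsub>trivial_module R G\<^esub> cls Y" using clsZ F H by (simp add: tm)
 next
  fix r X assume r: "r \<in> carrier R" and "X \<in> carrier (HH (Suc N))"
  then obtain F where F: "F \<in> ?Z" "X = coset (Suc N) F" by (auto simp: cohomology_carrier)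
  let ?W = "r \<odot>\<^bsub>HH (Suc N)\<^esub> X"
  have cc: "A \<in> Ch (Suc N)" if "A \<in> X" for A
   using that cochain_lin(1)[OF coboundary_cochain Zc[OF F(1)]] by (auto simp: coset_def F(2))
  have evr: "ev (plus_on (Suc N) h (\<lambda>x\<in>CC (Suc N). r \<otimes> A x)) = hcomp R G 0 r \<otimes> ev F"
   if A: "A \<in> X" and h: "h \<in> BB (Suc N)" for A h
  proof -
   have AR: "A (g (Suc N) et) \<in> carrier R" by (rule hom_R[OF cochain_hom[OF cc[OF A]] gt_carrier])
   have hR: "h (g (Suc N) et) \<in> carrier R" by (rule hom_R[OF cochain_hom[OF coboundary_cochain[OF h]] gt_carrier])
   have "ev (plus_on (Suc N) h (\<lambda>x\<in>CC (Suc N). r \<otimes> A x)) =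
    ev h \<oplus> hcomp R G 0 r \<otimes> ev A"
    using gt_carrier AR hR r by (simp add: ev_def D.hcomp_add hcomp0_mult)
   moreover have "ev A = ev F" using ev_coset[OF Zc[OF F(1)]] A F(2) by simp
   ultimately show ?thesis using ev_coboundary[OF h] r D.hcomp_closed D.G_sub[OF evG[OF F(1)]] by simp
  qed
  have evW: "ev L = hcomp R G 0 r \<otimes> ev F" if "L \<in> ?W" for L
   using that evr by (auto simp: cohomology_smult coset_def)
  have "plus_on (Suc N) (zf (Suc N)) (\<lambda>x\<in>CC (Suc N). r \<otimes> F x) \<in> ?W"
   unfolding cohomology_smult F(2)
   by (rule UN_I[OF coset_self[OF Zc[OF F(1)]]], unfold coset_def, rule CollectI,
     rule exI, rule conjI[OF refl zero_coboundary])
  then have "cls ?W = hcomp R G 0 r \<otimes> ev F" unfolding cls_def by (rule someI2[of "\<lambda>F. F \<in> ?W", OF _ evW])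
  then show "cls ?W = r \<odot>\<^bsub>trivial_module R G\<^esub> cls X" using clsZ F by (simp add: tm)
 qed
 show "bij_betw cls (carrier (HH (Suc N))) (carrier (trivial_module R G))"
  unfolding bij_betw_def
 proof
  show "inj_on cls (carrier (HH (Suc N)))"
  proof (rule inj_onI)
   fix X Y assume "X \<in> carrier (HH (Suc N))" "Y \<in> carrier (HH (Suc N))" and eq: "cls X = cls Y"
   then obtain F H where F: "F \<in> ?Z" "X = coset (Suc N) F" and H: "H \<in> ?Z" "Y = coset (Suc N) H"
    by (auto simp: cohomology_carrier)
   let ?D = "\<lambda>x\<in>CC (Suc N). F x \<ominus> H x"
   have D: "?D \<in> ?Z" by (rule cocycle_diff[OF F(1) H(1)])
   have pd: "plus_on (Suc N) ?D H = F"
    using Zh[OF F(1)] Zh[OF H(1)] cochain_ext[OF Zc[OF F(1)]]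
    by (intro ext) (auto simp: a_minus_def R.a_assoc R.l_neg extensional_def)
   have "ev F = ev ?D \<oplus> ev H" using ev_plus[OF Zc[OF D] Zc[OF H(1)]] unfolding pd .
   moreover have "ev F = ev H" using eq clsZ F H by simp
   ultimately have "ev ?D = \<zero>"
    using D.G_sub[OF evG[OF D]] D.G_sub[OF evG[OF H(1)]] by (simp add: R.add.r_cancel_one')
   then have "?D \<in> BB (Suc N)" by (intro cocycle_coboundary[OF D])
   then show "X = Y" using coset_eq_iff[OF Zc[OF F(1)] Zc[OF H(1)]] F H by simp
  qed
  show "cls ` carrier (HH (Suc N)) = carrier (trivial_module R G)"
  proof
   show "cls ` carrier (HH (Suc N)) \<subseteq> carrier (trivial_module R G)"
    using clsZ evG by (auto simp: cohomology_carrier tm)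
   show "carrier (trivial_module R G) \<subseteq> cls ` carrier (HH (Suc N))"
   proof
    fix c assume "c \<in> carrier (trivial_module R G)"
    then have c: "c \<in> G 0" by (simp add: tm)
    show "c \<in> cls ` carrier (HH (Suc N))"
     unfolding cohomology_carrier using \<phi>f_cocycle(2)[OF c] clsZ[OF IntD1[OF \<phi>f_cocycle(1)[OF c]]]
     by (intro image_eqI[OF _ imageI[OF IntD1[OF \<phi>f_cocycle(1)[OF c]]]]) simp
   qed
  qed
 qed
 fix j
 show "cls ` cohomology_grading R G C (Suc N) j = shift (trivial_grading R G) (int (Suc N)) j"
 proof (cases "j = - int (Suc N)")
  case True
  have "cls ` cohomology_grading R G C (Suc N) j = G 0"
  proof
   show "cls ` cohomology_grading R G C (Suc N) j \<subseteq> G 0"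
    using clsZ evG by (auto simp: cohomology_grading_eq)
   show "G 0 \<subseteq> cls ` cohomology_grading R G C (Suc N) j"
   proof
    fix c assume c: "c \<in> G 0"
    show "c \<in> cls ` cohomology_grading R G C (Suc N) j"
     unfolding cohomology_grading_eq True using \<phi>f_cocycle(2)[OF c] clsZ[OF IntD1[OF \<phi>f_cocycle(1)[OF c]]]
     by (intro image_eqI[OF _ imageI[OF \<phi>f_cocycle(1)[OF c]]]) simp
   qed
  qed
  then show ?thesis using True by (simp add: shift_def trivial_grading_def)
 next
  case False
  have z: "ev F = \<zero>" if F: "F \<in> DD (Suc N) j" for F
  proof -
   have "F (g (Suc N) et) \<in> NG (int (Suc N) + j)" using F g(2)[OF et] by (auto simp: dual_deg_def)
   then consider "F (g (Suc N) et) = \<zero>" | "F (g (Suc N) et) \<in> G (nat (int (Suc N) + j))" "nat (int (Suc N) + j) \<noteq> 0"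
    using False by (auto simp: int_grading_def split: if_splits)
   then show ?thesis by cases (auto simp: ev_def D.hcomp_homog)
  qed
  have zd: "(zf (Suc N)) \<in> ?Z \<inter> DD (Suc N) j"
   using zero_cocycle cochain_hom[OF cochain_zero] ND.G_zero C_sub by (auto simp: dual_deg_def)
  have "cls ` cohomology_grading R G C (Suc N) j = {\<zero>}"
  proof
   show "cls ` cohomology_grading R G C (Suc N) j \<subseteq> {\<zero>}"
    using clsZ z by (auto simp: cohomology_grading_eq)
   have "cls (coset (Suc N) (zf (Suc N))) = \<zero>"
    using clsZ[OF IntD1[OF zd]] z[OF IntD2[OF zd]] by (rule trans)
   then show "{\<zero>} \<subseteq> cls ` cohomology_grading R G C (Suc N) j"
    unfolding cohomology_grading_eq using imageI[OF imageI[OF zd, of "coset (Suc N)"], of cls] by simp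
  qed
  then show ?thesis using False by (simp add: shift_def trivial_grading_def)
 qed
qed

end

declare One_nat_def [simp del]

section \<open>The Koszul resolution of the trivial module\<close>

lemma abelian_group_type:
 fixes M :: "('a::ab_group_add, 'm) ring_scheme"
 assumes "add M = (+)" "zero M = 0" "0 \<in> carrier M"
  and "\<And>x y. \<lbrakk>x \<in> carrier M; y \<in> carrier M\<rbrakk> \<Longrightarrow> x + y \<in> carrier M"
  and "\<And>x. x \<in> carrier M \<Longrightarrow> - x \<in> carrier M"
 shows "abelian_group M"
proof (rule abelian_groupI)
 fix x assume "x \<in> carrier M"
 then show "\<exists>y\<in>carrier M. y \<oplus>\<^bsub>M\<^esub> x = \<zero>\<^bsub>M\<^esub>" using assms by (intro bexI[of _ "- x"]) auto
qed (use assms in "auto simp: algebra_simps")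

lemma finsum_type:
 fixes M :: "('a::ab_group_add, 'm) ring_scheme"
 assumes "abelian_group M" "add M = (+)" "zero M = 0" and "\<And>i. i \<in> A \<Longrightarrow> f i \<in> carrier M"
 shows "finsum M f A = sum f A"
proof -
 interpret abelian_group M by fact
 show ?thesis using assms(4)
 proof (induction A rule: infinite_finite_induct)
  case (infinite A)
  then show ?case using finsum_infinite[of A f] assms(3) by simp
 next
  case (insert i A)
  have "finsum M f (insert i A) = f i \<oplus>\<^bsub>M\<^esub> finsum M f A"
   by (rule finsum_insert) (use insert in auto)
  then show ?case using insert assms(2) by (simp only: sum.insert insert_iff simp_thms)
 qed (simp only: finsum_empty sum.empty assms(3))
qed

text \<open>A module of functions graded by a degree of the coordinates: \<open>G i\<close> consists of the
 elements whose nonzero coordinates \<open>co x z\<close> have \<open>deg z = i\<close>.\<close>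

lemma is_direct_sum_coordinates:
 fixes M :: "('a::ab_group_add, 'm) ring_scheme" and co :: "'a \<Rightarrow> 'z \<Rightarrow> 'k::field" and deg :: "'z \<Rightarrow> 'i"
 assumes M: "abelian_group M" "add M = (+)" "zero M = 0"
  and co_add: "\<And>x y z. co (x + y) z = co x z + co y z"
  and co_inj: "\<And>x y. (\<And>z. co x z = co y z) \<Longrightarrow> x = y"
  and fin: "\<And>x. x \<in> carrier M \<Longrightarrow> finite {z. co x z \<noteq> 0}"
  and pr: "\<And>i x. x \<in> carrier M \<Longrightarrow> pr i x \<in> carrier M" "\<And>i x z. co (pr i x) z = (if deg z = i then co x z else 0)"
  and G: "\<And>i. G i = {x \<in> carrier M. \<forall>z. co x z \<noteq> 0 \<longrightarrow> deg z = i}"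
 shows "is_direct_sum M G" "x \<in> carrier M \<Longrightarrow> hcomp M G i x = pr i x"
proof -
 interpret M: abelian_group M by fact
 have co0: "co 0 z = 0" for z using co_add[of 0 0 z] by (metis add_0 add_cancel_right_right)
 have co_neg: "co (- x) z = - co x z" for x z using co_add[of x "- x" z] co0[of z] by (simp add: eq_neg_iff_add_eq_0 add.commute)
 have co_sum: "co (sum f A) z = (\<Sum>i\<in>A. co (f i) z)" for f z and A :: "'i set"
  by (rule additive_sum[of "\<lambda>x. co x z"]) (rule co0, rule co_add)
 have fs: "finsum M f A = sum f A" if "\<And>i. i \<in> A \<Longrightarrow> f i \<in> carrier M" for f and A :: "'i set"
  by (rule finsum_type[OF M that])
 have prG: "pr i x \<in> G i" if "x \<in> carrier M" for i x using pr(1)[OF that] by (auto simp: G pr(2))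
 have neg: "\<ominus>\<^bsub>M\<^esub> x = - x" and negM: "- x \<in> carrier M" if "x \<in> carrier M" for x
 proof -
  have "x + \<ominus>\<^bsub>M\<^esub> x = 0" using M.r_neg[OF that] M(2,3) by simp
  then show "\<ominus>\<^bsub>M\<^esub> x = - x" using minus_unique by metis
  then show "- x \<in> carrier M" using M.a_inv_closed[OF that] by simp
 qed
 have pr_eq: "pr i x = (if i \<in> A then f i else 0)" if "finite A" "\<And>i. i \<in> A \<Longrightarrow> f i \<in> G i" "x = sum f A" for f A x i
 proof (rule co_inj)
  fix z
  have "co x z = (\<Sum>j\<in>A. if j = deg z then co (f j) z else 0)"
   unfolding that(3) co_sum by (intro sum.cong refl) (use that(2) in "auto simp: G")
  then have "co x z = (if deg z \<in> A then co (f (deg z)) z else 0)" using that(1) by simp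
  then show "co (pr i x) z = co (if i \<in> A then f i else 0) z"
   using that(2) by (auto simp: pr(2) co0 G)
 qed
 have main: "finite {i. pr i x \<noteq> 0} \<and> x = (\<Sum>i\<in>{i. pr i x \<noteq> 0}. pr i x)" if x: "x \<in> carrier M" for x
 proof
  have nz: "deg z \<in> {i. pr i x \<noteq> 0}" if "co x z \<noteq> 0" for z
   using pr(2)[of "deg z" x z] co0[of z] that by auto
  have "{i. pr i x \<noteq> 0} \<subseteq> deg ` {z. co x z \<noteq> 0}"
  proof
   fix i assume "i \<in> {i. pr i x \<noteq> 0}"
   then obtain z where "co (pr i x) z \<noteq> co 0 z" using co_inj by blast
   then show "i \<in> deg ` {z. co x z \<noteq> 0}" by (auto simp: pr(2) co0 split: if_splits)
  qed
  then show F: "finite {i. pr i x \<noteq> 0}" using fin[OF x] finite_subset by blast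
  show "x = (\<Sum>i\<in>{i. pr i x \<noteq> 0}. pr i x)"
  proof (rule co_inj)
   fix z
   have "co (\<Sum>i\<in>{i. pr i x \<noteq> 0}. pr i x) z = (\<Sum>i\<in>{i. pr i x \<noteq> 0}. if i = deg z then co x z else 0)"
    unfolding co_sum pr(2) by (intro sum.cong refl) auto
   also have "\<dots> = (if deg z \<in> {i. pr i x \<noteq> 0} then co x z else 0)" using F by simp
   also have "\<dots> = co x z" using nz[of z] by auto
   finally show "co x z = co (\<Sum>i\<in>{i. pr i x \<noteq> 0}. pr i x) z" ..
  qed
 qed
 show ds: "is_direct_sum M G" unfolding is_direct_sum_def
 proof (intro conjI allI ballI)
  fix i
  have c: "0 \<in> carrier M" "x + y \<in> carrier M" if "x \<in> carrier M" "y \<in> carrier M" for x y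
   using M.zero_closed M.a_closed[OF that] M(2,3) by auto
  show "additive_subgroup (G i) M" unfolding additive_subgroup_def
  proof (rule subgroup.intro)
   fix x y assume xy: "x \<in> G i" "y \<in> G i"
   have "deg z = i" if z: "co (x + y) z \<noteq> 0" for z
    using z xy unfolding co_add G by (cases "co x z = 0") auto
   then show "x \<otimes>\<^bsub>add_monoid M\<^esub> y \<in> G i" using xy c(2)[of x y] by (simp add: G M(2))
  next
   fix x assume x: "x \<in> G i"
   then have "inv\<^bsub>add_monoid M\<^esub> x = - x" using neg[of x] by (simp add: G a_inv_def)
   then show "inv\<^bsub>add_monoid M\<^esub> x \<in> G i" using x negM[of x] by (simp add: G co_neg)
  qed (use M.zero_closed in "auto simp: G M(3) co0")
 next
  fix x assume x: "x \<in> carrier M"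
  show "\<exists>!f. (\<forall>i. f i \<in> G i) \<and> finite {i. f i \<noteq> \<zero>\<^bsub>M\<^esub>} \<and> x = (\<Oplus>\<^bsub>M\<^esub>i\<in>{i. f i \<noteq> \<zero>\<^bsub>M\<^esub>}. f i)"
  proof (rule ex1I[of _ "\<lambda>i. pr i x"])
   show "(\<forall>i. pr i x \<in> G i) \<and> finite {i. pr i x \<noteq> \<zero>\<^bsub>M\<^esub>} \<and> x = (\<Oplus>\<^bsub>M\<^esub>i\<in>{i. pr i x \<noteq> \<zero>\<^bsub>M\<^esub>}. pr i x)"
    using main[OF x] prG[OF x] fs[of _ "\<lambda>i. pr i x"] pr(1)[OF x] M(3) by simp
  next
   fix f assume f: "(\<forall>i. f i \<in> G i) \<and> finite {i. f i \<noteq> \<zero>\<^bsub>M\<^esub>} \<and> x = (\<Oplus>\<^bsub>M\<^esub>i\<in>{i. f i \<noteq> \<zero>\<^bsub>M\<^esub>}. f i)"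
   then have "f i \<in> carrier M" for i by (auto simp: G)
   then have "x = (\<Sum>i\<in>{i. f i \<noteq> 0}. f i)" using f fs[of "{i. f i \<noteq> 0}" f] M(3) by simp
   from pr_eq[OF _ _ this] have "pr i x = (if i \<in> {i. f i \<noteq> 0} then f i else 0)" for i using f M(3) by simp
   then show "f = (\<lambda>i. pr i x)" by (intro ext) simp
  qed
 qed
 then interpret D: direct_sum M G by (simp add: direct_sum_def direct_sum_axioms_def M)
 show "hcomp M G i x = pr i x" if x: "x \<in> carrier M"
 proof -
  have m: "finite {i. pr i x \<noteq> 0}" "x = (\<Oplus>\<^bsub>M\<^esub>i\<in>{i. pr i x \<noteq> 0}. pr i x)"
   using main[OF x] fs[of _ "\<lambda>i. pr i x"] pr(1)[OF x] by auto
  show ?thesis using D.hcomp_unique[OF m(1) prG[OF x] m(2), of i] M(3) by (simp split: if_splits)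
 qed
qed

lemma transport_apply:
 assumes "inj_on t (carrier N)"
 shows "\<lbrakk>x \<in> carrier N; y \<in> carrier N\<rbrakk> \<Longrightarrow> t x \<oplus>\<^bsub>transport t N\<^esub> t y = t (x \<oplus>\<^bsub>N\<^esub> y)"
  "x \<in> carrier N \<Longrightarrow> r \<odot>\<^bsub>transport t N\<^esub> t x = t (r \<odot>\<^bsub>N\<^esub> x)"
 using assms by (simp_all add: transport_def)

lemma graded_module_transport:
 assumes N: "graded_module R G N NG" and t: "inj_on t (carrier N)"
 shows "graded_module R G (transport t N) (\<lambda>j. t ` NG j)"
proof -
 note d = graded_moduleD[OF N] and th = transport_hom[OF graded_moduleD(1)[OF N] t]
 interpret N: left_module R N by (rule d(1))
 interpret D: direct_sum N NG by (rule d(2))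
 let ?T = "transport t N"
 have T: "left_module R ?T" by (rule left_module_transport[OF d(1) t])
 interpret T: left_module R ?T by fact
 have inj: "t x = t y \<longleftrightarrow> x = y" if "x \<in> carrier N" "y \<in> carrier N" for x y
  using t that by (auto dest: inj_onD)
 have fs: "t (\<Oplus>\<^bsub>N\<^esub>i\<in>A. f i) = (\<Oplus>\<^bsub>?T\<^esub>i\<in>A. t (f i))" if "finite A" "\<And>i. f i \<in> carrier N" for f and A :: "int set"
  by (rule mod_hom_finsum[OF d(1) T th that])
 show ?thesis unfolding graded_module_def is_direct_sum_def
 proof (intro conjI allI ballI T)
  fix i
  interpret H: additive_subgroup "NG i" N using D.ds by (simp add: is_direct_sum_def)
  show "additive_subgroup (t ` NG i) ?T"
   unfolding additive_subgroup_def
  proof (rule subgroup.intro)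
   fix x assume "x \<in> t ` NG i"
   then obtain y where y: "y \<in> NG i" "x = t y" by blast
   have "inv\<^bsub>add_monoid ?T\<^esub> x = t (\<ominus>\<^bsub>N\<^esub> y)"
    using mod_hom_neg[OF d(1) T th, of y] D.G_sub[OF y(1)] y(2) by (simp add: a_inv_def)
   then show "inv\<^bsub>add_monoid ?T\<^esub> x \<in> t ` NG i" using H.a_inv_closed[OF y(1)] by simp
  qed (use D.G_sub D.G_zero D.G_add in "auto simp: transport_apply[OF t]")
 next
  fix y assume "y \<in> carrier ?T"
  then obtain x where x: "x \<in> carrier N" "y = t x" by auto
  let ?h = "\<lambda>i. hcomp N NG i x"
  have hz: "{i. t (?h i) \<noteq> \<zero>\<^bsub>?T\<^esub>} = {i. ?h i \<noteq> \<zero>\<^bsub>N\<^esub>}" using inj D.hcomp_closed[OF x(1)] by simp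
  show "\<exists>!f. (\<forall>i. f i \<in> t ` NG i) \<and> finite {i. f i \<noteq> \<zero>\<^bsub>?T\<^esub>} \<and> y = (\<Oplus>\<^bsub>?T\<^esub>i\<in>{i. f i \<noteq> \<zero>\<^bsub>?T\<^esub>}. f i)"
  proof (rule ex1I[of _ "\<lambda>i. t (?h i)"])
   show "(\<forall>i. t (?h i) \<in> t ` NG i) \<and> finite {i. t (?h i) \<noteq> \<zero>\<^bsub>?T\<^esub>} \<and> y = (\<Oplus>\<^bsub>?T\<^esub>i\<in>{i. t (?h i) \<noteq> \<zero>\<^bsub>?T\<^esub>}. t (?h i))"
    unfolding hz using D.hcomp_mem[OF x(1)] D.hcomp_finite[OF x(1)] D.hcomp_sum[OF x(1)] x(2)
     fs[OF D.hcomp_finite[OF x(1)], of ?h] D.hcomp_closed[OF x(1)] by auto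
  next
   fix f assume f: "(\<forall>i. f i \<in> t ` NG i) \<and> finite {i. f i \<noteq> \<zero>\<^bsub>?T\<^esub>} \<and> y = (\<Oplus>\<^bsub>?T\<^esub>i\<in>{i. f i \<noteq> \<zero>\<^bsub>?T\<^esub>}. f i)"
   then have "\<exists>g. \<forall>i. g i \<in> NG i \<and> f i = t (g i)" by (intro choice) auto
   then obtain g where g: "\<And>i. g i \<in> NG i" "\<And>i. f i = t (g i)" by blast
   have gc: "g i \<in> carrier N" for i using D.G_sub g(1) by blast
   have z: "{i. f i \<noteq> \<zero>\<^bsub>?T\<^esub>} = {i. g i \<noteq> \<zero>\<^bsub>N\<^esub>}" using inj gc g(2) by simp
   have fin: "finite {i. g i \<noteq> \<zero>\<^bsub>N\<^esub>}" using f z by simp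
   have "t x = t (\<Oplus>\<^bsub>N\<^esub>i\<in>{i. g i \<noteq> \<zero>\<^bsub>N\<^esub>}. g i)"
    using f fs[OF fin gc] z x(2) by (simp only: g(2))
   then have "x = (\<Oplus>\<^bsub>N\<^esub>i\<in>{i. g i \<noteq> \<zero>\<^bsub>N\<^esub>}. g i)" using inj x(1) gc by (simp add: N.M.finsum_closed)
   from D.hcomp_unique[OF fin g(1) this] have "?h i = g i" for i by simp
   then show "f = (\<lambda>i. t (?h i))" using g(2) by (intro ext) simp
  qed
 next
  fix i j r x assume r: "r \<in> G i" and "x \<in> t ` NG j"
  then obtain y where y: "y \<in> NG j" "x = t y" by blast
  then have "r \<odot>\<^bsub>?T\<^esub> x = t (r \<odot>\<^bsub>N\<^esub> y)" using D.G_sub[OF y(1)] by (simp add: transport_apply[OF t])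
  then show "r \<odot>\<^bsub>?T\<^esub> x \<in> t ` NG (int i + j)" using d(3)[OF r y(1)] by blast
 qed
qed

text \<open>A linear bijection from families of coefficients onto P has the coordinates as its
  inverse. It is applied to \<open>psi\<close> for the Koszul terms and to \<open>PP\<close> for the
  expansion in powers of a variable.\<close>

lemma free_on_bij:
 fixes P :: "('r, 'u) module" and \<Psi> :: "('b \<Rightarrow> 'r) \<Rightarrow> 'u"
 assumes P: "left_module R P" and bij: "bij_betw \<Psi> W (carrier P)"
  and W: "\<And>f b. f \<in> W \<Longrightarrow> f b \<in> carrier R" "\<And>f b. \<lbrakk>f \<in> W; b \<notin> B\<rbrakk> \<Longrightarrow> f b = \<zero>\<^bsub>R\<^esub>"
   "\<And>f. f \<in> W \<Longrightarrow> finite {b. f b \<noteq> \<zero>\<^bsub>R\<^esub>}"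
  and zero: "(\<lambda>_. \<zero>\<^bsub>R\<^esub>) \<in> W"
  and add: "\<And>f g. \<lbrakk>f \<in> W; g \<in> W\<rbrakk> \<Longrightarrow> (\<lambda>b. f b \<oplus>\<^bsub>R\<^esub> g b) \<in> W \<and> \<Psi> (\<lambda>b. f b \<oplus>\<^bsub>R\<^esub> g b) = \<Psi> f \<oplus>\<^bsub>P\<^esub> \<Psi> g"
  and smult: "\<And>r f. \<lbrakk>r \<in> carrier R; f \<in> W\<rbrakk> \<Longrightarrow> (\<lambda>b. r \<otimes>\<^bsub>R\<^esub> f b) \<in> W \<and> \<Psi> (\<lambda>b. r \<otimes>\<^bsub>R\<^esub> f b) = r \<odot>\<^bsub>P\<^esub> \<Psi> f"
  and unit: "\<And>b. b \<in> B \<Longrightarrow> (\<lambda>b'. if b' = b then \<one>\<^bsub>R\<^esub> else \<zero>\<^bsub>R\<^esub>) \<in> W \<and>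
   \<Psi> (\<lambda>b'. if b' = b then \<one>\<^bsub>R\<^esub> else \<zero>\<^bsub>R\<^esub>) = e b"
 shows "free_on R P B e (\<lambda>b p. inv_into W \<Psi> p b)"
proof -
 interpret P: left_module R P by fact
 have inv: "inv_into W \<Psi> p \<in> W" "\<Psi> (inv_into W \<Psi> p) = p" if "p \<in> carrier P" for p
  using that bij by (auto simp: bij_betw_def inv_into_into f_inv_into_f)
 have inv': "inv_into W \<Psi> (\<Psi> f) = f" if "f \<in> W" for f using that bij by (simp add: bij_betw_def)
 have \<Psi>c: "\<Psi> f \<in> carrier P" if "f \<in> W" for f using that bij by (auto simp: bij_betw_def)
 show ?thesis unfolding free_on_def
 proof (intro conjI ballI P impI)
  fix b assume b: "b \<in> B"
  show "e b \<in> carrier P" using unit[OF b] \<Psi>c by metis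
  show "(\<lambda>p. inv_into W \<Psi> p b) \<in> mod_hom R P (regular_module R)"
  proof (rule mod_homI)
   fix p q assume pq: "p \<in> carrier P" "q \<in> carrier P"
   have "inv_into W \<Psi> (p \<oplus>\<^bsub>P\<^esub> q) = (\<lambda>b. inv_into W \<Psi> p b \<oplus>\<^bsub>R\<^esub> inv_into W \<Psi> q b)"
    using add[OF inv(1)[OF pq(1)] inv(1)[OF pq(2)]] inv' inv(2)[OF pq(1)] inv(2)[OF pq(2)] by metis
   then show "inv_into W \<Psi> (p \<oplus>\<^bsub>P\<^esub> q) b = inv_into W \<Psi> p b \<oplus>\<^bsub>regular_module R\<^esub> inv_into W \<Psi> q b" by simp
  next
   fix r p assume rp: "r \<in> carrier R" "p \<in> carrier P"
   have "inv_into W \<Psi> (r \<odot>\<^bsub>P\<^esub> p) = (\<lambda>b. r \<otimes>\<^bsub>R\<^esub> inv_into W \<Psi> p b)"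
    using smult[OF rp(1) inv(1)[OF rp(2)]] inv' inv(2)[OF rp(2)] by metis
   then show "inv_into W \<Psi> (r \<odot>\<^bsub>P\<^esub> p) b = r \<odot>\<^bsub>regular_module R\<^esub> inv_into W \<Psi> p b" by simp
  qed (use W(1) inv(1) in simp)
 next
  fix p assume p: "p \<in> carrier P"
  show "finite {b \<in> B. inv_into W \<Psi> p b \<noteq> \<zero>\<^bsub>R\<^esub>}"
   by (rule finite_subset[OF _ W(3)[OF inv(1)[OF p]]]) auto
  assume z: "\<forall>b\<in>B. inv_into W \<Psi> p b = \<zero>\<^bsub>R\<^esub>"
  \<comment> \<open>The family of coordinates is its own multiple by 0, so linearity of \<Psi> gives
    p = 0 p.\<close>
  have "\<zero>\<^bsub>R\<^esub> \<otimes>\<^bsub>R\<^esub> inv_into W \<Psi> p b = inv_into W \<Psi> p b" for b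
   using W(1,2)[OF inv(1)[OF p], of b] z by (cases "b \<in> B") auto
  then have "(\<lambda>b. \<zero>\<^bsub>R\<^esub> \<otimes>\<^bsub>R\<^esub> inv_into W \<Psi> p b) = inv_into W \<Psi> p" by (rule ext)
  from conjunct2[OF smult[OF P.R.zero_closed inv(1)[OF p]], unfolded this]
  have "\<Psi> (inv_into W \<Psi> p) = \<zero>\<^bsub>R\<^esub> \<odot>\<^bsub>P\<^esub> \<Psi> (inv_into W \<Psi> p)" .
  then have "p = \<zero>\<^bsub>R\<^esub> \<odot>\<^bsub>P\<^esub> p" unfolding inv(2)[OF p] .
  then show "p = \<zero>\<^bsub>P\<^esub>" using P.smult_l_null[OF p] by simp
 next
  fix b b' assume b': "b' \<in> B"
  have "inv_into W \<Psi> (e b') = (\<lambda>b. if b = b' then \<one>\<^bsub>R\<^esub> else \<zero>\<^bsub>R\<^esub>)"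
   using inv'[OF conjunct1[OF unit[OF b']]] unfolding conjunct2[OF unit[OF b']] .
  then show "inv_into W \<Psi> (e b') b = (if b = b' then \<one>\<^bsub>R\<^esub> else \<zero>\<^bsub>R\<^esub>)" by simp
 qed
qed

context forms
begin

text \<open>Here the binomials remove the terms with k > 0: \<Gamma> has eigenvalue 0 on the
  constant monomial.\<close>

lemma cf_star_const_right:
 assumes p: "p \<in> PU" and w: "w \<in> Om" shows "cf ((w \<star> emb p) I) 0 = cf p 0 * cf (w I) 0"
proof -
 obtain N where "nilp N w" using nilp_ex w by blast
 then have N: "nilp (Suc N) w" by (rule nilp_mono) simp
 have f: "fsup ((Dl ^^ k) w)" for k by (rule fmP_fsup[OF fmP_Dl_pow[OF w]])
 have "(w \<star> emb p) I = (\<Sum>k<Suc N. Gam_binom n a k p * (Dl ^^ k) w I)"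
  unfolding st_eq[OF N] gb_emb sum_fun_apply wedge_emb[OF f] pm_apply ..
 then have "cf ((w \<star> emb p) I) 0 = (\<Sum>k<Suc N. cf (Gam_binom n a k p) 0 * cf ((Dl ^^ k) w I) 0)"
  by (simp only: lookup_sum cf_mult_0)
 also have "\<dots> = (\<Sum>k<Suc N. if k = 0 then cf p 0 * cf (w I) 0 else 0)"
 proof (intro sum.cong refl)
  fix k show "cf (Gam_binom n a k p) 0 * cf ((Dl ^^ k) w I) 0 = (if k = 0 then cf p 0 * cf (w I) 0 else 0)"
   by (cases k) (simp_all add: Gam_binom_diag gbinomial_0)
 qed
 finally show ?thesis by simp
qed

section \<open>The ring, its opposite and its grading\<close>

abbreviation "RR \<equiv> Rna n a"

text \<open>R itself for \<open>True\<close> and its opposite for \<open>False\<close>, so that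
  \<open>act s\<close> is a left action of \<open>RS s\<close> on forms for either side.\<close>

definition RS :: "bool \<Rightarrow> 'k mpoly ring" where "RS s = (if s then RR else op_ring RR)"
definition smul :: "bool \<Rightarrow> 'k mpoly \<Rightarrow> 'k mpoly \<Rightarrow> 'k mpoly" where
 "smul s p q = (if s then star n a p q else star n a q p)"

lemma RR_simps [simp]: "carrier RR = PU" "monoid.mult RR = star n a" "one RR = 1" "zero RR = 0" "add RR = (+)"
 by (simp_all add: Rna_def)

lemma RS_simps [simp]: "carrier (RS s) = PU" "monoid.mult (RS s) = smul s" "one (RS s) = 1"
 "zero (RS s) = 0" "add (RS s) = (+)"
 by (auto simp: RS_def smul_def fun_eq_iff)

lemma polys_simps [simp]: "0 \<in> PU" "1 \<in> PU" "Const c \<in> PU"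
 by (auto simp: polys_upto_def in_keys_iff Const_def lookup_one lookup_single when_def)

lemma polys_add: "\<lbrakk>p \<in> PU; q \<in> PU\<rbrakk> \<Longrightarrow> p + q \<in> PU"
 and polys_uminus: "p \<in> PU \<Longrightarrow> - p \<in> PU"
 for p q :: "'k mpoly"
 unfolding emb_Om[symmetric] emb_simps by (rule fmP_add fmP_uminus; assumption)+

lemma act_emb: "\<lbrakk>p \<in> PU; q \<in> PU\<rbrakk> \<Longrightarrow> act s p (emb q) = emb (smul s p q)"
 by (simp add: act_def smul_def star_emb)

lemma act_fmP:
 assumes "p \<in> PU" "w \<in> fmP Q" "\<And>c d m. Q c d \<Longrightarrow> cf p m \<noteq> 0 \<Longrightarrow> S c (mdegree m + d)"
 shows "act s p w \<in> fmP S"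
proof -
 have e: "emb p \<in> fmP (\<lambda>c d. c = 0 \<and> (\<exists>m. cf p m \<noteq> 0 \<and> mdegree m = d))" by (rule emb_fmP[OF assms(1)]) auto
 have "emb p \<star> w \<in> fmP S" by (rule fmP_st[OF e assms(2)]) (use assms(3) in auto)
 moreover have "w \<star> emb p \<in> fmP S" by (rule fmP_st[OF assms(2) e]) (use assms(3) in "auto simp: add.commute")
 ultimately show ?thesis by (simp add: act_def)
qed

lemma act_V: "\<lbrakk>p \<in> PU; w \<in> V i\<rbrakk> \<Longrightarrow> act s p w \<in> V i"
 by (rule act_fmP) auto

lemma act_Om: "\<lbrakk>p \<in> PU; w \<in> Om\<rbrakk> \<Longrightarrow> act s p w \<in> Om"
 by (rule act_fmP) auto

lemma smul_closed: "\<lbrakk>p \<in> PU; q \<in> PU\<rbrakk> \<Longrightarrow> smul s p q \<in> PU"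
 using act_Om[of p "emb q" s] by (simp add: act_emb emb_Om)

lemma act_add_right: "\<lbrakk>p \<in> PU; v \<in> Om; w \<in> Om\<rbrakk> \<Longrightarrow> act s p (v + w) = act s p v + act s p w"
 unfolding act_def using st_add_right[of "emb p"] st_add_left[of v w] emb_Om[of p] by (cases s) (simp_all only: if_True if_False)

lemma act_add_left: "\<lbrakk>p \<in> PU; q \<in> PU; w \<in> Om\<rbrakk> \<Longrightarrow> act s (p + q) w = act s p w + act s q w"
 unfolding act_def emb_simps using st_add_right[of w] st_add_left[of "emb p" "emb q"] emb_Om[of p] emb_Om[of q]
 by (cases s) (simp_all only: if_True if_False)

lemma act_assoc:
 assumes "p \<in> PU" "q \<in> PU" "w \<in> Om" shows "act s (smul s p q) w = act s p (act s q w)"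
proof -
 note e = assms[folded emb_Om(1)]
 show ?thesis
  by (cases s) (simp_all add: act_def smul_def star_emb[symmetric] assms st_assoc e)
qed

lemma act_one: "w \<in> Om \<Longrightarrow> act s 1 w = w"
 by (simp add: act_def one_st st_one fmP_fsup)

lemma act_zero [simp]: "act s 0 w = 0" "act s p 0 = 0"
 by (simp_all only: act_def emb_simps st_zero if_cancel)

lemma act_const: "\<lbrakk>p \<in> PU; w \<in> Om\<rbrakk> \<Longrightarrow> cf (act s p w I) 0 = cf p 0 * cf (w I) 0"
 by (simp add: act_def cf_star_const cf_star_const_right)

lemma smul_const: "\<lbrakk>p \<in> PU; q \<in> PU\<rbrakk> \<Longrightarrow> cf (smul s p q) 0 = cf p 0 * cf q 0"
 using act_const[of p "emb q" s "{}"] by (simp add: act_emb emb_Om) (simp add: emb_def)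

text \<open>\<open>dd\<close> vanishes on polynomials, so the Leibniz rule leaves only the term with
  \<open>dd w\<close>, with sign 1 on either side. This makes the Koszul complex a complex of left
  and of right modules.\<close>

lemma act_dd:
 assumes p: "p \<in> PU" and w: "w \<in> V i" shows "dd (act s p w) = act s p (dd w)"
proof -
 have "dd (emb p) \<in> fmP (\<lambda>_ _. False)" by (rule fmP_dd[OF emb_V0[OF p]]) simp
 then have "cf (dd (emb p) I) m = 0" for I m using fmPD[of "dd (emb p)" "\<lambda>_ _. False" I m] by blast
 then have d0: "dd (emb p) = 0" by (intro ext poly_mapping_eqI) simp
 have e: "emb p \<in> Om" using p emb_Om by simp
 have pm1: "pm (Const ((- 1) ^ 0)) v = v" for v :: "'k form" by (rule ext) simp
 have pm0: "pm c 0 = (0 :: 'k form)" for c by (rule ext) simp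
 show ?thesis
  using dd_st[OF emb_V0[OF p] fmP_Om[OF w]] dd_st[OF w e]
  by (cases s) (simp_all only: act_def if_True if_False d0 st_zero pm1 pm0 add_0_left add_0_right)
qed

text \<open>The ring laws are the laws of the action on forms of exterior degree 0, read back
  through the injective \<open>emb\<close>.\<close>

lemma ring_RS: "ring (RS s)"
proof (rule ringI)
 show "abelian_group (RS s)" by (rule abelian_group_type) (auto intro: polys_add polys_uminus)
 show "monoid (RS s)"
 proof (rule monoidI)
  fix x y z assume "x \<in> carrier (RS s)" "y \<in> carrier (RS s)" "z \<in> carrier (RS s)"
  then have c: "x \<in> PU" "y \<in> PU" "z \<in> PU" by auto
  then have "emb (smul s (smul s x y) z) = emb (smul s x (smul s y z))"
   using act_assoc[OF c(1,2), of "emb z" s] by (simp add: act_emb smul_closed emb_Om)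
  then show "x \<otimes>\<^bsub>RS s\<^esub> y \<otimes>\<^bsub>RS s\<^esub> z = x \<otimes>\<^bsub>RS s\<^esub> (y \<otimes>\<^bsub>RS s\<^esub> z)" by (simp add: emb_inj)
 next
  fix x assume "x \<in> carrier (RS s)"
  then have x: "x \<in> PU" by simp
  show "\<one>\<^bsub>RS s\<^esub> \<otimes>\<^bsub>RS s\<^esub> x = x"
   using act_one[of "emb x" s] x by (simp add: act_emb emb_Om emb_inj)
  have "smul s x 1 = smul (\<not> s) 1 x" by (simp add: smul_def)
  then show "x \<otimes>\<^bsub>RS s\<^esub> \<one>\<^bsub>RS s\<^esub> = x"
   using act_one[of "emb x" "\<not> s"] x by (simp add: act_emb emb_Om emb_inj)
 qed (auto simp: smul_closed)
next
 fix x y z assume "x \<in> carrier (RS s)" "y \<in> carrier (RS s)" "z \<in> carrier (RS s)"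
 then have c: "x \<in> PU" "y \<in> PU" "z \<in> PU" by auto
 have "emb (smul s (x + y) z) = emb (smul s x z + smul s y z)"
  using act_add_left[OF c(1,2), of "emb z" s] c by (simp add: act_emb polys_add emb_Om)
 then show "(x \<oplus>\<^bsub>RS s\<^esub> y) \<otimes>\<^bsub>RS s\<^esub> z = x \<otimes>\<^bsub>RS s\<^esub> z \<oplus>\<^bsub>RS s\<^esub> y \<otimes>\<^bsub>RS s\<^esub> z" by (simp only: RS_simps emb_inj)
 have "emb (smul s z (x + y)) = emb (smul s z x + smul s z y)"
  using act_add_right[OF c(3), of "emb x" "emb y" s] c act_emb[OF c(3), of "x + y"] by (simp add: act_emb polys_add emb_Om)
 then show "z \<otimes>\<^bsub>RS s\<^esub> (x \<oplus>\<^bsub>RS s\<^esub> y) = z \<otimes>\<^bsub>RS s\<^esub> x \<oplus>\<^bsub>RS s\<^esub> z \<otimes>\<^bsub>RS s\<^esub> y" by (simp only: RS_simps emb_inj)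
qed

lemma smul_Const:
 assumes p: "p \<in> PU" shows "smul s (Const c) p = Const c * p" "smul s p (Const c) = Const c * p"
proof -
 have eC: "emb (Const c) = pm (Const c) (emb 1 :: 'k form)" using emb_simps(4)[of c 1] by simp
 have 1: "emb 1 \<in> Om" and e: "emb p \<in> Om" using p by (simp_all add: emb_Om)
 have "act s (Const c) (emb p) = pm (Const c) (act s 1 (emb p))" for s
  by (cases s) (simp_all only: act_def if_True if_False eC st_sc_left[OF 1] st_sc_right[OF e])
 then have "emb (smul s (Const c) p) = emb (Const c * p)" for s
  using act_one[OF e] p by (simp add: act_emb)
 then have *: "smul s (Const c) p = Const c * p" for s by (simp only: emb_inj)
 then show "smul s (Const c) p = Const c * p" .
 have "smul s p (Const c) = smul (\<not> s) (Const c) p" by (simp add: smul_def)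
 then show "smul s p (Const c) = Const c * p" using * by simp
qed

lemma ring_RR: "ring RR"
 using ring_RS[of True] by (simp add: RS_def)

lemma grading_RR: "is_direct_sum RR (Rna_grading n)"
 "p \<in> PU \<Longrightarrow> hcomp RR (Rna_grading n) 0 p = Const (cf p 0)"
proof -
 interpret R: ring RR by (rule ring_RR)
 have ab: "abelian_group RR" by unfold_locales
 define pr where "pr i p = diag (\<lambda>m. if mdegree m = i then 1 else 0) p" for i and p :: "'k mpoly"
 have prc: "pr i p \<in> carrier RR" if "p \<in> carrier RR" for i p
  using that by (auto simp: pr_def polys_upto_def in_keys_iff split: if_splits)
 have G: "Rna_grading n i = {x \<in> carrier RR. \<forall>z. cf x z \<noteq> 0 \<longrightarrow> mdegree z = i}" for i
  by (auto simp: Rna_grading_def in_keys_iff)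
 have fin: "finite {z. cf x z \<noteq> 0}" for x :: "'k mpoly" by simp
 have pc: "cf (pr i x) z = (if mdegree z = i then cf x z else 0)" for i x z by (simp add: pr_def)
 note * = is_direct_sum_coordinates[where co = cf and deg = mdegree and pr = pr, OF ab RR_simps(5,4) lookup_add poly_mapping_eqI fin prc pc G]
 show "is_direct_sum RR (Rna_grading n)" by (rule *(1)) simp_all
 assume p: "p \<in> PU"
 have "hcomp RR (Rna_grading n) 0 p = pr 0 p" by (rule *(2)) (use p in simp_all)
 also have "\<dots> = Const (cf p 0)" by (rule poly_mapping_eqI) (auto simp: pc Const_def lookup_single when_def)
 finally show "hcomp RR (Rna_grading n) 0 p = Const (cf p 0)" .
qed

lemma grading_smul:
 assumes "p \<in> Rna_grading n i" "q \<in> Rna_grading n j" shows "smul s p q \<in> Rna_grading n (i + j)"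
proof -
 have c: "p \<in> PU" "q \<in> PU" using assms by (auto simp: Rna_grading_def)
 have "emb q \<in> fmP (\<lambda>c d. d = j)" by (rule emb_fmP[OF c(2)]) (use assms in "auto simp: Rna_grading_def in_keys_iff")
 then have "act s p (emb q) \<in> fmP (\<lambda>c d. d = i + j)"
  by (rule act_fmP[OF c(1)]) (use assms in "auto simp: Rna_grading_def in_keys_iff")
 then have "mdegree m = i + j" if "cf (smul s p q) m \<noteq> 0" for m
  using fmPD[where I = "{}" and m = m, of "act s p (emb q)"] that unfolding act_emb[OF c] by (fastforce simp: emb_def)
 then show ?thesis using smul_closed[OF c] by (auto simp: Rna_grading_def in_keys_iff)
qed

lemma grading_0: "Rna_grading n 0 = range (Const :: 'k \<Rightarrow> 'k mpoly)"
proof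
 show "Rna_grading n 0 \<subseteq> range (Const :: 'k \<Rightarrow> 'k mpoly)"
 proof
  fix p :: "'k mpoly" assume p: "p \<in> Rna_grading n 0"
  have "p = Const (cf p 0)"
   by (rule poly_mapping_eqI) (use p in "auto simp: Rna_grading_def in_keys_iff Const_def lookup_single when_def")
  then show "p \<in> range Const" by blast
 qed
 show "range (Const :: 'k \<Rightarrow> 'k mpoly) \<subseteq> Rna_grading n 0"
  by (auto simp: Rna_grading_def in_keys_iff) (auto simp: Const_def lookup_single when_def split: if_splits)
qed

lemma subfield_Const: "subfield (range Const) RR"
proof -
 interpret R: ring RR by (rule ring_RR)
 have neg: "\<ominus>\<^bsub>RR\<^esub> x = - x" if "x \<in> PU" for x
  using R.minus_equality[of "- x" x] that polys_uminus by simp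
 have C: "star n a (Const c) p = Const c * p" "star n a p (Const c) = Const c * p" if "p \<in> PU" for c p
  using smul_Const[OF that, of True c] by (simp_all add: smul_def)
 have sub: "subring (range Const) RR"
 proof (rule R.subringI)
  show "range Const \<subseteq> carrier RR" by auto
  show "\<one>\<^bsub>RR\<^esub> \<in> range Const" using Const_simps(2) by (metis RR_simps(3) rangeI)
 qed (auto simp: neg C)
 show ?thesis
 proof (rule R.subfieldI)
  show "subcring (range Const) RR"
   by (rule R.subcringI[OF sub]) (auto simp: C mult.commute)
  have "Const c \<in> Units (RR\<lparr>carrier := range Const\<rparr>)" if "c \<noteq> 0" for c
   using that by (auto simp: Units_def C intro!: exI[of _ "inverse c"])
  moreover have "c \<noteq> 0" if u: "Const c \<in> Units (RR\<lparr>carrier := range Const\<rparr>)" for c :: 'k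
  proof
   assume "c = 0"
   then obtain y :: "'k mpoly" where "y \<in> range Const" "star n a y 0 = 1"
    using u by (auto simp: Units_def)
   then show False using C(2)[of y 0] by (auto dest: arg_cong[of _ _ "\<lambda>p. cf p 0"] simp: lookup_one)
  qed
  ultimately have u: "Const c \<in> Units (RR\<lparr>carrier := range Const\<rparr>) \<longleftrightarrow> c \<noteq> 0" for c by blast
  have "Const c = 0 \<longleftrightarrow> c = 0" for c :: 'k
  proof
   assume "Const c = 0"
   then have "cf (Const c) 0 = 0" by simp
   then show "c = 0" by (simp add: Const_def)
  qed simp
  moreover have "Units (RR\<lparr>carrier := range Const\<rparr>) \<subseteq> range Const" by (auto simp: Units_def)
  ultimately show "Units (RR\<lparr>carrier := range Const\<rparr>) = range Const - {\<zero>\<^bsub>RR\<^esub>}"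
   using u u[of 0] by (intro equalityI subsetI) (auto simp: subset_iff)
 qed
qed

lemma connected_graded_RR: "connected_graded_algebra RR (range Const) (Rna_grading n)"
 unfolding connected_graded_algebra_def
proof (intro conjI ballI allI ring_RR subfield_Const grading_RR(1) grading_0)
 fix c x assume "c \<in> range (Const :: 'k \<Rightarrow> _)" "x \<in> carrier RR"
 then show "c \<otimes>\<^bsub>RR\<^esub> x = x \<otimes>\<^bsub>RR\<^esub> c" using smul_Const[of x True] by (auto simp: smul_def)
next
 fix i j and x y :: "'k mpoly" assume "x \<in> Rna_grading n i" "y \<in> Rna_grading n j"
 then show "x \<otimes>\<^bsub>RR\<^esub> y \<in> Rna_grading n (i + j)" using grading_smul[of x i y j True] by (simp add: smul_def)
qed

end

lemma proj_resolution_transport: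
 assumes P: "proj_resolution R M P d aug" and t: "inj_on t (carrier M)"
 shows "proj_resolution R (transport t M) P d (\<lambda>x. t (aug x))"
proof -
 note p = proj_resolutionD[OF P]
 have "t (aug x) = t \<zero>\<^bsub>M\<^esub> \<longleftrightarrow> aug x = \<zero>\<^bsub>M\<^esub>" if "x \<in> carrier (P 0)" for x
 proof -
  interpret left_module R M by (rule p(1))
  show ?thesis using inj_on_eq_iff[OF t] mod_hom_closed[OF p(5) that] by simp
 qed
 then have "d 0 ` carrier (P (Suc 0)) = {x \<in> carrier (P 0). t (aug x) = t \<zero>\<^bsub>M\<^esub>}" unfolding p(7) by blast
 then show ?thesis
  using p left_module_transport[OF p(1) t] mod_hom_comp[OF p(5) transport_hom[OF p(1) t]]
  by (auto simp: proj_resolution_def One_nat_def image_image[symmetric])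
qed

text \<open>If \<open>P\<close> vanishes in degree \<open>Suc N\<close>, then the comparison maps show that the identity of
 \<open>E\<^bsub>Suc N\<^esub>\<close> is homotopic to \<open>0\<close>, hence factors through the differential.\<close>

lemma proj_dim_lower:
 fixes M :: "('r, 'u) module" and E :: "nat \<Rightarrow> ('r, 'u) module"
 assumes E: "proj_resolution R M E d aug" and van: "carrier (E (Suc (Suc N))) = {\<zero>\<^bsub>E (Suc (Suc N))\<^esub>}"
  and e: "e \<in> carrier (E (Suc N))" and nosplit: "\<And>h. h \<in> mod_hom R (E N) (E (Suc N)) \<Longrightarrow> h (d N e) \<noteq> e"
 shows "enat (Suc N) \<le> proj_dim R M"
 unfolding proj_dim_def
proof (rule Inf_greatest, clarify, rule ccontr)
 fix m and P :: "nat \<Rightarrow> ('r, 'u) module" and d' aug'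
 assume P: "proj_resolution R M P d' aug'" and z: "\<forall>i>m. carrier (P i) = {\<zero>\<^bsub>P i\<^esub>}" and "\<not> enat (Suc N) \<le> enat m"
 then have Pz: "carrier (P (Suc N)) = {\<zero>\<^bsub>P (Suc N)\<^esub>}" by simp
 note ep = proj_resolutionD[OF E] and pp = proj_resolutionD[OF P]
 obtain f where f: "\<And>i. f i \<in> mod_hom R (E i) (P i)" "\<And>x. x \<in> carrier (E 0) \<Longrightarrow> aug' (f 0 x) = aug x"
  "\<And>i x. x \<in> carrier (E (Suc i)) \<Longrightarrow> d' i (f (Suc i) x) = f i (d i x)" using proj_resolution_lift[OF E P] by blast
 obtain g where g: "\<And>i. g i \<in> mod_hom R (P i) (E i)" "\<And>x. x \<in> carrier (P 0) \<Longrightarrow> aug (g 0 x) = aug' x"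
  "\<And>i x. x \<in> carrier (P (Suc i)) \<Longrightarrow> d i (g (Suc i) x) = g i (d' i x)" using proj_resolution_lift[OF P E] by blast
 define u where "u i x = x \<ominus>\<^bsub>E i\<^esub> g i (f i x)" for i x
 have id: "(\<lambda>x. x) \<in> mod_hom R (E i) (E i)" for i by (rule mod_homI) auto
 have gf: "(\<lambda>x. g i (f i x)) \<in> mod_hom R (E i) (E i)" for i by (rule mod_hom_comp[OF f(1) g(1)])
 have u: "u i \<in> mod_hom R (E i) (E i)" for i unfolding u_def by (rule mod_hom_minus[OF ep(3) id gf])
 have ud: "d i (u (Suc i) x) = u i (d i x)" if x: "x \<in> carrier (E (Suc i))" for i x
  unfolding u_def using mod_hom_diff[OF ep(3) ep(3) ep(4) x mod_hom_closed[OF gf x]]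
   f(3)[OF x] g(3)[OF mod_hom_closed[OF f(1) x]] by simp
 have u0: "aug (u 0 x) = \<zero>\<^bsub>M\<^esub>" if x: "x \<in> carrier (E 0)" for x
 proof -
  interpret left_module R M by (rule ep(1))
  show ?thesis unfolding u_def using mod_hom_diff[OF ep(3) ep(1) ep(5) x mod_hom_closed[OF gf x]]
   f(2)[OF x] g(2)[OF mod_hom_closed[OF f(1) x]] mod_hom_closed[OF ep(5) x] by (simp add: a_minus_def M.r_neg)
 qed
 obtain h where h: "\<And>i. h i \<in> mod_hom R (E i) (E (Suc i))"
  "\<And>i x. x \<in> carrier (E (Suc i)) \<Longrightarrow> u (Suc i) x = d (Suc i) (h (Suc i) x) \<oplus>\<^bsub>E (Suc i)\<^esub> h i (d i x)"
  using proj_resolution_homotopy[OF E E u ud u0] by blast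
 interpret EN: left_module R "E (Suc N)" by (rule ep(3))
 have hd: "h N (d N e) \<in> carrier (E (Suc N))" by (rule mod_hom_closed[OF h(1) mod_hom_closed[OF ep(4) e]])
 have "h (Suc N) e = \<zero>\<^bsub>E (Suc (Suc N))\<^esub>" using mod_hom_closed[OF h(1) e] van by simp
 then have "u (Suc N) e = h N (d N e)" using h(2)[OF e] mod_hom_zero[OF ep(3) ep(3) ep(4)] hd by simp
 moreover have "f (Suc N) e = \<zero>\<^bsub>P (Suc N)\<^esub>" using mod_hom_closed[OF f(1) e] Pz by simp
 then have "u (Suc N) e = e" unfolding u_def using mod_hom_zero[OF pp(3) ep(3) g(1)] e by (simp add: a_minus_def)
 ultimately show False using nosplit[OF h(1)] by simp
qed

context forms
begin

section \<open>The Koszul complex as a graded free resolution\<close>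

definition EM :: "bool \<Rightarrow> nat \<Rightarrow> ('k mpoly, 'k form) module" where
 "EM s i = \<lparr>carrier = V i, monoid.mult = undefined, one = undefined, zero = 0, add = (+), smult = act s\<rparr>"
text \<open>Each theta counts as degree 1, so that \<open>dd\<close>, which trades a theta for a
  variable, preserves the degree.\<close>

definition EG :: "nat \<Rightarrow> int \<Rightarrow> 'k form set" where "EG i j = fmP (\<lambda>c d. c = i \<and> int (c + d) = j)"
definition augE :: "'k form \<Rightarrow> 'k mpoly" where "augE w = Const (cf (w {}) 0)"

abbreviation "RG \<equiv> Rna_grading n :: nat \<Rightarrow> 'k mpoly set"
abbreviation "TM \<equiv> trivial_module RR RG"
abbreviation "TG \<equiv> trivial_grading RR RG"

lemma EM_simps [simp]: "carrier (EM s i) = V i" "zero (EM s i) = 0" "add (EM s i) = (+)" "smult (EM s i) = act s"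
 by (simp_all add: EM_def)

lemma left_module_EM: "left_module (RS s) (EM s i)"
proof (intro left_module.intro left_module_axioms.intro ring_RS)
 show "abelian_group (EM s i)" by (rule abelian_group_type) (auto intro: fmP_add fmP_uminus)
qed (auto simp only: RS_simps EM_simps intro: act_V act_add_left act_add_right act_assoc act_one fmP_Om)

lemma TM_simps [simp]: "carrier TM = range Const" "zero TM = 0" "add TM = (+)"
 by (simp_all add: trivial_module_def grading_0)

lemma TM_smult: "r \<in> PU \<Longrightarrow> r \<odot>\<^bsub>TM\<^esub> Const c = Const (cf r 0 * c)"
 using smul_Const(1)[of "Const c" True "cf r 0"]
 by (simp add: trivial_module_def grading_RR(2) smul_def)

lemma left_module_TM: "left_module (RS s) TM"
proof (intro left_module.intro left_module_axioms.intro ring_RS)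
 show "abelian_group TM"
 proof (rule abelian_group_type)
  show "0 \<in> carrier TM" using Const_simps(1) by (metis TM_simps(1) rangeI)
 qed auto
qed (auto simp: TM_smult smul_closed smul_const polys_add lookup_add lookup_one algebra_simps)

lemma TG_eq: "TG j = {x \<in> range Const. \<forall>z. cf x z \<noteq> 0 \<longrightarrow> (0::int) = j}"
proof (cases "j = 0")
 case False
 have "x = 0" if "\<forall>z. cf x z = 0" for x :: "'k mpoly" using that by (intro poly_mapping_eqI) simp
 moreover have "(0 :: 'k mpoly) \<in> range Const" using Const_simps(1) by (metis rangeI)
 ultimately show ?thesis using False by (auto simp: trivial_grading_def)
qed (simp add: trivial_grading_def grading_0)

lemma graded_TM: "graded_module (RS s) RG TM TG"
 unfolding graded_module_def
proof (intro conjI allI ballI left_module_TM)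
 interpret left_module "RS True" TM by (rule left_module_TM)
 show "is_direct_sum TM TG"
 proof (rule is_direct_sum_coordinates(1)[where co = cf and deg = "\<lambda>_. 0" and pr = "\<lambda>i x. if i = 0 then x else 0"])
  show "abelian_group TM" by unfold_locales
  show "(if i = 0 then x else 0) \<in> carrier TM" if "x \<in> carrier TM" for i :: int and x
   using that M.zero_closed by simp
 qed (auto simp: lookup_add TG_eq intro: poly_mapping_eqI)
next
 fix i j r x assume r: "r \<in> RG i" and "x \<in> TG j"
 then obtain c where c: "x = Const c" "j \<noteq> 0 \<Longrightarrow> cf x 0 = 0" by (auto simp: TG_eq)
 have z0: "cf (Const (0 :: 'k)) z = 0" for z by (simp only: Const_simps lookup_zero)
 have "cf r 0 = 0" if i: "i \<noteq> 0"
 proof (rule ccontr)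
  assume "cf r 0 \<noteq> 0"
  then have "0 \<in> mkeys r" by (simp only: in_keys_iff not_False_eq_True)
  then have "mdegree 0 = i" using r unfolding Rna_grading_def by blast
  then show False using i by simp
 qed
 moreover have "c = 0" if "j \<noteq> 0"
  using c(1) c(2)[OF that] by (simp add: Const_def)
 moreover have "r \<in> PU" using r by (simp add: Rna_grading_def)
 ultimately show "r \<odot>\<^bsub>TM\<^esub> x \<in> TG (int i + j)"
  using c(1) z0 by (cases "i = 0 \<and> j = 0") (auto simp: TM_smult TG_eq simp del: Const_simps(1))
qed

lemma graded_EM: "graded_module (RS s) RG (EM s i) (EG i)"
 unfolding graded_module_def
proof (intro conjI allI ballI left_module_EM)
 interpret left_module "RS s" "EM s i" by (rule left_module_EM)
 have fin: "finite {z. case z of (I, m) \<Rightarrow> cf (w I) m \<noteq> 0}" if "w \<in> V i" for w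
  by (rule finite_subset[of _ "Sigma {I. w I \<noteq> 0} (\<lambda>I. mkeys (w I))"])
   (use fmP_finite[OF that] in "auto simp: in_keys_iff")
 show "is_direct_sum (EM s i) (EG i)"
 proof (rule is_direct_sum_coordinates(1)[where co = "\<lambda>w (I, m). cf (w I) m" and deg = "\<lambda>(I, m). int (card I + mdegree m)"
    and pr = "\<lambda>j w I. diag (\<lambda>m. if int (card I + mdegree m) = j then 1 else 0) (w I)"])
  show "abelian_group (EM s i)" by unfold_locales
  show "\<And>x y. (\<And>z. (case z of (I, m) \<Rightarrow> cf (x I) m) = (case z of (I, m) \<Rightarrow> cf (y I) m)) \<Longrightarrow> x = y"
   by (intro ext poly_mapping_eqI) (metis case_prod_conv)
  show "(\<lambda>I. diag (\<lambda>m. if int (card I + mdegree m) = j then 1 else 0) (w I)) \<in> carrier (EM s i)"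
   if w: "w \<in> carrier (EM s i)" for j w
  proof (simp only: EM_simps, rule fmPI)
   fix I m assume "cf (diag (\<lambda>m. if int (card I + mdegree m) = j then 1 else 0) (w I)) m \<noteq> 0"
   then have "cf (w I) m \<noteq> 0" by (auto split: if_splits)
   then show "upn I m (card I = i)" using fmPD[of w "\<lambda>c d. c = i"] w by simp
  qed
  show "EG i j = {w \<in> carrier (EM s i). \<forall>z. (case z of (I, m) \<Rightarrow> cf (w I) m) \<noteq> 0 \<longrightarrow> (case z of (I, m) \<Rightarrow> int (card I + mdegree m)) = j}" for j
   unfolding EG_def EM_simps fmP_def mem_Collect_eq split_paired_All prod.case by (rule Collect_cong) blast
 qed (use fin in "auto simp: lookup_add case_prod_beta")
next
 fix k j r x assume r: "r \<in> RG k" and x: "x \<in> EG i j"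
 have "act s r x \<in> EG i (int k + j)" unfolding EG_def
  by (rule act_fmP[OF _ x[unfolded EG_def]]) (use r in "auto simp: Rna_grading_def in_keys_iff")
 then show "r \<odot>\<^bsub>EM s i\<^esub> x \<in> EG i (int k + j)" by simp
qed

lemma LB_bs: assumes "I \<in> LB i" shows "bs I \<in> V i" "bs I \<in> Om"
 using bs_V[of I] bs_Om[of I] assms by (auto simp: LB_def)

lemma act_sum:
 assumes "p \<in> PU" "\<And>I. I \<in> A \<Longrightarrow> f I \<in> Om"
 shows "act s p (sum f A) = (\<Sum>I\<in>A. act s p (f I))"
 unfolding act_def using st_sum_right[of "emb p" f A] st_sum_left[of A f "emb p"] assms emb_Om[of p]
 by (cases s) (simp_all only: if_True if_False)

lemma free_EM: "free_on (RS s) (EM s i) (LB i) bs (\<lambda>I w. inv_into (V i) (psi s i) w I)"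
proof (rule free_on_bij)
 show "left_module (RS s) (EM s i)" by (rule left_module_EM)
 show "bij_betw (psi s i) (V i) (carrier (EM s i))" using psi_bij by simp
 show "f I \<in> carrier (RS s)" if "f \<in> V i" for f I using V_component[OF that] by simp
 show z: "f I = \<zero>\<^bsub>RS s\<^esub>" if f: "f \<in> V i" and I: "I \<notin> LB i" for f I
 proof -
  have "cf (f I) m = 0" for m using fmPD[OF f, of I m] I by (auto simp: LB_def)
  then show ?thesis by (auto intro: poly_mapping_eqI)
 qed
 show "finite {I. f I \<noteq> \<zero>\<^bsub>RS s\<^esub>}" if "f \<in> V i" for f using fmP_finite[OF that] by simp
 show "(\<lambda>_. \<zero>\<^bsub>RS s\<^esub>) \<in> V i" by (rule VI) simp_all
 show "(\<lambda>I. f I \<oplus>\<^bsub>RS s\<^esub> g I) \<in> V i \<and> psi s i (\<lambda>I. f I \<oplus>\<^bsub>RS s\<^esub> g I) = psi s i f \<oplus>\<^bsub>EM s i\<^esub> psi s i g"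
  if fg: "f \<in> V i" "g \<in> V i" for f g
 proof
  have "(\<lambda>I. f I \<oplus>\<^bsub>RS s\<^esub> g I) = f + g" by (rule ext) simp
  then show "(\<lambda>I. f I \<oplus>\<^bsub>RS s\<^esub> g I) \<in> V i" using fmP_add[OF fg] by (simp only:)
  show "psi s i (\<lambda>I. f I \<oplus>\<^bsub>RS s\<^esub> g I) = psi s i f \<oplus>\<^bsub>EM s i\<^esub> psi s i g"
   unfolding psi_def RS_simps EM_simps sum.distrib[symmetric]
   by (intro sum.cong refl act_add_left V_component[OF fg(1)] V_component[OF fg(2)] LB_bs(2))
 qed
 show "(\<lambda>I. r \<otimes>\<^bsub>RS s\<^esub> f I) \<in> V i \<and> psi s i (\<lambda>I. r \<otimes>\<^bsub>RS s\<^esub> f I) = r \<odot>\<^bsub>EM s i\<^esub> psi s i f"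
  if r: "r \<in> carrier (RS s)" and f: "f \<in> V i" for r f
 proof
  have r': "r \<in> PU" using r by simp
  show "(\<lambda>I. r \<otimes>\<^bsub>RS s\<^esub> f I) \<in> V i"
  proof (rule VI)
   fix I show "r \<otimes>\<^bsub>RS s\<^esub> f I \<in> PU" using smul_closed[OF r' V_component[OF f]] by simp
   assume "I \<notin> LB i"
   then show "r \<otimes>\<^bsub>RS s\<^esub> f I = 0" using z[OF f] smul_Const(2)[OF r', of s 0] by simp
  qed
  show "psi s i (\<lambda>I. r \<otimes>\<^bsub>RS s\<^esub> f I) = r \<odot>\<^bsub>EM s i\<^esub> psi s i f"
   unfolding psi_def RS_simps EM_simps
   by (subst act_sum[OF r' act_Om[OF V_component[OF f] LB_bs(2)]], assumption)
    (intro sum.cong refl act_assoc r' V_component[OF f] LB_bs(2))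
 qed
 show "(\<lambda>I'. if I' = I then \<one>\<^bsub>RS s\<^esub> else \<zero>\<^bsub>RS s\<^esub>) \<in> V i \<and>
  psi s i (\<lambda>I'. if I' = I then \<one>\<^bsub>RS s\<^esub> else \<zero>\<^bsub>RS s\<^esub>) = bs I" if I: "I \<in> LB i" for I
 proof
  show "(\<lambda>I'. if I' = I then \<one>\<^bsub>RS s\<^esub> else \<zero>\<^bsub>RS s\<^esub>) \<in> V i" by (rule VI) (use I in auto)
  have "psi s i (\<lambda>I'. if I' = I then 1 else 0) = (\<Sum>I'\<in>LB i. if I' = I then bs I else 0)"
   unfolding psi_def by (intro sum.cong refl) (auto simp only: act_one[OF LB_bs(2)[OF I]] act_zero split: if_split)
  also have "\<dots> = bs I" using sum.delta[OF finite_LB[of i], of I "\<lambda>_. bs I"] I by (simp only: if_True)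
  finally show "psi s i (\<lambda>I'. if I' = I then \<one>\<^bsub>RS s\<^esub> else \<zero>\<^bsub>RS s\<^esub>) = bs I" by (simp only: RS_simps)
 qed
qed

text \<open>Minimality: \<open>dd\<close> has image in \<open>R\<^bsub>\<ge>1\<^esub>\<close> times the basis, so a linear map composed with it has no
 constant terms.\<close>

lemma const_free_hom:
 fixes k :: "'k form \<Rightarrow> 'k"
 assumes k: "\<And>v w. \<lbrakk>v \<in> V i; w \<in> V i\<rbrakk> \<Longrightarrow> k (v + w) = k v + k w"
  "\<And>r w. \<lbrakk>r \<in> PU; w \<in> V i\<rbrakk> \<Longrightarrow> k (act s r w) = cf r 0 * k w"
  and w: "w \<in> V (Suc i)"
 shows "k (dd w) = 0"
proof -
 have dw: "dd w \<in> fmP (\<lambda>c d. c = i \<and> 1 \<le> d)" by (rule fmP_dd[OF w]) auto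
 then have "dd w \<in> V i" by (rule fmP_mono) simp
 then have "dd w \<in> psi s i ` V i" using bij_betw_imp_surj_on[OF psi_bij[of s i]] by simp
 then obtain g where g: "g \<in> V i" "psi s i g = dd w" unfolding image_iff by (elim bexE) (rule that, assumption, rule sym)
 have A: "act s (g I) (bs I) \<in> V i" if "I \<in> LB i" for I by (rule act_V[OF V_component[OF g(1)] LB_bs(1)[OF that]])
 have k0: "k 0 = 0" using k(1)[of 0 0] by simp
 \<comment> \<open>Constant terms are multiplicative under \<open>act\<close>, so the component of
   \<open>dd w\<close> at J has the constant term of \<open>g J\<close>; it is 0 because
   \<open>dd w\<close> has positive polynomial degree.\<close>
 have gI: "cf (g J) 0 = 0" if J: "J \<in> LB i" for J
 proof -
  have "cf (dd w J) 0 = 0" using fmPD[OF dw, of J 0] by (auto simp: One_nat_def)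
  moreover have "cf (dd w J) 0 = (\<Sum>I\<in>LB i. cf (act s (g I) (bs I) J) 0)"
   unfolding g(2)[symmetric] psi_def sum_fun_apply lookup_sum ..
  moreover have "\<dots> = (\<Sum>I\<in>LB i. if I = J then cf (g I) 0 else 0)"
  proof (intro sum.cong refl)
   fix I assume I: "I \<in> LB i"
   show "cf (act s (g I) (bs I) J) 0 = (if I = J then cf (g I) 0 else 0)"
    unfolding act_const[OF V_component[OF g(1)] LB_bs(2)[OF I]] by (auto simp: bs_def bas_def)
  qed
  ultimately show ?thesis using J by simp
 qed
 have ks: "k (sum h A) = (\<Sum>I\<in>A. k (h I))" if "\<And>I. I \<in> A \<Longrightarrow> h I \<in> V i" for h and A :: "nat set set"
  using that by (induction A rule: infinite_finite_induct) (simp_all only: sum.infinite sum.empty sum.insert k0 k(1) fmP_sum insert_iff simp_thms)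
 have "k (dd w) = (\<Sum>I\<in>LB i. k (act s (g I) (bs I)))" unfolding g(2)[symmetric] psi_def by (rule ks[OF A])
 also have "\<dots> = 0" by (rule sum.neutral) (simp add: k(2)[OF V_component[OF g(1)] LB_bs(1)] gI)
 finally show ?thesis .
qed

text \<open>The Koszul complex copied along t into the type in which resolutions are compared; the
  maps are conjugated by t.\<close>

definition res :: "bool \<Rightarrow> ('k form \<Rightarrow> 'u) \<Rightarrow> ('k mpoly, 'u, 'k mpoly) resolution" where
 "res s t = \<lparr>res_mod = \<lambda>i. transport t (EM s i), res_grading = \<lambda>i j. t ` EG i j,
   res_diff = \<lambda>i x. t (dd (inv_into (V (Suc i)) t x)), res_aug = \<lambda>x. augE (inv_into (V 0) t x)\<rparr>"

lemma res_simps [simp]: "res_mod (res s t) i = transport t (EM s i)" "res_grading (res s t) i j = t ` EG i j"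
 "res_diff (res s t) i x = t (dd (inv_into (V (Suc i)) t x))" "res_aug (res s t) x = augE (inv_into (V 0) t x)"
 by (simp_all add: res_def)

lemma dd_V: "w \<in> V (Suc i) \<Longrightarrow> dd w \<in> V i"
 by (erule fmP_dd) simp

lemma dd_hom: "dd \<in> mod_hom (RS s) (EM s (Suc i)) (EM s i)"
 by (rule mod_homI) (simp_all only: EM_simps RS_simps dd_V dd_simps act_dd)

lemma augE_hom: "augE \<in> mod_hom (RS s) (EM s 0) TM"
 by (rule mod_homI) (auto simp: augE_def TM_smult act_const fmP_Om lookup_add)

lemma dd_image_0: "dd ` V (Suc 0) = {w \<in> V 0. augE w = 0}"
proof (intro equalityI subsetI)
 fix w assume "w \<in> dd ` V (Suc 0)"
 then obtain v where v: "v \<in> V (Suc 0)" "w = dd v" by blast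
 have "dd v \<in> fmP (\<lambda>c d. 1 \<le> d)" by (rule fmP_dd[OF v(1)]) auto
 then have "cf (dd v {}) 0 = 0" using fmPD[of "dd v" _ "{}" 0] by (auto simp: One_nat_def)
 then show "w \<in> {w \<in> V 0. augE w = 0}" using dd_V[OF v(1)] v(2) by (simp add: augE_def)
next
 fix w assume "w \<in> {w \<in> V 0. augE w = 0}"
 then have w: "w \<in> V 0" "cf (w {}) 0 = 0" by (auto simp: augE_def) (metis Const_def lookup_single_eq lookup_zero)
 have "dd w \<in> fmP (\<lambda>_ _. False)" by (rule fmP_dd[OF w(1)]) simp
 then have "cf (dd w I) m = 0" for I m using fmPD[of "dd w" "\<lambda>_ _. False" I m] by blast
 then have "dd w = 0" by (intro ext poly_mapping_eqI) simp
 then show "w \<in> dd ` V (Suc 0)" using Koszul_exact[OF w(1) _ w(2), of "\<lambda>c d. c = Suc 0"] by auto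
qed

lemma dd_image_Suc: "dd ` V (Suc (Suc i)) = {w \<in> V (Suc i). dd w = 0}"
proof (intro equalityI subsetI)
 fix w assume "w \<in> dd ` V (Suc (Suc i))"
 then show "w \<in> {w \<in> V (Suc i). dd w = 0}" using dd_V dd_dd fmP_fsup by fastforce
next
 fix w assume w: "w \<in> {w \<in> V (Suc i). dd w = 0}"
 then have "cf (w {}) 0 = 0" using fmPD[of w "\<lambda>c d. c = Suc i" "{}" 0] by auto
 then show "w \<in> dd ` V (Suc (Suc i))" using w Koszul_exact[of w "\<lambda>c d. c = Suc i" "\<lambda>c d. c = Suc (Suc i)"] by blast
qed

lemma V_Om: "V i \<subseteq> Om"
 using fmP_Om by blast

lemma graded_resolution:
 fixes t :: "'k form \<Rightarrow> 'u"
 assumes t: "inj_on t Om" shows "graded_proj_resolution (RS s) RG TM TG (res s t)"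
 unfolding graded_proj_resolution_def proj_resolution_def
proof (intro conjI allI left_module_TM graded_TM)
 have tV: "inj_on t (V i)" for i by (rule inj_on_subset[OF t V_Om])
 have tE: "inj_on t (carrier (EM s i))" for i using tV by simp
 have ti: "inv_into (V i) t (t w) = w" if "w \<in> V i" for w i using tV that by simp
 have tz: "t w = t 0 \<longleftrightarrow> w = 0" if "w \<in> V i" for w i using inj_on_eq_iff[OF tV that fmP_zero] .
 have tih: "inv_into (V i) t \<in> mod_hom (RS s) (transport t (EM s i)) (EM s i)" for i
  using transport_inv_hom[OF left_module_EM tE, of i] by simp
 fix i
 show "projective (RS s) (res_mod (res s t) i)"
  unfolding res_simps by (rule free_on_projective[OF transport_free_on[OF free_EM tE]])
 show "res_diff (res s t) i \<in> mod_hom (RS s) (res_mod (res s t) (Suc i)) (res_mod (res s t) i)"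
  using mod_hom_comp[OF mod_hom_comp[OF tih dd_hom] transport_hom[OF left_module_EM tE]] by (simp add: res_def)
 show "res_aug (res s t) \<in> mod_hom (RS s) (res_mod (res s t) 0) TM"
  using mod_hom_comp[OF tih augE_hom] by (simp add: res_def)
 show "res_aug (res s t) ` carrier (res_mod (res s t) 0) = carrier TM"
 proof (intro equalityI subsetI)
  fix x assume "x \<in> carrier TM"
  then obtain c where c: "x = Const c" by auto
  have e: "emb (Const c) \<in> V 0" by (rule emb_V0) simp
  have "augE (emb (Const c)) = Const c" by (simp add: augE_def emb_def Const_def)
  then show "x \<in> res_aug (res s t) ` carrier (res_mod (res s t) 0)"
   using e ti[OF e] c by (intro image_eqI[of _ _ "t (emb (Const c))"]) auto
 qed (auto simp: augE_def)
 have im: "res_diff (res s t) i ` carrier (res_mod (res s t) (Suc i)) = t ` dd ` V (Suc i)" for i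
  unfolding res_simps transport_simps EM_simps image_image by (intro image_cong refl) (simp add: ti)
 show "res_diff (res s t) 0 ` carrier (res_mod (res s t) 1) = {x \<in> carrier (res_mod (res s t) 0). res_aug (res s t) x = \<zero>\<^bsub>TM\<^esub>}"
  unfolding One_nat_def im dd_image_0 by (auto simp: ti)
 show "res_diff (res s t) (Suc i) ` carrier (res_mod (res s t) (Suc (Suc i))) =
  {x \<in> carrier (res_mod (res s t) (Suc i)). res_diff (res s t) i x = \<zero>\<^bsub>res_mod (res s t) i\<^esub>}"
  unfolding im dd_image_Suc by (auto simp: ti tz[OF dd_V])
 show "graded_module (RS s) RG (res_mod (res s t) i) (res_grading (res s t) i)"
  using graded_module_transport[OF graded_EM tE] by (simp add: res_def)
 fix j
 have EV: "w \<in> V i" if "w \<in> EG i j" for w i j using that unfolding EG_def by (rule fmP_mono) simp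
 show "res_diff (res s t) i ` res_grading (res s t) (Suc i) j \<subseteq> res_grading (res s t) i j"
 proof (clarsimp simp: ti EV)
  fix w assume w: "w \<in> EG (Suc i) j"
  have "dd w \<in> EG i j" unfolding EG_def by (rule fmP_dd[OF w[unfolded EG_def]]) auto
  then show "t (dd w) \<in> t ` EG i j" by blast
 qed
 show "res_aug (res s t) ` res_grading (res s t) 0 j \<subseteq> TG j"
 proof (clarsimp simp: ti EV)
  fix w assume w: "w \<in> EG 0 j"
  have "j = 0" if "cf (w {}) 0 \<noteq> 0" using fmPD[OF w[unfolded EG_def] that] by simp
  then show "augE w \<in> TG j" using rangeI[of Const "0::'k"] by (cases "cf (w {}) 0 = 0") (auto simp: augE_def TG_eq)
 qed
qed

end

section \<open>Self-duality of the Koszul complex and the lower bound for the dimension\<close>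

context forms
begin

lemma RS_False: "op_ring RR = RS False"
 by (simp add: RS_def)

lemma top_hom:
 assumes i: "i \<le> Suc n" and v: "v \<in> V (Suc n - i)"
 shows "(\<lambda>w. top (v \<star> w)) \<in> mod_hom (RS False) (EM False i) (regular_module (RS False))"
proof (rule mod_homI)
 have vw: "v \<star> w \<in> V (Suc n)" if "w \<in> V i" for w by (rule fmP_st[OF v that]) (use i in simp)
 fix w assume "w \<in> carrier (EM False i)"
 then have w: "w \<in> V i" by simp
 show "top (v \<star> w) \<in> carrier (regular_module (RS False))" using V_component[OF vw[OF w]] by (simp add: top_def)
 show "top (v \<star> (w \<oplus>\<^bsub>EM False i\<^esub> w')) = top (v \<star> w) \<oplus>\<^bsub>regular_module (RS False)\<^esub> top (v \<star> w')" for w'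
  by (simp only: EM_simps RS_simps regular_module_simps st_add_right[OF fmP_Om[OF v]] top_add)
 fix r assume "r \<in> carrier (RS False)"
 then have r: "r \<in> PU" by simp
 have "v \<star> (w \<star> emb r) = (v \<star> w) \<star> emb r"
  by (rule st_assoc[symmetric]) (use fmP_Om[OF v] fmP_Om[OF w] r emb_Om in auto)
 then show "top (v \<star> (r \<odot>\<^bsub>EM False i\<^esub> w)) = r \<odot>\<^bsub>regular_module (RS False)\<^esub> top (v \<star> w)"
  using top_star[OF vw[OF w], of r] by (simp add: act_def smul_def)
qed

lemma bs_top: "bs top_set \<in> V (Suc n)"
 using bs_V[of top_set] by simp

text \<open>The model is the Koszul complex with N = n, the generator is the top form and the dual
  functional is \<open>top\<close>. Exactness of the dual is \<open>dual_exact\<close>, and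
  minimality is \<open>const_free_hom\<close>.\<close>

lemma ext_comparison_Koszul:
 fixes t :: "'k form \<Rightarrow> 'u" and C :: "('k mpoly, 'u, 'k mpoly) resolution"
 assumes t: "inj_on t Om" and C: "graded_proj_resolution (op_ring RR) RG TM TG C"
 shows "ext_comparison RR (range Const) RG TM TG C (res False t) n (t (bs top_set)) (\<lambda>x. top (inv_into (V (Suc n)) t x))"
proof -
 have tV: "inj_on t (V i)" for i by (rule inj_on_subset[OF t V_Om])
 have tE: "inj_on t (carrier (EM s i))" for i s using tV by simp
 have ti: "inv_into (V i) t (t w) = w" if "w \<in> V i" for w i using tV that by simp
 have th: "t \<in> mod_hom (RS False) (EM False i) (transport t (EM False i))" for i
  by (rule transport_hom[OF left_module_EM tE])
 have tih: "inv_into (V i) t \<in> mod_hom (RS False) (transport t (EM False i)) (EM False i)" for i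
  using transport_inv_hom[OF left_module_EM[of False i] tE] by simp
 have F: "F (t w) \<in> PU" "F (t (v + w)) = F (t v) + F (t w)" "F (t (act False f w)) = smul False f (F (t w))"
  if "F \<in> mod_hom (RS False) (transport t (EM False i)) (regular_module (RS False))" "v \<in> V i" "w \<in> V i" "f \<in> PU" for F i v w f
  using mod_hom_closed[OF mod_hom_comp[OF th that(1)], of w] mod_hom_add[OF mod_hom_comp[OF th that(1)], of v w]
   mod_hom_smult[OF mod_hom_comp[OF th that(1)], of f w] that by simp_all
 have dual: "\<exists>v'. v' \<in> V (Suc n - i + 1) \<and> (\<forall>w\<in>V i. F (t w) = top (dd v' \<star> w))"
  if i: "i \<le> Suc n" and F': "F \<in> mod_hom (RS False) (transport t (EM False i)) (regular_module (RS False))"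
   and coc: "\<And>u. u \<in> V (Suc i) \<Longrightarrow> F (t (dd u)) = 0" and c: "i = Suc n \<Longrightarrow> cf (F (t (bs top_set))) 0 = 0" for i F
  by (rule dual_exact[OF i]) (use F[OF F' fmP_zero _ polys_simps(1)] F(2)[OF F' _ _ polys_simps(1)] F(3)[OF F' fmP_zero] coc c in \<open>auto simp: act_def smul_def\<close>)
 show ?thesis
 proof (rule ext_comparison.intro)
  show "connected_graded_algebra RR (range Const) RG" by (rule connected_graded_RR)
  show "graded_proj_resolution (op_ring RR) RG TM TG C" by (rule C)
  show "graded_proj_resolution (op_ring RR) RG TM TG (res False t)"
   unfolding RS_False by (rule graded_resolution[OF t])
 next
  fix i assume "Suc n < i"
  then have "V i = {0}" using V_big[of _ i] fmP_zero by blast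
  then show "carrier (res_mod (res False t) i) = {\<zero>\<^bsub>res_mod (res False t) i\<^esub>}" by simp
 next
  fix F x assume F': "F \<in> mod_hom (op_ring RR) (res_mod (res False t) 0) (regular_module (op_ring RR))"
   and c: "\<And>x. x \<in> carrier (res_mod (res False t) (Suc 0)) \<Longrightarrow> F (res_diff (res False t) 0 x) = \<zero>\<^bsub>RR\<^esub>"
   and x: "x \<in> carrier (res_mod (res False t) 0)"
  have "F (t (dd u)) = 0" if "u \<in> V (Suc 0)" for u using c[of "t u"] that ti[OF that] by simp
  then obtain v where v: "v \<in> V (Suc n - 0 + 1)" "\<forall>w\<in>V 0. F (t w) = top (dd v \<star> w)"
   using dual[of 0 F] F' unfolding RS_False res_simps by blast
  \<comment> \<open>The representing form has exterior degree n + 2, so it is 0, and so is F: the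
    cohomology vanishes in degree 0.\<close>
  have "v = 0" by (rule V_big[OF v(1)]) (simp add: One_nat_def)
  then have "top (dd v \<star> w) = 0" for w by (simp only: dd_simps st_zero top_add)
  then show "F x = \<zero>\<^bsub>RR\<^esub>" using v(2) x by auto
 next
  fix F i assume F': "F \<in> mod_hom (op_ring RR) (res_mod (res False t) (Suc i)) (regular_module (op_ring RR))" and i: "i \<le> n"
   and c: "\<And>x. x \<in> carrier (res_mod (res False t) (Suc (Suc i))) \<Longrightarrow> F (res_diff (res False t) (Suc i) x) = \<zero>\<^bsub>RR\<^esub>"
   and c0: "i = n \<Longrightarrow> hcomp RR RG 0 (F (t (bs top_set))) = \<zero>\<^bsub>RR\<^esub>"
  note F'' = F'[unfolded RS_False res_simps]
  have "F (t (dd u)) = 0" if "u \<in> V (Suc (Suc i))" for u using c[of "t u"] that ti[OF that] by simp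
  moreover have "cf (F (t (bs top_set))) 0 = 0" if "Suc i = Suc n"
  proof -
   have "Const (cf (F (t (bs top_set))) 0) = 0"
    using c0 that F(1)[OF F'' fmP_zero _ polys_simps(1), of "bs top_set"] bs_top by (simp add: grading_RR(2))
   then show ?thesis by (metis Const_def lookup_single_eq lookup_zero)
  qed
  ultimately obtain v where v: "v \<in> V (Suc n - Suc i + 1)" "\<forall>w\<in>V (Suc i). F (t w) = top (dd v \<star> w)"
   using dual[OF _ F''] i by auto
  \<comment> \<open>The sign with which \<open>dd\<close> moves across the pairing in
    \<open>top_dd_st\<close>.\<close>
  let ?c = "- ((- 1) ^ (Suc n - i)) :: 'k"
  have vV: "v \<in> V (Suc n - i)" using v(1) i by (simp add: Suc_diff_le One_nat_def)
  let ?v = "pm (Const ?c) v"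
  have ps: "(\<lambda>x. top (?v \<star> inv_into (V i) t x)) \<in> mod_hom (op_ring RR) (res_mod (res False t) i) (regular_module (op_ring RR))"
   unfolding RS_False res_simps by (rule mod_hom_comp[OF tih top_hom[OF _ fmP_sc[OF vV]]]) (use i in simp)
  have "F x = top (?v \<star> inv_into (V i) t (res_diff (res False t) i x))"
   if "x \<in> carrier (res_mod (res False t) (Suc i))" for x
  proof -
   from that obtain w where w: "w \<in> V (Suc i)" "x = t w" by auto
   have "top (?v \<star> dd w) = top (dd v \<star> w)"
    unfolding st_sc_left[OF fmP_Om[OF vV]] top_add top_dd_st[OF Suc_leI[OF le_imp_less_Suc[OF i]] vV w(1)]
    by (simp flip: Const_simps(5))
   then show ?thesis using v(2) w ti[OF dd_V[OF w(1)]] ti[OF w(1)] by simp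
  qed
  then show "\<exists>\<psi>\<in>mod_hom (op_ring RR) (res_mod (res False t) i) (regular_module (op_ring RR)).
    \<forall>x\<in>carrier (res_mod (res False t) (Suc i)). F x = \<psi> (res_diff (res False t) i x)"
   using ps by (intro bexI[of _ "\<lambda>x. top (?v \<star> inv_into (V i) t x)"]) auto
 next
  have "bs top_set \<in> EG (Suc n) (int (Suc n))"
   unfolding EG_def by (rule fmP_mono[OF bs_fmP[OF order_refl]]) simp
  then show "t (bs top_set) \<in> res_grading (res False t) (Suc n) (int (Suc n))" by simp
  have 1: "emb 1 \<in> V (Suc n - Suc n)" using emb_V0[of 1] by simp
  have "(\<lambda>w. top (emb 1 \<star> w)) \<in> mod_hom (RS False) (EM False (Suc n)) (regular_module (RS False))" by (rule top_hom[OF order_refl 1])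
  then have "top \<in> mod_hom (RS False) (EM False (Suc n)) (regular_module (RS False))"
   by (rule mod_hom_cong[OF left_module_EM]) (simp add: one_st fmP_fsup)
  from mod_hom_comp[OF tih this]
  show "(\<lambda>x. top (inv_into (V (Suc n)) t x)) \<in> mod_hom (op_ring RR) (res_mod (res False t) (Suc n)) (regular_module (op_ring RR))"
   unfolding RS_False res_simps .
  show "top (inv_into (V (Suc n)) t (t (bs top_set))) = \<one>\<^bsub>RR\<^esub>" by (simp add: ti[OF bs_top] top_bs)
 next
  fix j x assume "x \<in> res_grading (res False t) (Suc n) j"
  then obtain w where w: "w \<in> EG (Suc n) j" "x = t w" by auto
  have wV: "w \<in> V (Suc n)" using w(1) unfolding EG_def by (rule fmP_mono) simp
  have d: "int (Suc n + mdegree m) = j" if "cf (top w) m \<noteq> 0" for m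
   using fmPD[OF w(1)[unfolded EG_def], of top_set m] that by (simp add: top_def)
  have P: "top w \<in> PU" using V_component[OF wV] by (simp add: top_def)
  have "top w \<in> int_grading RR RG (j - int (Suc n))"
  proof (cases "int (Suc n) \<le> j")
   case True
   have "mdegree m = nat (j - int (Suc n))" if "cf (top w) m \<noteq> 0" for m using d[OF that] by simp
   then show ?thesis using True P by (auto simp: int_grading_def Rna_grading_def in_keys_iff)
  next
   case False
   then have "cf (top w) m = 0" for m using d[of m] by auto
   then have "top w = 0" by (intro poly_mapping_eqI) simp
   then show ?thesis using False by (simp add: int_grading_def)
  qed
  then show "top (inv_into (V (Suc n)) t x) \<in> int_grading RR RG (j - int (Suc n))" using ti[OF wV] w(2) by simp
 next
  fix \<psi> assume "\<psi> \<in> mod_hom (op_ring RR) (res_mod (res False t) n) (regular_module (op_ring RR))"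
  then have ps: "\<psi> \<in> mod_hom (RS False) (transport t (EM False n)) (regular_module (RS False))" unfolding RS_False res_simps .
  have "cf (\<psi> (t (dd (bs top_set)))) 0 = 0"
   by (rule const_free_hom[of n "\<lambda>w. cf (\<psi> (t w)) 0" False, OF _ _ bs_top])
    (simp_all add: F(2)[OF ps _ _ polys_simps(1)] F(3)[OF ps fmP_zero] lookup_add smul_const F(1)[OF ps fmP_zero _ polys_simps(1)])
  moreover have "\<psi> (t (dd (bs top_set))) \<in> PU" by (rule F(1)[OF ps fmP_zero dd_V[OF bs_top] polys_simps(1)])
  ultimately show "hcomp RR RG 0 (\<psi> (res_diff (res False t) n (t (bs top_set)))) = \<zero>\<^bsub>RR\<^esub>"
   by (simp add: ti[OF bs_top] grading_RR(2))
 qed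
qed

text \<open>By minimality, a linear map sends the differential of the top form to a form whose top
  coefficient has no constant term, whereas the top coefficient of the top form is 1. So the last
  differential has no left inverse, as \<open>proj_dim_lower\<close> requires.\<close>

lemma proj_dim_trivial_ge:
 fixes t :: "'k form \<Rightarrow> 'u" and t' :: "'k mpoly \<Rightarrow> 'u"
 assumes t: "inj_on t Om" and t': "inj t'"
 shows "enat (Suc n) \<le> proj_dim (RS s) (transport t' TM)"
proof (rule proj_dim_lower)
 have tV: "inj_on t (V i)" for i by (rule inj_on_subset[OF t V_Om])
 have ti: "inv_into (V i) t (t w) = w" if "w \<in> V i" for w i using tV that by simp
 have E: "proj_resolution (RS s) TM (res_mod (res s t)) (res_diff (res s t)) (res_aug (res s t))"
  using graded_resolution[OF t] by (simp add: graded_proj_resolution_def)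
 show "proj_resolution (RS s) (transport t' TM) (res_mod (res s t)) (res_diff (res s t)) (\<lambda>x. t' (res_aug (res s t) x))"
  by (rule proj_resolution_transport[OF E inj_on_subset[OF t']]) simp
 have "V (Suc (Suc n)) = {0}" using V_big[of _ "Suc (Suc n)"] fmP_zero by blast
 then show "carrier (res_mod (res s t) (Suc (Suc n))) = {\<zero>\<^bsub>res_mod (res s t) (Suc (Suc n))\<^esub>}" by simp
 show "t (bs top_set) \<in> carrier (res_mod (res s t) (Suc n))" using bs_top by simp
 fix h assume "h \<in> mod_hom (RS s) (res_mod (res s t) n) (res_mod (res s t) (Suc n))"
 then have h: "h \<in> mod_hom (RS s) (transport t (EM s n)) (transport t (EM s (Suc n)))" by simp
 have tE: "inj_on t (carrier (EM s i))" for i using tV by simp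
 have g: "(\<lambda>w. inv_into (V (Suc n)) t (h (t w))) \<in> mod_hom (RS s) (EM s n) (EM s (Suc n))"
  using mod_hom_comp[OF mod_hom_comp[OF transport_hom[OF left_module_EM tE] h] transport_inv_hom[OF left_module_EM tE]] by simp
 have gc: "inv_into (V (Suc n)) t (h (t w)) \<in> Om" if "w \<in> V n" for w using mod_hom_closed[OF g, of w] fmP_Om that by simp
 have "cf (inv_into (V (Suc n)) t (h (t (dd (bs top_set)))) top_set) 0 = 0"
  by (rule const_free_hom[of n "\<lambda>w. cf (inv_into (V (Suc n)) t (h (t w)) top_set) 0" s, OF _ _ bs_top])
   (use mod_hom_add[OF g] mod_hom_smult[OF g] in "auto simp: lookup_add act_const[OF _ gc]")
 moreover have "cf (bs top_set top_set) 0 = 1" by (simp add: bs_def bas_def)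
 ultimately have "inv_into (V (Suc n)) t (h (t (dd (bs top_set)))) \<noteq> bs top_set" by auto
 then show "h (res_diff (res s t) n (t (bs top_set))) \<noteq> t (bs top_set)" using ti[OF bs_top] by auto
qed

end

section \<open>The iterated Ore extension\<close>

lemma cf_mult_sgl: "cf (sgl k 1 * p) (k + m) = cf p m" for p :: "'k::comm_ring_1 mpoly"
proof (induction p rule: mpoly_induct)
 case (single m')
 have "k + m' = k + m \<longleftrightarrow> m' = m" by simp
 then show ?case by (simp add: mult_single lookup_single)
qed (simp_all add: algebra_simps lookup_add)

lemma cf_add_nonzero: "cf (p + q) m \<noteq> 0 \<Longrightarrow> cf p m \<noteq> 0 \<or> cf q m \<noteq> 0"
 for p q :: "'k::comm_ring_1 mpoly"
 by (auto simp: lookup_add)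

text \<open>Delta acts on monomials by moves from \<open>X\<^sub>i\<close> to
  \<open>X\<^sub>i\<^sub>-\<^sub>1\<close>, and functions of \<Gamma> do not enlarge the support. So
  a property of monomials that is stable under these moves controls all summands of the star
  product.\<close>

lemma star_support:
 assumes nz: "cf (star n a p q) m \<noteq> 0"
  and p: "\<And>m. cf p m \<noteq> 0 \<Longrightarrow> P m" and q: "\<And>m. cf q m \<noteq> 0 \<Longrightarrow> Q m"
  and D: "\<And>m m' i. \<lbrakk>P m'; cf m' i \<noteq> 0; 1 \<le> i; m' + sgl (i - 1) 1 = m + sgl i 1\<rbrakk> \<Longrightarrow> P m"
  and R: "\<And>m m'. \<lbrakk>P m; Q m'\<rbrakk> \<Longrightarrow> S (m + m')"
 shows "S m"
proof -
 have Dk: "P m" if "cf ((Delta n ^^ k) p) m \<noteq> 0" for k m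
  using that
 proof (induction k arbitrary: m)
  case (Suc k)
  from cf_Delta_nonzero[of n "(Delta n ^^ k) p" m] Suc.prems obtain m' j where
   "cf ((Delta n ^^ k) p) m' \<noteq> 0" "1 \<le> j" "cf m' j \<noteq> 0" "m' + sgl (j - 1) 1 = m + sgl j 1" by auto
  then show ?case using D Suc.IH by blast
 qed (use p in simp)
 obtain k where "cf ((Delta n ^^ k) p * Gam_binom n a k q) m \<noteq> 0"
  using nz unfolding star_def Sum_any.expand_set lookup_sum by (meson sum.not_neutral_contains_not_neutral)
 from cf_mult_nonzero[OF this] obtain m1 m2 where
  "cf ((Delta n ^^ k) p) m1 \<noteq> 0" "cf (Gam_binom n a k q) m2 \<noteq> 0" "m = m1 + m2" by blast
 then show ?thesis using R[OF Dk q] by (simp add: Gam_binom_diag)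
qed

context forms
begin

text \<open>Polynomials in the variables up to j with degree at most d in the last of them. The
  bound is an \<open>enat\<close> so that infinity gives the whole subalgebra.\<close>

definition FS :: "nat \<Rightarrow> enat \<Rightarrow> 'k mpoly set" where
 "FS j d = {p. \<forall>m. cf p m \<noteq> 0 \<longrightarrow> mkeys m \<subseteq> {..j} \<and> enat (cf m j) \<le> d}"
definition PS :: "nat \<Rightarrow> 'k mpoly set" where
 "PS j = {p. \<forall>m. cf p m \<noteq> 0 \<longrightarrow> mkeys m \<subseteq> {..<j}}"
definition L :: "nat \<Rightarrow> 'k mpoly set" where
 "L s = {p \<in> PU. \<forall>m. cf p m \<noteq> 0 \<longrightarrow> wgt {} m < s}"

lemma PS_0: "PS 0 = range Const"
proof -
 have "p = Const (cf p 0)" if "p \<in> PS 0" for p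
  using that by (intro poly_mapping_eqI) (fastforce simp: PS_def Const_def lookup_single when_def)
 moreover have "Const c \<in> PS 0" for c by (auto simp: PS_def Const_def lookup_single when_def)
 ultimately show ?thesis by blast
qed

lemma PS_Suc: "PS (Suc j) = FS j \<infinity>"
 by (auto simp: PS_def FS_def lessThan_Suc_atMost)

lemma PS_top: "PS (Suc n) = PU"
 by (auto simp: PS_def polys_upto_def lessThan_Suc_atMost in_keys_iff)

lemma PS_FS: "PS j \<subseteq> FS j 0"
proof -
 have "cf m j = 0" if "mkeys m \<subseteq> {..<j}" for m :: "nat \<Rightarrow>\<^sub>0 nat"
  using that by (metis in_keys_iff lessThan_iff less_irrefl subsetD)
 then show ?thesis by (fastforce simp: PS_def FS_def zero_enat_def)
qed

lemma FS_mono: "p \<in> FS j d \<Longrightarrow> d \<le> e \<Longrightarrow> p \<in> FS j e"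
 unfolding FS_def mem_Collect_eq by (meson order_trans)

lemma PS_polys: assumes "j \<le> Suc n" "p \<in> PS j" shows "p \<in> PU"
 unfolding polys_upto_def mem_Collect_eq
proof
 fix m assume "m \<in> mkeys p"
 then have "mkeys m \<subseteq> {..<j}" using assms(2) by (simp add: PS_def in_keys_iff)
 also have "\<dots> \<subseteq> {..n}" using assms(1) by auto
 finally show "mkeys m \<subseteq> {..n}" .
qed

lemma FS_polys: "j \<le> n \<Longrightarrow> p \<in> FS j d \<Longrightarrow> p \<in> PU"
 by (rule PS_polys[of "Suc j"]) (simp_all add: PS_Suc FS_mono)

lemma FS_zero [simp]: "0 \<in> FS j d" by (simp add: FS_def)

lemma FS_add: "\<lbrakk>p \<in> FS j d; q \<in> FS j d\<rbrakk> \<Longrightarrow> p + q \<in> FS j d"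
 unfolding FS_def mem_Collect_eq
proof (intro allI impI)
 fix m assume *: "\<forall>m. cf p m \<noteq> 0 \<longrightarrow> mkeys m \<subseteq> {..j} \<and> enat (cf m j) \<le> d" "\<forall>m. cf q m \<noteq> 0 \<longrightarrow> mkeys m \<subseteq> {..j} \<and> enat (cf m j) \<le> d"
  and "cf (p + q) m \<noteq> 0"
 from cf_add_nonzero[OF this(3)] show "mkeys m \<subseteq> {..j} \<and> enat (cf m j) \<le> d" by (elim disjE) (use *[THEN spec, of m] in simp_all)
qed

lemma FS_uminus: "p \<in> FS j d \<Longrightarrow> - p \<in> FS j d"
 by (simp add: FS_def)

lemma FS_sum: "(\<And>i. i \<in> A \<Longrightarrow> f i \<in> FS j d) \<Longrightarrow> sum f A \<in> FS j d"
 by (induction A rule: infinite_finite_induct) (auto intro: FS_add)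

text \<open>All indices are at most j, so the moves of Delta never raise the exponent of
  \<open>X\<^sub>j\<close>; degrees in \<open>X\<^sub>j\<close> add as for the commutative
  product.\<close>

lemma FS_star:
 assumes p: "p \<in> FS j d" and q: "q \<in> FS j e" shows "star n a p q \<in> FS j (d + e)"
 unfolding FS_def mem_Collect_eq
proof (intro allI impI)
 fix m assume "cf (star n a p q) m \<noteq> 0"
 then show "mkeys m \<subseteq> {..j} \<and> enat (cf m j) \<le> d + e"
 proof (rule star_support)
  show "\<And>m. cf p m \<noteq> 0 \<Longrightarrow> mkeys m \<subseteq> {..j} \<and> enat (cf m j) \<le> d" using p by (simp add: FS_def)
  show "\<And>m. cf q m \<noteq> 0 \<Longrightarrow> mkeys m \<subseteq> {..j} \<and> enat (cf m j) \<le> e" using q by (simp add: FS_def)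
  fix m m' :: "nat \<Rightarrow>\<^sub>0 nat"
  show "mkeys (m + m') \<subseteq> {..j} \<and> enat (cf (m + m') j) \<le> d + e"
   if "mkeys m \<subseteq> {..j} \<and> enat (cf m j) \<le> d" "mkeys m' \<subseteq> {..j} \<and> enat (cf m' j) \<le> e"
   using that by (simp add: keys_add_nat lookup_add add_mono flip: plus_enat_simps(1))
  fix i assume m': "mkeys m' \<subseteq> {..j} \<and> enat (cf m' j) \<le> d" "cf m' i \<noteq> 0" "1 \<le> i"
   and eq: "m' + sgl (i - 1) 1 = m + sgl i 1"
  have ij: "i \<le> j" using m'(1,2) by (auto simp: in_keys_iff subset_iff)
  have "mkeys m \<subseteq> mkeys (m + sgl i 1)" unfolding keys_add_nat by (rule Un_upper1)
  then have "mkeys m \<subseteq> {..j}" unfolding eq[symmetric] using m'(1) ij by (auto simp: keys_add_nat)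
  moreover have "cf m j \<le> cf m' j" using arg_cong[OF eq, of "\<lambda>m. cf m j"] ij m'(3)
   by (auto simp: lookup_add lookup_single when_def split: if_splits)
  ultimately show "mkeys m \<subseteq> {..j} \<and> enat (cf m j) \<le> d" using m'(1) by (meson enat_ord_simps(1) order_trans)
 qed
qed

lemma FS_smul: "\<lbrakk>p \<in> FS j d; q \<in> FS j e\<rbrakk> \<Longrightarrow> smul s p q \<in> FS j (d + e)"
 using FS_star[of p j d q e] FS_star[of q j e p d] by (simp add: smul_def add.commute)

lemma PS_smul: "\<lbrakk>p \<in> PS j; q \<in> PS j\<rbrakk> \<Longrightarrow> smul s p q \<in> PS j"
proof (cases j)
 case 0
 assume "p \<in> PS j" "q \<in> PS j"
 then show ?thesis using 0 smul_Const(1)[of q s] by (auto simp: PS_0)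
next
 case (Suc i)
 assume "p \<in> PS j" "q \<in> PS j"
 then show ?thesis using Suc FS_smul[of p i \<infinity> q \<infinity> s] by (simp add: PS_Suc)
qed

lemma PS_zero [simp]: "0 \<in> PS j" by (simp add: PS_def)

lemma PS_add: "\<lbrakk>p \<in> PS j; q \<in> PS j\<rbrakk> \<Longrightarrow> p + q \<in> PS j"
 unfolding PS_def mem_Collect_eq
proof (intro allI impI)
 fix m assume *: "\<forall>m. cf p m \<noteq> 0 \<longrightarrow> mkeys m \<subseteq> {..<j}" "\<forall>m. cf q m \<noteq> 0 \<longrightarrow> mkeys m \<subseteq> {..<j}"
  and "cf (p + q) m \<noteq> 0"
 from cf_add_nonzero[OF this(3)] show "mkeys m \<subseteq> {..<j}" by (elim disjE) (use *[THEN spec, of m] in simp_all)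
qed

lemma PS_uminus: "p \<in> PS j \<Longrightarrow> - p \<in> PS j"
 by (simp add: PS_def)

lemma PS_one [simp]: "1 \<in> PS j"
 by (auto simp: PS_def lookup_one when_def)

abbreviation "RP s j \<equiv> RS s\<lparr>carrier := PS j\<rparr>"

lemma ring_PS:
 assumes "j \<le> Suc n" shows "ring (RP s j)"
proof -
 interpret R: ring "RS s" by (rule ring_RS)
 note P = PS_polys[OF assms]
 show ?thesis
 proof (rule ringI)
  show "abelian_group (RP s j)" by (rule abelian_group_type) (auto intro: PS_add PS_uminus)
  show "monoid (RP s j)"
   by (rule monoidI) (use R.m_assoc R.l_one R.r_one in "auto intro: PS_smul simp: P")
 qed (use R.l_distr R.r_distr in "auto simp: P")
qed

lemma L_iff: "p \<in> L s \<longleftrightarrow> emb p \<in> lv s"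
 by (auto simp: L_def lv_def emb_Om) (auto simp: emb_def split: if_splits)

lemma L_add: "\<lbrakk>p \<in> L s; q \<in> L s\<rbrakk> \<Longrightarrow> p + q \<in> L s"
 and L_uminus: "p \<in> L s \<Longrightarrow> - p \<in> L s"
 unfolding L_iff emb_simps by (rule lv_add lv_uminus; assumption)+

lemma L_mono: "p \<in> L s \<Longrightarrow> s \<le> t \<Longrightarrow> p \<in> L t"
 unfolding L_iff by (rule lv_mono)

lemma L_sum: "(\<And>i. i \<in> A \<Longrightarrow> f i \<in> L s) \<Longrightarrow> sum f A \<in> L s"
proof (induction A rule: infinite_finite_induct)
 case (insert x F)
 then show ?case using L_add[of "f x" s "sum f F"] by simp
qed (simp_all add: L_def)

lemma L_mult: "\<lbrakk>p \<in> L s; q \<in> L t\<rbrakk> \<Longrightarrow> p * q \<in> L (s + t - 1)"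
 unfolding L_iff emb_mult[symmetric] by (rule lv_wedge)

lemma L_smul: assumes "p \<in> L b" "q \<in> L c" shows "smul s p q - p * q \<in> L (b + c - 2)"
proof -
 have P: "p \<in> PU" "q \<in> PU" using assms by (auto simp: L_def)
 have e: "emb (x - y) = emb x - (emb y :: 'k form)" for x y using emb_simps(2)[of "x - y" y] by simp
 note A = assms[unfolded L_iff]
 have "emb (star n a p q) - emb (p * q) \<in> lv (b + c - 2)"
  using st_lower[OF A] by (simp add: star_emb[OF P(1)] emb_mult)
 moreover have "emb (star n a q p) - emb (p * q) \<in> lv (b + c - 2)"
  using st_lower[OF A(2,1)] by (simp add: star_emb[OF P(2)] emb_mult mult.commute add.commute)
 ultimately show ?thesis unfolding L_iff e smul_def by simp
qed

section \<open>Expansion in star powers of the last variable\<close>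

primrec pw :: "bool \<Rightarrow> nat \<Rightarrow> nat \<Rightarrow> 'k mpoly" where
 "pw s j 0 = 1" | "pw s j (Suc i) = smul s (pw s j i) (Var j)"

lemma pw_eq: "Var j [^]\<^bsub>RS s\<lparr>carrier := S\<rparr>\<^esub> i = pw s j i"
 by (induction i) (simp_all add: nat_pow_def)

lemma Var_FS: "Var j \<in> FS j 1"
 by (auto simp: FS_def Var_def lookup_single when_def one_enat_def One_nat_def split: if_splits)

lemma pw_FS: "pw s j i \<in> FS j (enat i)"
proof (induction i)
 case (Suc i)
 then show ?case using FS_smul[OF Suc Var_FS, of s] by (simp add: one_enat_def One_nat_def)
qed (use PS_FS[of j] PS_one[of j] in "auto simp: zero_enat_def")

abbreviation "vp j i \<equiv> (sgl (sgl j i) 1 :: 'k mpoly)"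

lemma wgt_sgl: assumes "j \<le> n" shows "wgt {} (sgl j i) = j * i"
proof -
 have "wgt {} (sgl j i) = (\<Sum>k\<le>n. if k = j then j * i else 0)"
  unfolding wgt_def sum.empty add_0 by (rule sum.cong[OF refl]) (simp add: lookup_single when_def)
 then show ?thesis using assms by simp
qed

lemma vp_L: assumes "j \<le> n" shows "vp j i \<in> L (Suc (j * i))"
proof -
 show ?thesis using assms wgt_sgl[OF assms, of i] by (auto simp: L_def polys_upto_def lookup_single when_def in_keys_iff split: if_splits)
qed

text \<open>Each further star factor adds only terms of lower weight to the commutative power
  \<open>vp j i\<close>, whose weight is j i.\<close>

lemma pw_L:
 assumes j: "j \<le> n" shows "pw s j i - vp j i \<in> L (j * i)" "pw s j i \<in> L (Suc (j * i))"
proof -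
 have mem: "pw s j i \<in> L (Suc (j * i))" if "pw s j i - vp j i \<in> L (j * i)" for i
  using L_add[OF L_mono[OF that le_SucI[OF order_refl]] vp_L[OF j, of i]] by simp
 have "pw s j i - vp j i \<in> L (j * i)" for i
 proof (induction i)
  case (Suc i)
  have V: "Var j = vp j 1" by (simp add: Var_def)
  have VL: "Var j \<in> L (Suc j)" using vp_L[OF j, of 1] V by simp
  have "smul s (pw s j i) (Var j) - pw s j i * Var j \<in> L (j * Suc i)"
   by (rule L_mono[OF L_smul[OF mem[OF Suc] VL]]) simp
  moreover have "(pw s j i - vp j i) * Var j \<in> L (j * Suc i)"
   by (rule L_mono[OF L_mult[OF Suc VL]]) simp
  moreover have "vp j (Suc i) = vp j i * Var j"
   by (simp only: Suc_eq_plus1) (simp add: V mult_single flip: single_add)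
  ultimately show ?case using L_add by (fastforce simp: algebra_simps)
 qed (simp add: L_def)
 then show "pw s j i - vp j i \<in> L (j * i)" "pw s j i \<in> L (Suc (j * i))" using mem by auto
qed

text \<open>An element is expanded in powers of \<open>X\<^sub>j\<close> in two ways, with the
  commutative product in \<open>TT\<close> and with the star product in \<open>PP\<close>; the
  coefficients involve the earlier variables only. \<open>co\<close> is inverse to
  \<open>TT\<close>, so that \<open>PP\<close> after \<open>co\<close> compares the two
  expansions.\<close>

definition co :: "nat \<Rightarrow> 'k mpoly \<Rightarrow> nat \<Rightarrow> 'k mpoly" where
 "co j b i = (\<Sum>m\<in>{m \<in> mkeys b. cf m j = i}. sgl (m - sgl j i) (cf b m))"
definition WW :: "nat \<Rightarrow> (nat \<Rightarrow> 'k mpoly) set" where "WW j = {c. (\<forall>i. c i \<in> PS j) \<and> finite {i. c i \<noteq> 0}}"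
definition TT :: "nat \<Rightarrow> (nat \<Rightarrow> 'k mpoly) \<Rightarrow> 'k mpoly" where "TT j c = (\<Sum>i | c i \<noteq> 0. c i * vp j i)"
definition PP :: "bool \<Rightarrow> nat \<Rightarrow> (nat \<Rightarrow> 'k mpoly) \<Rightarrow> 'k mpoly" where "PP s j c = (\<Sum>i | c i \<noteq> 0. smul s (c i) (pw s j i))"

lemma cf_co: "cf (co j b i) m = (if cf m j = 0 then cf b (sgl j i + m) else 0)"
proof -
 have *: "m' - sgl j i = m \<longleftrightarrow> m' = sgl j i + m \<and> cf m j = 0" if "cf m' j = i" for m' :: "nat \<Rightarrow>\<^sub>0 nat"
 proof -
  have "sgl j i + (m' - sgl j i) = m'"
   by (rule poly_mapping_eqI) (use that in "auto simp: lookup_add lookup_minus lookup_single when_def")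
  moreover have "cf (m' - sgl j i) j = 0" using that by (simp add: lookup_minus)
  ultimately show ?thesis by auto
 qed
 have "cf (co j b i) m = (\<Sum>m'\<in>{m' \<in> mkeys b. cf m' j = i}. if m' = sgl j i + m then (if cf m j = 0 then cf b m' else 0) else 0)"
  unfolding co_def lookup_sum by (intro sum.cong refl) (auto simp: lookup_single when_def *)
 also have "\<dots> = (if sgl j i + m \<in> {m' \<in> mkeys b. cf m' j = i} then (if cf m j = 0 then cf b (sgl j i + m) else 0) else 0)"
  by (subst sum.delta) simp_all
 also have "\<dots> = (if cf m j = 0 then cf b (sgl j i + m) else 0)" by (auto simp: in_keys_iff lookup_add)
 finally show ?thesis .
qed

lemma PS_cf: "c \<in> PS j \<Longrightarrow> cf c m \<noteq> 0 \<Longrightarrow> cf m j = 0"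
 by (auto simp: PS_def) (metis in_keys_iff lessThan_iff less_irrefl subsetD)

lemma cf_TT:
 assumes c: "c \<in> WW j" and m: "cf m j = 0" shows "cf (TT j c) (sgl j i + m) = cf (c i) m"
proof -
 have "cf (TT j c) (sgl j i + m) = (\<Sum>i' | c i' \<noteq> 0. if i' = i then cf (c i) m else 0)"
  unfolding TT_def lookup_sum
 proof (intro sum.cong refl)
  fix i' assume "i' \<in> {i. c i \<noteq> 0}"
  show "cf (c i' * vp j i') (sgl j i + m) = (if i' = i then cf (c i) m else 0)"
  proof (cases "i' = i")
   case True
   then show ?thesis by (simp add: mult.commute[of "c i"] cf_mult_sgl)
  next
   case False
   have "cf (c i' * vp j i') (sgl j i + m) = 0"
   proof (rule ccontr)
    assume "cf (c i' * vp j i') (sgl j i + m) \<noteq> 0"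
    then obtain m1 where m1: "cf (c i') m1 \<noteq> 0" "sgl j i + m = m1 + sgl j i'"
     using cf_mult_nonzero by (fastforce simp: lookup_single when_def split: if_splits)
    have "cf m1 j = 0" using PS_cf[OF _ m1(1)] c by (simp add: WW_def)
    then show False using arg_cong[OF m1(2), of "\<lambda>m. cf m j"] m False by (simp add: lookup_add)
   qed
   then show ?thesis using False by simp
  qed
 qed
 also have "\<dots> = cf (c i) m" using c by (auto simp: WW_def)
 finally show ?thesis .
qed

lemma co_TT: assumes c: "c \<in> WW j" shows "co j (TT j c) = c"
proof (rule ext, rule poly_mapping_eqI)
 fix i m
 have "cf (c i) m = 0" if "cf m j \<noteq> 0" using PS_cf[of "c i" j m] c that by (auto simp: WW_def)
 then show "cf (co j (TT j c) i) m = cf (c i) m" using cf_TT[OF c] by (simp add: cf_co)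
qed

lemma co_WW: assumes b: "b \<in> FS j d" shows "co j b \<in> WW j" "TT j (co j b) = b" "enat i > d \<Longrightarrow> co j b i = 0"
proof -
 have nz: "cf b (sgl j i + m) \<noteq> 0" if "cf (co j b i) m \<noteq> 0" for i m using that by (auto simp: cf_co split: if_splits)
 have PS: "co j b i \<in> PS j" for i unfolding PS_def mem_Collect_eq
 proof (intro allI impI)
  fix m assume m: "cf (co j b i) m \<noteq> 0"
  then have "mkeys (sgl j i + m) \<subseteq> {..j}" using nz b unfolding FS_def by blast
  then have "mkeys m \<subseteq> {..j}" unfolding keys_add_nat by (simp only: Un_subset_iff)
  moreover have "j \<notin> mkeys m" using m by (auto simp: cf_co in_keys_iff split: if_splits)
  ultimately have "mkeys m \<subseteq> {..j} - {j}" by (simp add: subset_Diff_insert)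
  then show "mkeys m \<subseteq> {..<j}" by (rule order_trans) auto
 qed
 have sub: "{i. co j b i \<noteq> 0} \<subseteq> (\<lambda>m. cf m j) ` mkeys b"
 proof
  fix i assume "i \<in> {i. co j b i \<noteq> 0}"
  then obtain m where m: "cf (co j b i) m \<noteq> 0" using poly_mapping_eqI[of "co j b i" 0] by auto
  then have "cf m j = 0" by (auto simp: cf_co split: if_splits)
  then show "i \<in> (\<lambda>m. cf m j) ` mkeys b"
   using nz[OF m] by (intro image_eqI[of _ _ "sgl j i + m"]) (auto simp: lookup_add in_keys_iff)
 qed
 then show W: "co j b \<in> WW j" using PS finite_subset[OF sub] by (simp add: WW_def)
 show "TT j (co j b) = b"
 proof (rule poly_mapping_eqI)
  fix m :: "nat \<Rightarrow>\<^sub>0 nat"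
  let ?m = "m - sgl j (cf m j)"
  have m: "sgl j (cf m j) + ?m = m" by (rule poly_mapping_eqI) (auto simp: lookup_add lookup_minus lookup_single when_def)
  have 0: "cf ?m j = 0" by (simp add: lookup_minus)
  show "cf (TT j (co j b)) m = cf b m" using cf_TT[OF W 0, of "cf m j"] m 0 by (simp add: cf_co)
 qed
 assume i: "d < enat i"
 show "co j b i = 0"
 proof (rule poly_mapping_eqI, rule ccontr)
  fix m assume "cf (co j b i) m \<noteq> cf 0 m"
  then have "enat (cf (sgl j i + m) j) \<le> d" using nz[of i m] b by (simp add: FS_def)
  then show False using i by (simp add: lookup_add) (meson enat_ord_simps(1) le_add1 leD order_trans)
 qed
qed

lemma PP_superset:
 assumes "finite A" "{i. c i \<noteq> 0} \<subseteq> A" shows "PP s j c = (\<Sum>i\<in>A. smul s (c i) (pw s j i))"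
proof -
 have "star n a 0 p = 0" for p using star_emb[of 0 p] emb_inj[of "star n a 0 p" 0] by simp
 moreover have "star n a (pw s j i) 0 = 0" for i
  unfolding star_def Gam_binom_diag by simp
 ultimately show ?thesis unfolding PP_def by (intro sum.mono_neutral_left assms) (auto simp: smul_def)
qed

text \<open>Different powers of \<open>X\<^sub>j\<close> cannot cancel, so if the total has weight
  at most l, then the i-th coefficient has weight at most l - j i. Passing to the star power and
  passing to the star product each change the summand by smaller weight only.\<close>

lemma PP_TT_low:
 assumes j: "j \<le> n" and c: "c \<in> WW j" and T: "TT j c \<in> L (Suc l)"
 shows "PP s j c - TT j c \<in> L l"
 unfolding PP_def TT_def sum_subtractf[symmetric]
proof (rule L_sum)
 fix i assume i: "i \<in> {i. c i \<noteq> 0}"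
 have wa: "wgt {} (m + m') = wgt {} m + wgt {} m'" for m m'
  by (simp add: wgt_def lookup_add sum.distrib algebra_simps)
 have P: "c i \<in> PU" using c PS_polys[of j] j by (simp add: WW_def)
 have w: "j * i + wgt {} m < Suc l" if "cf (c i) m \<noteq> 0" for m
 proof -
  have "cf m j = 0" using PS_cf[OF _ that] c by (simp add: WW_def)
  from cf_TT[OF c this, of i] that have "cf (TT j c) (sgl j i + m) \<noteq> 0" by simp
  then show ?thesis using T wa wgt_sgl[OF j, of i] unfolding L_def by fastforce
 qed
 obtain m where m: "cf (c i) m \<noteq> 0" using i poly_mapping_eqI[of "c i" 0] by auto
 then have ji: "j * i \<le> l" using w[OF m] by simp
 have cL: "c i \<in> L (Suc l - j * i)" unfolding L_def using P w by fastforce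
 have "smul s (c i) (pw s j i) - c i * pw s j i \<in> L l"
  by (rule L_mono[OF L_smul[OF cL pw_L(2)[OF j]]]) (use ji in simp)
 moreover have "c i * (pw s j i - vp j i) \<in> L l"
  by (rule L_mono[OF L_mult[OF cL pw_L(1)[OF j]]]) (use ji in simp)
 ultimately have "(smul s (c i) (pw s j i) - c i * pw s j i) + c i * (pw s j i - vp j i) \<in> L l" by (rule L_add)
 then show "smul s (c i) (pw s j i) - c i * vp j i \<in> L l" by (simp add: right_diff_distrib)
qed

lemma smul_add_left: "\<lbrakk>p \<in> PU; q \<in> PU; r \<in> PU\<rbrakk> \<Longrightarrow> smul s (p + q) r = smul s p r + smul s q r"
 using ring.ring_simprules(13)[OF ring_RS, of p s q r] by simp

lemma smul_add_right: "\<lbrakk>p \<in> PU; q \<in> PU; r \<in> PU\<rbrakk> \<Longrightarrow> smul s r (p + q) = smul s r p + smul s r q"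
 using ring.ring_simprules(23)[OF ring_RS, of p s q r] by simp

lemma smul_assoc: "\<lbrakk>p \<in> PU; q \<in> PU; r \<in> PU\<rbrakk> \<Longrightarrow> smul s (smul s p q) r = smul s p (smul s q r)"
 using ring.ring_simprules(11)[OF ring_RS, of p s q r] by simp

lemma polys_sum: "(\<And>i. i \<in> A \<Longrightarrow> f i \<in> PU) \<Longrightarrow> sum f A \<in> PU" for f :: "'b \<Rightarrow> 'k mpoly"
 by (induction A rule: infinite_finite_induct) (auto intro: polys_add)

lemma smul_sum: "\<lbrakk>r \<in> PU; \<And>i. i \<in> A \<Longrightarrow> f i \<in> PU\<rbrakk> \<Longrightarrow> smul s r (sum f A) = (\<Sum>i\<in>A. smul s r (f i))"
proof (induction A rule: infinite_finite_induct)
 case (insert i A)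
 then show ?case using smul_add_right[OF _ polys_sum, of "f i" A f r s] by simp
qed (use smul_Const(2)[of r s 0] in simp_all)

lemma pw_polys: "j \<le> n \<Longrightarrow> pw s j i \<in> PU"
 using pw_L(2)[of j s i] by (simp add: L_def)

lemma WW_polys: "\<lbrakk>j \<le> n; c \<in> WW j\<rbrakk> \<Longrightarrow> c i \<in> PU"
 using PS_polys[of j "c i"] by (simp add: WW_def)

lemma PP_add:
 assumes j: "j \<le> n" and c: "c \<in> WW j" and d: "d \<in> WW j"
 shows "(\<lambda>i. c i + d i) \<in> WW j" "PP s j (\<lambda>i. c i + d i) = PP s j c + PP s j d"
proof -
 let ?A = "{i. c i \<noteq> 0} \<union> {i. d i \<noteq> 0}"
 have A: "finite ?A" "{i. c i + d i \<noteq> 0} \<subseteq> ?A" using c d by (auto simp: WW_def)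
 show "(\<lambda>i. c i + d i) \<in> WW j" using c d finite_subset[OF A(2,1)] by (auto simp: WW_def intro: PS_add)
 show "PP s j (\<lambda>i. c i + d i) = PP s j c + PP s j d"
  unfolding PP_superset[OF A] PP_superset[OF A(1) Un_upper1] PP_superset[OF A(1) Un_upper2] sum.distrib[symmetric]
  by (intro sum.cong refl smul_add_left WW_polys[OF j c] WW_polys[OF j d] pw_polys[OF j])
qed

lemma PP_smul:
 assumes j: "j \<le> n" and r: "r \<in> PS j" and c: "c \<in> WW j"
 shows "(\<lambda>i. smul s r (c i)) \<in> WW j" "PP s j (\<lambda>i. smul s r (c i)) = smul s r (PP s j c)"
proof -
 have rP: "r \<in> PU" using PS_polys[of j r] j r by simp
 have A: "finite {i. c i \<noteq> 0}" "{i. smul s r (c i) \<noteq> 0} \<subseteq> {i. c i \<noteq> 0}"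
  using c smul_Const(2)[OF rP, of s 0] by (auto simp: WW_def)
 show "(\<lambda>i. smul s r (c i)) \<in> WW j" using c r finite_subset[OF A(2,1)] by (auto simp: WW_def intro: PS_smul)
 show "PP s j (\<lambda>i. smul s r (c i)) = smul s r (PP s j c)"
  unfolding PP_superset[OF A] unfolding PP_def
  by (subst smul_sum[OF rP smul_closed[OF WW_polys[OF j c] pw_polys[OF j]]])
   (intro sum.cong refl smul_assoc rP WW_polys[OF j c] pw_polys[OF j])
qed

lemma PP_FS: assumes "c \<in> WW j" "\<And>i. d < enat i \<Longrightarrow> c i = 0" shows "PP s j c \<in> FS j d"
 unfolding PP_def
proof (rule FS_sum)
 fix i assume "i \<in> {i. c i \<noteq> 0}"
 then have "enat i \<le> d" using assms(2)[of i] by (auto simp: not_less[symmetric])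
 moreover have "c i \<in> FS j 0" using assms(1) PS_FS[of j] by (auto simp: WW_def)
 ultimately show "smul s (c i) (pw s j i) \<in> FS j d" using FS_mono[OF FS_smul[OF _ pw_FS[of s j i], of "c i" 0 s], of d] by simp
qed

text \<open>The comparison is unipotent on each \<open>FS j d\<close> separately. Infinite d gives
  freeness over the previous subalgebra, and d = 1 gives the commutation rule.\<close>

lemma PP_co_bij:
 assumes j: "j \<le> n" shows "bij_betw (\<lambda>b. PP s j (co j b)) (FS j d) (FS j d)"
proof (rule unipotent_bij[where F = "\<lambda>l. FS j d \<inter> L l"])
 fix x assume "x \<in> FS j d"
 then have "emb x \<in> Om" using FS_polys[OF j] emb_Om by blast
 then show "\<exists>l. x \<in> FS j d \<inter> L l" using lv_ex L_iff \<open>x \<in> FS j d\<close> by blast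
next
 show "FS j d \<inter> L 0 \<subseteq> {0}"
 proof
  fix x assume "x \<in> FS j d \<inter> L 0"
  then have "emb x = emb (0 :: 'k mpoly)" using lv_0[of "emb x"] L_iff[of x 0] by simp
  then show "x \<in> {0}" unfolding emb_inj by simp
 qed
next
 fix x y assume xy: "x \<in> FS j d" "y \<in> FS j d"
 show "x + y \<in> FS j d" by (rule FS_add[OF xy])
 have "co j (x + y) = (\<lambda>i. co j x i + co j y i)"
  by (rule ext, rule poly_mapping_eqI) (simp add: cf_co lookup_add)
 then show "PP s j (co j (x + y)) = PP s j (co j x) + PP s j (co j y)"
  using PP_add(2)[OF j co_WW(1)[OF xy(1)] co_WW(1)[OF xy(2)]] by simp
next
 fix l x assume x: "x \<in> FS j d \<inter> L (Suc l)"
 then have xF: "x \<in> FS j d" by simp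
 have "PP s j (co j x) + (- x) \<in> FS j d"
  by (rule FS_add[OF PP_FS[OF co_WW(1)[OF xF] co_WW(3)[OF xF]] FS_uminus[OF xF]])
 moreover have "PP s j (co j x) - x \<in> L l"
  using PP_TT_low[OF j co_WW(1)[OF xF], of l s] x unfolding co_WW(2)[OF xF] by simp
 ultimately show "PP s j (co j x) - x \<in> FS j d \<inter> L l" by simp
qed (use FS_uminus L_uminus in auto)

text \<open>\<open>TT\<close> identifies families of coefficients with polynomials and has the
  inverse \<open>co\<close>, so this is \<open>PP_co_bij\<close> for infinite d.\<close>

lemma PP_bij:
 assumes j: "j \<le> n" shows "bij_betw (PP s j) (WW j) (FS j \<infinity>)"
proof -
 have T: "TT j c \<in> FS j \<infinity>" if c: "c \<in> WW j" for c
  unfolding TT_def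
 proof (rule FS_sum)
  fix i
  have "c i \<in> PS j" using c by (simp add: WW_def)
  show "c i * vp j i \<in> FS j \<infinity>" unfolding FS_def mem_Collect_eq
  proof (intro allI impI conjI)
   fix m assume "cf (c i * vp j i) m \<noteq> 0"
   from cf_mult_nonzero[OF this] obtain m1 m2 where m: "cf (c i) m1 \<noteq> 0" "cf (vp j i) m2 \<noteq> 0" "m = m1 + m2" by blast
   have "mkeys m1 \<subseteq> {..<j}" using m(1) \<open>c i \<in> PS j\<close> by (simp add: PS_def)
   moreover have "m2 = sgl j i" using m(2) by (auto simp: lookup_single when_def split: if_splits)
   ultimately show "mkeys m \<subseteq> {..j}" unfolding m(3) keys_add_nat by auto
  qed simp
 qed
 note U = PP_co_bij[OF j, of s \<infinity>]
 have "inj_on (PP s j) (WW j)"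
 proof (rule inj_onI)
  fix c d assume c: "c \<in> WW j" and d: "d \<in> WW j" and "PP s j c = PP s j d"
  then have "PP s j (co j (TT j c)) = PP s j (co j (TT j d))" by (simp add: co_TT)
  then have "TT j c = TT j d" using inj_onD[OF bij_betw_imp_inj_on[OF U]] T[OF c] T[OF d] by blast
  from arg_cong[OF this, of "co j"] show "c = d" unfolding co_TT[OF c] co_TT[OF d] .
 qed
 moreover have "PP s j ` WW j = FS j \<infinity>"
 proof (intro equalityI subsetI)
  fix b assume "b \<in> FS j \<infinity>"
  then have "b \<in> (\<lambda>b. PP s j (co j b)) ` FS j \<infinity>" using bij_betw_imp_surj_on[OF U] by simp
  then show "b \<in> PP s j ` WW j" using co_WW(1) by (auto intro!: imageI)
 qed (auto intro!: PP_FS)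
 ultimately show ?thesis by (simp add: bij_betw_def)
qed

lemma PS_mono: assumes "j \<le> k" shows "PS j \<subseteq> PS k"
proof
 have jk: "{..<j} \<subseteq> {..<k}" using assms by auto
 fix p assume "p \<in> PS j"
 then show "p \<in> PS k" unfolding PS_def mem_Collect_eq by (meson jk order_trans)
qed

text \<open>The star product of \<open>X\<^sub>j\<close> with an element of the previous subalgebra
  has degree at most 1 in \<open>X\<^sub>j\<close>. By \<open>PP_co_bij\<close> with d = 1 its star
  expansion stops after the first power, and the two coefficients are the required elements.\<close>

lemma ore_extension_PS:
 assumes j: "j \<le> n"
 shows "\<exists>\<kappa>. ore_extension (RP s (Suc j)) (PS j) (Var j) \<kappa>"
proof -
 let ?R = "RP s (Suc j)"
 have R: "ring ?R" and S: "ring (RP s j)" using ring_PS j by auto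
 have sub: "PS j \<subseteq> PS (Suc j)" by (rule PS_mono) simp
 have V: "Var j \<in> PS (Suc j)" unfolding PS_Suc by (rule FS_mono[OF Var_FS]) simp
 have one: "smul s 1 p = p" if "p \<in> PU" for p using smul_Const(1)[OF that, of s 1] by simp
 have free: "free_on (RP s j) (regular_module ?R) UNIV (\<lambda>i. Var j [^]\<^bsub>?R\<^esub> i) (\<lambda>i p. inv_into (WW j) (PP s j) p i)"
 proof (rule free_on_bij)
  show "left_module (RP s j) (regular_module ?R)"
   using left_module_subring[OF left_module_regular[OF R], of "PS j"] S sub by simp
  show "bij_betw (PP s j) (WW j) (carrier (regular_module ?R))" using PP_bij[OF j] by (simp add: PS_Suc)
  show "(\<lambda>i'. if i' = i then \<one>\<^bsub>RP s j\<^esub> else \<zero>\<^bsub>RP s j\<^esub>) \<in> WW j \<and>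
   PP s j (\<lambda>i'. if i' = i then \<one>\<^bsub>RP s j\<^esub> else \<zero>\<^bsub>RP s j\<^esub>) = Var j [^]\<^bsub>?R\<^esub> i" for i
  proof -
   have e: "(\<lambda>i'. if i' = i then \<one>\<^bsub>RP s j\<^esub> else \<zero>\<^bsub>RP s j\<^esub>) = (\<lambda>i'. if i' = i then 1 else 0)"
    by (rule ext) simp
   have "PP s j (\<lambda>i'. if i' = i then 1 else 0) = pw s j i"
    by (subst PP_superset[of "{i}"]) (auto simp: one[OF pw_polys[OF j]])
   then show ?thesis unfolding e pw_eq by (simp add: WW_def)
  qed
 qed (use PP_add[OF j] PP_smul[OF j] in "auto simp: WW_def")
 have "\<exists>t\<in>PS j. \<exists>u\<in>PS j. smul s (Var j) c = smul s t (Var j) + u" if c: "c \<in> PS j" for c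
 proof -
  have "smul s (Var j) c \<in> FS j 1" using FS_smul[OF Var_FS, of c j 0 s] c PS_FS by auto
  then have "smul s (Var j) c \<in> (\<lambda>b. PP s j (co j b)) ` FS j 1" using bij_betw_imp_surj_on[OF PP_co_bij[OF j, of s 1]] by simp
  then obtain b where b: "b \<in> FS j 1" "smul s (Var j) c = PP s j (co j b)" by auto
  have W: "co j b i \<in> PS j" "co j b i \<in> PU" for i using co_WW(1)[OF b(1)] WW_polys[OF j] by (auto simp: WW_def)
  have "{i. co j b i \<noteq> 0} \<subseteq> {0, 1}"
  proof
   fix i assume "i \<in> {i. co j b i \<noteq> 0}"
   then have "\<not> 1 < enat i" using co_WW(3)[OF b(1), of i] by auto
   then show "i \<in> {0, 1}" by (simp add: one_enat_def One_nat_def) linarith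
  qed
  from PP_superset[OF _ this, of s] have "PP s j (co j b) = smul s (co j b 0) 1 + smul s (co j b 1) (smul s 1 (Var j))"
   by (simp add: One_nat_def)
  also have "\<dots> = smul s (co j b 1) (Var j) + co j b 0"
   using smul_Const(2)[OF W(2), of s 0 1] one[of "Var j"] PS_polys[OF _ V] j by (simp add: add.commute)
  finally show ?thesis using b(2) W(1) by auto
 qed
 then have "ore_extension ?R (PS j) (Var j) (\<lambda>i p. inv_into (WW j) (PP s j) p i)"
  using R S sub V free by (intro ore_extension.intro ore_extension_axioms.intro) auto
 then show ?thesis by (intro exI)
qed

text \<open>Each of the n + 1 variables costs one dimension. The start is the field of constants,
  over which all modules are projective.\<close>

lemma pd_le_PS:
 fixes M :: "('k mpoly, 'u) module" and enc :: "('u \<times> 'k mpoly) list \<Rightarrow> 'u"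
 assumes enc: "inj enc"
 shows "j \<le> Suc n \<Longrightarrow> left_module (RP s j) M \<Longrightarrow> pd_le (RP s j) j M"
proof (induction j)
 case 0
 have "projective (RP s 0) M"
 proof (rule projective_division_ring[OF 0(2)])
  fix x assume x: "x \<in> carrier (RP s 0)" "x \<noteq> \<zero>\<^bsub>RP s 0\<^esub>"
  then obtain c where c0: "x = Const c" by (auto simp: PS_0)
  then have c: "x = Const c" "c \<noteq> 0" using x(2) by auto
  show "\<exists>y\<in>carrier (RP s 0). y \<otimes>\<^bsub>RP s 0\<^esub> x = \<one>\<^bsub>RP s 0\<^esub>"
   using c smul_Const(1)[of "Const c" s "inverse c"] by (intro bexI[of _ "Const (inverse c)"]) (auto simp: PS_0)
 qed
 then show ?case by simp
next
 case (Suc j)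
 then obtain \<kappa> where o: "ore_extension (RP s (Suc j)) (PS j) (Var j) \<kappa>" using ore_extension_PS by auto
 have M: "left_module (RP s j) M"
  using left_module_subring[OF Suc.prems(2), of "PS j"] ring_PS[of j s] PS_mono[of j "Suc j"] Suc.prems(1) by simp
 show ?case by (rule ore_extension.pd_le_Suc[OF o enc Suc.prems(2)]) (use Suc.IH[OF _ M] Suc.prems(1) in simp)
qed

lemma proj_dim_le:
 fixes M :: "('k mpoly, 'u) module" and enc :: "('u \<times> 'k mpoly) list \<Rightarrow> 'u"
 assumes enc: "inj enc" and M: "left_module (RS s) M" shows "proj_dim (RS s) M \<le> enat (Suc n)"
proof -
 have "RP s (Suc n) = RS s" unfolding PS_top RS_simps(1)[of s, symmetric] by simp
 then show ?thesis using pd_le_imp_proj_dim_le[OF enc M] pd_le_PS[OF enc order_refl, of s M] M by simp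
qed

end

section \<open>The Gelfand-Kirillov dimension\<close>

text \<open>The spanning list may be dependent, so it is first replaced by an independent list of
  the same span and of no greater length; an independent list in V is then no longer than
  that.\<close>

lemma (in ring) dim_subalgebra_le:
 assumes K: "subfield K R" and us: "set us \<subseteq> carrier R" and V: "subalgebra K V R" "V \<subseteq> Span K us"
 shows "dim K V \<le> length us"
proof -
 obtain ws where ws: "independent K ws" "Span K ws = Span K us" "length ws \<le> length us"
 proof -
  obtain vs where vs: "set vs \<subseteq> carrier R" "independent K vs" "Span K vs = Span K us"
   using exists_base[OF K finite_dimensionE[OF K Span_finite_dimension[OF K us]]] by blast
  have "\<exists>k\<le>length us. dimension k K (Span K us)" using us
  proof (induction us)
   case (Cons u us)
   then obtain k where k: "k \<le> length us" "dimension k K (Span K us)" by auto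
   show ?case
   proof (cases "u \<in> Span K us")
    case True
    have "Span K (u # us) = Span K us"
     using subalgebra_Span_incl[OF K Span_is_subalgebra[OF K, of us], of "u # us"]
      subalgebra_Span_incl[OF K Span_is_subalgebra[OF K Cons.prems], of us]
      Span_base_incl[OF K, of us] Span_base_incl[OF K Cons.prems] Cons.prems True by auto
    then show ?thesis using k by (metis le_SucI length_Cons)
   next
    case False
    have "dimension (Suc k) K (Span K (u # us))"
     using Suc_dim[OF _ False k(2)] Cons.prems by simp
    then show ?thesis using k(1) by (intro exI[of _ "Suc k"]) simp
   qed
  qed auto
  then obtain k where k: "k \<le> length us" "dimension k K (Span K us)" by blast
  have "k = length vs" using dimension_is_inj[OF K k(2)] dimensionI[OF K vs(2,3)] by blast
  then show ?thesis using that[of vs] vs k(1) by simp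
 qed
 have "finite_dimension K V"
  by (rule subalbegra_incl_imp_finite_dimension[OF K Span_finite_dimension[OF K us] V])
 from finite_dimensionE[OF K this] have "dimension (dim K V) K V" by (simp add: over_def)
 from exists_base[OF K this] obtain vs where vs: "independent K vs" "length vs = dim K V" "Span K vs = V" "set vs \<subseteq> carrier R" by blast
 have "set vs \<subseteq> Span K ws" using Span_base_incl[OF K vs(4)] vs(3) V(2) ws(2) by auto
 then show ?thesis using independent_length_le[OF K vs(1) ws(1)] vs(2) ws(3) by simp
qed

text \<open>The union of spans is directed: the spans of two lists lie in the span of the
  concatenated list.\<close>

lemma (in ring) power_span_subalgebra:
 assumes K: "subfield K R" and V: "V \<subseteq> carrier R" shows "subalgebra K (power_span R K V m) R"
proof -
 let ?P = "{foldr (monoid.mult R) vs \<one> | vs. set vs \<subseteq> V \<and> length vs \<le> m}"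
 have "foldr (monoid.mult R) vs \<one> \<in> carrier R" if "set vs \<subseteq> V" for vs
  using that V by (induction vs) auto
 then have P: "?P \<subseteq> carrier R" by blast
 have in_ps: "x \<in> power_span R K V m \<longleftrightarrow> (\<exists>us. set us \<subseteq> ?P \<and> x \<in> Span K us)" for x
  unfolding power_span_def by blast
 note S = Span_is_subalgebra[OF K, OF order_trans[OF _ P]]
 have mono: "Span K us \<subseteq> Span K vs" if "set us \<subseteq> set vs" "set vs \<subseteq> ?P" for us vs
  using subalgebra_Span_incl[OF K S[OF that(2)], of us] Span_base_incl[OF K order_trans[OF that(2) P]] that(1) by blast
 show ?thesis
 proof (intro subalgebra.intro subalgebra_axioms.intro subgroup.intro)
  show "power_span R K V m \<subseteq> carrier (add_monoid R)"
  proof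
   fix x assume "x \<in> power_span R K V m"
   then obtain us where us: "set us \<subseteq> ?P" "x \<in> Span K us" unfolding in_ps by blast
   show "x \<in> carrier (add_monoid R)" using subsetD[OF subalgebra_in_carrier[OF S[OF us(1)]] us(2)] by simp
  qed
  show "\<one>\<^bsub>add_monoid R\<^esub> \<in> power_span R K V m" unfolding in_ps by (intro exI[of _ "[]"]) simp
 next
  fix x y assume "x \<in> power_span R K V m" "y \<in> power_span R K V m"
  then obtain us vs where us: "set us \<subseteq> ?P" "x \<in> Span K us" and vs: "set vs \<subseteq> ?P" "y \<in> Span K vs" unfolding in_ps by blast
  have uv: "set (us @ vs) \<subseteq> ?P" using us(1) vs(1) by simp
  have "x \<in> Span K (us @ vs)" "y \<in> Span K (us @ vs)" using mono[of us "us @ vs"] mono[of vs "us @ vs"] uv us(2) vs(2) by auto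
  then have "x \<otimes>\<^bsub>add_monoid R\<^esub> y \<in> Span K (us @ vs)"
   by (rule subgroup.m_closed[OF subalgebra.axioms(1)[OF S[OF uv]]])
  then show "x \<otimes>\<^bsub>add_monoid R\<^esub> y \<in> power_span R K V m" unfolding in_ps using uv by blast
 next
  fix x assume "x \<in> power_span R K V m"
  then obtain us where us: "set us \<subseteq> ?P" "x \<in> Span K us" unfolding in_ps by blast
  show "inv\<^bsub>add_monoid R\<^esub> x \<in> power_span R K V m"
   using subgroup.m_inv_closed[OF subalgebra.axioms(1)[OF S[OF us(1)]] us(2)] us(1) unfolding in_ps by blast
 next
  fix k x assume "k \<in> K" "x \<in> power_span R K V m"
  then show "k \<otimes> x \<in> power_span R K V m"
   using subalgebra.smult_closed[OF S] unfolding in_ps by blast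
 qed
qed

context forms
begin

definition PD :: "nat \<Rightarrow> 'k mpoly set" where
 "PD N = {p \<in> PU. \<forall>m. cf p m \<noteq> 0 \<longrightarrow> mdegree m \<le> N}"

lemma PD_star: assumes p: "p \<in> PD N" and q: "q \<in> PD M" shows "star n a p q \<in> PD (N + M)"
proof -
 have c: "p \<in> PU" "q \<in> PU" using p q by (auto simp: PD_def)
 have "emb q \<in> fmP (\<lambda>c d. d \<le> M)" by (rule emb_fmP[OF c(2)]) (use q in "auto simp: PD_def")
 then have e: "act True p (emb q) \<in> fmP (\<lambda>c d. d \<le> N + M)"
  by (rule act_fmP[OF c(1)]) (use p in "auto simp: PD_def add_mono")
 have "mdegree m \<le> N + M" if "cf (smul True p q) m \<noteq> 0" for m
  using fmPD[OF e, of "{}" m] that unfolding act_emb[OF c] by (simp add: emb_def)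
 then show ?thesis using smul_closed[OF c, of True] by (simp add: PD_def smul_def)
qed

lemma PD_mono: "N \<le> M \<Longrightarrow> PD N \<subseteq> PD M"
 by (auto simp: PD_def)

lemma PD_subalgebra: "subalgebra (range Const) (PD N) RR"
proof -
 interpret R: ring RR by (rule ring_RR)
 show ?thesis
 proof (intro subalgebra.intro subalgebra_axioms.intro subgroup.intro)
  fix x y assume xy: "x \<in> PD N" "y \<in> PD N"
  have "mdegree m \<le> N" if "cf (x + y) m \<noteq> 0" for m using cf_add_nonzero[OF that] xy by (auto simp: PD_def)
  then show "x \<otimes>\<^bsub>add_monoid RR\<^esub> y \<in> PD N" using xy by (simp add: PD_def polys_add)
 next
  fix x assume x: "x \<in> PD N"
  have "inv\<^bsub>add_monoid RR\<^esub> x = - x"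
   using R.minus_equality[of "- x" x] x polys_uminus[of x] by (simp add: PD_def a_inv_def)
  then show "inv\<^bsub>add_monoid RR\<^esub> x \<in> PD N" using x polys_uminus[of x] by (simp add: PD_def)
 next
  fix k x assume "k \<in> range (Const :: 'k \<Rightarrow> _)" "x \<in> PD N"
  moreover have "Const c \<in> PD 0" for c by (auto simp: PD_def Const_def lookup_single when_def polys_upto_def)
  ultimately show "k \<otimes>\<^bsub>RR\<^esub> x \<in> PD N" using PD_star[of k 0 x N] by auto
 qed (auto simp: PD_def)
qed

text \<open>A monomial of degree at most N has n + 1 exponents between 0 and N, which bounds the
  number of spanning monomials.\<close>

lemma PD_Span: "\<exists>us. set us \<subseteq> carrier RR \<and> PD N \<subseteq> ring.Span RR (range Const) us \<and> length us \<le> Suc N ^ Suc n"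
proof -
 interpret R: ring RR by (rule ring_RR)
 define B where "B = {m :: nat \<Rightarrow>\<^sub>0 nat. mkeys m \<subseteq> {..n} \<and> mdegree m \<le> N}"
 define F where "F m = (\<lambda>i\<in>{..n}. cf m i)" for m :: "nat \<Rightarrow>\<^sub>0 nat"
 have "cf m i \<le> N" if m: "m \<in> B" and i: "i \<le> n" for m i
 proof -
  have "cf m i \<le> (\<Sum>i\<le>n. cf m i)" by (rule member_le_sum) (use i in auto)
  then show ?thesis using m mdegree_alt[of m "{..n}"] by (simp add: B_def)
 qed
 then have FB: "F ` B \<subseteq> Pi\<^sub>E {..n} (\<lambda>_. {..N})" by (auto simp: F_def restrict_def split: if_splits)
 have inj: "inj_on F B"
 proof (rule inj_onI)
  fix m m' assume m: "m \<in> B" "m' \<in> B" "F m = F m'"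
  show "m = m'"
  proof (rule poly_mapping_eqI)
   fix i show "cf m i = cf m' i"
   proof (cases "i \<le> n")
    case True
    then show ?thesis using fun_cong[OF m(3), of i] by (simp add: F_def)
   next
    case False
    then have "i \<notin> mkeys m" "i \<notin> mkeys m'" using m(1,2) by (auto simp: B_def)
    then show ?thesis by (simp add: in_keys_iff)
   qed
  qed
 qed
 have finP: "finite (Pi\<^sub>E {..n} (\<lambda>_. {..N}))" by (simp add: finite_PiE)
 have finB: "finite B" by (rule inj_on_finite[OF inj FB finP])
 have "card B \<le> card (Pi\<^sub>E {..n} (\<lambda>_. {..N}))" by (rule card_inj_on_le[OF inj FB finP])
 then have card: "card B \<le> Suc N ^ Suc n" by (simp add: card_PiE)
 obtain ms where ms: "set ms = B" "distinct ms" using finite_distinct_list[OF finB] by blast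
 define us where "us = map (\<lambda>m. sgl m 1 :: 'k mpoly) ms"
 have us: "set us \<subseteq> carrier RR"
  by (auto simp: us_def ms B_def polys_upto_def)
 interpret S: subalgebra "range Const" "R.Span (range Const) us" RR by (rule R.Span_is_subalgebra[OF subfield_Const us])
 have "PD N \<subseteq> R.Span (range Const) us"
 proof
  fix p assume p: "p \<in> PD N"
  show "p \<in> R.Span (range Const) us"
  proof (induction p rule: mpoly_induct)
   case zero
   show ?case using S.one_closed by simp
  next
   case (single m)
   then have mB: "m \<in> B" using p by (auto simp: PD_def B_def polys_upto_def in_keys_iff)
   then have s: "sgl m 1 \<in> set us" by (simp add: us_def ms)
   then have "sgl m 1 \<in> R.Span (range Const) us" using R.Span_base_incl[OF subfield_Const us] by blast
   then have "Const (cf p m) \<otimes>\<^bsub>RR\<^esub> sgl m 1 \<in> R.Span (range Const) us" by (intro S.smult_closed) simp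
   moreover have "Const (cf p m) \<otimes>\<^bsub>RR\<^esub> sgl m 1 = sgl m (cf p m)"
    using smul_Const(1)[of "sgl m 1" True "cf p m"] s us by (auto simp: smul_def Const_def mult_single)
   ultimately show ?case by simp
  next
   case (add p q)
   then show ?case using S.m_closed[of p q] by simp
  qed
 qed
 then show ?thesis using us card ms distinct_card[OF ms(2)] by (intro exI[of _ us]) (auto simp: us_def)
qed

text \<open>V lies in degrees at most some D, so products of at most m of its elements have degree
  at most D m and span a space of dimension at most (D m + 1)^(n + 1). Only finiteness is at stake,
  and the crude exponent 2 (n + 1) makes the estimate a single inequality.\<close>

lemma GKdim_RR: "GKdim RR (range Const) < \<infinity>"
proof -
 interpret R: ring RR by (rule ring_RR)
 let ?K = "range Const :: 'k mpoly set"
 have "limsup (\<lambda>m. ereal (log (real m) (real (R.dim ?K (power_span RR ?K V m))))) \<le> ereal (real (2 * Suc n))"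
  if V: "subalgebra ?K V RR" "R.finite_dimension ?K V" for V
 proof -
  obtain vs where vs: "set vs \<subseteq> carrier RR" "R.Span ?K vs = V"
   using R.exists_base[OF subfield_Const R.finite_dimensionE[OF subfield_Const V(2)]] by blast
  have "\<exists>D. set us \<subseteq> PD D" if "set us \<subseteq> carrier RR" for us
   using that
  proof (induction us)
   case (Cons u us)
   then obtain D where D: "set us \<subseteq> PD D" by auto
   have "u \<in> PD (\<Sum>m\<in>mkeys u. mdegree m)"
    using Cons.prems by (auto simp: PD_def in_keys_iff intro: member_le_sum)
   then have "set (u # us) \<subseteq> PD (D + (\<Sum>m\<in>mkeys u. mdegree m))"
    using subset_trans[OF D PD_mono[OF le_add1]] subsetD[OF PD_mono[OF le_add2]] by simp
   then show ?case by blast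
  qed auto
  then obtain D where "set vs \<subseteq> PD D" using vs(1) by blast
  then have VD: "V \<subseteq> PD D" using R.subalgebra_Span_incl[OF subfield_Const PD_subalgebra] vs(2) by blast
  have VR: "V \<subseteq> carrier RR" by (rule R.subalgebra_in_carrier[OF V(1)])
  have prod: "foldr (star n a) ws 1 \<in> PD (D * length ws)" if "set ws \<subseteq> V" for ws
   using that
  proof (induction ws)
   case Nil
   show ?case by (auto simp: PD_def lookup_one when_def split: if_splits)
  next
   case (Cons w ws)
   then have "star n a w (foldr (star n a) ws 1) \<in> PD (D + D * length ws)" using VD by (intro PD_star) auto
   then show ?case by simp
  qed
  have ps: "power_span RR ?K V m \<subseteq> PD (D * m)" for m
  proof -
   have "R.Span ?K us \<subseteq> PD (D * m)"
    if us: "set us \<subseteq> {foldr (monoid.mult RR) ws \<one>\<^bsub>RR\<^esub> | ws. set ws \<subseteq> V \<and> length ws \<le> m}" for us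
   proof (rule R.subalgebra_Span_incl[OF subfield_Const PD_subalgebra])
    show "set us \<subseteq> PD (D * m)"
    proof
     fix x assume "x \<in> set us"
     then obtain ws where "x = foldr (star n a) ws 1" "set ws \<subseteq> V" "length ws \<le> m" using us by auto
     then show "x \<in> PD (D * m)" using prod[of ws] PD_mono[of "D * length ws" "D * m"] by auto
    qed
   qed
   then show ?thesis unfolding power_span_def by blast
  qed
  have le: "R.dim ?K (power_span RR ?K V m) \<le> Suc (D * m) ^ Suc n" for m
  proof -
   obtain us where us: "set us \<subseteq> carrier RR" "PD (D * m) \<subseteq> R.Span ?K us" "length us \<le> Suc (D * m) ^ Suc n"
    using PD_Span by blast
   have "R.dim ?K (power_span RR ?K V m) \<le> length us"
    by (rule R.dim_subalgebra_le[OF subfield_Const us(1) R.power_span_subalgebra[OF subfield_Const VR] order_trans[OF ps us(2)]])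
   then show ?thesis using us(3) by simp
  qed
  \<comment> \<open>For m >= D + 2 one has D m + 1 <= (D + 1) m <= m^2, and the base m of the
    logarithm exceeds 1. Dimension 0 is covered by the convention that the logarithm of 0 is
    0.\<close>
  have "ereal (log (real m) (real (R.dim ?K (power_span RR ?K V m)))) \<le> ereal (real (2 * Suc n))" if m: "D + 2 \<le> m" for m
  proof (cases "R.dim ?K (power_span RR ?K V m) = 0")
   case False
   let ?d = "R.dim ?K (power_span RR ?K V m)"
   have "Suc (D * m) \<le> Suc D * m" using m by simp
   also have "\<dots> \<le> m * m" using m by (intro mult_right_mono) auto
   finally have "Suc (D * m) ^ Suc n \<le> (m * m) ^ Suc n" by (rule power_mono) simp
   also have "(m * m) ^ Suc n = m ^ (2 * Suc n)" by (simp only: power_mult power2_eq_square)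
   finally have "?d \<le> m ^ (2 * Suc n)" using le[of m] by (rule order_trans[rotated])
   then have "real ?d \<le> real m ^ (2 * Suc n)" by (simp only: of_nat_power[symmetric] of_nat_le_iff)
   then have "log (real m) (real ?d) \<le> log (real m) (real m ^ (2 * Suc n))"
    using False m by (intro log_mono) auto
   also have "\<dots> = real (2 * Suc n)" using m by (intro log_pow_cancel) auto
   finally show ?thesis by simp
  qed (simp add: log_def)
  then have "eventually (\<lambda>m. ereal (log (real m) (real (R.dim ?K (power_span RR ?K V m)))) \<le> ereal (real (2 * Suc n))) sequentially"
   by (intro eventually_sequentiallyI)
  then show ?thesis by (rule Limsup_bounded)
 qed
 then have "GKdim RR ?K \<le> ereal (real (2 * Suc n))" unfolding GKdim_def by (intro SUP_least) auto
 then show ?thesis by (rule le_less_trans) simp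
qed

end

section \<open>Global dimension and regularity\<close>

text \<open>Iterated pairing is injective on lists of a fixed length; the length is recorded in
  addition, through an embedding of the natural numbers.\<close>

lemma list_encoding:
 assumes "infinite (UNIV :: 'u set)" shows "\<exists>enc :: 'u list \<Rightarrow> 'u. inj enc"
proof -
 have "\<exists>f. bij_betw f (UNIV \<times> UNIV :: ('u \<times> 'u) set) (UNIV :: 'u set)"
  unfolding card_of_ordIso by (rule card_of_Times_same_infinite[OF assms])
 then obtain f :: "'u \<times> 'u \<Rightarrow> 'u" where f: "inj f" by (auto simp: bij_betw_def)
 obtain q :: "nat \<Rightarrow> 'u" where q: "inj q" using infinite_countable_subset[OF assms] by blast
 define e where "e xs = foldr (\<lambda>x y. f (x, y)) xs (q 0)" for xs
 have e: "xs = ys" if "length xs = length ys" "e xs = e ys" for xs ys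
  using that by (induction xs ys rule: list_induct2) (auto simp: e_def dest: injD[OF f])
 have "inj (\<lambda>xs. f (q (length xs), e xs))"
  by (rule injI) (auto dest!: injD[OF f] injD[OF q] intro: e)
 then show ?thesis by blast
qed

context forms
begin

text \<open>The factor of natural numbers makes the type infinite, hence able to code lists of its
  own elements. A form in \<open>Om\<close> is coded by its values on the finitely many subsets of
  {..n}, outside of which it vanishes.\<close>

lemma encodings:
 obtains enc :: "(('k mpoly \<times> nat \<times> 'm) \<times> 'k mpoly) list \<Rightarrow> 'k mpoly \<times> nat \<times> 'm"
  and t :: "'k form \<Rightarrow> 'k mpoly \<times> nat \<times> 'm" and t' :: "'k mpoly \<Rightarrow> 'k mpoly \<times> nat \<times> 'm"
 where "inj enc" "inj_on t Om" "inj t'"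
proof -
 have inf: "infinite (UNIV :: ('k mpoly \<times> nat \<times> 'm) set)"
  using finite_imageD[of "\<lambda>(p, k, x). k" UNIV] by (simp add: finite_prod)
 then obtain e :: "('k mpoly \<times> nat \<times> 'm) list \<Rightarrow> 'k mpoly \<times> nat \<times> 'm" where e: "inj e" using list_encoding by blast
 define t' where "t' p = (p, 0 :: nat, undefined :: 'm)" for p :: "'k mpoly"
 have t': "inj t'" by (auto simp: inj_def t'_def)
 define g where "g = (\<lambda>(u, r). e [u, t' r])"
 have g: "inj g" by (auto simp: inj_def g_def dest!: injD[OF e] injD[OF t'])
 obtain Is where Is: "set Is = Pow {..n}" using finite_list[of "Pow {..n}"] by auto
 define t where "t w = e (map (\<lambda>I. t' (w I)) Is)" for w
 have "inj_on t Om"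
 proof (rule inj_onI)
  fix v w assume vw: "v \<in> Om" "w \<in> Om" "t v = t w"
  then have *: "map (\<lambda>I. t' (v I)) Is = map (\<lambda>I. t' (w I)) Is" unfolding t_def by (blast dest: injD[OF e])
  show "v = w"
  proof
   fix I show "v I = w I"
   proof (cases "I \<subseteq> {..n}")
    case True
    then show ?thesis using * Is injD[OF t'] by auto
   next
    case False
    then show ?thesis using fmP_outside[OF vw(1)] fmP_outside[OF vw(2)] by simp
   qed
  qed
 qed
 moreover have "inj (\<lambda>xs. e (map g xs))"
  by (rule injI) (blast dest: injD[OF e] injD[OF inj_mapI[OF g]])
 ultimately show ?thesis using that t' by blast
qed

text \<open>The trivial module, copied into the type, attains the upper bound coming from the tower
  of extensions.\<close>

lemma gldim_RS: "left_gldim TYPE('k mpoly \<times> nat \<times> 'm) (RS s) = enat (n + 1)"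
proof -
 obtain enc :: "(('k mpoly \<times> nat \<times> 'm) \<times> 'k mpoly) list \<Rightarrow> 'k mpoly \<times> nat \<times> 'm"
  and t :: "'k form \<Rightarrow> 'k mpoly \<times> nat \<times> 'm" and t' :: "'k mpoly \<Rightarrow> 'k mpoly \<times> nat \<times> 'm"
  where i: "inj enc" "inj_on t Om" "inj t'" by (rule encodings)
 have "left_module (RS s) (transport t' TM)"
  by (rule left_module_transport[OF left_module_TM inj_on_subset[OF i(3)]]) simp
 then have "enat (Suc n) \<le> left_gldim TYPE('k mpoly \<times> nat \<times> 'm) (RS s)"
  unfolding left_gldim_def by (intro order_trans[OF proj_dim_trivial_ge[OF i(2,3)]] Sup_upper) blast
 moreover have "left_gldim TYPE('k mpoly \<times> nat \<times> 'm) (RS s) \<le> enat (Suc n)"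
  unfolding left_gldim_def by (rule Sup_least) (auto intro: proj_dim_le[OF i(1)])
 ultimately show ?thesis unfolding Suc_eq_plus1 by (rule order_antisym[rotated])
qed

lemma has_gldim_RR: "has_gldim TYPE('m) RR (n + 1)"
 using gldim_RS[of True] gldim_RS[of False] by (simp add: has_gldim_def right_gldim_def RS_def)

text \<open>A graded projective resolution exists, namely the Koszul one, so the chosen resolution
  really is a resolution; the comparison then applies to it whichever it is.\<close>

lemma AS_regular_RR: "AS_regular TYPE('m) RR (range Const) RG"
proof -
 obtain t :: "'k form \<Rightarrow> 'k mpoly \<times> nat \<times> 'm" where t: "inj_on t Om" using encodings by metis
 let ?C = "chosen_resolution TYPE('k mpoly \<times> nat \<times> 'm) RR RG TM TG"
 have "graded_proj_resolution (op_ring RR) RG TM TG ?C"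
  unfolding chosen_resolution_def by (rule someI[of _ "res False t"]) (simp only: RS_False graded_resolution[OF t])
 note C = ext_comparison_Koszul[OF t this]
 show ?thesis
  unfolding AS_regular_def Ext_def Ext_grading_def
 proof (intro conjI exI[of _ "n + 1"] exI[of _ "int (Suc n)"] allI impI connected_graded_RR GKdim_RR has_gldim_RR)
  fix i assume "i \<noteq> n + 1"
  then show "carrier (cohomology RR RG ?C i) = {\<zero>\<^bsub>cohomology RR RG ?C i\<^esub>}"
   by (intro ext_comparison.cohomology_trivial[OF C]) simp
 next
  show "graded_iso RR (cohomology RR RG ?C (n + 1)) (cohomology_grading RR RG ?C (n + 1)) TM (shift TG (int (Suc n)))"
   using ext_comparison.cohomology_top[OF C] by (simp only: Suc_eq_plus1)
 qed
qed

end

theorem theorem3p8: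
 fixes n :: nat and a :: "'k :: field_char_0"
 assumes "n \<ge> 1"
 shows "AS_regular TYPE('m) (Rna n a) (range Const) (Rna_grading n)
  \<and> has_gldim TYPE('m) (Rna n a) (n + 1)"
 by (intro conjI forms.AS_regular_RR forms.has_gldim_RR)

end
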